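(* Let $\Omega\subset\mathbb{R}^3$ be a bounded open set with smooth boundary, and let $C_0(\kappa,H)$ denote the Ginzburg–Landau ground state energy defined in the context. Suppose that the magnetic field $H=H(\kappa)>0$ is a function of $\kappa$ satisfying $$\frac{\ln\kappa}{\kappa}\ll H\ll\kappa\quad\text{as }\kappa\to\infty.$$ Then $$C_0(\kappa,H)=|\Omega|\,\kappa H\ln\sqrt{\frac{\kappa}{H}}+o\bigg(\kappa H\ln\sqrt{\frac{\kappa}{H}}\bigg)\quad\text{as }\kappa\to\infty.$$
   Context: Notation: $a(\kappa)\ll b(\kappa)$ means $a(\kappa)/b(\kappa)\to0$ as $\kappa\to\infty$; $|\Omega|$ is the Lebesgue measure of $\Omega$. Let $\beta=(0,0,1)$ and $\mathbf F(x)=(-x_2/2,x_1/2,0)$ for $x=(x_1,x_2,x_3)\in\mathbb{R}^3$. Let $\dot H^1(\mathbb{R}^3)$ be the closure of $C_c^\infty(\mathbb{R}^3)$ under the norm $u\mapsto\|\nabla u\|_{L^2(\mathbb{R}^3)}$, and let $\dot H^1_{\mathrm{div},\mathbf F}(\mathbb{R}^3)=\{\mathbf A:\ \operatorname{div}\mathbf A=0,\ \mathbf A-\mathbf F\in\dot H^1(\mathbb{R}^3)\}$. For $\kappa,H>0$, $\psi\in H^1(\Omega;\mathbb{C})$ and $\mathbf A\in\dot H^1_{\mathrm{div},\mathbf F}(\mathbb{R}^3)$, the Ginzburg–Landau functional is $$\mathcal E^{3D}_{\kappa,H}(\psi,\mathbf A)=\int_\Omega\Big(|(\nabla-i\kappa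 H\mathbf A)\psi|^2+\frac{\kappa^2}{2}(1-|\psi|^2)^2\Big)dx+\kappa^2H^2\int_{\mathbb{R}^3}|\operatorname{curl}\mathbf A-\beta|^2dx,$$ and $C_0(\kappa,H)=\inf\{\mathcal E^{3D}_{\kappa,H}(\psi,\mathbf A):(\psi,\mathbf A)\in H^1(\Omega;\mathbb{C})\times\dot H^1_{\mathrm{div},\mathbf F}(\mathbb{R}^3)\}$. *)

theory Defs
  imports "HOL-Analysis.Analysis" "HOL-Library.Landau_Symbols"
begin

inductive_set higher_partials ::
  "('a::euclidean_space \<Rightarrow> 'b::real_normed_vector) \<Rightarrow> ('a \<Rightarrow> 'b) set" for f where
  base: "f \<in> higher_partials f"
| step: "g \<in> higher_partials f \<Longrightarrow> i \<in> Basis \<Longrightarrow>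
         (\<lambda>x. frechet_derivative g (at x) i) \<in> higher_partials f"

definition smooth_fun :: "('a::euclidean_space \<Rightarrow> 'b::real_normed_vector) \<Rightarrow> bool" where
  "smooth_fun f \<longleftrightarrow> (\<forall>g\<in>higher_partials f. g differentiable_on UNIV)"

definition smooth_boundary :: "(real^3) set \<Rightarrow> bool" where
  "smooth_boundary \<Omega> \<longleftrightarrow>
     (\<forall>p\<in>frontier \<Omega>. \<exists>(R :: real^3 \<Rightarrow> real^3) r (g :: real^2 \<Rightarrow> real).
        orthogonal_transformation R \<and> r > 0 \<and> smooth_fun g \<and>
        (\<forall>x\<in>ball p r. x \<in> \<Omega> \<longleftrightarrow>
            (R (x - p)) $ 3 < g (vector [(R (x - p)) $ 1, (R (x - p)) $ 2])))"

definition pd :: "3 \<Rightarrow> (real^3 \<Rightarrow> real) \<Rightarrow> real^3 \<Rightarrow> real" where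
  "pd j \<phi> x = frechet_derivative \<phi> (at x) (axis j 1)"

definition test_fun :: "(real^3) set \<Rightarrow> (real^3 \<Rightarrow> real) \<Rightarrow> bool" where
  "test_fun U \<phi> \<longleftrightarrow> smooth_fun \<phi> \<and> compact (closure {x. \<phi> x \<noteq> 0})
      \<and> closure {x. \<phi> x \<noteq> 0} \<subseteq> U"

definition weak_partial ::
  "(real^3) set \<Rightarrow> (real^3 \<Rightarrow> 'b::{banach,second_countable_topology}) \<Rightarrow> 3 \<Rightarrow> (real^3 \<Rightarrow> 'b) \<Rightarrow> bool" where
  "weak_partial U u j v \<longleftrightarrow>
     (\<forall>K. compact K \<and> K \<subseteq> U \<longrightarrow> integrable (lebesgue_on K) u \<and> integrable (lebesgue_on K) v) \<and>
     (\<forall>\<phi>. test_fun U \<phi> \<longrightarrow>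
        (\<integral>x. pd j \<phi> x *\<^sub>R u x \<partial>lebesgue_on U) = - (\<integral>x. \<phi> x *\<^sub>R v x \<partial>lebesgue_on U))"

definition weak_grad ::
  "(real^3) set \<Rightarrow> (real^3 \<Rightarrow> 'b::{banach,second_countable_topology}) \<Rightarrow> (3 \<Rightarrow> real^3 \<Rightarrow> 'b) \<Rightarrow> bool" where
  "weak_grad U u G \<longleftrightarrow> (\<forall>j. weak_partial U u j (G j))"

text \<open>The weak gradient (unique almost everywhere when it exists).\<close>
definition wgrad ::
  "(real^3) set \<Rightarrow> (real^3 \<Rightarrow> 'b::{banach,second_countable_topology}) \<Rightarrow> 3 \<Rightarrow> real^3 \<Rightarrow> 'b" where
  "wgrad U u = (SOME G. weak_grad U u G)"

definition L2 :: "(real^3) set \<Rightarrow> (real^3 \<Rightarrow> 'b::{banach,second_countable_topology}) \<Rightarrow> bool" where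
  "L2 U f \<longleftrightarrow> f \<in> borel_measurable (lebesgue_on U) \<and> integrable (lebesgue_on U) (\<lambda>x. (norm (f x))\<^sup>2)"

definition H1 :: "(real^3) set \<Rightarrow> (real^3 \<Rightarrow> complex) \<Rightarrow> bool" where
  "H1 U \<psi> \<longleftrightarrow> L2 U \<psi> \<and> (\<exists>G. weak_grad U \<psi> G \<and> (\<forall>j. L2 U (G j)))"

text \<open>Homogeneous space dot-H^1(R^3): completion of C_c^infinity under u \<mapsto> ||grad u||_2,
  realised as functions u in L^2_loc with L^2 weak gradient that are limits of test
  functions (gradients in L^2, functions in L^2_loc).\<close>
definition Hdot1 :: "(real^3 \<Rightarrow> real) \<Rightarrow> bool" where
  "Hdot1 u \<longleftrightarrow>
     (\<forall>K. compact K \<longrightarrow> L2 K u) \<and>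
     (\<exists>G. weak_grad UNIV u G \<and> (\<forall>j. L2 UNIV (G j)) \<and>
        (\<exists>\<phi> :: nat \<Rightarrow> real^3 \<Rightarrow> real. (\<forall>n. test_fun UNIV (\<phi> n)) \<and>
           (\<lambda>n. \<Sum>j\<in>UNIV. \<integral>x. (pd j (\<phi> n) x - G j x)\<^sup>2 \<partial>lebesgue) \<longlonglongrightarrow> 0 \<and>
           (\<forall>K. compact K \<longrightarrow> (\<lambda>n. \<integral>x. (\<phi> n x - u x)\<^sup>2 \<partial>lebesgue_on K) \<longlonglongrightarrow> 0)))"

definition F_field :: "real^3 \<Rightarrow> real^3" where
  "F_field x = vector [- x $ 2 / 2, x $ 1 / 2, 0]"

definition beta_vec :: "real^3" where
  "beta_vec = vector [0, 0, 1]"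

definition Hdot1_div_F :: "(real^3 \<Rightarrow> real^3) \<Rightarrow> bool" where
  "Hdot1_div_F A \<longleftrightarrow>
     (\<forall>j. Hdot1 (\<lambda>x. A x $ j - F_field x $ j)) \<and>
     (\<forall>\<phi>. test_fun UNIV \<phi> \<longrightarrow> (\<integral>x. (\<Sum>j\<in>UNIV. A x $ j * pd j \<phi> x) \<partial>lebesgue) = 0)"

definition curlA :: "(real^3 \<Rightarrow> real^3) \<Rightarrow> real^3 \<Rightarrow> real^3" where
  "curlA A x = (let D = (\<lambda>j k. wgrad UNIV (\<lambda>y. A y $ j) k x) in
     vector [D 3 2 - D 2 3, D 1 3 - D 3 1, D 2 1 - D 1 2])"

definition GL_energy ::
  "(real^3) set \<Rightarrow> real \<Rightarrow> real \<Rightarrow> (real^3 \<Rightarrow> complex) \<Rightarrow> (real^3 \<Rightarrow> real^3) \<Rightarrow> real" where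
  "GL_energy \<Omega> \<kappa> H \<psi> A =
     (\<integral>x. (\<Sum>j\<in>UNIV. (cmod (wgrad \<Omega> \<psi> j x - \<i> * complex_of_real (\<kappa> * H * A x $ j) * \<psi> x))\<^sup>2)
            + \<kappa>\<^sup>2 / 2 * (1 - (cmod (\<psi> x))\<^sup>2)\<^sup>2 \<partial>lebesgue_on \<Omega>)
     + \<kappa>\<^sup>2 * H\<^sup>2 * (\<integral>x. (norm (curlA A x - beta_vec))\<^sup>2 \<partial>lebesgue)"

definition C0 :: "(real^3) set \<Rightarrow> real \<Rightarrow> real \<Rightarrow> real" where
  "C0 \<Omega> \<kappa> H = Inf {GL_energy \<Omega> \<kappa> H \<psi> A | \<psi> A. H1 \<Omega> \<psi> \<and> Hdot1_div_F A}"

end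

theory Submission
 imports Defs
begin

text \<open>
  Put \<open>h = \<kappa> H\<close> and \<open>L = ln (\<kappa> / H)\<close>; the infimum to be found is about \<open>|\<Omega>| h L / 2\<close>.

  Lower bound. Regularise \<open>(\<psi>, A)\<close> by mollification; this needs \<open>\<psi> \<in> L^4\<close>, which comes from the cone
  property of the boundary. On a horizontal circle of radius \<open>r\<close> on which \<open>|\<psi>|\<close> is close to 1 the circulation of the
  normalised current differs from an integer multiple of \<open>2 \<pi>\<close> by the magnetic flux \<open>\<pi> h r^2\<close>. For small flux this
  forces circulation squared \<open>\<ge> 2 (\<pi> - \<eta>)\<close> times (circulation plus flux), up to errors controlled by the
  potential and the field energy; no vortices have to be located. Integrating over all centres removes
  the linear circulation term, so the mean square circulation is at least about \<open>2 \<pi>^2 h r^2\<close>.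
  Integrated against \<open>dr / r^3\<close> over \<open>1/\<kappa> << r << 1/sqrt h\<close> this produces the logarithm, while a Calderon type identity
  bounds the left side by \<open>2 \<pi>^2\<close> times the square of the \<open>L^2\<close> norm of the current, with the sharp constant.

  Upper bound. Take \<open>A = F\<close> and the lattice function \<open>g = \<Sum>n. c (X - n) e^{2 \<pi> i n Y}\<close>, regularised to
  \<open>g / sqrt (|g|^2 + t^2)\<close> with \<open>t\<close> of order \<open>sqrt h / \<kappa>\<close>; its energy density is periodic and a suitable translate has
  at most the mean energy on \<open>\<Omega>\<close>.
\<close>

text \<open>In Fourier variables a circle average multiplies by \<open>2 pi J_1(r |k|)\<close> up to
  a phase, where k is the horizontal frequency, and the integral of \<open>J_1(s)^2 / s\<close> over
  the half line is 1/2: this is the origin of \<open>2 pi^2\<close>. The proof reaches the constant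
  through autocorrelations instead of a Fourier transform.

  The ends of the range of radii are the core size 1/\<kappa> and the spacing 1/sqrt h of the
  vortices. Their ratio is sqrt (\<kappa>/H), whose logarithm is L/2; shrinking the range by a
  factor M at both ends costs only 2 ln M. The lower hypothesis on H enters as L << h, which makes
  E/h small against h in the linear error terms.

  The L^4 bound answers two needs. A Bochner integral is 0 where its integrand is not integrable, so
  without it an admissible pair with a non-integrable quartic term would have a small nominal
  energy. And the product of potential and order parameter converges in L^2 under mollification
  because both factors converge in L^4.\<close>

abbreviation "L1 \<equiv> integrable lborel"
abbreviation "cont \<equiv> continuous_on UNIV"
abbreviation "BM \<equiv> borel_measurable borel"

section \<open>Continuous functions of compact support: integration, translation and Fubini\<close>

definition ccs :: "('a::euclidean_space => 'b::real_normed_vector) => bool" where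
 "ccs f \<longleftrightarrow> cont f \<and> (\<exists>R. \<forall>x. R < norm x --> f x = 0)"

lemma ccs_cbox:
 fixes f :: "'a::euclidean_space => 'b::real_normed_vector"
 assumes "ccs f"
 obtains a b where "\<And>x. x \<notin> cbox a b ==> f x = 0"
proof -
 obtain R where R: "\<And>x. R < norm x ==> f x = 0"
  using assms by (auto simp: ccs_def)
 obtain a where "cball (0::'a) R \<subseteq> cbox (-a) a"
  using bounded_subset_cbox_symmetric[OF bounded_cball] by metis
 then have "f x = 0" if "x \<notin> cbox (-a) a" for x
  using that R[of x] by (force simp: subset_iff not_less)
 then show ?thesis using that by blast
qed

lemma integral_lborel_eq_cbox:
 fixes f :: "'a::euclidean_space => 'b::euclidean_space"
 assumes c: "cont f" and z: "\<And>x. x \<notin> cbox a b ==> f x = 0"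
 shows "L1 f" "(LBINT x. f x) = integral (cbox a b) f"
proof -
 have f: "f = (%x. indicator (cbox a b) x *\<^sub>R f x)"
  using z by (auto simp: indicator_def)
 have si: "set_integrable lborel (cbox a b) f"
  unfolding set_integrable_def
  by (rule borel_integrable_compact) (auto intro: continuous_on_subset[OF c])
 then show "L1 f"
  unfolding set_integrable_def using f by simp
 have "(LBINT x. f x) = set_lebesgue_integral lborel (cbox a b) f"
  unfolding set_lebesgue_integral_def using f by simp
 also have "... = integral (cbox a b) f"
  by (rule set_borel_integral_eq_integral(2)[OF si])
 finally show "(LBINT x. f x) = integral (cbox a b) f" .
qed

lemma ccs_integrable:
 fixes f :: "'a::euclidean_space => 'b::euclidean_space"
 shows "ccs f ==> L1 f"
 by (metis ccs_cbox ccs_def integral_lborel_eq_cbox(1))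

lemma integral_lborel_shift:
 fixes f :: "'a::euclidean_space => 'b::{banach, second_countable_topology}"
 shows "(LBINT x. f (x + v)) = (LBINT x. f x)"
proof -
 have d: "distr lborel borel (%x. v + x) = (lborel :: 'a measure)"
  by (rule lborel_distr_plus)
 show ?thesis
 proof (cases "f \<in> BM")
  case True
  have "(LBINT x. f x) = (\<integral>x. f x \<partial>distr lborel borel (%x. v + x))" by (simp add: d)
  also have "... = (LBINT x. f (v + x))"
   using True by (subst integral_distr) auto
  finally show ?thesis by (simp add: add.commute)
 next
  \<comment> \<open>A function that is not Borel measurable is not integrable, nor is its translate,
    so both Bochner integrals have their default value 0.\<close>
  case False
  then have 1: "\<not> L1 f"
   using borel_measurable_integrable by fastforce
  have "\<not> L1 (%x. f (x + v))"
  proof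
   assume "L1 (%x. f (x + v))"
   then have m: "(%x. f (x + v)) \<in> BM"
    using borel_measurable_integrable by fastforce
   have "(%x. (%x. f (x + v)) (x - v)) \<in> BM"
    by (rule measurable_compose[OF _ m]) auto
   then show False using False by simp
  qed
  then show ?thesis using 1 by (simp add: not_integrable_integral_eq)
 qed
qed

text \<open>The support in x is bounded uniformly in y, so Fubini reduces to continuous functions on
  a product of boxes. The parameter box will hold angles, discs in polar coordinates, and
  segments.\<close>

lemma integral_lborel_swap:
 fixes f :: "'a::euclidean_space => 'c::euclidean_space => 'b::euclidean_space"
 assumes c: "cont (%(x,y). f x y)"
  and z: "\<And>x y. y \<in> cbox c d ==> x \<notin> cbox a b ==> f x y = 0"
 shows "(LBINT x. integral (cbox c d) (f x)) = integral (cbox c d) (%y. \<integral>x. f x y \<partial>lborel)"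
proof -
 have cc: "continuous_on (cbox (a,c) (b,d)) (%(x,y). f x y)"
  using c continuous_on_subset by blast
 have cy: "cont (%x. f x y)" for y
  by (rule continuous_on_compose2[OF c, of _ "%x. (x,y)", simplified]) (auto intro!: continuous_intros)
 have c1: "cont (%x. integral (cbox c d) (f x))"
  by (rule integral_continuous_on_param) (auto intro: continuous_on_subset[OF c])
 have "(LBINT x. integral (cbox c d) (f x)) = integral (cbox a b) (%x. integral (cbox c d) (f x))"
  by (rule integral_lborel_eq_cbox(2)[OF c1]) (use z in \<open>auto intro!: integral_eq_0_iff[THEN iffD2] simp: integral_cong[of _ _ "%_. 0"]\<close>)
 also have "... = integral (cbox c d) (%y. integral (cbox a b) (%x. f x y))"
  by (rule integral_swap_continuous[OF cc])
 also have "... = integral (cbox c d) (%y. \<integral>x. f x y \<partial>lborel)"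
  by (rule integral_cong) (use z in \<open>auto intro!: integral_lborel_eq_cbox(2)[OF cy, symmetric]\<close>)
 finally show ?thesis .
qed

lemma integral_periodic_shift:
 fixes f :: "real => 'b::euclidean_space"
 assumes c: "cont f" and p: "p > 0" and per: "\<And>x. f (x + p) = f x"
 shows "integral {0..p} (%x. f (x + a)) = integral {0..p} f"
proof -
 \<comment> \<open>A primitive for arguments of both signs; periodicity then says that
   \<open>F (v + p) - F v\<close> does not depend on v.\<close>
 define F where "F x = (if x \<ge> 0 then integral {0..x} f else - integral {x..0} f)" for x
 have ii: "f integrable_on {u..v}" for u v
  by (rule integrable_continuous_interval) (rule continuous_on_subset[OF c], simp)
 have Fd: "integral {u..v} f = F v - F u" if "u <= v" for u v
 proof -
  consider "0 <= u" | "u < 0" "0 <= v" | "v < 0" by linarith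
  then show ?thesis
  proof cases
   case 1 then show ?thesis using that Henstock_Kurzweil_Integration.integral_combine[of 0 u v f] ii by (simp add: F_def algebra_simps)
  next
   case 2 then show ?thesis using that Henstock_Kurzweil_Integration.integral_combine[of u 0 v f] ii by (simp add: F_def algebra_simps)
  next
   case 3 then show ?thesis using that Henstock_Kurzweil_Integration.integral_combine[of u v 0 f] ii by (simp add: F_def algebra_simps)
  qed
 qed
 have sh: "integral {u..v} (%x. f (x + w)) = integral {u + w..v + w} f" for u v w
  using integral_shift[of u w v f] continuous_on_subset[OF c, of "{u + w..v + w}"]
  by (simp add: o_def)
 have per': "integral {u + p..v + p} f = integral {u..v} f" for u v
  using sh[of u v p] per by simp
 have D: "F (v + p) - F (u + p) = F v - F u" if "u <= v" for u v
  using per'[of u v] Fd[of u v] Fd[of "u + p" "v + p"] that by simp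
 have "F (p + a) - F a = F p - F 0"
  using D[of 0 a] D[of a 0] by (cases "a \<ge> 0") (auto simp: algebra_simps)
 then have "integral {0 + a..p + a} f = integral {0..p} f"
  using Fd[of a "p + a"] Fd[of 0 p] p by simp
 then show ?thesis by (simp add: sh)
qed

section \<open>The circle transform\<close>

text \<open>The integral over r depends on the angle only through \<open>sin (\<alpha>/2)\<close>,
  so after exchanging the integrals one integrates \<open>cos \<alpha> * D \<alpha>\<close> by parts
  against \<open>sin \<alpha>\<close>. The derivative of \<open>D\<close> brings the factor
  \<open>cos (\<alpha>/2) / (2 * sin (\<alpha>/2))\<close>, whose product with
  \<open>sin \<alpha>\<close> is \<open>(cos (\<alpha>/2))^2\<close>; only the two end radii
  survive.\<close>

lemma angular_kernel_identity:
 fixes m :: "real => real"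
 assumes c: "cont m" and r: "0 < r0" "r0 <= r1"
 shows "integral {r0..r1} (%r. integral {0..2*pi} (%\<alpha>. cos \<alpha> * m (2 * r * sin (\<alpha>/2))) / r)
    = integral {0..2*pi} (%\<alpha>. (cos (\<alpha>/2))^2 * m (2 * r0 * sin (\<alpha>/2)))
    - integral {0..2*pi} (%\<alpha>. (cos (\<alpha>/2))^2 * m (2 * r1 * sin (\<alpha>/2)))"
proof -
 define D where "D \<alpha> = integral {r0..r1} (%r. m (2 * r * sin (\<alpha>/2)) / r)" for \<alpha>
 have cm: "continuous_on S (%x. m (g x))" if "continuous_on S g" for S :: "'c::topological_space set" and g
  by (rule continuous_on_compose2[OF c that]) simp
 have "integral {r0..r1} (%r. integral {0..2*pi} (%\<alpha>. cos \<alpha> * m (2 * r * sin (\<alpha>/2))) / r)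
   = integral {r0..r1} (%r. integral {0..2*pi} (%\<alpha>. cos \<alpha> * m (2 * r * sin (\<alpha>/2)) / r))"
  by simp
 also have "... = integral {0..2*pi} (%\<alpha>. integral {r0..r1} (%r. cos \<alpha> * m (2 * r * sin (\<alpha>/2)) / r))"
 proof -
  have "continuous_on (cbox (r0,0) (r1,2*pi)) (%(r,\<alpha>). cos \<alpha> * m (2 * r * sin (\<alpha>/2)) / r)"
   unfolding case_prod_beta using r
   by (intro continuous_intros cm) (auto simp: cbox_Pair_eq)
  from integral_swap_continuous[OF this] show ?thesis by simp
 qed
 also have "... = integral {0..2*pi} (%\<alpha>. cos \<alpha> * D \<alpha>)"
  unfolding D_def by (simp add: mult.assoc flip: times_divide_eq_right)
 finally have 1: "integral {r0..r1} (%r. integral {0..2*pi} (%\<alpha>. cos \<alpha> * m (2 * r * sin (\<alpha>/2))) / r)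
   = integral {0..2*pi} (%\<alpha>. cos \<alpha> * D \<alpha>)" .
 have cD: "continuous_on {0..2*pi} D"
 proof -
  have "continuous_on ({0..2*pi} \<times> cbox r0 r1) (%(\<alpha>,r). m (2 * r * sin (\<alpha>/2)) / r)"
   unfolding case_prod_beta using r
   by (intro continuous_intros cm) (auto simp: cbox_Pair_eq)
  from integral_continuous_on_param[OF this] show ?thesis by (simp add: D_def[abs_def])
 qed
 \<comment> \<open>A primitive of \<open>m\<close> in logarithmic scale: \<open>m s / s\<close> is
   the derivative of \<open>P (ln s)\<close> for s > 0. Composing with \<open>exp\<close> keeps the
   singularity at 0 out of sight.\<close>
 obtain P where P: "\<And>y. (P has_real_derivative m (exp y)) (at y)"
 proof -
  have "isCont (%y. m (exp y)) y" for y
  proof -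
   have "cont (%y. m (exp y))" by (rule cm[OF continuous_on_exp[OF continuous_on_id]])
   then show ?thesis using continuous_on_eq_continuous_at[OF open_UNIV] by blast
  qed
  then have "\<exists>F. \<forall>x::real. -\<infinity> < ereal x --> ereal x < \<infinity> --> (F has_vector_derivative m (exp x)) (at x)"
   by (intro einterval_antiderivative) auto
  then show ?thesis using that by (auto simp: has_real_derivative_iff_has_vector_derivative)
 qed
 have DP: "D \<alpha> = P (ln (2 * sin (\<alpha>/2) * r1)) - P (ln (2 * sin (\<alpha>/2) * r0))" if "sin (\<alpha>/2) > 0" for \<alpha>
 proof -
  have "((%r. m (2 * r * sin (\<alpha>/2)) / r) has_integral
    (P (ln (2 * sin (\<alpha>/2) * r1)) - P (ln (2 * sin (\<alpha>/2) * r0)))) {r0..r1}"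
  proof (rule fundamental_theorem_of_calculus[OF r(2)])
   fix r assume "r \<in> {r0..r1}"
   then have rp: "r > 0" using r by auto
   have "((%r. ln (2 * sin (\<alpha>/2) * r)) has_real_derivative 1 / (2 * sin (\<alpha>/2) * r) * (2 * sin (\<alpha>/2))) (at r)"
    using that rp by (auto intro!: derivative_eq_intros)
   from DERIV_chain2[OF P this]
   have "((%r. P (ln (2 * sin (\<alpha>/2) * r))) has_real_derivative m (2 * r * sin (\<alpha>/2)) / r) (at r)"
    using that rp by (simp add: exp_ln field_simps)
   then show "((%r. P (ln (2 * sin (\<alpha>/2) * r))) has_vector_derivative m (2 * r * sin (\<alpha>/2)) / r)
     (at r within {r0..r1})"
    by (metis has_real_derivative_iff_has_vector_derivative has_vector_derivative_at_within)
  qed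
  then show ?thesis unfolding D_def by (rule integral_unique)
 qed
 define g where "g \<alpha> = (cos (\<alpha>/2))^2 * (m (2 * r1 * sin (\<alpha>/2)) - m (2 * r0 * sin (\<alpha>/2)))" for \<alpha>
 have sp: "sin (\<alpha>/2) > 0" if "\<alpha> \<in> {0<..<2*pi}" for \<alpha>
  using that by (intro sin_gt_zero) auto
 have Qd: "((%\<alpha>. sin \<alpha> * D \<alpha>) has_real_derivative (cos \<alpha> * D \<alpha> + g \<alpha>)) (at \<alpha>)"
  if a: "\<alpha> \<in> {0<..<2*pi}" for \<alpha>
 proof -
  let ?s = "sin (\<alpha>/2)" and ?c = "cos (\<alpha>/2)"
  have s: "?s > 0" using sp[OF a] .
  have e: "((%\<alpha>. P (ln (2 * sin (\<alpha>/2) * q))) has_real_derivative m (2 * q * ?s) * (?c / (2 * ?s))) (at \<alpha>)"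
   if "q > 0" for q
  proof -
   have "((%\<alpha>. ln (2 * sin (\<alpha>/2) * q)) has_real_derivative 1 / (2 * ?s * q) * (2 * (?c * (1/2)) * q)) (at \<alpha>)"
    using s that by (auto intro!: derivative_eq_intros)
   from DERIV_chain2[OF P this]
   show ?thesis using that s by (simp add: exp_ln field_simps)
  qed
  have "((%\<alpha>. sin \<alpha> * (P (ln (2 * sin (\<alpha>/2) * r1)) - P (ln (2 * sin (\<alpha>/2) * r0)))) has_real_derivative
   cos \<alpha> * (P (ln (2 * ?s * r1)) - P (ln (2 * ?s * r0))) +
   sin \<alpha> * (m (2 * r1 * ?s) * (?c / (2 * ?s)) - m (2 * r0 * ?s) * (?c / (2 * ?s)))) (at \<alpha>)"
   using r by (auto intro!: derivative_eq_intros e)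
  moreover have "sin \<alpha> * (m (2 * r1 * ?s) * (?c / (2 * ?s)) - m (2 * r0 * ?s) * (?c / (2 * ?s))) = g \<alpha>"
   using s sin_double[of "\<alpha>/2"] by (simp add: g_def field_simps power2_eq_square)
  ultimately have "((%\<alpha>. sin \<alpha> * (P (ln (2 * sin (\<alpha>/2) * r1)) - P (ln (2 * sin (\<alpha>/2) * r0)))) has_real_derivative
   (cos \<alpha> * D \<alpha> + g \<alpha>)) (at \<alpha>)"
   using DP[OF s] by simp
  then show ?thesis
   by (rule has_field_derivative_transform_within_open[OF _ open_greaterThanLessThan[of 0 "2*pi"] a])
     (use DP sp in auto)
 qed
 have cg: "continuous_on {0..2*pi} g"
  unfolding g_def by (intro continuous_intros cm) simp_all
 \<comment> \<open>The logarithms in the formula for \<open>D\<close> are useless at the two end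
   angles, but \<open>D\<close> itself is continuous there; the interior version of the theorem
   applies, and \<open>sin\<close> kills both boundary values.\<close>
 have "((%\<alpha>. cos \<alpha> * D \<alpha> + g \<alpha>) has_integral (sin (2*pi) * D (2*pi) - sin 0 * D 0)) {0..2*pi}"
  by (rule fundamental_theorem_of_calculus_interior)
   (use Qd in \<open>auto intro!: continuous_intros cD simp: has_real_derivative_iff_has_vector_derivative\<close>)
 then have "integral {0..2*pi} (%\<alpha>. cos \<alpha> * D \<alpha> + g \<alpha>) = 0"
  by (simp add: integral_unique)
 moreover have "integral {0..2*pi} (%\<alpha>. cos \<alpha> * D \<alpha> + g \<alpha>)
   = integral {0..2*pi} (%\<alpha>. cos \<alpha> * D \<alpha>) + integral {0..2*pi} g"
  by (intro integral_add integrable_continuous_interval continuous_intros cD cg)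
 moreover have "integral {0..2*pi} g = integral {0..2*pi} (%\<alpha>. (cos (\<alpha>/2))^2 * m (2 * r1 * sin (\<alpha>/2)))
   - integral {0..2*pi} (%\<alpha>. (cos (\<alpha>/2))^2 * m (2 * r0 * sin (\<alpha>/2)))"
  unfolding g_def right_diff_distrib
  by (intro integral_diff integrable_continuous_interval continuous_intros cm) simp_all
 ultimately show ?thesis using 1 by simp
qed

lemma integral_cos_half_squared: "integral {0..2*pi} (%\<alpha>. (cos (\<alpha>/2))^2) = pi"
proof -
 have "((%\<alpha>. (cos (\<alpha>/2))^2) has_integral ((2*pi)/2 + sin (2*pi)/2 - (0/2 + sin 0/2))) {0..2*pi}"
 proof (rule fundamental_theorem_of_calculus)
  fix x :: real
  have c: "cos x = 2 * (cos (x/2))^2 - 1" using cos_double_cos[of "x/2"] by simp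
  have "((%x. x/2 + sin x/2) has_real_derivative 1/2 + cos x / 2) (at x)"
   by (auto intro!: derivative_eq_intros)
  then have "((%x. x/2 + sin x/2) has_real_derivative (cos (x/2))\<^sup>2) (at x)"
   by (simp add: c diff_divide_distrib)
  then show "((%x. x/2 + sin x/2) has_vector_derivative (cos (x/2))\<^sup>2) (at x within {0..2*pi})"
   by (metis has_real_derivative_iff_has_vector_derivative has_vector_derivative_at_within)
 qed simp
 then show ?thesis by (simp add: integral_unique)
qed

text \<open>Non-negativity in r allows the outer radius to grow to infinity. The boundary term there
  vanishes since \<open>m\<close> is 0 beyond S, and the one at \<open>r0\<close> is at most
  \<open>m0\<close> times the integral of \<open>(cos (\<alpha>/2))^2\<close>, which is pi.\<close>

lemma angular_kernel_bound:
 fixes m :: "real => real"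
 assumes c: "cont m" and r: "0 < r0" "r0 <= r1"
  and bd: "\<And>s. \<bar>m s\<bar> <= m0" and supp: "\<And>s. s > S ==> m s = 0"
  and pos: "\<And>r. r > 0 ==> integral {0..2*pi} (%\<alpha>. cos \<alpha> * m (2 * r * sin (\<alpha>/2))) \<ge> 0"
 shows "integral {r0..r1} (%r. integral {0..2*pi} (%\<alpha>. cos \<alpha> * m (2 * r * sin (\<alpha>/2))) / r) <= pi * m0"
proof -
 have cm: "continuous_on S (%x. m (g x))" if "continuous_on S g" for S :: "'c::topological_space set" and g
  by (rule continuous_on_compose2[OF c that]) simp
 define f where "f r = integral {0..2*pi} (%\<alpha>. cos \<alpha> * m (2 * r * sin (\<alpha>/2))) / r" for r
 define \<Phi> where "\<Phi> r = integral {0..2*pi} (%\<alpha>. (cos (\<alpha>/2))^2 * m (2 * r * sin (\<alpha>/2)))" for r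
 have cf: "continuous_on {r0..R} f" for R
 proof -
  have "continuous_on ({r0..R} \<times> cbox 0 (2*pi)) (%(r,\<alpha>). cos \<alpha> * m (2 * r * sin (\<alpha>/2)))"
   unfolding case_prod_beta by (intro continuous_intros cm) simp_all
  from integral_continuous_on_param[OF this]
  have "continuous_on {r0..R} (%r. integral {0..2*pi} (%\<alpha>. cos \<alpha> * m (2 * r * sin (\<alpha>/2))))"
   by simp
  then show ?thesis
   unfolding f_def by (rule continuous_on_divide[OF _ continuous_on_id]) (use r in auto)
 qed
 have le: "integral {r0..r1} f <= \<Phi> r0 - \<Phi> R" if "R \<ge> r1" for R
 proof -
  have "integral {r0..r1} f <= integral {r0..R} f"
   using that r pos by (intro integral_subset_le integrable_continuous_interval cf) (auto simp: f_def)
  also have "... = \<Phi> r0 - \<Phi> R"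
   using angular_kernel_identity[OF c r(1), of R] that r by (simp add: f_def[abs_def] \<Phi>_def)
  finally show ?thesis .
 qed
 have \<Phi>0: "\<Phi> r0 <= pi * m0"
 proof -
  have "\<Phi> r0 <= integral {0..2*pi} (%\<alpha>. (cos (\<alpha>/2))^2 * m0)"
   unfolding \<Phi>_def
   by (intro integral_le integrable_continuous_interval continuous_intros cm mult_left_mono)
     (use bd abs_le_D1 in auto)
  then show ?thesis by (simp add: integral_cos_half_squared)
 qed
 \<comment> \<open>For interior angles the argument \<open>2 * n * sin (\<alpha>/2)\<close>
   eventually exceeds S. At the two end angles it stays 0, so the pointwise limit is written with an
   exceptional set of two points.\<close>
 have lim: "(%n. \<Phi> (real n)) \<longlonglongrightarrow> 0"
 proof -
  have "(%n. integral {0..2*pi} (%\<alpha>. (cos (\<alpha>/2))^2 * m (2 * real n * sin (\<alpha>/2))))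
    \<longlonglongrightarrow> integral {0..2*pi} (%\<alpha>. if \<alpha> \<in> {0,2*pi} then (cos (\<alpha>/2))\<^sup>2 * m (2 * sin (\<alpha>/2)) else 0)"
  proof (rule dominated_convergence(2)[where h="%_. m0"])
   show "(%\<alpha>. (cos (\<alpha>/2))^2 * m (2 * real n * sin (\<alpha>/2))) integrable_on {0..2*pi}" for n
    by (intro integrable_continuous_interval continuous_intros cm) simp_all
   show "(%_. m0) integrable_on {0..2*pi}" by (rule integrable_const_ivl)
   show "norm ((cos (\<alpha>/2))^2 * m (2 * real n * sin (\<alpha>/2))) <= m0" for n \<alpha>
   proof -
    have "\<bar>(cos (\<alpha>/2))\<^sup>2\<bar> <= 1" by (simp add: abs_square_le_1)
    then have "\<bar>(cos (\<alpha>/2))\<^sup>2\<bar> * \<bar>m (2 * real n * sin (\<alpha>/2))\<bar> <= 1 * m0"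
     using bd by (intro mult_mono) auto
    then show ?thesis by (simp add: abs_mult)
   qed
   fix \<alpha> :: real assume a: "\<alpha> \<in> {0..2*pi}"
   show "(%n. (cos (\<alpha>/2))^2 * m (2 * real n * sin (\<alpha>/2)))
    \<longlonglongrightarrow> (if \<alpha> \<in> {0,2*pi} then (cos (\<alpha>/2))\<^sup>2 * m (2 * sin (\<alpha>/2)) else 0)"
   proof (cases "\<alpha> \<in> {0,2*pi}")
    case True then show ?thesis by auto
   next
    case False
    then have s: "sin (\<alpha>/2) > 0" using a by (intro sin_gt_zero) auto
    obtain n0 :: nat where n0: "real n0 > S / (2 * sin (\<alpha>/2))" using reals_Archimedean2 by blast
    have "eventually (%n. (cos (\<alpha>/2))^2 * m (2 * real n * sin (\<alpha>/2)) = 0) sequentially"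
    proof (rule eventually_sequentiallyI[of n0])
     fix n assume "n0 <= n"
     then have "real n > S / (2 * sin (\<alpha>/2))" using n0 by linarith
     then have "2 * real n * sin (\<alpha>/2) > S" using s by (simp add: field_simps)
     then show "(cos (\<alpha>/2))^2 * m (2 * real n * sin (\<alpha>/2)) = 0" using supp by simp
    qed
    then show ?thesis using False by (simp add: tendsto_eventually)
   qed
  qed
  moreover have "integral {0..2*pi} (%\<alpha>. if \<alpha> \<in> {0,2*pi} then (cos (\<alpha>/2))\<^sup>2 * m (2 * sin (\<alpha>/2)) else 0)
    = integral {0..2*pi} (%\<alpha>. 0)"
   by (rule integral_spike[of "{0,2*pi}"]) auto
  ultimately show ?thesis by (simp add: \<Phi>_def)
 qed
 have "integral {r0..r1} f <= \<Phi> r0 - 0"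
 proof (rule LIMSEQ_le_const)
  show "(%n. \<Phi> r0 - \<Phi> (real n)) \<longlonglongrightarrow> \<Phi> r0 - 0" by (intro tendsto_intros lim)
  obtain N :: nat where "real N > r1" using reals_Archimedean2 by blast
  then show "\<exists>N. \<forall>n\<ge>N. integral {r0..r1} f <= \<Phi> r0 - \<Phi> (real n)"
   using le by (metis less_le_trans less_imp_le of_nat_le_iff)
 qed
 then show ?thesis using \<Phi>0 by (simp add: f_def[abs_def])
qed

section \<open>Averages over horizontal circles and autocorrelation\<close>

definition ee :: "real => real^3" where
 "ee th = cos th *\<^sub>R axis 1 1 + sin th *\<^sub>R axis 2 1"

lemma ee_nth [simp]: "ee th $ 1 = cos th" "ee th $ 2 = sin th" "ee th $ 3 = 0"
 by (simp_all add: ee_def axis_def)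

lemma norm_ee [simp]: "norm (ee th) = 1"
 by (simp add: norm_eq_sqrt_inner inner_vec_def sum_3 flip: power2_eq_square)

lemma continuous_on_ee [continuous_intros]:
 fixes f :: "'c::t2_space => real"
 shows "continuous_on S f ==> continuous_on S (%x. ee (f x))"
 unfolding ee_def by (intro continuous_intros)

lemma ee_add_pi: "ee (th + pi) = - ee th"
 by (simp add: vec_eq_iff forall_3)

lemma ee_periodic: "ee (th + 2 * pi) = ee th"
 by (simp add: vec_eq_iff forall_3)

lemma ee_diff: "ee th - ee (th - \<alpha>) = (2 * sin (\<alpha>/2)) *\<^sub>R ee (th + (pi/2 - \<alpha>/2))"
proof -
 have "cos th - cos (th - \<alpha>) = 2 * sin ((th + (th - \<alpha>))/2) * sin (((th - \<alpha>) - th)/2)"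
  by (rule cos_diff_cos)
 moreover have "sin th - sin (th - \<alpha>) = 2 * sin ((th - (th - \<alpha>))/2) * cos ((th + (th - \<alpha>))/2)"
  by (rule sin_diff_sin)
 moreover have "cos (th + (pi/2 - \<alpha>/2)) = - sin (th - \<alpha>/2)" "sin (th + (pi/2 - \<alpha>/2)) = cos (th - \<alpha>/2)"
  using cos_add[of "th - \<alpha>/2" "pi/2"] sin_add[of "th - \<alpha>/2" "pi/2"] by (simp_all add: algebra_simps)
 moreover have "(2 * th - \<alpha>)/2 = th - \<alpha>/2" "(th + (th - \<alpha>))/2 = th - \<alpha>/2" "((th - \<alpha>) - th)/2 = - (\<alpha>/2)" "(th - (th - \<alpha>))/2 = \<alpha>/2"
  by (simp_all add: field_simps)
 ultimately show ?thesis by (simp add: vec_eq_iff forall_3)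
qed

lemma scaled_circle_periodic_integral:
 fixes C :: "real^3 => complex"
 assumes c: "cont C"
 shows "integral {0..2*pi} (%th. C (s *\<^sub>R ee (th + a))) = integral {0..2*pi} (%th. C (s *\<^sub>R ee th))"
 by (rule integral_periodic_shift[where f="%th. C (s *\<^sub>R ee th)"])
   (auto intro!: continuous_on_compose2[OF c] continuous_intros simp: ee_periodic)

text \<open>For \<open>J = j2 + i j1\<close> the real part is the circulation of (j1, j2) on the
  horizontal circle of radius r about x, divided by r; the imaginary part is the outward flux
  divided by r. The third coordinate is only a parameter.\<close>

definition circle_transform :: "(real^3 => complex) => real => real^3 => complex" where
 "circle_transform J r x = integral {0..2*pi} (%th. J (x + r *\<^sub>R ee th) * cis th)"

definition autocorr :: "(real^3 => complex) => real^3 => complex" where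
 "autocorr J z = (LBINT x. J (x + z) * cnj (J x))"

lemma continuous_on_shift_comp:
 assumes "cont J" "continuous_on S f"
 shows "continuous_on S (%x. J (f x))"
 by (rule continuous_on_compose2[OF assms]) simp

lemma ccs_bound:
 fixes f :: "'a::euclidean_space => 'b::real_normed_vector"
 assumes "ccs f"
 obtains R where "R > 0" "\<And>x. R < norm x ==> f x = 0"
proof -
 obtain R where "\<And>x. R < norm x ==> f x = 0" using assms by (auto simp: ccs_def)
 then have "\<And>x. max R 1 < norm x ==> f x = 0" by auto
 then show ?thesis using that[of "max R 1"] by simp
qed

lemma ccsI: "cont f ==> (\<And>x. R < norm x ==> f x = 0) ==> ccs f"
 by (auto simp: ccs_def)

lemma ccs_continuous: "ccs f ==> cont f"
 by (simp add: ccs_def)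

lemma ccs_norm2: "ccs f ==> ccs (%x. (norm (f x))^2)"
 by (auto simp: ccs_def intro!: continuous_intros)

lemma ccs_mult_left:
 fixes f g :: "'a::euclidean_space => 'b::real_normed_algebra"
 shows "ccs f ==> cont g ==> ccs (%x. f x * g x)"
 by (fastforce simp: ccs_def intro!: continuous_intros)

context
 fixes J :: "real^3 => complex"
 assumes J: "ccs J"
begin

lemma autocorr_continuous: "cont (autocorr J)"
proof -
 obtain a b where ab: "\<And>x. x \<notin> cbox a b ==> J x = 0" using ccs_cbox[OF J] by metis
 have e: "autocorr J z = integral (cbox a b) (%x. J (x + z) * cnj (J x))" for z
  unfolding autocorr_def
  by (rule integral_lborel_eq_cbox(2))
    (use ab in \<open>auto intro!: continuous_intros continuous_on_shift_comp[OF ccs_continuous[OF J]]\<close>)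
 have "cont (%z. integral (cbox a b) (%x. J (x + z) * cnj (J x)))"
  by (rule integral_continuous_on_param)
    (auto simp: case_prod_beta intro!: continuous_intros continuous_on_shift_comp[OF ccs_continuous[OF J]])
 then show ?thesis by (simp add: e[abs_def])
qed

lemma autocorr_uminus: "autocorr J (- z) = cnj (autocorr J z)"
proof -
 have "autocorr J (- z) = (LBINT x. J (x + z + - z) * cnj (J (x + z)))"
  unfolding autocorr_def by (rule integral_lborel_shift[where v=z, symmetric])
 also have "... = (LBINT x. cnj (J (x + z) * cnj (J x)))"
  by (simp add: mult.commute)
 also have "... = cnj (autocorr J z)" unfolding autocorr_def by (rule Bochner_Integration.integral_cnj)
 finally show ?thesis .
qed

lemma autocorr_norm: "cmod (autocorr J z) <= (LBINT x. (cmod (J x))^2)"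
proof -
 have i: "L1 (%x. (cmod (J x))^2)"
  by (intro ccs_integrable ccs_norm2 J)
 obtain R where R: "\<And>x. R < norm x ==> J x = 0" using ccs_bound[OF J] by metis
 have "ccs (%x. (cmod (J (x + z)))^2)"
 proof (rule ccsI[where R="R + norm z"])
  show "cont (%x. (cmod (J (x + z)))^2)"
   by (intro continuous_intros continuous_on_shift_comp[OF ccs_continuous[OF J]])
  show "(cmod (J (x + z)))^2 = 0" if "R + norm z < norm x" for x
   using R[of "x + z"] norm_triangle_ineq4[of "x + z" z] that by simp
 qed
 then have i2: "L1 (%x. (cmod (J (x + z)))^2)" by (rule ccs_integrable)
 have "cmod (autocorr J z) <= (LBINT x. ((cmod (J (x + z)))^2 + (cmod (J x))^2) / 2)"
  unfolding autocorr_def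
 proof (rule Bochner_Integration.integral_norm_bound_integral)
  show "L1 (%x. J (x + z) * cnj (J x))"
   by (subst mult.commute, intro ccs_integrable ccs_mult_left continuous_on_shift_comp[OF ccs_continuous[OF J]])
     (use J in \<open>auto simp: ccs_def intro!: continuous_intros\<close>)
  show "L1 (%x. ((cmod (J (x + z)))^2 + (cmod (J x))^2) / 2)"
   using i i2 by simp
  show "cmod (J (x + z) * cnj (J x)) <= ((cmod (J (x + z)))^2 + (cmod (J x))^2) / 2" for x
   using sum_squares_bound[of "cmod (J (x + z))" "cmod (J x)"] by (simp add: norm_mult)
 qed
 also have "... = (LBINT x. (cmod (J x))^2)"
  using i i2 integral_lborel_shift[of "%x. (cmod (J x))^2" z] by simp
 finally show ?thesis .
qed

lemma circle_transform_continuous: "cont (circle_transform J r)"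
proof -
 have "cont (%x. integral (cbox 0 (2*pi)) (%th. J (x + r *\<^sub>R ee th) * cis th))"
  by (rule integral_continuous_on_param)
    (auto simp: case_prod_beta intro!: continuous_intros continuous_on_shift_comp[OF ccs_continuous[OF J]])
 then show ?thesis by (simp add: circle_transform_def[abs_def])
qed

lemma circle_transform_ccs: "ccs (circle_transform J r)"
proof -
 obtain R where R: "\<And>x. R < norm x ==> J x = 0" using ccs_bound[OF J] by metis
 have "J (x + r *\<^sub>R ee th) = 0" if "R + \<bar>r\<bar> < norm x" for x th
 proof (rule R)
  have "norm x <= norm (x + r *\<^sub>R ee th) + norm (r *\<^sub>R ee th)"
   by (metis add_diff_cancel_right' norm_triangle_ineq4)
  then show "R < norm (x + r *\<^sub>R ee th)" using that by simp
 qed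
 then show ?thesis
  by (intro ccsI[where R="R + \<bar>r\<bar>"] circle_transform_continuous) (simp add: circle_transform_def)
qed

text \<open>Expanding the square and translating in x leaves the autocorrelation at the chord
  between two points of the circle. With \<alpha> the difference of the two angles, the chord has
  length \<open>2 * r * sin (\<alpha>/2)\<close> by \<open>ee_diff\<close>, and its direction runs
  once around the circle with the other angle, so the phase \<open>pi/2 - \<alpha>/2\<close> can be
  shifted away.\<close>

lemma circle_transform_norm2:
 "of_real (LBINT x. (cmod (circle_transform J r x))^2)
  = integral {0..2*pi} (%\<alpha>. cis \<alpha> * integral {0..2*pi} (%th. autocorr J ((2 * r * sin (\<alpha>/2)) *\<^sub>R ee th)))"
proof -
 note cJ = ccs_continuous[OF J]
 note cs = continuous_on_shift_comp[OF cJ]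
 note cA = continuous_on_shift_comp[OF autocorr_continuous]
 obtain R where R: "\<And>x. R < norm x ==> J x = 0" using ccs_bound[OF J] by metis
 obtain b where "cball (0::real^3) (R + \<bar>r\<bar>) \<subseteq> cbox (-b) b"
  using bounded_subset_cbox_symmetric[OF bounded_cball] by metis
 then have b: "R + \<bar>r\<bar> < norm x" if "x \<notin> cbox (-b) b" for x using that by (force simp: subset_iff not_less)
 have Jz: "J (x + r *\<^sub>R ee th) = 0" if "x \<notin> cbox (-b) b" for x th
 proof (rule R)
  have "norm x <= norm (x + r *\<^sub>R ee th) + norm (r *\<^sub>R ee th)"
   by (metis add_diff_cancel_right' norm_triangle_ineq4)
  then show "R < norm (x + r *\<^sub>R ee th)" using b[OF that] by simp
 qed
 define T where "T = circle_transform J r"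
 have cT: "continuous_on S (%x. T (f x))" if "continuous_on S f" for S :: "'c::topological_space set" and f
  unfolding T_def by (rule continuous_on_shift_comp[OF circle_transform_continuous that])
 have iJ: "(%th. cnj (J (x + r *\<^sub>R ee th) * cis th)) integrable_on {0..2*pi}" for x
  by (intro integrable_continuous_interval continuous_intros cs)
 have cnjT: "cnj (T x) = integral {0..2*pi} (%th. cnj (J (x + r *\<^sub>R ee th) * cis th))" for x
  unfolding T_def circle_transform_def
  by (rule Henstock_Kurzweil_Integration.integral_cnj)
 have "complex_of_real (LBINT x. (cmod (T x))^2) = (LBINT x. T x * cnj (T x))"
  by (simp add: complex_norm_square flip: integral_complex_of_real del: of_real_power)
 also have "... = (LBINT x. integral (cbox 0 (2*pi)) (%th. J (x + r *\<^sub>R ee th) * cis th * cnj (T x)))"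
  by (simp add: T_def circle_transform_def)
 also have "... = integral (cbox 0 (2*pi)) (%th. \<integral>x. J (x + r *\<^sub>R ee th) * cis th * cnj (T x) \<partial>lborel)"
  by (rule integral_lborel_swap)
    (use Jz in \<open>auto simp: case_prod_beta intro!: continuous_intros cs cT\<close>)
 also have "... = integral (cbox 0 (2*pi)) (%th. \<integral>x. integral (cbox 0 (2*pi)) (%\<phi>. J (x + r *\<^sub>R ee th) * cis th * cnj (J (x + r *\<^sub>R ee \<phi>) * cis \<phi>)) \<partial>lborel)"
  by (simp add: cnjT del: complex_cnj_mult)
 also have "... = integral (cbox 0 (2*pi)) (%th. integral (cbox 0 (2*pi)) (%\<phi>. \<integral>x. J (x + r *\<^sub>R ee th) * cis th * cnj (J (x + r *\<^sub>R ee \<phi>) * cis \<phi>) \<partial>lborel))"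
  by (rule Henstock_Kurzweil_Integration.integral_cong, rule integral_lborel_swap)
    (use Jz in \<open>auto simp: case_prod_beta intro!: continuous_intros cs cT\<close>)
 also have "... = integral (cbox 0 (2*pi)) (%th. integral (cbox 0 (2*pi)) (%\<phi>. cis (th - \<phi>) * autocorr J (r *\<^sub>R (ee th - ee \<phi>))))"
 proof -
  have "(LBINT x. J (x + r *\<^sub>R ee th) * cis th * cnj (J (x + r *\<^sub>R ee \<phi>) * cis \<phi>))
   = cis (th - \<phi>) * autocorr J (r *\<^sub>R (ee th - ee \<phi>))" for th \<phi>
  proof -
   have "(LBINT x. J (x + r *\<^sub>R ee th) * cis th * cnj (J (x + r *\<^sub>R ee \<phi>) * cis \<phi>))
    = (LBINT x. cis (th - \<phi>) * (J ((x + r *\<^sub>R ee \<phi>) + r *\<^sub>R (ee th - ee \<phi>)) * cnj (J (x + r *\<^sub>R ee \<phi>))))"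
    by (rule Bochner_Integration.integral_cong)
      (simp_all add: algebra_simps cis_cnj cis_mult)
   also have "... = (LBINT x. cis (th - \<phi>) * (J (x + r *\<^sub>R (ee th - ee \<phi>)) * cnj (J x)))"
    by (rule integral_lborel_shift)
   also have "... = cis (th - \<phi>) * autocorr J (r *\<^sub>R (ee th - ee \<phi>))"
    unfolding autocorr_def by (rule integral_mult_right_zero)
   finally show ?thesis .
  qed
  then show ?thesis by simp
 qed
 also have "... = integral (cbox 0 (2*pi)) (%th. integral (cbox 0 (2*pi)) (%\<alpha>. cis \<alpha> * autocorr J ((2 * r * sin (\<alpha>/2)) *\<^sub>R ee (th + (pi/2 - \<alpha>/2)))))"
 proof (rule Henstock_Kurzweil_Integration.integral_cong)
  fix th :: real
  define f where "f \<phi> = cis (th - \<phi>) * autocorr J (r *\<^sub>R (ee th - ee \<phi>))" for \<phi>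
  have cf: "cont f" unfolding f_def by (intro continuous_intros cA)
  have pf: "f (\<phi> + 2 * pi) = f \<phi>" for \<phi>
  proof -
   have "cis (th - (\<phi> + 2 * pi)) = cis (th - \<phi>)"
    by (simp add: complex_eq_iff cos_diff sin_diff cos_add sin_add)
   then show ?thesis by (simp add: f_def ee_periodic)
  qed
  \<comment> \<open>A reflection and two translations by periodicity perform the substitution
    \<open>\<phi> = th - \<alpha>\<close>.\<close>
  have "integral {0..2*pi} f = integral {- (2*pi)..- 0} (%x. f (- x))"
   by (rule Henstock_Kurzweil_Integration.integral_reflect_real[symmetric])
  also have "... = integral {0 + - (2*pi)..2*pi + - (2*pi)} (%x. f (- x))" by simp
  also have "... = integral {0..2*pi} ((%x. f (- x)) \<circ> (%x. x + - (2*pi)))"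
   by (rule integral_shift[symmetric]) (intro continuous_on_shift_comp[OF cf] continuous_intros)
  also have "... = integral {0..2*pi} (%x. f (- x))"
   using pf[of "- x" for x] by (simp add: o_def algebra_simps)
  also have "... = integral {0..2*pi} (%x. f (- x + th))"
  proof -
   have "integral {0..2*pi} (%x. (%x. f (- x)) (x + - th)) = integral {0..2*pi} (%x. f (- x))"
   proof (rule integral_periodic_shift)
    show "cont (%x. f (- x))" by (intro continuous_on_shift_comp[OF cf] continuous_intros)
    show "f (- (x + 2 * pi)) = f (- x)" for x using pf[of "- x - 2 * pi"] by simp
   qed simp
   then show ?thesis by (simp add: algebra_simps)
  qed
  also have "... = integral {0..2*pi} (%\<alpha>. cis \<alpha> * autocorr J ((2 * r * sin (\<alpha>/2)) *\<^sub>R ee (th + (pi/2 - \<alpha>/2))))"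
  proof -
   have "f (- \<alpha> + th) = cis \<alpha> * autocorr J ((2 * r * sin (\<alpha>/2)) *\<^sub>R ee (th + (pi/2 - \<alpha>/2)))" for \<alpha>
   proof -
    have "- \<alpha> + th = th - \<alpha>" by simp
    then show ?thesis unfolding f_def by (simp only: ee_diff) (simp add: mult_ac)
   qed
   then show ?thesis by simp
  qed
  finally show "integral (cbox 0 (2*pi)) (%\<phi>. cis (th - \<phi>) * autocorr J (r *\<^sub>R (ee th - ee \<phi>)))
   = integral (cbox 0 (2*pi)) (%\<alpha>. cis \<alpha> * autocorr J ((2 * r * sin (\<alpha>/2)) *\<^sub>R ee (th + (pi/2 - \<alpha>/2))))"
   by (simp add: f_def[abs_def])
 qed
 also have "... = integral (cbox 0 (2*pi)) (%\<alpha>. integral (cbox 0 (2*pi)) (%th. cis \<alpha> * autocorr J ((2 * r * sin (\<alpha>/2)) *\<^sub>R ee (th + (pi/2 - \<alpha>/2)))))"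
  by (rule integral_swap_continuous) (auto simp: case_prod_beta intro!: continuous_intros cA)
 also have "... = integral {0..2*pi} (%\<alpha>. cis \<alpha> * integral {0..2*pi} (%th. autocorr J ((2 * r * sin (\<alpha>/2)) *\<^sub>R ee th)))"
  by (simp add: scaled_circle_periodic_integral[OF autocorr_continuous])
 finally show ?thesis by (simp add: T_def)
qed

text \<open>The angular integral of the autocorrelation is real, because
  \<open>autocorr J (- z)\<close> is the conjugate of \<open>autocorr J z\<close> and opposite
  directions are averaged together. The squared norm of the transform is then a cosine integral of
  it, non-negative for free. The angular integral is at most \<open>2 * pi\<close> times the squared
  norm of J, and \<open>angular_kernel_bound\<close> supplies the other factor pi.\<close>

theorem circle_transform_scales_bound:
 assumes r: "0 < r0" "r0 <= r1"
 shows "(%r. (LBINT x. (cmod (circle_transform J r x))^2) / r) integrable_on {r0..r1}" (is ?A)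
  and "integral {r0..r1} (%r. (LBINT x. (cmod (circle_transform J r x))^2) / r)
    <= 2 * pi^2 * (LBINT x. (cmod (J x))^2)" (is ?B)
proof -
 note cA = continuous_on_shift_comp[OF autocorr_continuous]
 define M where "M s = integral {0..2*pi} (%th. autocorr J (s *\<^sub>R ee th))" for s
 define m where "m s = Re (M s)" for s
 have cM: "cont M"
 proof -
  have "cont (%s. integral (cbox 0 (2*pi)) (%th. autocorr J (s *\<^sub>R ee th)))"
   by (rule integral_continuous_on_param) (auto simp: case_prod_beta intro!: continuous_intros cA)
  then show ?thesis by (simp add: M_def[abs_def])
 qed
 then have cm: "cont m" unfolding m_def by (intro continuous_intros)
 note cms = continuous_on_shift_comp[OF cm]
 have iM: "(%th. autocorr J (s *\<^sub>R ee th)) integrable_on {0..2*pi}" for s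
  by (intro integrable_continuous_interval cA continuous_intros)
 have Mreal: "M s = of_real (m s)" for s
 proof -
  have "M s = integral {0..2*pi} (%th. autocorr J (s *\<^sub>R ee (th + pi)))"
   unfolding M_def by (rule scaled_circle_periodic_integral[OF autocorr_continuous, symmetric])
  also have "... = integral {0..2*pi} (%th. cnj (autocorr J (s *\<^sub>R ee th)))"
   by (simp add: ee_add_pi autocorr_uminus)
  also have "... = cnj (M s)"
   unfolding M_def
   by (rule Henstock_Kurzweil_Integration.integral_cnj[symmetric])
  finally show ?thesis by (simp add: m_def complex_eq_iff)
 qed
 have G: "(LBINT x. (cmod (circle_transform J r x))^2) = integral {0..2*pi} (%\<alpha>. cos \<alpha> * m (2 * r * sin (\<alpha>/2)))" for r
 proof -
  have "(LBINT x. (cmod (circle_transform J r x))^2)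
   = Re (integral {0..2*pi} (%\<alpha>. cis \<alpha> * of_real (m (2 * r * sin (\<alpha>/2)))))"
   using arg_cong[OF circle_transform_norm2[of r], of Re] by (simp add: M_def[symmetric] Mreal)
  also have "... = integral {0..2*pi} (Re \<circ> (%\<alpha>. cis \<alpha> * of_real (m (2 * r * sin (\<alpha>/2)))))"
   by (rule integral_linear[OF _ bounded_linear_Re, symmetric])
     (intro integrable_continuous_interval continuous_intros cms, simp_all)
  finally show ?thesis by (simp add: o_def)
 qed
 have "continuous_on ({r0..r1} \<times> cbox 0 (2*pi)) (%(r,\<alpha>). cos \<alpha> * m (2 * r * sin (\<alpha>/2)))"
  unfolding case_prod_beta by (intro continuous_intros cms) simp_all
 from integral_continuous_on_param[OF this]
 have "continuous_on {r0..r1} (%r. integral {0..2*pi} (%\<alpha>. cos \<alpha> * m (2 * r * sin (\<alpha>/2))))" by simp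
 then have "continuous_on {r0..r1} (%r. integral {0..2*pi} (%\<alpha>. cos \<alpha> * m (2 * r * sin (\<alpha>/2))) / r)"
  by (rule continuous_on_divide[OF _ continuous_on_id]) (use r in auto)
 then show ?A unfolding G by (rule integrable_continuous_interval)
 let ?n = "\<integral>x. (cmod (J x))^2 \<partial>lborel"
 have bd: "\<bar>m s\<bar> <= 2 * pi * ?n" for s
 proof -
  have "norm (M s) <= integral {0..2*pi} (%_. ?n)"
   unfolding M_def by (rule Henstock_Kurzweil_Integration.integral_norm_bound_integral[OF iM]) (auto intro: autocorr_norm)
  then have "norm (M s) <= 2 * pi * ?n" by simp
  then show ?thesis unfolding Mreal by simp
 qed
 obtain R where R: "\<And>x. R < norm x ==> J x = 0" using ccs_bound[OF J] by metis
 have supp: "m s = 0" if "s > 2 * \<bar>R\<bar>" for s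
 proof -
  have "autocorr J (s *\<^sub>R ee th) = 0" for th
  proof -
   have "J (x + s *\<^sub>R ee th) * cnj (J x) = 0" for x
   proof (cases "R < norm x")
    case False
    have "norm (s *\<^sub>R ee th) <= norm (x + s *\<^sub>R ee th) + norm x"
     by (metis add_diff_cancel_left' norm_triangle_ineq4)
    then have "R < norm (x + s *\<^sub>R ee th)" using False that by simp
    then show ?thesis using R by simp
   qed (use R in simp)
   then show ?thesis unfolding autocorr_def by (simp only: Bochner_Integration.integral_zero)
  qed
  then show ?thesis by (simp add: m_def M_def)
 qed
 have "integral {r0..r1} (%r. integral {0..2*pi} (%\<alpha>. cos \<alpha> * m (2 * r * sin (\<alpha>/2))) / r) <= pi * (2 * pi * ?n)"
  by (rule angular_kernel_bound[OF cm r bd supp]) (auto simp flip: G)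
 then show ?B unfolding G by (simp add: power2_eq_square mult_ac)
qed

end

section \<open>Circulation and winding\<close>

abbreviation "ex1 \<equiv> axis 1 1 :: real^3"
abbreviation "ex2 \<equiv> axis 2 1 :: real^3"

definition tt :: "real => real^3" where
 "tt th = - sin th *\<^sub>R ex1 + cos th *\<^sub>R ex2"

lemma continuous_on_tt [continuous_intros]:
 fixes f :: "'c::t2_space => real"
 shows "continuous_on S f ==> continuous_on S (%x. tt (f x))"
 unfolding tt_def by (intro continuous_intros)

lemma ee_has_vector_derivative: "(ee has_vector_derivative tt th) (at th within S)"
proof -
 have "(cos has_real_derivative - sin th) (at th within S)" "(sin has_real_derivative cos th) (at th within S)"
  using DERIV_cos DERIV_sin DERIV_subset[OF _ subset_UNIV] by blast+
 from has_vector_derivative_add[OF has_vector_derivative_scaleR[OF this(1) has_vector_derivative_const[of ex1]]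
   has_vector_derivative_scaleR[OF this(2) has_vector_derivative_const[of ex2]]]
 show ?thesis by (simp add: ee_def[abs_def] tt_def)
qed

lemma has_integral_antiderivative:
 fixes F :: "real => real"
 assumes "\<And>x. (F has_real_derivative f x) (at x)" "a <= b"
 shows "(f has_integral (F b - F a)) {a..b}"
 by (rule fundamental_theorem_of_calculus[OF assms(2)])
   (rule has_real_derivative_iff_has_vector_derivative[THEN iffD1, OF DERIV_subset[OF assms(1) subset_UNIV]])

lemma integral_cis_period: "integral {0..2*pi} cis = 0"
proof -
 have 1: "((%x. - cos x) has_real_derivative sin x) (at x)" for x :: real
  by (auto intro!: derivative_eq_intros)
 have "integral {0..2*pi} (sin::real=>real) = 0" "integral {0..2*pi} (cos::real=>real) = 0"
  using has_integral_antiderivative[OF 1, of 0 "2*pi"] has_integral_antiderivative[OF DERIV_sin, of 0 "2*pi"]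
  by (auto simp: integral_unique)
 moreover have "cis = (%x. of_real (cos x) + \<i> * of_real (sin x))"
  by (auto simp: complex_eq_iff)
 moreover have i: "(%x::real. sin x) integrable_on {0..2*pi}" "(%x::real. cos x) integrable_on {0..2*pi}"
  by (auto intro!: integrable_continuous_interval continuous_intros)
 moreover have "integral {0..2*pi} (%x. complex_of_real (cos x) + \<i> * of_real (sin x))
  = integral {0..2*pi} (%x. complex_of_real (cos x)) + integral {0..2*pi} (%x. \<i> * of_real (sin x))"
  by (intro integral_add integrable_continuous_interval continuous_intros)
 ultimately show ?thesis
  using integral_linear[OF i(1) bounded_linear_of_real[where 'a=complex]] integral_linear[OF i(2) bounded_linear_of_real[where 'a=complex]]
  by (simp add: o_def)
qed

lemma periodic_FTC:
 fixes f :: "real => 'b::banach"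
 assumes "\<And>th. (f has_vector_derivative f' th) (at th)" "f (2*pi) = f 0"
 shows "integral {0..2*pi} f' = 0"
proof -
 have "(f' has_integral (f (2*pi) - f 0)) {0..2*pi}"
  by (rule fundamental_theorem_of_calculus) (auto intro: assms has_vector_derivative_at_within)
 then show ?thesis using assms by (simp add: integral_unique)
qed

text \<open>For a primitive L of \<open>g' / g\<close> the product \<open>g * exp (- L)\<close> is
  constant, so periodicity of g makes \<open>exp (- L (2*pi))\<close> equal to 1. This yields the
  winding number without choosing an argument of g.\<close>

lemma log_derivative_integral:
 fixes g :: "real => complex"
 assumes d: "\<And>th. (g has_vector_derivative g' th) (at th)" and c: "cont g'"
  and nz: "\<And>th. th \<in> {0..2*pi} ==> g th \<noteq> 0" and per: "g (2*pi) = g 0"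
 obtains n :: int where "integral {0..2*pi} (%th. Im (g' th / g th)) = 2 * pi * n"
proof -
 have cg: "continuous_on S g" for S
  by (meson d continuous_at_imp_continuous_on has_vector_derivative_continuous)
 have ci: "continuous_on {0..2*pi} (%th. g' th / g th)"
  using nz by (intro continuous_intros continuous_on_subset[OF c] cg) auto
 define L where "L th = integral {0..th} (%th. g' th / g th)" for th
 have Ld: "(L has_vector_derivative g' th / g th) (at th within {0..2*pi})" if "th \<in> {0..2*pi}" for th
  unfolding L_def by (rule integral_has_vector_derivative[OF ci that])
 have "((%th. g th * exp (- L th)) has_vector_derivative 0) (at th within {0..2*pi})"
  if t: "th \<in> {0..2*pi}" for th
 proof -
  have "((%th. exp (- L th)) has_vector_derivative (- (g' th / g th)) * exp (- L th)) (at th within {0..2*pi})"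
   using field_vector_diff_chain_within[OF has_vector_derivative_minus[OF Ld[OF t]], of exp "exp (- L th)"]
   by (simp add: o_def DERIV_subset[OF DERIV_exp])
  from has_vector_derivative_mult[OF has_vector_derivative_at_within[OF d] this]
  have "((%th. g th * exp (- L th)) has_vector_derivative
   g th * (- (g' th / g th) * exp (- L th)) + g' th * exp (- L th)) (at th within {0..2*pi})" .
  moreover have "g th * (- (g' th / g th) * exp (- L th)) + g' th * exp (- L th) = 0"
   using nz[OF t] by simp
  ultimately show ?thesis by (simp only:)
 qed
 note D = this
 obtain k where "\<And>th. th \<in> {0..2*pi} ==> g th * exp (- L th) = k"
  using has_vector_derivative_zero_constant[OF convex_closed_interval D] by blast
 from this[of 0] this[of "2*pi"] have "g 0 * exp (- L (2*pi)) = g 0"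
  using per by (simp add: L_def)
 then have "exp (- L (2*pi)) = 1" using nz[of 0] by simp
 then obtain n :: int where n: "Im (- L (2*pi)) = of_int (2 * n) * pi"
  by (auto simp: exp_eq_1)
 have "integral {0..2*pi} (Im \<circ> (%th. g' th / g th)) = Im (L (2*pi))"
  unfolding L_def by (rule integral_linear[OF integrable_continuous_interval[OF ci] bounded_linear_Im])
 then have "integral {0..2*pi} (%th. Im (g' th / g th)) = - Im (- L (2*pi))"
  by (simp add: o_def)
 also have "... = 2 * pi * of_int (- n)" unfolding n by simp
 finally show ?thesis using that by blast
qed

text \<open>Compare the value at t with the value at any s of the period and average over s; the
  resulting factor 1/(2 pi) is dropped. It is the one-dimensional Sobolev inequality that turns
  integrated smallness on a circle into smallness at each of its points.\<close>

lemma sup_le_integral_period: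
 fixes f :: "real => real"
 assumes d: "\<And>th. (f has_real_derivative f' th) (at th)"
  and c: "cont g1" "cont g2"
  and le: "\<And>th. 0 <= f th" "\<And>th. f th <= g1 th" "\<And>th. \<bar>f' th\<bar> <= g2 th"
  and t: "t \<in> {0..2*pi}"
 shows "f t <= integral {0..2*pi} (%th. g1 th + g2 th)"
proof -
 have i: "g1 integrable_on {a..b}" "g2 integrable_on {a..b}" for a b
  by (auto intro!: integrable_continuous_interval continuous_on_subset[OF c(1)] continuous_on_subset[OF c(2)])
 have g2: "g2 th \<ge> 0" for th using le(3)[of th] by linarith
 have A: "\<bar>f b - f a\<bar> <= integral {0..2*pi} g2" if "a <= b" "0 <= a" "b <= 2*pi" for a b
 proof -
  have "(f' has_integral (f b - f a)) {a..b}"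
   by (rule has_integral_antiderivative[OF d that(1)])
  then have "norm (f b - f a) <= integral {a..b} g2"
   by (metis Henstock_Kurzweil_Integration.integral_norm_bound_integral has_integral_integrable_integral i(2) le(3) real_norm_def)
  also have "... <= integral {0..2*pi} g2"
   by (intro integral_subset_le) (use that i g2 in auto)
  finally show ?thesis by simp
 qed
 have B: "f t <= g1 s + integral {0..2*pi} g2" if "s \<in> {0..2*pi}" for s
  using A[of s t] A[of t s] that t le(2)[of s] by (cases "s <= t") auto
 have "integral {0..2*pi} (%_. f t) <= integral {0..2*pi} (%s. g1 s + integral {0..2*pi} g2)"
  by (intro integral_le integrable_add i B) auto
 then have "2 * pi * f t <= integral {0..2*pi} g1 + 2 * pi * integral {0..2*pi} g2"
  by (simp add: integral_add[OF i(1) integrable_const_ivl])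
 also have "integral {0..2*pi} g1 <= 2 * pi * integral {0..2*pi} g1"
 proof -
  have "0 <= integral {0..2*pi} g1"
   using le by (intro integral_nonneg i) (meson order_trans)
  then show ?thesis using pi_gt3 mult_right_mono[of 1 "2*pi" "integral {0..2*pi} g1"] by simp
 qed
 finally have "2 * pi * f t <= 2 * pi * (integral {0..2*pi} g1 + integral {0..2*pi} g2)"
  by (simp add: algebra_simps)
 then show ?thesis using i by (simp add: integral_add)
qed

text \<open>In polar coordinates the radial derivative of the circulation integrand is s times the
  curl plus the angular derivative of the radial component \<open>q\<close>; the latter integrates
  to 0 over a period.\<close>

lemma stokes_disc:
 fixes b1 b2 :: "real^3 => real"
 assumes d1: "\<And>x. (b1 has_derivative db1 x) (at x)" and c1: "\<And>v. cont (%x. db1 x v)"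
  and d2: "\<And>x. (b2 has_derivative db2 x) (at x)" and c2: "\<And>v. cont (%x. db2 x v)"
  and r: "0 <= r"
 shows "integral {0..2*pi} (%th. r * (- sin th * b1 (x + r *\<^sub>R ee th) + cos th * b2 (x + r *\<^sub>R ee th)))
  = integral (cbox (0,0) (r,2*pi)) (%(s,th). s * (db2 (x + s *\<^sub>R ee th) ex1 - db1 (x + s *\<^sub>R ee th) ex2))"
proof -
 have lin1: "linear (db1 y)" and lin2: "linear (db2 y)" for y
  using d1 d2 has_derivative_linear by blast+
 have cb1: "cont b1" and cb2: "cont b2"
  using d1 d2 by (auto intro!: continuous_at_imp_continuous_on has_derivative_continuous)
 note cs = continuous_on_shift_comp[OF cb1] continuous_on_shift_comp[OF cb2]
  continuous_on_shift_comp[OF c1] continuous_on_shift_comp[OF c2]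
 have ed1: "db1 y (ee th) = cos th * db1 y ex1 + sin th * db1 y ex2"
  and ed2: "db2 y (ee th) = cos th * db2 y ex1 + sin th * db2 y ex2"
  and td1: "db1 y (tt th) = - sin th * db1 y ex1 + cos th * db1 y ex2"
  and td2: "db2 y (tt th) = - sin th * db2 y ex1 + cos th * db2 y ex2" for y th
  by (simp_all add: ee_def tt_def linear_add[OF lin1] linear_add[OF lin2]
    linear_cmul[OF lin1] linear_cmul[OF lin2] linear_diff[OF lin1] linear_diff[OF lin2])
 define k where "k s th = s * (- sin th * b1 (x + s *\<^sub>R ee th) + cos th * b2 (x + s *\<^sub>R ee th))" for s th
 define k' where "k' s th = (- sin th * b1 (x + s *\<^sub>R ee th) + cos th * b2 (x + s *\<^sub>R ee th))
   + s * (- sin th * db1 (x + s *\<^sub>R ee th) (ee th) + cos th * db2 (x + s *\<^sub>R ee th) (ee th))" for s th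
 define q where "q s th = cos th * b1 (x + s *\<^sub>R ee th) + sin th * b2 (x + s *\<^sub>R ee th)" for s th
 define q' where "q' s th = (- sin th * b1 (x + s *\<^sub>R ee th) + cos th * b2 (x + s *\<^sub>R ee th))
   + s * (cos th * db1 (x + s *\<^sub>R ee th) (tt th) + sin th * db2 (x + s *\<^sub>R ee th) (tt th))" for s th
 define cu where "cu s th = s * (db2 (x + s *\<^sub>R ee th) ex1 - db1 (x + s *\<^sub>R ee th) ex2)" for s th
 have k'eq: "k' s th = cu s th + q' s th" for s th
 proof -
  have "(cos th)^2 = 1 - (sin th)\<^sup>2" by (simp add: cos_squared_eq)
  then show ?thesis unfolding k'_def cu_def q'_def ed1 ed2 td1 td2 by algebra
 qed
 have kd: "((%s. k s th) has_vector_derivative k' s th) (at s within {0..r})" for s th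
 proof -
  have p: "((%s. x + s *\<^sub>R ee th) has_vector_derivative ee th) (at s)"
   using has_vector_derivative_add[OF has_vector_derivative_const[of x]
     has_vector_derivative_scaleR[OF DERIV_ident has_vector_derivative_const[of "ee th"]]] by simp
  have "((%s. b1 (x + s *\<^sub>R ee th)) has_real_derivative db1 (x + s *\<^sub>R ee th) (ee th)) (at s)"
   "((%s. b2 (x + s *\<^sub>R ee th)) has_real_derivative db2 (x + s *\<^sub>R ee th) (ee th)) (at s)"
   using vector_derivative_diff_chain_within[OF p has_derivative_at_withinI[OF d1]]
    vector_derivative_diff_chain_within[OF p has_derivative_at_withinI[OF d2]]
   by (auto simp: o_def has_real_derivative_iff_has_vector_derivative)
  then have "((%s. k s th) has_real_derivative k' s th) (at s)"
   unfolding k_def k'_def by (auto intro!: derivative_eq_intros)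
  then show ?thesis
   by (rule has_real_derivative_iff_has_vector_derivative[THEN iffD1, OF DERIV_subset[OF _ subset_UNIV]])
 qed
 have qd: "(q s has_vector_derivative q' s th) (at th)" for s th
 proof -
  have p: "((%th. x + s *\<^sub>R ee th) has_vector_derivative s *\<^sub>R tt th) (at th)"
   using has_vector_derivative_add[OF has_vector_derivative_const[of x]
     has_vector_derivative_scaleR[OF DERIV_const[of s] ee_has_vector_derivative]] by simp
  have "((%th. b1 (x + s *\<^sub>R ee th)) has_real_derivative db1 (x + s *\<^sub>R ee th) (s *\<^sub>R tt th)) (at th)"
   "((%th. b2 (x + s *\<^sub>R ee th)) has_real_derivative db2 (x + s *\<^sub>R ee th) (s *\<^sub>R tt th)) (at th)"
   using vector_derivative_diff_chain_within[OF p has_derivative_at_withinI[OF d1]]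
    vector_derivative_diff_chain_within[OF p has_derivative_at_withinI[OF d2]]
   by (auto simp: o_def has_real_derivative_iff_has_vector_derivative)
  then have "((%th. q s th) has_real_derivative q' s th) (at th)"
   unfolding q_def q'_def linear_cmul[OF lin1] linear_cmul[OF lin2]
   by (auto intro!: derivative_eq_intros simp: algebra_simps)
  then show ?thesis by (simp add: has_real_derivative_iff_has_vector_derivative)
 qed
 have c: "continuous_on S (%z. k' (f z) (g z))" "continuous_on S (%z. q' (f z) (g z))" "continuous_on S (%z. cu (f z) (g z))"
  if "continuous_on S f" "continuous_on S g" for S :: "'z::t2_space set" and f g
  unfolding k'_def q'_def cu_def ed1 ed2 td1 td2 by (intro continuous_intros cs that)+
 have "integral {0..2*pi} (k r) = integral {0..2*pi} (%th. integral {0..r} (%s. k' s th))"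
 proof (rule Henstock_Kurzweil_Integration.integral_cong)
  fix th
  have "((%s. k' s th) has_integral (k r th - k 0 th)) {0..r}"
   by (rule fundamental_theorem_of_calculus[OF r kd])
  then show "k r th = integral {0..r} (%s. k' s th)" by (simp add: integral_unique k_def)
 qed
 also have "... = integral (cbox 0 r) (%s. integral (cbox 0 (2*pi)) (%th. k' s th))"
  by (simp add: flip: box_real(2)) (rule integral_swap_continuous, auto simp: case_prod_beta intro!: c continuous_intros)
 also have "... = integral (cbox 0 r) (%s. integral (cbox 0 (2*pi)) (%th. cu s th))"
 proof (rule Henstock_Kurzweil_Integration.integral_cong)
  fix s
  have "integral {0..2*pi} (%th. k' s th) = integral {0..2*pi} (%th. cu s th) + integral {0..2*pi} (%th. q' s th)"
   unfolding k'eq by (intro integral_add integrable_continuous_interval c continuous_intros)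
  moreover have "integral {0..2*pi} (q' s) = 0"
   by (rule periodic_FTC[OF qd]) (simp add: q_def ee_periodic[of 0, simplified])
  ultimately show "integral (cbox 0 (2*pi)) (%th. k' s th) = integral (cbox 0 (2*pi)) (%th. cu s th)" by simp
 qed
 also have "... = integral (cbox (0,0) (r,2*pi)) (%z. cu (fst z) (snd z))"
  by (subst integral_prod_continuous) (auto intro!: c continuous_intros)
 finally show ?thesis by (simp only: k_def[abs_def] cu_def case_prod_beta')
qed

section \<open>Circulation of normalised currents\<close>

text \<open>Either the circulation is quantised, or the penalty \<open>N + 4b^2/\<eta>^2\<close> pays for the failure.\<close>
lemma quantised_circulation_bound:
 fixes c \<phi> b N \<eta> \<gamma> :: real
 assumes q: "N < 1 ==> \<exists>n::int. c + \<phi> + b = 2 * pi * n"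
  and \<phi>: "0 <= \<phi>" "\<phi> <= \<eta>/2" and \<eta>: "0 < \<eta>" "\<eta> <= 1" and \<gamma>: "0 < \<gamma>" and N: "0 <= N"
 shows "2 * (pi - \<eta>) * (c + \<phi> + b)
   <= (1 + \<gamma>) * c^2 + (pi^2/\<gamma> + pi^2 + pi) * (N + 4 * b^2 / \<eta>^2) + b^2"
proof (cases "N + 4 * b^2 / \<eta>^2 < 1")
 case True
 have b4: "4 * b^2 / \<eta>^2 < 1" using True N by simp
 then have "(2 * b)^2 < \<eta>^2" using \<eta> by (simp add: field_simps power2_eq_square)
 then have b: "\<bar>2 * b\<bar> < \<eta>" using \<eta> power2_less_imp_less[of "\<bar>2 * b\<bar>" \<eta>] by simp
 have "N < 1" using True by (smt (verit) divide_nonneg_nonneg zero_le_power2)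
 then obtain n :: int where n: "c + \<phi> + b = 2 * pi * n" using q by blast
 have K: "0 <= (pi^2/\<gamma> + pi^2 + pi) * (N + 4 * b^2 / \<eta>^2)"
  using \<gamma> N by (intro mult_nonneg_nonneg add_nonneg_nonneg) auto
 have "2 * (pi - \<eta>) * (c + \<phi> + b) <= c^2"
 proof (cases "n <= 0")
  case True
  then have "c + \<phi> + b <= 0" unfolding n by (simp add: mult_le_0_iff)
  then have "2 * (pi - \<eta>) * (c + \<phi> + b) <= 0"
   using \<eta> pi_gt3 by (intro mult_nonneg_nonpos) auto
  then show ?thesis by (smt (verit) zero_le_power2)
 next
  case False
  then have n1: "real_of_int n \<ge> 1" by linarith
  define m where "m = 2 * pi * real_of_int n"
  have m: "m \<ge> 2 * pi" using n1 by (simp add: m_def)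
  define f where "f = \<phi> + b"
  have f: "\<bar>f\<bar> <= \<eta>" using b \<phi> by (simp add: f_def)
  have c: "c = m - f" using n by (simp add: m_def f_def)
  \<comment> \<open>Here \<open>c = m - f\<close> with m at least 2 pi and |f| at most \<eta>; the
    term f^2 of c^2 is given away.\<close>
  have "2 * (pi - \<eta>) * m <= (m - 2 * f) * m"
   using m f pi_gt3 by (intro mult_right_mono) auto
  also have "... <= c^2" unfolding c by (simp add: power2_eq_square algebra_simps)
  finally show ?thesis using n by (simp add: m_def)
 qed
 also have "... <= (1 + \<gamma>) * c^2" using \<gamma> by (simp add: algebra_simps)
 finally show ?thesis using K by (smt (verit) zero_le_power2)
next
 \<comment> \<open>No quantisation is available, but the penalty is at least 1, and its constant
   exceeds what completing the squares leaves behind: \<open>pi^2/\<gamma>\<close> from c,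
   \<open>pi^2\<close> from b, and pi from \<phi>.\<close>
 case False
 then have N1: "1 <= N + 4 * b^2 / \<eta>^2" by simp
 have "2 * (pi - \<eta>) * (c + \<phi> + b) <= 2 * (pi - \<eta>) * (\<bar>c\<bar> + (\<eta>/2 + \<bar>b\<bar>))"
  using \<eta> \<phi> pi_gt3 by (intro mult_left_mono) auto
 also have "... <= 2 * pi * (\<bar>c\<bar> + (\<eta>/2 + \<bar>b\<bar>))"
  using \<eta> by (intro mult_right_mono) auto
 also have "... = 2 * pi * \<bar>c\<bar> + pi * \<eta> + 2 * pi * \<bar>b\<bar>" by (simp add: algebra_simps)
 also have "... <= (\<gamma> * c^2 + pi^2/\<gamma>) + pi + (pi^2 + b^2)"
 proof -
  have "0 <= (sqrt \<gamma> * \<bar>c\<bar> - pi / sqrt \<gamma>)^2" by simp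
  then have "2 * (\<bar>c\<bar> * pi) <= \<gamma> * c^2 + pi^2/\<gamma>"
   using \<gamma> by (simp add: power2_diff power_mult_distrib power_divide)
  then have "2 * pi * \<bar>c\<bar> <= \<gamma> * c^2 + pi^2/\<gamma>" by (simp only: mult_ac)
  moreover have "2 * pi * \<bar>b\<bar> <= pi^2 + b^2" using sum_squares_bound[of pi "\<bar>b\<bar>"] by simp
  moreover have "pi * \<eta> <= pi" using \<eta> by simp
  ultimately show ?thesis by linarith
 qed
 also have "... = \<gamma> * c^2 + (pi^2/\<gamma> + pi^2 + pi) * 1 + b^2" by simp
 also have "... <= (1 + \<gamma>) * c^2 + (pi^2/\<gamma> + pi^2 + pi) * (N + 4 * b^2 / \<eta>^2) + b^2"
  using \<gamma> N1 by (intro add_mono mult_right_mono mult_left_mono) auto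
 finally show ?thesis .
qed

text \<open>With s the squared modulus, this function measures the distance of the modulus from 1
  and lies below \<open>(1 - s)^2\<close>, while its derivative carries \<open>(1 + s)^3\<close> in
  the denominator, which pays for the growth of s' with the modulus. The estimate on circles thus
  works without a maximum principle.\<close>

lemma moebius_square_derivative:
 fixes s :: "real => real"
 assumes d: "(s has_real_derivative s') (at t)" and nz: "1 + s t \<noteq> 0"
 shows "((%t. ((1 - s t) / (1 + s t))^2) has_real_derivative - 4 * (1 - s t) * s' / (1 + s t)^3) (at t)"
proof -
 have "2 * (a / c) * ((- s' * c - a * s') / (c * c)) = - 4 * a * s' / c ^ 3"
  if "a + c = 2" "c \<noteq> 0" for a c :: real
 proof -
  have "- s' * c - a * s' = - s' * (a + c)" by (simp add: algebra_simps)
  then have "- s' * c - a * s' = - 2 * s'" using that(1) by simp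
  then show ?thesis by (simp add: power3_eq_cube)
 qed
 from this[of "1 - s t" "1 + s t"]
 have e: "2 * ((1 - s t) / (1 + s t)) * ((- s' * (1 + s t) - (1 - s t) * s') / ((1 + s t) * (1 + s t)))
   = - 4 * (1 - s t) * s' / (1 + s t) ^ 3" using nz by simp
 have "((%t. (1 - s t) / (1 + s t)) has_real_derivative
   ((- s' * (1 + s t) - (1 - s t) * s') / ((1 + s t) * (1 + s t)))) (at t)"
  using DERIV_divide[OF DERIV_diff[OF DERIV_const[of 1] d] DERIV_add[OF DERIV_const[of 1] d] nz] by simp
 from DERIV_power[OF this, of 2] show ?thesis
  by (rule DERIV_cong) (unfold e[symmetric], simp only: mult_ac of_nat_numeral diff_Suc_1 numeral_2_eq_2 power_one_right,
   simp add: mult_ac)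
qed

text \<open>The smooth configurations to which the circulation argument applies. The potentials
  \<open>a1\<close>, \<open>a2\<close> already contain the factor h, so the ideal field is h. The
  weight \<zeta> averages over centres, \<xi> localises the current, and \<open>sep\<close> makes
  every circle of radius at most \<open>r1\<close> about a weighted centre lie where \<xi> = 1;
  energies are measured on U.\<close>

locale gl_config =
 fixes u :: "real^3 => complex" and du :: "real^3 => real^3 => complex"
  and a1 a2 :: "real^3 => real" and da1 da2 :: "real^3 => real^3 => real"
  and \<zeta> \<xi> :: "real^3 => real" and U :: "(real^3) set" and h \<kappa> r1 \<Lambda> \<delta> :: real
 assumes u_der: "\<And>x. (u has_derivative du x) (at x)" and du_cont: "\<And>v. cont (%x. du x v)"
  and a1_der: "\<And>x. (a1 has_derivative da1 x) (at x)" and da1_cont: "\<And>v. cont (%x. da1 x v)"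
  and a2_der: "\<And>x. (a2 has_derivative da2 x) (at x)" and da2_cont: "\<And>v. cont (%x. da2 x v)"
  and \<zeta>: "ccs \<zeta>" "\<And>x. 0 <= \<zeta> x" "\<And>x. \<zeta> x <= 1" "\<And>x y. \<bar>\<zeta> x - \<zeta> y\<bar> <= \<Lambda> * norm (x - y)"
  and \<xi>: "ccs \<xi>" "\<And>x. 0 <= \<xi> x" "\<And>x. \<xi> x <= 1" "\<And>x. \<xi> x \<noteq> 0 ==> x \<in> U"
  and U: "U \<in> sets borel" "bounded U"
  and sep: "\<And>x v. \<zeta> x \<noteq> 0 ==> norm v <= r1 ==> \<xi> (x + v) = 1"
  and pos: "0 < h" "0 < \<kappa>" "0 < \<delta>" "\<delta> <= 1/2"
begin

definition "cov1 x = du x ex1 - \<i> * of_real (a1 x) * u x"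
definition "cov2 x = du x ex2 - \<i> * of_real (a2 x) * u x"
definition "kin x = (cmod (cov1 x))^2 + (cmod (cov2 x))^2"
definition "pot x = 1 - (cmod (u x))\<^sup>2"
definition "mag x = da2 x ex1 - da1 x ex2 - h"
text \<open>The denominator never drops below \<open>(1 - \<delta>)^2\<close>. Hence the current
  stays continuous across zeros of u and its square is at most
  \<open>kin / (1 - \<delta>)^2\<close>, while nothing changes where the modulus is at least 1 -
  \<delta>.\<close>

definition "cutw x = max ((cmod (u x))^2) ((1 - \<delta>)^2)"
text \<open>The second component is the real part, so that \<open>Re (cur x * cis th)\<close> is the
  component along the tangent (- sin th, cos th).\<close>

definition "cur x = of_real (\<xi> x) * Complex (Im (cnj (u x) * cov2 x) / cutw x) (Im (cnj (u x) * cov1 x) / cutw x)"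
definition "circ r x = r * Re (circle_transform cur r x)"
definition "flux r x = integral {0..2*pi} (%th. r * (- sin th * a1 (x + r *\<^sub>R ee th) + cos th * a2 (x + r *\<^sub>R ee th)))"
definition "exc r x = flux r x - pi * h * r^2"
text \<open>The first term bounds the Moebius function used in \<open>circ_quantised\<close>, the
  second its derivative along a circle of radius r. A value of \<open>pen\<close> below 1 then
  forces the modulus to stay near 1 on that circle.\<close>

definition "den r x = (pot x)^2 + 2 * r * (\<kappa> * (pot x)^2 + kin x / \<kappa>)"
definition "pen r x = integral {0..2*pi} (%th. den r (x + r *\<^sub>R ee th)) / \<delta>^2"
definition "IU f = (LINT x:U|lborel. f x)" for f :: "real^3 => real"

lemma u_cont: "cont u"
 and a1_cont: "cont a1" and a2_cont: "cont a2"
 using u_der a1_der a2_der by (auto intro!: continuous_at_imp_continuous_on has_derivative_continuous)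

lemma cov_cont: "cont cov1" "cont cov2"
 unfolding cov1_def[abs_def] cov2_def[abs_def]
 by (intro continuous_intros du_cont u_cont a1_cont a2_cont)+

lemma kin_cont: "cont kin"
 unfolding kin_def[abs_def] by (intro continuous_intros cov_cont)

lemma pot_cont: "cont pot"
 unfolding pot_def[abs_def] by (intro continuous_intros u_cont)

lemma mag_cont: "cont mag"
 unfolding mag_def[abs_def] by (intro continuous_intros da1_cont da2_cont)

lemma cutw_pos: "cutw x > 0"
 using pos by (simp add: cutw_def less_max_iff_disj)

lemma cutw_cont: "cont cutw"
 unfolding cutw_def[abs_def] by (intro continuous_intros u_cont)

lemma cur_cont: "cont cur"
proof -
 have "cur = (%x. of_real (\<xi> x) * (of_real (Im (cnj (u x) * cov2 x) / cutw x) + \<i> * of_real (Im (cnj (u x) * cov1 x) / cutw x)))"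
  by (auto simp: cur_def complex_eq_iff)
 moreover have "cont ..."
  using cutw_pos by (intro continuous_intros u_cont cov_cont cutw_cont ccs_continuous[OF \<xi>(1)])
   (auto simp: less_imp_neq[THEN not_sym])
 ultimately show ?thesis by simp
qed

lemma cur_ccs: "ccs cur"
proof -
 obtain R where "\<And>x. R < norm x ==> \<xi> x = 0" using ccs_bound[OF \<xi>(1)] by metis
 then show ?thesis by (intro ccsI[where R=R] cur_cont) (simp add: cur_def)
qed

lemma den_cont: "cont (den r)"
 unfolding den_def[abs_def] using pos by (intro continuous_intros pot_cont kin_cont) auto

lemma kin_nonneg: "kin x \<ge> 0" by (simp add: kin_def)

lemma den_nonneg: "r \<ge> 0 ==> den r x \<ge> 0"
 unfolding den_def using pos kin_nonneg[of x] by (intro add_nonneg_nonneg mult_nonneg_nonneg) auto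

lemma IU_integrable: "cont f ==> set_integrable lborel U f" for f :: "real^3 => real"
proof -
 assume c: "cont f"
 obtain a where a: "U \<subseteq> cbox (-a) a" using bounded_subset_cbox_symmetric[OF U(2)] by metis
 have "set_integrable lborel (cbox (-a) a) f"
  unfolding set_integrable_def
  by (rule borel_integrable_compact) (auto intro: continuous_on_subset[OF c])
 then show ?thesis by (rule set_integrable_subset) (use U a in auto)
qed

lemma ccs_zeta_mult: "cont f ==> ccs (%x. \<zeta> x * f x)" for f :: "real^3 => real"
 by (rule ccs_mult_left[OF \<zeta>(1)])

lemma shift_cont: "cont f ==> cont (%x. f (x + v))" for f :: "real^3 => real"
 by (erule continuous_on_shift_comp) (intro continuous_intros)

lemma shift_IU:
 fixes f :: "real^3 => real"
 assumes c: "cont f" and f: "\<And>x. f x \<ge> 0" and v: "norm v <= r1"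
 shows "(LBINT x. \<zeta> x * f (x + v)) <= IU f"
proof -
 have 1: "ccs (%x. \<zeta> x * f (x + v))" by (rule ccs_zeta_mult[OF shift_cont[OF c]])
 have "(LBINT x. \<zeta> x * f (x + v)) = (LBINT x. (%x. \<zeta> x * f (x + v)) (x + - v))"
  by (rule integral_lborel_shift[symmetric])
 also have "... = (LBINT x. \<zeta> (x - v) * f x)" by simp
 also have "... <= (LBINT x. indicator U x *\<^sub>R f x)"
 proof (rule integral_mono)
  show "L1 (%x. \<zeta> (x - v) * f x)"
  proof (rule ccs_integrable)
   obtain R where R: "\<And>x. R < norm x ==> \<zeta> x = 0" using ccs_bound[OF \<zeta>(1)] by metis
   show "ccs (%x. \<zeta> (x - v) * f x)"
   proof (rule ccsI[where R="R + norm v"])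
    show "cont (%x. \<zeta> (x - v) * f x)"
     by (intro continuous_intros c continuous_on_shift_comp[OF ccs_continuous[OF \<zeta>(1)]])
    show "\<zeta> (x - v) * f x = 0" if "R + norm v < norm x" for x
     using R[of "x - v"] that norm_triangle_sub[of x v] by simp
   qed
  qed
  show "L1 (%x. indicator U x *\<^sub>R f x)"
   using IU_integrable[OF c] by (simp add: set_integrable_def)
  show "\<zeta> (x - v) * f x <= indicator U x *\<^sub>R f x" for x
  proof (cases "\<zeta> (x - v) = 0")
   case False
   then have "\<xi> (x - v + v) = 1" using sep v by blast
   then have "x \<in> U" using \<xi>(4)[of x] by simp
   then show ?thesis using mult_right_mono[OF \<zeta>(3) f] by simp
  qed (use f in simp)
 qed
 finally show ?thesis by (simp add: IU_def set_lebesgue_integral_def)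
qed

lemma path_derivative:
 fixes g :: "real^3 => 'b::real_normed_vector"
 assumes "\<And>x. (g has_derivative dg x) (at x)"
 shows "((%th. g (x + r *\<^sub>R ee th)) has_vector_derivative dg (x + r *\<^sub>R ee th) (r *\<^sub>R tt th)) (at th)"
proof -
 have p: "((%th. x + r *\<^sub>R ee th) has_vector_derivative r *\<^sub>R tt th) (at th)"
  using has_vector_derivative_add[OF has_vector_derivative_const[of x]
    has_vector_derivative_scaleR[OF DERIV_const[of r] ee_has_vector_derivative]] by simp
 show ?thesis
  using vector_derivative_diff_chain_within[OF p has_derivative_at_withinI[OF assms]] by (simp add: o_def)
qed

text \<open>A penalty below 1 keeps \<open>|u|^2\<close> above \<open>(1 - \<delta>)^2\<close> on
  the whole circle. There the cut-offs are inactive, and the tangential current is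
  \<open>Im (u' / u)\<close> minus the tangential potential. So circulation plus flux is a winding
  integral, and \<open>pi * h * r^2 + exc r x\<close> is the flux.\<close>

lemma circ_quantised:
 assumes x: "\<zeta> x \<noteq> 0" and r: "0 < r" "r <= r1" and N: "pen r x < 1"
 shows "\<exists>n::int. circ r x + pi * h * r^2 + exc r x = 2 * pi * n"
proof -
 define g where "g th = u (x + r *\<^sub>R ee th)" for th
 define g' where "g' th = du (x + r *\<^sub>R ee th) (r *\<^sub>R tt th)" for th
 define al where "al th = r * (- sin th * a1 (x + r *\<^sub>R ee th) + cos th * a2 (x + r *\<^sub>R ee th))" for th
 define E where "E th = kin (x + r *\<^sub>R ee th)" for th
 define D1 where "D1 th = cov1 (x + r *\<^sub>R ee th)" for th
 define D2 where "D2 th = cov2 (x + r *\<^sub>R ee th)" for th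
 define s where "s th = (cmod (g th))^2" for th
 have lin: "linear (du y)" for y using u_der has_derivative_linear by blast
 have gd: "(g has_vector_derivative g' th) (at th)" for th
  unfolding g_def g'_def by (rule path_derivative[OF u_der])
 have g'eq: "g' th = of_real r * (- of_real (sin th) * du (x + r *\<^sub>R ee th) ex1 + of_real (cos th) * du (x + r *\<^sub>R ee th) ex2)" for th
 proof -
  have "r *\<^sub>R tt th = (- (r * sin th)) *\<^sub>R ex1 + (r * cos th) *\<^sub>R ex2"
   by (simp add: tt_def scaleR_add_right scaleR_diff_right)
  then have "g' th = (- (r * sin th)) *\<^sub>R du (x + r *\<^sub>R ee th) ex1 + (r * cos th) *\<^sub>R du (x + r *\<^sub>R ee th) ex2"
   unfolding g'_def by (simp only: linear_add[OF lin] linear_cmul[OF lin])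
  then show ?thesis by (simp add: scaleR_conv_of_real algebra_simps)
 qed
 have cov: "g' th - \<i> * of_real (al th) * g th = of_real r * (- of_real (sin th) * D1 th + of_real (cos th) * D2 th)" for th
  unfolding g'eq al_def D1_def D2_def cov1_def cov2_def g_def by (simp add: algebra_simps)
 note cs = continuous_on_shift_comp[OF u_cont] continuous_on_shift_comp[OF a1_cont] continuous_on_shift_comp[OF a2_cont]
   continuous_on_shift_comp[OF du_cont] continuous_on_shift_comp[OF kin_cont] continuous_on_shift_comp[OF pot_cont]
 have cg': "cont g'" unfolding g'eq by (intro continuous_intros cs)
 have cal: "continuous_on S al" for S unfolding al_def by (intro continuous_intros cs)
 have covn: "cmod (of_real r * (- of_real (sin th) * D1 th + of_real (cos th) * D2 th)) <= r * sqrt (E th)" for th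
 proof -
  have "cmod (- of_real (sin th) * D1 th + of_real (cos th) * D2 th) <= \<bar>sin th\<bar> * cmod (D1 th) + \<bar>cos th\<bar> * cmod (D2 th)"
   by (rule order_trans[OF norm_triangle_ineq]) (simp add: norm_mult)
  also have "... <= sqrt (E th)"
  proof (rule real_le_rsqrt)
   have "0 <= (\<bar>cos th\<bar> * cmod (D1 th) - \<bar>sin th\<bar> * cmod (D2 th))^2" by simp
   moreover have "(\<bar>cos th\<bar> * cmod (D1 th) - \<bar>sin th\<bar> * cmod (D2 th))^2 + (\<bar>sin th\<bar> * cmod (D1 th) + \<bar>cos th\<bar> * cmod (D2 th))^2
     = (\<bar>sin th\<bar>\<^sup>2 + \<bar>cos th\<bar>\<^sup>2) * ((cmod (D1 th))^2 + (cmod (D2 th))^2)" by algebra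
   moreover have "(\<bar>sin th\<bar>\<^sup>2 + \<bar>cos th\<bar>\<^sup>2) * ((cmod (D1 th))^2 + (cmod (D2 th))^2) = E th"
    by (simp add: E_def kin_def D1_def D2_def)
   ultimately show "(\<bar>sin th\<bar> * cmod (D1 th) + \<bar>cos th\<bar> * cmod (D2 th))^2 <= E th"
    by linarith
  qed
  finally show ?thesis using r by (simp add: norm_mult)
 qed
 have sd: "(s has_real_derivative 2 * Re (cnj (g th) * g' th)) (at th)" for th
 proof -
  have "((%th. Re (g th)) has_real_derivative Re (g' th)) (at th)" "((%th. Im (g th)) has_real_derivative Im (g' th)) (at th)"
   using bounded_linear.has_vector_derivative[OF bounded_linear_Re gd] bounded_linear.has_vector_derivative[OF bounded_linear_Im gd]
   by (simp_all add: has_real_derivative_iff_has_vector_derivative)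
  from DERIV_add[OF DERIV_power[OF this(1), of 2] DERIV_power[OF this(2), of 2]]
  have "((%th. (Re (g th))^2 + (Im (g th))^2) has_real_derivative 2 * Re (cnj (g th) * g' th)) (at th)"
   by (simp add: algebra_simps)
  then show ?thesis by (simp add: s_def[abs_def] cmod_power2)
 qed
 have s0: "s th \<ge> 0" for th by (simp add: s_def)
 define W where "W th = ((1 - s th) / (1 + s th))^2" for th
 define W' where "W' th = - 4 * (1 - s th) * (2 * Re (cnj (g th) * g' th)) / (1 + s th)^3" for th
 have Wd: "(W has_real_derivative W' th) (at th)" for th
 proof -
  have "1 + s th \<noteq> 0" using s0[of th] by linarith
  from moebius_square_derivative[OF sd this] show ?thesis unfolding W_def W'_def .
 qed
 have ReD: "Re (cnj (g th) * g' th) = Re (cnj (g th) * (of_real r * (- of_real (sin th) * D1 th + of_real (cos th) * D2 th)))" for th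
  unfolding cov[symmetric] by (simp add: algebra_simps)
 \<comment> \<open>The inequality \<open>2 |u| <= 1 + |u|^2\<close> cancels one factor 1 + s of the
   denominator, and the other two are at least 1. Young's inequality with weight \<kappa> then
   separates potential from kinetic energy.\<close>
 have W'b: "\<bar>W' th\<bar> <= 2 * r * (\<kappa> * (1 - s th)^2 + E th / \<kappa>)" for th
 proof -
  have E0: "E th \<ge> 0" by (simp add: E_def kin_nonneg)
  have "\<bar>Re (cnj (g th) * g' th)\<bar> <= cmod (g th) * (r * sqrt (E th))"
   unfolding ReD
   by (rule order_trans[OF abs_Re_le_cmod]) (use covn in \<open>simp add: norm_mult mult_left_mono\<close>)
  also have "... <= (1 + s th) / 2 * (r * sqrt (E th))"
   using r E0 sum_squares_bound[of 1 "cmod (g th)"] by (intro mult_right_mono) (auto simp: s_def)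
  finally have R: "2 * \<bar>Re (cnj (g th) * g' th)\<bar> <= (1 + s th) * (r * sqrt (E th))" by simp
  have "\<bar>W' th\<bar> = 4 * \<bar>1 - s th\<bar> * (2 * \<bar>Re (cnj (g th) * g' th)\<bar>) / (1 + s th)^3"
  proof -
   have aux: "\<bar>- 4 * a * (2 * q) / c^3\<bar> = 4 * \<bar>a\<bar> * (2 * \<bar>q\<bar>) / c^3" if "c \<ge> 1" for a q c :: real
    using that by (simp add: abs_mult)
   show ?thesis unfolding W'_def by (rule aux) (use s0[of th] in simp)
  qed
  also have "... <= 4 * \<bar>1 - s th\<bar> * ((1 + s th) * (r * sqrt (E th))) / (1 + s th)^3"
   using R s0[of th] by (intro divide_right_mono mult_left_mono) auto
  also have "... = 4 * \<bar>1 - s th\<bar> * (r * sqrt (E th)) / (1 + s th)^2"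
  proof -
   have aux: "A * (c * B) / c^3 = A * B / c^2" if "c \<noteq> 0" for A B c :: real
    using that by (simp add: power2_eq_square power3_eq_cube)
   show ?thesis by (rule aux) (use s0[of th] in linarith)
  qed
  also have "... <= 4 * \<bar>1 - s th\<bar> * (r * sqrt (E th)) / 1"
   using s0[of th] r E0 by (intro divide_left_mono) (auto simp: one_le_power)
  also have "... <= 2 * r * (\<kappa> * (1 - s th)^2 + E th / \<kappa>)"
  proof -
   have "0 <= (sqrt \<kappa> * \<bar>1 - s th\<bar> - sqrt (E th) / sqrt \<kappa>)^2" by simp
   then have "2 * \<bar>1 - s th\<bar> * sqrt (E th) <= \<kappa> * (1 - s th)^2 + E th / \<kappa>"
    using pos E0 by (simp add: power2_diff power_mult_distrib power_divide)
   then have "2 * r * (2 * \<bar>1 - s th\<bar> * sqrt (E th)) <= 2 * r * (\<kappa> * (1 - s th)^2 + E th / \<kappa>)"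
    using r by (intro mult_left_mono) auto
   then show ?thesis by (simp add: mult_ac)
  qed
  finally show ?thesis .
 qed
 have W1: "W th <= (1 - s th)^2" for th
 proof -
  have "(1 - s th)^2 / (1 + s th)^2 <= (1 - s th)^2 / 1"
   using s0[of th] by (intro divide_left_mono) (auto simp: one_le_power)
  then show ?thesis by (simp add: W_def power_divide)
 qed
 have cs1: "cont (%th. (1 - s th)^2)" "cont (%th. 2 * r * (\<kappa> * (1 - s th)^2 + E th / \<kappa>))"
  unfolding s_def g_def E_def using pos by (auto intro!: continuous_intros cs)
 have sup: "W th < \<delta>^2" if "th \<in> {0..2*pi}" for th
 proof -
  have "W th <= integral {0..2*pi} (%th. (1 - s th)^2 + 2 * r * (\<kappa> * (1 - s th)^2 + E th / \<kappa>))"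
   by (rule sup_le_integral_period[OF Wd cs1 _ W1 W'b that]) (simp add: W_def)
  also have "... = \<delta>^2 * pen r x"
   using pos by (simp add: pen_def den_def pot_def s_def g_def E_def)
  also have "... < \<delta>^2 * 1" using N pos by (intro mult_strict_left_mono) auto
  finally show ?thesis by simp
 qed
 have sbig: "s th \<ge> (1 - \<delta>)^2" if "th \<in> {0..2*pi}" for th
 proof -
  have "\<bar>(1 - s th) / (1 + s th)\<bar> < \<delta>"
   using sup[OF that] pos unfolding W_def by (metis abs_of_pos power2_abs power_less_imp_less_base less_imp_le)
  then have "(1 - s th) / (1 + s th) < \<delta>" by linarith
  then have "1 - s th < \<delta> * (1 + s th)" using s0[of th] by (simp add: divide_less_eq)
  then have A: "1 - \<delta> < s th * (1 + \<delta>)" by (simp add: algebra_simps)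
  \<comment> \<open>So far s exceeds (1 - \<delta>)/(1 + \<delta>); since
    \<open>1 - \<delta>^2 <= 1\<close>, this quotient is at least
    \<open>(1 - \<delta>)^2\<close>.\<close>
  have "(1 - \<delta>)^2 * (1 + \<delta>) = (1 - \<delta>) * (1 - \<delta>\<^sup>2)" by (simp add: power2_eq_square algebra_simps)
  also have "... <= (1 - \<delta>) * 1" using pos by (intro mult_left_mono) auto
  finally have "(1 - \<delta>)^2 * (1 + \<delta>) <= s th * (1 + \<delta>)" using A by simp
  then show ?thesis using pos by simp
 qed
 have nz: "g th \<noteq> 0" if "th \<in> {0..2*pi}" for th
  using sbig[OF that] pos by (auto simp: s_def)
 have gper: "g (2*pi) = g 0" by (simp add: g_def ee_periodic[of 0, simplified])
 obtain n :: int where n: "integral {0..2*pi} (%th. Im (g' th / g th)) = 2 * pi * n"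
  by (rule log_derivative_integral[OF gd cg' nz gper])
 have cgi: "continuous_on {0..2*pi} (%th. Im (g' th / g th))"
  using nz by (intro continuous_intros continuous_on_subset[OF cg'])
   (auto simp: g_def intro!: continuous_intros cs)
 have "circ r x = Re (integral {0..2*pi} (%th. r *\<^sub>R (cur (x + r *\<^sub>R ee th) * cis th)))"
  by (simp add: circ_def circle_transform_def)
 also have "... = integral {0..2*pi} (Re \<circ> (%th. r *\<^sub>R (cur (x + r *\<^sub>R ee th) * cis th)))"
  by (rule integral_linear[OF _ bounded_linear_Re, symmetric])
    (intro integrable_continuous_interval continuous_intros continuous_on_shift_comp[OF cur_cont])
 also have "... = integral {0..2*pi} (%th. Im (g' th / g th) - al th)"
 proof (rule Henstock_Kurzweil_Integration.integral_cong)
  fix th :: real assume t: "th \<in> {0..2*pi}"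
  have chi1: "\<xi> (x + r *\<^sub>R ee th) = 1" using sep[OF x, of "r *\<^sub>R ee th"] r by simp
  have cut1: "cutw (x + r *\<^sub>R ee th) = s th" using sbig[OF t] by (simp add: cutw_def s_def g_def)
  have sp: "s th > 0" using nz[OF t] by (simp add: s_def)
  have "(Re \<circ> (%th. r *\<^sub>R (cur (x + r *\<^sub>R ee th) * cis th))) th
   = (r * (- sin th * Im (cnj (g th) * D1 th) + cos th * Im (cnj (g th) * D2 th))) / s th"
   using sp by (simp add: cur_def chi1 cut1 D1_def D2_def g_def field_simps)
  also have "r * (- sin th * Im (cnj (g th) * D1 th) + cos th * Im (cnj (g th) * D2 th))
   = Im (cnj (g th) * (of_real r * (- of_real (sin th) * D1 th + of_real (cos th) * D2 th)))"
   by (simp add: algebra_simps)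
  also have "... = Im (cnj (g th) * g' th) - al th * s th"
   unfolding cov[symmetric] s_def cmod_power2 by (simp add: algebra_simps power2_eq_square)
  also have "... / s th = Im (g' th / g th) - al th"
  proof -
   have "g' th / g th = g' th * cnj (g th) / of_real (s th)"
    unfolding s_def by (rule complex_div_cnj)
   then have "Im (g' th / g th) = Im (cnj (g th) * g' th) / s th"
    by (simp only: Im_divide_of_real mult.commute)
   then show ?thesis using sp by (simp add: diff_divide_distrib)
  qed
  finally show "(Re \<circ> (%th. r *\<^sub>R (cur (x + r *\<^sub>R ee th) * cis th))) th = Im (g' th / g th) - al th" .
 qed
 also have "... = 2 * pi * n - flux r x"
 proof -
  have "integral {0..2*pi} (%th. Im (g' th / g th) - al th)
    = integral {0..2*pi} (%th. Im (g' th / g th)) - integral {0..2*pi} al"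
   by (intro integral_diff integrable_continuous_interval cgi cal)
  then show ?thesis by (simp add: n flux_def al_def[abs_def])
 qed
 finally show ?thesis by (auto simp: exc_def)
qed

end

section \<open>The lower bound for smooth configurations\<close>

text \<open>Because \<open>cis\<close> has mean 0 over a period, the value at shift 0 can be
  subtracted once the translation has been moved onto \<zeta>. What is left is a difference of
  \<zeta> at distance r. This makes the weighted mean of the circulation of order r^2 rather than
  r.\<close>

lemma circle_transform_against_lipschitz:
 fixes J :: "real^3 => complex" and \<zeta> :: "real^3 => real"
 assumes J: "ccs J" and \<zeta>: "ccs \<zeta>" and L: "\<And>x y. \<bar>\<zeta> x - \<zeta> y\<bar> <= \<Lambda> * norm (x - y)" and r: "0 <= r"
 shows "cmod (LBINT x. of_real (\<zeta> x) * circle_transform J r x) <= 2 * pi * (\<Lambda> * r * (LBINT x. cmod (J x)))"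
proof -
 note cz = continuous_on_shift_comp[OF ccs_continuous[OF \<zeta>]]
 note cJ = continuous_on_shift_comp[OF ccs_continuous[OF J]]
 obtain b where b: "\<And>x. x \<notin> cbox (-b) b ==> \<zeta> x = 0"
 proof -
  obtain R where R: "\<And>x. R < norm x ==> \<zeta> x = 0" using ccs_bound[OF \<zeta>] by metis
  obtain b where "cball (0::real^3) R \<subseteq> cbox (-b) b"
   using bounded_subset_cbox_symmetric[OF bounded_cball] by metis
  then have "\<zeta> x = 0" if "x \<notin> cbox (-b) b" for x using that R[of x] by (force simp: subset_iff not_less)
  then show ?thesis using that by blast
 qed
 obtain a c where ac: "\<And>x. x \<notin> cbox a c ==> J x = 0" using ccs_cbox[OF J] by metis
 define I where "I v = (LBINT x. of_real (\<zeta> (x - v)) * J x)" for v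
 have Ic: "cont I"
 proof -
  have "I v = integral (cbox a c) (%x. of_real (\<zeta> (x - v)) * J x)" for v
   unfolding I_def by (rule integral_lborel_eq_cbox(2)) (use ac in \<open>auto intro!: continuous_intros cz cJ\<close>)
  moreover have "cont (%v. integral (cbox a c) (%x. of_real (\<zeta> (x - v)) * J x))"
   by (rule integral_continuous_on_param) (auto simp: case_prod_beta intro!: continuous_intros cz cJ)
  ultimately show ?thesis by simp
 qed
 note cI = continuous_on_shift_comp[OF Ic]
 have int: "L1 (%x. of_real (\<zeta> (x - v)) * J x)" for v
 proof -
  have "ccs (%x. J x * of_real (\<zeta> (x - v)))"
   by (rule ccs_mult_left[OF J]) (intro continuous_intros cz)
  then show ?thesis using ccs_integrable by (simp add: mult.commute)
 qed
 have iJ: "L1 (%x. cmod (J x))" using ccs_integrable[OF J] by simp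
 have Idiff: "cmod (I v - I 0) <= \<Lambda> * norm v * (LBINT x. cmod (J x))" for v
 proof -
  have "I v - I 0 = (LBINT x. of_real (\<zeta> (x - v) - \<zeta> x) * J x)"
   unfolding I_def using int[of v] int[of 0] by (simp add: algebra_simps)
  also have "cmod ... <= (LBINT x. \<Lambda> * norm v * cmod (J x))"
  proof (rule Bochner_Integration.integral_norm_bound_integral)
   show "L1 (%x. of_real (\<zeta> (x - v) - \<zeta> x) * J x)"
    using int[of v] int[of 0] by (simp add: algebra_simps)
   show "L1 (%x. \<Lambda> * norm v * cmod (J x))" using iJ by simp
   fix x
   have "cmod (of_real (\<zeta> (x - v) - \<zeta> x)) <= \<Lambda> * norm v"
    using L[of "x - v" x] by (simp del: of_real_diff)
   then show "cmod (of_real (\<zeta> (x - v) - \<zeta> x) * J x) <= \<Lambda> * norm v * cmod (J x)"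
    unfolding norm_mult by (rule mult_right_mono) simp
  qed
  finally show ?thesis by simp
 qed
 have "(LBINT x. of_real (\<zeta> x) * circle_transform J r x)
   = (LBINT x. integral (cbox 0 (2*pi)) (%th. of_real (\<zeta> x) * (J (x + r *\<^sub>R ee th) * cis th)))"
  by (simp add: circle_transform_def)
 also have "... = integral (cbox 0 (2*pi)) (%th. \<integral>x. of_real (\<zeta> x) * (J (x + r *\<^sub>R ee th) * cis th) \<partial>lborel)"
  by (rule integral_lborel_swap) (use b in \<open>auto simp: case_prod_beta intro!: continuous_intros cz cJ\<close>)
 also have "... = integral (cbox 0 (2*pi)) (%th. cis th * I (r *\<^sub>R ee th))"
 proof (rule Henstock_Kurzweil_Integration.integral_cong)
  fix th
  have "(LBINT x. of_real (\<zeta> x) * (J (x + r *\<^sub>R ee th) * cis th))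
   = (LBINT x. (%y. cis th * (of_real (\<zeta> (y - r *\<^sub>R ee th)) * J y)) (x + r *\<^sub>R ee th))"
   by (simp add: mult_ac)
  also have "... = (LBINT x. cis th * (of_real (\<zeta> (x - r *\<^sub>R ee th)) * J x))"
   by (rule integral_lborel_shift)
  also have "... = cis th * I (r *\<^sub>R ee th)" by (simp add: I_def)
  finally show "(LBINT x. of_real (\<zeta> x) * (J (x + r *\<^sub>R ee th) * cis th)) = cis th * I (r *\<^sub>R ee th)" .
 qed
 also have "... = integral {0..2*pi} (%th. cis th * (I (r *\<^sub>R ee th) - I 0))"
 proof -
  have "integral {0..2*pi} (%th. cis th * I (r *\<^sub>R ee th) - cis th * I 0)
    = integral {0..2*pi} (%th. cis th * I (r *\<^sub>R ee th)) - integral {0..2*pi} (%th. cis th * I 0)"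
   by (intro integral_diff integrable_continuous_interval continuous_intros cI)
  then show ?thesis by (simp add: right_diff_distrib integral_cis_period)
 qed
 also have "cmod ... <= integral {0..2*pi} (%th. \<Lambda> * r * (LBINT x. cmod (J x)))"
 proof (rule Henstock_Kurzweil_Integration.integral_norm_bound_integral)
  show "(%th. cis th * (I (r *\<^sub>R ee th) - I 0)) integrable_on {0..2*pi}"
   by (intro integrable_continuous_interval continuous_intros cI)
  show "cmod (cis th * (I (r *\<^sub>R ee th) - I 0)) <= \<Lambda> * r * (LBINT x. cmod (J x))" for th
   using Idiff[of "r *\<^sub>R ee th"] r by (simp add: norm_mult)
 qed (rule integrable_const_ivl)
 finally show ?thesis by (simp add: mult_ac)
qed

lemma weighted_Cauchy_Schwarz_box:
 fixes c :: "real => real => real"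
 assumes c: "cont (%z. c (fst z) (snd z))" and r: "0 < r"
 shows "(integral (cbox (0,0) (r,2*pi)) (%(s,th). s * c s th))^2
   <= pi * r^2 * integral (cbox (0,0) (r,2*pi)) (%(s,th). s * (c s th)^2)"
  and "integral (cbox (0,0) (r,2*pi)) (%(s,th). s) = pi * r^2"
proof -
 let ?B = "cbox (0,0) (r,2*pi)"
 have cc: "continuous_on ?B (%z. c (fst z) (snd z))" by (rule continuous_on_subset[OF c]) simp
 have i: "(%z. fst z) integrable_on ?B" "(%z. fst z * c (fst z) (snd z)) integrable_on ?B"
  "(%z. fst z * (c (fst z) (snd z))^2) integrable_on ?B"
  by (intro integrable_continuous continuous_intros cc)+
 have "integral ?B (%z. fst z) = integral (cbox 0 r) (%s. integral (cbox 0 (2*pi)) (%th. s))"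
  by (subst integral_prod_continuous) (auto intro!: continuous_intros)
 also have "... = integral {0..r} (%s. 2 * pi * s)" by simp
 also have "... = pi * r^2"
 proof -
  have "((%s. 2 * pi * s) has_integral (pi * r^2 - pi * 0\<^sup>2)) {0..r}"
   by (rule has_integral_antiderivative) (use r in \<open>auto intro!: derivative_eq_intros\<close>)
  then have "((%s. 2 * pi * s) has_integral (pi * r^2)) {0..r}" by simp
  then show ?thesis by (rule integral_unique)
 qed
 finally have S: "integral ?B (%z. fst z) = pi * r^2" .
 then show "integral ?B (%(s,th). s) = pi * r^2" by (simp add: case_prod_beta')
 define M where "M = integral ?B (%z. fst z * c (fst z) (snd z))"
 define V where "V = integral ?B (%z. fst z * (c (fst z) (snd z))^2)"
 \<comment> \<open>The mean of c over the disc; the claim is that the variance is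
   non-negative.\<close>
 define l where "l = M / (pi * r^2)"
 have "0 <= integral ?B (%z. fst z * (c (fst z) (snd z) - l)^2)"
 proof (rule integral_nonneg)
  show "(%z. fst z * (c (fst z) (snd z) - l)^2) integrable_on ?B"
   by (intro integrable_continuous continuous_intros cc)
 qed (auto simp: cbox_Pair_eq)
 also have "... = integral ?B (%z. fst z * (c (fst z) (snd z))^2 - 2 * l * (fst z * c (fst z) (snd z)) + l^2 * fst z)"
  by (simp add: power2_diff algebra_simps power2_eq_square)
 also have "... = V - 2 * l * M + l^2 * (pi * r^2)"
  unfolding M_def V_def S[symmetric]
  by (rule integral_unique[OF has_integral_add[OF has_integral_diff[OF integrable_integral[OF i(3)]
   has_integral_mult_right[OF integrable_integral[OF i(2)], of "2 * l"]]
   has_integral_mult_right[OF integrable_integral[OF i(1)], of "l^2"]]])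
 also have "... = V - M\<^sup>2 / (pi * r^2)"
  using r by (simp add: l_def field_simps power2_eq_square)
 finally have "M^2 <= pi * r^2 * V" using r by (simp add: field_simps)
 then show "(integral ?B (%(s,th). s * c s th))^2 <= pi * r^2 * integral ?B (%(s,th). s * (c s th)^2)"
  by (simp add: M_def V_def case_prod_beta')
qed

context gl_config
begin

lemma cur_norm2: "(cmod (cur x))^2 <= indicator U x * (kin x / (1 - \<delta>)^2)"
proof (cases "\<xi> x = 0")
 case True
 then show ?thesis using kin_nonneg by (simp add: cur_def)
next
 case False
 then have xU: "x \<in> U" using \<xi> by blast
 define s where "s = (cmod (u x))^2"
 have c: "s <= cutw x" "(1 - \<delta>)^2 <= cutw x" by (simp_all add: cutw_def s_def)
 have d: "(1 - \<delta>)^2 > 0" using pos by simp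
 have I: "(Im (cnj (u x) * w))^2 <= s * (cmod w)^2" for w
 proof -
  have "(Im (cnj (u x) * w))^2 <= (cmod (cnj (u x) * w))^2"
   using abs_Im_le_cmod power_mono[OF abs_Im_le_cmod abs_ge_zero, of "cnj (u x) * w" 2] by simp
  then show ?thesis by (simp add: norm_mult power_mult_distrib s_def)
 qed
 have "(cmod (cur x))^2 = (\<xi> x)^2 * (((Im (cnj (u x) * cov2 x))^2 + (Im (cnj (u x) * cov1 x))^2) / (cutw x)^2)"
  unfolding cur_def norm_mult power_mult_distrib by (simp add: cmod_power2 power_divide add_divide_distrib)
 also have "... <= 1 * ((s * kin x) / (cutw x)^2)"
 proof (rule mult_mono)
  show "(\<xi> x)^2 <= 1" using \<xi>(2)[of x] \<xi>(3)[of x] by (simp add: power_le_one)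
  show "((Im (cnj (u x) * cov2 x))^2 + (Im (cnj (u x) * cov1 x))^2) / (cutw x)^2 <= s * kin x / (cutw x)^2"
   using I[of "cov1 x"] I[of "cov2 x"] by (intro divide_right_mono) (auto simp: kin_def algebra_simps)
 qed auto
 also have "... <= 1 * ((cutw x * kin x) / (cutw x)^2)"
  using c kin_nonneg[of x] by (intro mult_left_mono divide_right_mono mult_right_mono) auto
 also have "... = kin x / cutw x" using cutw_pos[of x] by (simp add: power2_eq_square)
 also have "... <= kin x / (1 - \<delta>)^2"
  using c d kin_nonneg[of x] by (intro divide_left_mono) (auto simp: cutw_pos)
 finally show ?thesis using xU by simp
qed

lemma IU_nonneg: "(\<And>x. f x \<ge> 0) ==> IU f \<ge> 0"
 unfolding IU_def set_lebesgue_integral_def by (rule Bochner_Integration.integral_nonneg) simp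

lemma cur_L2: "(LBINT x. (cmod (cur x))^2) <= IU kin / (1 - \<delta>)^2"
proof -
 have "(LBINT x. (cmod (cur x))^2) <= (LBINT x. indicator U x *\<^sub>R kin x / (1 - \<delta>)^2)"
 proof (rule integral_mono)
  show "L1 (%x. (cmod (cur x))^2)" by (intro ccs_integrable ccs_norm2 cur_ccs)
  show "L1 (%x. indicator U x *\<^sub>R kin x / (1 - \<delta>)^2)"
   using IU_integrable[OF kin_cont] unfolding set_integrable_def by (rule integrable_divide_zero)
  show "(cmod (cur x))^2 <= indicator U x *\<^sub>R kin x / (1 - \<delta>)^2" for x using cur_norm2[of x] by simp
 qed
 then show ?thesis by (simp add: IU_def set_lebesgue_integral_def)
qed

text \<open>A pointwise arithmetic-geometric mean with a free weight l; the factor 4 bounds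
  \<open>1 / (1 - \<delta>)^2\<close> for \<delta> <= 1/2. The weight becomes
  \<open>\<nu> * h\<close> later, which balances h against E/h.\<close>

lemma cur_L1:
 assumes l: "0 < l"
 shows "(LBINT x. cmod (cur x)) <= (l * IU (%_. 1) + 4 * IU kin / l) / 2"
proof -
 have d: "(1 - \<delta>)^2 \<ge> 1/4" using pos power_mono[of "1/2" "1 - \<delta>" 2] by (simp add: power2_eq_square)
 have "(LBINT x. cmod (cur x)) <= (LBINT x. (l * (indicator U x *\<^sub>R 1) + 4 * (indicator U x *\<^sub>R kin x) / l) / 2)"
 proof (rule integral_mono)
  show "L1 (%x. cmod (cur x))" using ccs_integrable[OF cur_ccs] by simp
  have "L1 (%x. indicator U x *\<^sub>R kin x)" "L1 (%x. indicator U x *\<^sub>R (1::real))"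
   using IU_integrable[OF kin_cont] IU_integrable[of "%_. 1"] by (auto simp: set_integrable_def)
  then show "L1 (%x. (l * (indicator U x *\<^sub>R 1) + 4 * (indicator U x *\<^sub>R kin x) / l) / 2)" by simp
  show "cmod (cur x) <= (l * (indicator U x *\<^sub>R 1) + 4 * (indicator U x *\<^sub>R kin x) / l) / 2" for x
  proof (cases "x \<in> U")
   case True
   have "(cmod (cur x))^2 <= kin x / (1 - \<delta>)^2" using cur_norm2[of x] True by simp
   also have "... <= kin x / (1/4)" using d kin_nonneg[of x] by (intro divide_left_mono) auto
   finally have k: "(cmod (cur x))^2 <= 4 * kin x" by simp
   have "0 <= (sqrt l - cmod (cur x) / sqrt l)^2" by simp
   then have "2 * cmod (cur x) <= l + (cmod (cur x))^2 / l"
    using l by (simp add: power2_diff power_divide)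
   also have "... <= l + 4 * kin x / l" using k l by (intro add_left_mono divide_right_mono) auto
   finally show ?thesis using True by simp
  next
   case False
   then have "\<xi> x = 0" using \<xi> by blast
   then show ?thesis using False by (simp add: cur_def)
  qed
 qed
 also have "... = (l * IU (%_. 1) + 4 * IU kin / l) / 2"
  using IU_integrable[OF kin_cont] IU_integrable[of "%_. 1"]
  by (simp add: IU_def set_lebesgue_integral_def set_integrable_def)
 finally show ?thesis .
qed

lemma circ_cont: "cont (circ r)"
 unfolding circ_def[abs_def] by (intro continuous_intros circle_transform_continuous[OF cur_ccs])

lemma flux_cont: "cont (flux r)"
proof -
 have "cont (%x. integral (cbox 0 (2*pi)) (%th. r * (- sin th * a1 (x + r *\<^sub>R ee th) + cos th * a2 (x + r *\<^sub>R ee th))))"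
  by (rule integral_continuous_on_param)
    (auto simp: case_prod_beta intro!: continuous_intros continuous_on_shift_comp[OF a1_cont] continuous_on_shift_comp[OF a2_cont])
 then show ?thesis by (simp add: flux_def[abs_def])
qed

lemma exc_cont: "cont (exc r)"
 unfolding exc_def[abs_def] by (intro continuous_intros flux_cont)

lemma pen_cont: "cont (pen r)"
proof -
 have "cont (%x. integral (cbox 0 (2*pi)) (%th. den r (x + r *\<^sub>R ee th)))"
  by (rule integral_continuous_on_param)
    (auto simp: case_prod_beta intro!: continuous_intros continuous_on_shift_comp[OF den_cont])
 then show ?thesis unfolding pen_def[abs_def] using pos by (intro continuous_intros) auto
qed

lemma zeta_cbox: obtains a b where "\<And>x. x \<notin> cbox a b ==> \<zeta> x = 0"
 using ccs_cbox[OF \<zeta>(1)] by metis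

lemma integral_pen:
 assumes r: "0 <= r" "r <= r1"
 shows "(LBINT x. \<zeta> x * pen r x) <= 2 * pi * IU (den r) / \<delta>^2"
proof -
 obtain a b where ab: "\<And>x. x \<notin> cbox a b ==> \<zeta> x = 0" using zeta_cbox by metis
 note cs = continuous_on_shift_comp[OF den_cont] continuous_on_shift_comp[OF ccs_continuous[OF \<zeta>(1)]]
 have "(LBINT x. \<zeta> x * pen r x)
   = (LBINT x. integral (cbox 0 (2*pi)) (%th. \<zeta> x * den r (x + r *\<^sub>R ee th)) / \<delta>^2)"
  by (simp add: pen_def)
 also have "... = (LBINT x. integral (cbox 0 (2*pi)) (%th. \<zeta> x * den r (x + r *\<^sub>R ee th))) / \<delta>^2"
  by (rule integral_divide_zero)
 also have "(LBINT x. integral (cbox 0 (2*pi)) (%th. \<zeta> x * den r (x + r *\<^sub>R ee th)))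
   = integral (cbox 0 (2*pi)) (%th. \<integral>x. \<zeta> x * den r (x + r *\<^sub>R ee th) \<partial>lborel)"
  by (rule integral_lborel_swap) (use ab in \<open>auto simp: case_prod_beta intro!: continuous_intros cs\<close>)
 also have "... <= integral {0..2*pi} (%th. IU (den r))"
  unfolding cbox_interval
 proof (rule integral_le)
  have "(LBINT x. \<zeta> x * den r (x + r *\<^sub>R ee th)) = integral (cbox a b) (%x. \<zeta> x * den r (x + r *\<^sub>R ee th))" for th
   by (rule integral_lborel_eq_cbox(2)) (use ab in \<open>auto intro!: continuous_intros cs\<close>)
  moreover have "continuous_on {0..2*pi} (%th. integral (cbox a b) (%x. \<zeta> x * den r (x + r *\<^sub>R ee th)))"
   by (rule integral_continuous_on_param) (auto simp: case_prod_beta intro!: continuous_intros cs)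
  ultimately show "(%th. \<integral>x. \<zeta> x * den r (x + r *\<^sub>R ee th) \<partial>lborel) integrable_on {0..2*pi}"
   by (simp add: integrable_continuous_interval)
  show "(LBINT x. \<zeta> x * den r (x + r *\<^sub>R ee th)) <= IU (den r)" for th
   by (rule shift_IU[OF den_cont den_nonneg[OF r(1)]]) (use r in simp)
 qed (rule integrable_const_ivl)
 finally show ?thesis using pos by (simp add: divide_right_mono)
qed

lemma exc_eq:
 assumes r: "0 < r"
 shows "exc r x = integral (cbox (0,0) (r,2*pi)) (%(s,th). s * mag (x + s *\<^sub>R ee th))"
proof -
 note cs = continuous_on_shift_comp[OF mag_cont]
 have "flux r x = integral (cbox (0,0) (r,2*pi)) (%(s,th). s * (da2 (x + s *\<^sub>R ee th) ex1 - da1 (x + s *\<^sub>R ee th) ex2))"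
  unfolding flux_def by (rule stokes_disc[OF a1_der da1_cont a2_der da2_cont]) (use r in simp)
 also have "... = integral (cbox (0,0) (r,2*pi)) (%z. fst z * mag (x + fst z *\<^sub>R ee (snd z)) + h * fst z)"
  by (simp add: case_prod_beta' mag_def algebra_simps)
 also have "... = integral (cbox (0,0) (r,2*pi)) (%z. fst z * mag (x + fst z *\<^sub>R ee (snd z)))
   + integral (cbox (0,0) (r,2*pi)) (%z. h * fst z)"
  by (intro integral_add integrable_continuous continuous_intros cs)
 also have "integral (cbox (0,0) (r,2*pi)) (%z. h * fst z) = h * (pi * r^2)"
  using weighted_Cauchy_Schwarz_box(2)[of "%_ _. 0", OF _ r] by (simp add: case_prod_beta' integral_mult_right)
 finally show ?thesis by (simp add: exc_def case_prod_beta')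
qed

text \<open>By \<open>exc_eq\<close>, \<open>exc\<close> is the field excess integrated over a disc,
  so Cauchy-Schwarz on the disc and then translation invariance give the square of the disc area.
  The power r^4 is high enough to survive the division by r^3 in
  \<open>kinetic_lower_bound\<close>.\<close>

lemma integral_exc2:
 assumes r: "0 < r" "r <= r1"
 shows "(LBINT x. \<zeta> x * (exc r x)^2) <= (pi * r^2)^2 * IU (%x. (mag x)^2)"
proof -
 obtain a b where ab: "\<And>x. x \<notin> cbox a b ==> \<zeta> x = 0" using zeta_cbox by metis
 note cs = continuous_on_shift_comp[OF mag_cont] continuous_on_shift_comp[OF ccs_continuous[OF \<zeta>(1)]]
 let ?B = "cbox (0,0) (r,2*pi)"
 define q where "q x z = \<zeta> x * (fst z * (mag (x + fst z *\<^sub>R ee (snd z)))^2)" for x and z :: "real \<times> real"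
 have cq: "cont (%x. integral ?B (q x))"
  unfolding q_def by (rule integral_continuous_on_param) (auto simp: case_prod_beta intro!: continuous_intros cs)
 have "(LBINT x. \<zeta> x * (exc r x)^2) <= (LBINT x. pi * r^2 * integral ?B (q x))"
 proof (rule integral_mono)
  show "L1 (%x. \<zeta> x * (exc r x)^2)"
   by (intro ccs_integrable ccs_zeta_mult continuous_intros exc_cont)
  have "L1 (%x. integral ?B (q x))"
   by (rule integral_lborel_eq_cbox(1)[OF cq, of a b]) (simp add: q_def[abs_def] ab)
  then show "L1 (%x. pi * r^2 * integral ?B (q x))" by simp
  fix x
  have "(exc r x)^2 <= pi * r^2 * integral ?B (%(s,th). s * (mag (x + s *\<^sub>R ee th))^2)"
   unfolding exc_eq[OF r(1)] by (rule weighted_Cauchy_Schwarz_box(1)[OF _ r(1)]) (intro continuous_intros cs)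
  then have "\<zeta> x * (exc r x)^2 <= \<zeta> x * (pi * r^2 * integral ?B (%(s,th). s * (mag (x + s *\<^sub>R ee th))^2))"
   by (rule mult_left_mono[OF _ \<zeta>(2)])
  also have "... = pi * r^2 * integral ?B (q x)"
  proof -
   have "integral ?B (q x) = \<zeta> x * integral ?B (%(s,th). s * (mag (x + s *\<^sub>R ee th))^2)"
    by (simp add: q_def[abs_def] case_prod_beta')
   then show ?thesis by simp
  qed
  finally show "\<zeta> x * (exc r x)^2 <= pi * r^2 * integral ?B (q x)" .
 qed
 also have "... = pi * r^2 * integral ?B (%z. \<integral>x. q x z \<partial>lborel)"
 proof -
  have "(LBINT x. integral ?B (q x)) = integral ?B (%z. \<integral>x. q x z \<partial>lborel)"
   unfolding q_def
   by (rule integral_lborel_swap[where a=a and b=b]) (use ab in \<open>auto simp: case_prod_beta intro!: continuous_intros cs\<close>)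
  then show ?thesis by simp
 qed
 also have "... <= pi * r^2 * integral ?B (%z. fst z * IU (%x. (mag x)^2))"
 proof (rule mult_left_mono[OF integral_le])
  have "(LBINT x. q x z) = integral (cbox a b) (%x. q x z)" for z
   unfolding q_def by (rule integral_lborel_eq_cbox(2)) (use ab in \<open>auto intro!: continuous_intros cs\<close>)
  moreover have "continuous_on ?B (%z. integral (cbox a b) (%x. q x z))"
   unfolding q_def by (rule integral_continuous_on_param) (auto simp: case_prod_beta intro!: continuous_intros cs)
  ultimately show "(%z. \<integral>x. q x z \<partial>lborel) integrable_on ?B"
   by (simp add: integrable_continuous)
  show "(%z. fst z * IU (%x. (mag x)^2)) integrable_on ?B"
   by (intro integrable_continuous continuous_intros)
  fix z :: "real \<times> real" assume "z \<in> ?B"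
  then have z: "0 <= fst z" "fst z <= r" by (auto simp: cbox_Pair_eq mem_Times_iff)
  have "(LBINT x. q x z) = (LBINT x. fst z * (\<zeta> x * (mag (x + fst z *\<^sub>R ee (snd z)))^2))"
   by (simp add: q_def mult_ac)
  also have "... = fst z * (LBINT x. \<zeta> x * (mag (x + fst z *\<^sub>R ee (snd z)))^2)" by simp
  also have "... <= fst z * IU (%x. (mag x)^2)"
   by (rule mult_left_mono[OF shift_IU[of "%x. (mag x)^2"]])
     (use z r in \<open>auto intro!: continuous_intros mag_cont\<close>)
  finally show "(LBINT x. q x z) <= fst z * IU (%x. (mag x)^2)" .
 qed simp
 also have "integral ?B (%z. fst z * IU (%x. (mag x)^2)) = pi * r^2 * IU (%x. (mag x)^2)"
  using weighted_Cauchy_Schwarz_box(2)[of "%_ _. 0", OF _ r(1)] by (simp add: case_prod_beta' integral_mult_left)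
 finally show ?thesis by (simp add: power2_eq_square mult_ac)
qed

end

context gl_config
begin

lemma int_zeta: "cont f ==> L1 (%x. \<zeta> x * f x)" for f :: "real^3 => real"
 by (intro ccs_integrable ccs_zeta_mult)

text \<open>The pointwise alternative of \<open>quantised_circulation_bound\<close>, weighted by
  \<zeta> and integrated. Only the quadratic circulation term loses its weight, through \<zeta> <=
  1, because the bound over all scales concerns the unweighted transform.\<close>

lemma fixed_radius_bound:
 assumes r: "0 < r" "r <= r1" and \<eta>: "0 < \<eta>" "\<eta> <= 1" "pi * h * r1^2 <= \<eta>/2" and \<gamma>: "0 < \<gamma>"
 defines "Z \<equiv> (LBINT x. \<zeta> x)" and "K \<equiv> pi\<^sup>2/\<gamma> + pi^2 + pi"
 shows "2 * (pi - \<eta>) * ((LBINT x. \<zeta> x * circ r x) + pi * h * r^2 * Z + (LBINT x. \<zeta> x * exc r x))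
  <= (1 + \<gamma>) * (r^2 * (LBINT x. (cmod (circle_transform cur r x))^2))
   + K * (LBINT x. \<zeta> x * pen r x) + (4 * K / \<eta>^2 + 1) * (LBINT x. \<zeta> x * (exc r x)^2)"
proof -
 note i = int_zeta[OF circ_cont] int_zeta[OF exc_cont] int_zeta[OF pen_cont]
  int_zeta[OF continuous_on_power[OF exc_cont]] ccs_integrable[OF \<zeta>(1)]
  ccs_integrable[OF ccs_norm2[OF circle_transform_ccs[OF cur_ccs]]]
 have "2 * (pi - \<eta>) * ((LBINT x. \<zeta> x * circ r x) + pi * h * r^2 * Z + (LBINT x. \<zeta> x * exc r x))
   = (LBINT x. 2 * (pi - \<eta>) * (\<zeta> x * circ r x + pi * h * r^2 * \<zeta> x + \<zeta> x * exc r x))"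
  using i by (simp add: Z_def)
 also have "... <= (LBINT x. (1 + \<gamma>) * (r^2 * (cmod (circle_transform cur r x))^2)
   + K * (\<zeta> x * pen r x) + (4 * K / \<eta>^2 + 1) * (\<zeta> x * (exc r x)^2))"
 proof (rule integral_mono)
  show "L1 (%x. 2 * (pi - \<eta>) * (\<zeta> x * circ r x + pi * h * r^2 * \<zeta> x + \<zeta> x * exc r x))"
   using i by simp
  show "L1 (%x. (1 + \<gamma>) * (r^2 * (cmod (circle_transform cur r x))^2)
   + K * (\<zeta> x * pen r x) + (4 * K / \<eta>^2 + 1) * (\<zeta> x * (exc r x)^2))"
   using i by simp
  fix x
  show "2 * (pi - \<eta>) * (\<zeta> x * circ r x + pi * h * r^2 * \<zeta> x + \<zeta> x * exc r x)
   <= (1 + \<gamma>) * (r^2 * (cmod (circle_transform cur r x))^2)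
   + K * (\<zeta> x * pen r x) + (4 * K / \<eta>^2 + 1) * (\<zeta> x * (exc r x)^2)"
  proof (cases "\<zeta> x = 0")
   case True
   then show ?thesis using \<gamma> by simp
  next
   case False
   have p0: "0 <= pen r x"
    unfolding pen_def using pos den_nonneg[of r] r
    by (intro divide_nonneg_nonneg integral_nonneg integrable_continuous_interval)
      (auto intro!: continuous_on_shift_comp[OF den_cont] continuous_intros)
   have rr: "pi * h * r^2 <= pi * h * r1^2"
    using r pos by (intro mult_left_mono power_mono) auto
   then have rr: "pi * h * r^2 <= \<eta>/2" using \<eta> by linarith
   have *: "2 * (pi - \<eta>) * (circ r x + pi * h * r^2 + exc r x)
    <= (1 + \<gamma>) * (circ r x)^2 + K * (pen r x + 4 * (exc r x)^2 / \<eta>^2) + (exc r x)^2"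
    unfolding K_def
    by (rule quantised_circulation_bound[OF circ_quantised[OF False r] _ _ \<eta>(1,2) \<gamma> p0])
      (use pos rr \<eta> in auto)
   have c2: "(circ r x)^2 <= r^2 * (cmod (circle_transform cur r x))^2"
    unfolding circ_def power_mult_distrib
    by (intro mult_left_mono) (auto simp: cmod_power2)
   have "2 * (pi - \<eta>) * (\<zeta> x * circ r x + pi * h * r^2 * \<zeta> x + \<zeta> x * exc r x)
    = \<zeta> x * (2 * (pi - \<eta>) * (circ r x + pi * h * r^2 + exc r x))" by (simp add: algebra_simps)
   also have "... <= \<zeta> x * ((1 + \<gamma>) * (circ r x)^2 + K * (pen r x + 4 * (exc r x)^2 / \<eta>^2) + (exc r x)^2)"
    by (rule mult_left_mono[OF * \<zeta>(2)])
   also have "... = \<zeta> x * ((1 + \<gamma>) * (circ r x)^2) + (K * (\<zeta> x * pen r x) + (4 * K / \<eta>^2 + 1) * (\<zeta> x * (exc r x)^2))"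
    by (simp add: algebra_simps add_divide_distrib)
   also have "\<zeta> x * ((1 + \<gamma>) * (circ r x)^2) <= 1 * ((1 + \<gamma>) * (circ r x)^2)"
    using \<zeta>(3)[of x] \<gamma> by (intro mult_right_mono) auto
   also have "... <= (1 + \<gamma>) * (r^2 * (cmod (circle_transform cur r x))^2)"
    using c2 \<gamma> by simp
   finally show ?thesis by simp
  qed
 qed
 also have "... = (1 + \<gamma>) * (r^2 * (LBINT x. (cmod (circle_transform cur r x))^2))
   + K * (LBINT x. \<zeta> x * pen r x) + (4 * K / \<eta>^2 + 1) * (LBINT x. \<zeta> x * (exc r x)^2)"
  using i by simp
 finally show ?thesis .
qed

lemma integral_circ_bound:
 assumes r: "0 < r" and l: "0 < l" and L: "0 <= \<Lambda>"
 shows "- (pi * r^2 * \<Lambda> * (l * IU (%_. 1) + 4 * IU kin / l)) <= (LBINT x. \<zeta> x * circ r x)"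
proof -
 have ci: "L1 (%x. of_real (\<zeta> x) * circle_transform cur r x)"
 proof -
  have "ccs (%x. circle_transform cur r x * of_real (\<zeta> x))"
   by (rule ccs_mult_left[OF circle_transform_ccs[OF cur_ccs]]) (intro continuous_intros ccs_continuous[OF \<zeta>(1)])
  then show ?thesis using ccs_integrable by (simp add: mult.commute)
 qed
 have "(LBINT x. \<zeta> x * circ r x) = (LBINT x. r * Re (of_real (\<zeta> x) * circle_transform cur r x))"
  by (simp add: circ_def mult_ac)
 also have "... = r * Re (LBINT x. of_real (\<zeta> x) * circle_transform cur r x)"
  by (simp only: integral_mult_right_zero integral_Re[OF ci])
 finally have e: "(LBINT x. \<zeta> x * circ r x) = r * Re (LBINT x. of_real (\<zeta> x) * circle_transform cur r x)" .
 have "\<bar>Re (LBINT x. of_real (\<zeta> x) * circle_transform cur r x)\<bar> <= 2 * pi * (\<Lambda> * r * (LBINT x. cmod (cur x)))"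
  by (rule order_trans[OF abs_Re_le_cmod circle_transform_against_lipschitz[OF cur_ccs \<zeta>(1,4)]]) (use r in simp)
 also have "... <= 2 * pi * (\<Lambda> * r * ((l * IU (%_. 1) + 4 * IU kin / l) / 2))"
  using r L by (intro mult_left_mono cur_L1[OF l]) auto
 also have "... = pi * \<Lambda> * r * (l * IU (%_. 1) + 4 * IU kin / l)" by simp
 finally have "\<bar>Re (LBINT x. of_real (\<zeta> x) * circle_transform cur r x)\<bar> <= pi * \<Lambda> * r * (l * IU (%_. 1) + 4 * IU kin / l)" .
 then have "- (pi * \<Lambda> * r * (l * IU (%_. 1) + 4 * IU kin / l)) <= Re (LBINT x. of_real (\<zeta> x) * circle_transform cur r x)"
  by linarith
 then have "r * - (pi * \<Lambda> * r * (l * IU (%_. 1) + 4 * IU kin / l)) <= r * Re (LBINT x. of_real (\<zeta> x) * circle_transform cur r x)"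
  using r by (intro mult_left_mono) auto
 then show ?thesis unfolding e by (simp add: power2_eq_square mult_ac)
qed

lemma integral_exc_bound:
 assumes r: "0 < r" and l: "0 < l"
 shows "- ((l * r^2 * (LBINT x. \<zeta> x) + (LBINT x. \<zeta> x * (exc r x)^2) / (l * r^2)) / 2) <= (LBINT x. \<zeta> x * exc r x)"
proof -
 note i = int_zeta[OF exc_cont] int_zeta[OF continuous_on_power[OF exc_cont]] ccs_integrable[OF \<zeta>(1)]
 have "- ((l * r^2 * (LBINT x. \<zeta> x) + (LBINT x. \<zeta> x * (exc r x)^2) / (l * r^2)) / 2)
  = (LBINT x. - ((l * r^2 * \<zeta> x + \<zeta> x * (exc r x)^2 / (l * r^2)) / 2))"
  using i by simp
 also have "... <= (LBINT x. \<zeta> x * exc r x)"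
 proof (rule integral_mono)
  fix x
  have lr: "l * r^2 > 0" using r l by simp
  have "0 <= (sqrt (l * r^2) + exc r x / sqrt (l * r^2))^2" by simp
  also have "... = l * r^2 + (exc r x)^2 / (l * r^2) + 2 * exc r x"
  proof -
   have "(A + B / A)^2 = A^2 + B^2 / A^2 + 2 * B" if "A > 0" for A B :: real
    using that by (simp add: power2_sum power_divide)
   from this[of "sqrt (l * r^2)" "exc r x"] show ?thesis using lr by simp
  qed
  finally have "- ((l * r^2 + (exc r x)^2 / (l * r^2)) / 2) <= exc r x" by argo
  from mult_left_mono[OF this \<zeta>(2)[of x]]
  show "- ((l * r^2 * \<zeta> x + \<zeta> x * (exc r x)^2 / (l * r^2)) / 2) <= \<zeta> x * exc r x"
   by (simp add: algebra_simps add_divide_distrib)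
 qed (use i in simp_all)
 finally show ?thesis .
qed

text \<open>At radius r the main term is a multiple of r^2, the penalty is of order r and the field
  error of order r^4. Dividing by r^3 makes the main term A/r, whose integral is the logarithm,
  while the penalty is governed by the core end \<open>r0\<close> and the field error by the outer
  end \<open>r1\<close>. The transform enters as its squared norm over r, exactly the quantity
  bounded by \<open>circle_transform_scales_bound\<close>.\<close>

theorem kinetic_lower_bound:
 assumes E: "IU kin + \<kappa>^2/2 * IU (%x. (pot x)^2) + IU (%x. (mag x)^2) <= E"
  and \<eta>: "0 < \<eta>" "\<eta> <= 1" "pi * h * r1^2 <= \<eta>/2" and \<gamma>: "0 < \<gamma>"
  and r0: "1/\<kappa> <= r0" "r0 <= r1" and \<nu>: "0 < \<nu>" and L: "0 <= \<Lambda>"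
 defines "Z \<equiv> (LBINT x. \<zeta> x)" and "K \<equiv> pi\<^sup>2/\<gamma> + pi^2 + pi" and "V \<equiv> IU (%_. 1)"
 shows "(2 * pi * (pi - \<eta>) * h * Z - 2 * pi * (pi * \<Lambda> * (V + 4) + (Z + pi^2) / 2) * (\<nu> * h + E / (\<nu> * h))) * ln (r1 / r0)
   - 16 * pi * K / \<delta>^2 * E / (\<kappa> * r0) - (4 * K / \<eta>^2 + 1) * pi^2 * E * r1^2 / 2
   <= 2 * pi^2 * (1 + \<gamma>) * IU kin / (1 - \<delta>)^2"
proof -
 define P B where "P = IU (%x. (pot x)^2)" and "B = IU (%x. (mag x)^2)"
 define Q where "Q r = (LBINT x. (cmod (circle_transform cur r x))^2)" for r
 define S where "S = \<nu> * h + E / (\<nu> * h)"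
 define C1 where "C1 = 2 * pi * (pi * \<Lambda> * (V + 4) + (Z + pi^2) / 2)"
 define C2 where "C2 = 16 * pi * K / \<delta>^2 * E / \<kappa>"
 define C3 where "C3 = (4 * K / \<eta>^2 + 1) * pi^2 * E"
 define A where "A = 2 * pi * (pi - \<eta>) * h * Z - C1 * S"
 have K1: "IU kin \<ge> 0" "P \<ge> 0" "B \<ge> 0" "V \<ge> 0"
  unfolding P_def B_def V_def by (intro IU_nonneg; simp add: kin_nonneg)+
 have E': "IU kin <= E" "P <= 2 * E / \<kappa>^2" "B <= E" and E0: "0 <= E"
 proof -
  have k: "\<kappa>^2/2 * P \<ge> 0" using K1 by simp
  have EE: "IU kin + \<kappa>^2/2 * P + B <= E" using E by (simp only: P_def B_def)
  show "IU kin <= E" "B <= E" "0 <= E" using EE K1 k by linarith+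
  have "\<kappa>^2/2 * P <= E" using EE K1 by linarith
  then show "P <= 2 * E / \<kappa>^2" using pos by (simp add: field_simps)
 qed
 have Z0: "Z \<ge> 0" unfolding Z_def using \<zeta> by (intro Bochner_Integration.integral_nonneg) auto
 have K0: "K \<ge> 0" unfolding K_def using \<gamma> by auto
 have S0: "0 <= S" "\<nu> * h <= S" "E / (\<nu> * h) <= S" using \<nu> pos E0 by (auto simp: S_def)
 have r0p: "0 < r0" using r0 pos by (meson less_le_trans zero_less_divide_1_iff)
 have key: "A / r - C2 / r^2 - C3 * r <= (1 + \<gamma>) * (Q r / r)" if r: "r0 <= r" "r <= r1" for r
 proof -
  have rp: "0 < r" using r r0p by linarith
  have "1 / \<kappa> <= r" using r r0 by linarith
  then have kr: "1 <= \<kappa> * r" using pos by (simp add: field_simps)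
  have x2: "(LBINT x. \<zeta> x * (exc r x)^2) <= pi^2 * r^4 * E"
  proof -
   have "(LBINT x. \<zeta> x * (exc r x)^2) <= (pi * r^2)^2 * B"
    unfolding B_def by (rule integral_exc2[OF rp r(2)])
   also have "... <= (pi * r^2)^2 * E" using E' by (intro mult_left_mono) auto
   finally show ?thesis by (simp add: power_mult_distrib)
  qed
  have circ: "- (pi * r^2 * \<Lambda> * (V + 4) * S) <= (LBINT x. \<zeta> x * circ r x)"
  proof -
   have "\<nu> * h * V + 4 * IU kin / (\<nu> * h) <= V * S + 4 * S"
   proof (rule add_mono)
    show "\<nu> * h * V <= V * S" using S0 K1 by (metis mult.commute mult_left_mono)
    have "IU kin / (\<nu> * h) <= E / (\<nu> * h)" using E' \<nu> pos by (intro divide_right_mono) auto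
    then show "4 * IU kin / (\<nu> * h) <= 4 * S" using S0 by simp
   qed
   then have "pi * r^2 * \<Lambda> * (\<nu> * h * V + 4 * IU kin / (\<nu> * h)) <= pi * r^2 * \<Lambda> * (V * S + 4 * S)"
    using L by (intro mult_left_mono) auto
   moreover have "- (pi * r^2 * \<Lambda> * (\<nu> * h * V + 4 * IU kin / (\<nu> * h))) <= (LBINT x. \<zeta> x * circ r x)"
    unfolding V_def by (rule integral_circ_bound[OF rp _ L]) (use \<nu> pos in simp)
   moreover have "pi * r^2 * \<Lambda> * (V * S + 4 * S) = pi * r^2 * \<Lambda> * (V + 4) * S" by (simp add: algebra_simps)
   ultimately show ?thesis by linarith
  qed
  have exc: "- (r^2 * (Z + pi^2) / 2 * S) <= (LBINT x. \<zeta> x * exc r x)"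
  proof -
   have "(LBINT x. \<zeta> x * (exc r x)^2) / (\<nu> * h * r^2) <= pi^2 * r^4 * E / (\<nu> * h * r^2)"
    using x2 \<nu> pos by (intro divide_right_mono) auto
   also have "... = r^2 * pi^2 * (E / (\<nu> * h))" using rp by (simp add: power2_eq_square power4_eq_xxxx)
   also have "... <= r^2 * pi^2 * S" using S0 by (intro mult_left_mono) auto
   finally have 1: "(LBINT x. \<zeta> x * (exc r x)^2) / (\<nu> * h * r^2) <= r^2 * pi^2 * S" .
   have 2: "\<nu> * h * r^2 * Z <= r^2 * Z * S"
    using mult_left_mono[OF S0(2), of "r^2 * Z"] Z0 by (simp add: mult_ac)
   have "- ((\<nu> * h * r^2 * Z + (LBINT x. \<zeta> x * (exc r x)^2) / (\<nu> * h * r^2)) / 2) <= (LBINT x. \<zeta> x * exc r x)"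
    unfolding Z_def by (rule integral_exc_bound[OF rp]) (use \<nu> pos in simp)
   moreover have "r^2 * (Z + pi^2) / 2 * S = (r^2 * Z * S + r^2 * pi^2 * S) / 2" by (simp add: algebra_simps)
   moreover have "- s <= w" if "- ((p + q) / 2) <= w" "s = (a + b) / 2" "q <= b" "p <= a" for p q w s a b :: real
    using that by argo
   ultimately show ?thesis using 1 2 by blast
  qed
  have pen: "(LBINT x. \<zeta> x * pen r x) <= 16 * pi / \<delta>^2 * E / \<kappa> * r"
  proof -
   have "IU (den r) = P + 2 * r * (\<kappa> * P + IU kin / \<kappa>)"
   proof -
    have "set_integrable lborel U (%x. (pot x)^2)" "set_integrable lborel U kin"
     by (intro IU_integrable continuous_intros pot_cont kin_cont)+
    then show ?thesis
     unfolding IU_def den_def[abs_def] P_def by (simp add: set_integral_add set_integral_mult_right set_integral_divide_zero)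
   qed
   also have "... <= 2 * E / \<kappa>^2 + 2 * r * (\<kappa> * (2 * E / \<kappa>^2) + E / \<kappa>)"
    using E' pos rp by (intro add_mono mult_left_mono divide_right_mono) auto
   also have "... = 2 * E / \<kappa>^2 + 6 * r * E / \<kappa>" using pos by (simp add: power2_eq_square field_simps)
   \<comment> \<open>Here \<open>\<kappa> * r >= 1\<close> enters: for radii below the core size the
     undifferentiated potential term of \<open>den\<close> would dominate.\<close>
   also have "2 * E / \<kappa>^2 <= 2 * r * E / \<kappa>"
   proof -
    have "2 * E / \<kappa>^2 * 1 <= 2 * E / \<kappa>^2 * (\<kappa> * r)" using kr E0 by (intro mult_left_mono) auto
    then show ?thesis using pos by (simp add: power2_eq_square mult_ac)
   qed
   finally have "IU (den r) <= 8 * r * E / \<kappa>" by (simp add: mult_ac)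
   then have "2 * pi * IU (den r) / \<delta>^2 <= 2 * pi * (8 * r * E / \<kappa>) / \<delta>^2"
    by (intro divide_right_mono mult_left_mono) auto
   then show ?thesis using integral_pen[of r] rp r by (simp add: mult_ac)
  qed
  have low: "2 * pi * (pi - \<eta>) * h * Z * r^2 - C1 * S * r^2 <=
    2 * (pi - \<eta>) * ((LBINT x. \<zeta> x * circ r x) + pi * h * r^2 * Z + (LBINT x. \<zeta> x * exc r x))"
  proof -
   define T where "T = (pi * \<Lambda> * (V + 4) + (Z + pi^2) / 2) * S * r^2"
   have T0: "T \<ge> 0" unfolding T_def using L K1 S0 Z0 by (intro mult_nonneg_nonneg add_nonneg_nonneg) auto
   have "- T = - (pi * r^2 * \<Lambda> * (V + 4) * S) + - (r^2 * (Z + pi^2) / 2 * S)" by (simp add: T_def algebra_simps)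
   then have "- T <= (LBINT x. \<zeta> x * circ r x) + (LBINT x. \<zeta> x * exc r x)" using circ exc by linarith
   then have "2 * (pi - \<eta>) * (- T + pi * h * r^2 * Z) <=
    2 * (pi - \<eta>) * ((LBINT x. \<zeta> x * circ r x) + pi * h * r^2 * Z + (LBINT x. \<zeta> x * exc r x))"
    using \<eta> pi_gt3 by (intro mult_left_mono) auto
   moreover have "2 * (pi - \<eta>) * (- T + pi * h * r^2 * Z) = 2 * pi * (pi - \<eta>) * h * Z * r^2 - 2 * (pi - \<eta>) * T"
    by (simp add: algebra_simps)
   moreover have "2 * (pi - \<eta>) * T <= 2 * pi * T" using \<eta> T0 by (intro mult_right_mono) auto
   moreover have "2 * pi * T = C1 * S * r^2" by (simp add: T_def C1_def)
   ultimately show ?thesis by linarith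
  qed
  have "2 * (pi - \<eta>) * ((LBINT x. \<zeta> x * circ r x) + pi * h * r^2 * Z + (LBINT x. \<zeta> x * exc r x))
    <= (1 + \<gamma>) * (r^2 * Q r) + K * (LBINT x. \<zeta> x * pen r x) + (4 * K / \<eta>^2 + 1) * (LBINT x. \<zeta> x * (exc r x)^2)"
   unfolding Q_def Z_def K_def by (rule fixed_radius_bound[OF rp r(2) \<eta> \<gamma>])
  also have "... <= (1 + \<gamma>) * (r^2 * Q r) + K * (16 * pi / \<delta>^2 * E / \<kappa> * r) + (4 * K / \<eta>^2 + 1) * (pi^2 * r^4 * E)"
   using pen x2 K0 by (intro add_mono mult_left_mono order_refl) auto
  finally have "A * r^2 <= (1 + \<gamma>) * (r^2 * Q r) + C2 * r + C3 * r^4"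
   using low by (simp add: A_def C2_def C3_def algebra_simps)
  then have "(A * r^2 - C2 * r - C3 * r^4) / r^3 <= (1 + \<gamma>) * (r^2 * Q r) / r^3"
   using rp by (intro divide_right_mono) auto
  then show ?thesis using rp by (simp add: diff_divide_distrib power2_eq_square power3_eq_cube power4_eq_xxxx)
 qed
 have hi: "((%r. A / r - C2 / r^2 - C3 * r) has_integral
   ((A * ln r1 + C2 / r1 - C3 * r1^2 / 2) - (A * ln r0 + C2 / r0 - C3 * r0^2 / 2))) {r0..r1}"
 proof (rule fundamental_theorem_of_calculus[OF r0(2)])
  fix r assume "r \<in> {r0..r1}"
  then have "r > 0" using r0p by simp
  then have "((%r. A * ln r + C2 / r - C3 * r^2 / 2) has_real_derivative (A / r - C2 / r^2 - C3 * r)) (at r)"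
   by (auto intro!: derivative_eq_intros simp: power2_eq_square)
  then show "((%r. A * ln r + C2 / r - C3 * r^2 / 2) has_vector_derivative (A / r - C2 / r^2 - C3 * r)) (at r within {r0..r1})"
   by (rule has_real_derivative_iff_has_vector_derivative[THEN iffD1, OF DERIV_subset[OF _ subset_UNIV]])
 qed
 have Qi: "(%r. Q r / r) integrable_on {r0..r1}"
  unfolding Q_def by (rule circle_transform_scales_bound(1)[OF cur_ccs r0p r0(2)])
 have "(A * ln r1 + C2 / r1 - C3 * r1^2 / 2) - (A * ln r0 + C2 / r0 - C3 * r0^2 / 2)
   <= (1 + \<gamma>) * integral {r0..r1} (%r. Q r / r)"
  by (rule has_integral_le[OF hi has_integral_mult_right[OF integrable_integral[OF Qi]]]) (use key in auto)
 also have "... <= (1 + \<gamma>) * (2 * pi^2 * (LBINT x. (cmod (cur x))^2))"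
  unfolding Q_def using \<gamma> by (intro mult_left_mono circle_transform_scales_bound(2)[OF cur_ccs r0p r0(2)]) auto
 also have "... <= (1 + \<gamma>) * (2 * pi^2 * (IU kin / (1 - \<delta>)^2))"
  using \<gamma> by (intro mult_left_mono cur_L2) auto
 finally have F: "A * (ln r1 - ln r0) + C2 / r1 + C3 * r0^2 / 2 - C2 / r0 - C3 * r1^2 / 2
   <= 2 * pi^2 * (1 + \<gamma>) * IU kin / (1 - \<delta>)^2" by (simp add: algebra_simps)
 have C0: "C2 / r1 \<ge> 0" "C3 * r0^2 / 2 \<ge> 0"
  using K0 E0 pos r0p r0 by (auto simp: C2_def C3_def intro!: divide_nonneg_nonneg mult_nonneg_nonneg add_nonneg_nonneg)
 have "ln r1 - ln r0 = ln (r1 / r0)" using r0p r0 by (simp add: ln_div)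
 with F C0 have "A * ln (r1 / r0) - C2 / r0 - C3 * r1^2 / 2 <= 2 * pi^2 * (1 + \<gamma>) * IU kin / (1 - \<delta>)^2" by simp
 then show ?thesis by (simp add: A_def C1_def C2_def C3_def S_def mult_ac)
qed

end

section \<open>Mollification\<close>

text \<open>The powers of 1/t are what repeated differentiation of exp (-1/t) produces, so the
  family is closed under derivatives up to linear combinations.\<close>

definition flat_exp :: "nat => real => real" where
 "flat_exp k t = (if t > 0 then (1/t)^k * exp (- (1/t)) else 0)"

lemma flat_exp_limit: "(flat_exp k \<longlongrightarrow> 0) (at 0)"
proof -
 have "((%x::real. x ^ k / exp x) \<longlongrightarrow> 0) at_top" by (rule tendsto_power_div_exp_0)
 then have "((%t::real. (1/t) ^ k / exp (1/t)) \<longlongrightarrow> 0) (at_right 0)"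
  by (rule filterlim_compose) (use filterlim_inverse_at_top_right in \<open>simp add: inverse_eq_divide\<close>)
 then have r: "(flat_exp k \<longlongrightarrow> 0) (at_right 0)"
  by (rule Lim_transform_eventually)
    (auto simp: eventually_at_right_field flat_exp_def exp_minus field_simps intro!: exI[of _ 1])
 have l: "(flat_exp k \<longlongrightarrow> 0) (at_left 0)"
  by (rule tendsto_eventually) (auto simp: eventually_at_left_field flat_exp_def intro!: exI[of _ "-1"])
 show ?thesis using l r filterlim_at_split[of "flat_exp k" "nhds 0" 0] by blast
qed

lemma flat_exp_derivative:
 "(flat_exp k has_real_derivative (flat_exp (k + 2) t - real k * flat_exp (k + 1) t)) (at t)"
proof -
 consider "t > 0" | "t < 0" | "t = 0" by linarith
 then show ?thesis
 proof cases
  case 1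
  have "((%t. (1/t)^k * exp (- (1/t))) has_real_derivative (flat_exp (k + 2) t - real k * flat_exp (k + 1) t)) (at t)"
  proof -
   have A: "((%t. 1/t) has_real_derivative (- ((1/t)^2))) (at t)"
    using 1 by (auto intro!: derivative_eq_intros simp: power2_eq_square)
   have B: "((%t. exp (- (1/t))) has_real_derivative (exp (- (1/t)) * (- (- ((1/t)^2))))) (at t)"
    by (rule DERIV_chain2[OF DERIV_exp DERIV_minus[OF A]])
   have "real k * (- ((1/t)^2) * (1/t)^(k - Suc 0)) = - (real k * (1/t)^(k + 1))"
    by (cases k) (simp_all add: power2_eq_square)
   with DERIV_mult[OF DERIV_power[OF A, of k] B]
   have "((%t. (1/t)^k * exp (- (1/t))) has_real_derivative
    - (real k * (1/t)^(k + 1)) * exp (- (1/t)) + exp (- (1/t)) * (- (- ((1/t)^2))) * (1/t)^k) (at t)" by metis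
   moreover have "- (real k * (1/t)^(k + 1)) * exp (- (1/t)) + exp (- (1/t)) * (- (- ((1/t)^2))) * (1/t)^k
    = flat_exp (k + 2) t - real k * flat_exp (k + 1) t"
    using 1 by (simp add: flat_exp_def power_add power2_eq_square mult_ac)
   ultimately show ?thesis by metis
  qed
  then show ?thesis
   by (rule has_field_derivative_transform_within_open[where S="{0<..}"]) (use 1 in \<open>auto simp: flat_exp_def\<close>)
 next
  case 2
  have "((%_. 0) has_real_derivative 0) (at t)" by simp
  then have "(flat_exp k has_real_derivative 0) (at t)"
   by (rule has_field_derivative_transform_within_open[where S="{..<0}"]) (use 2 in \<open>auto simp: flat_exp_def\<close>)
  then show ?thesis using 2 by (simp add: flat_exp_def)
 next
  case 3
  have "((%h. (flat_exp k (0 + h) - flat_exp k 0) / h) \<longlongrightarrow> 0) (at 0)"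
  proof (rule Lim_transform_eventually[OF flat_exp_limit[of "k + 1"]])
   show "\<forall>\<^sub>F h in at 0. flat_exp (k + 1) h = (flat_exp k (0 + h) - flat_exp k 0) / h"
    by (auto simp: eventually_at flat_exp_def intro!: exI[of _ 1])
  qed
  then show ?thesis using 3 by (simp add: DERIV_def flat_exp_def)
 qed
qed

text \<open>A class of smooth functions of one variable that contains bump functions and is closed under differentiation.\<close>
inductive_set smooth1 :: "(real => real) set" where
 base: "(%t. flat_exp k (a * t + b)) \<in> smooth1"
| const: "(%t. c) \<in> smooth1"
| add: "f \<in> smooth1 ==> g \<in> smooth1 ==> (%t. f t + g t) \<in> smooth1"
| mult: "f \<in> smooth1 ==> g \<in> smooth1 ==> (%t. f t * g t) \<in> smooth1"

lemma smooth1_affine: "f \<in> smooth1 ==> (%t. f (a * t + b)) \<in> smooth1"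
proof (induction rule: smooth1.induct)
 case (base k c d)
 show ?case using smooth1.base[of k "c * a" "c * b + d"] by (simp add: algebra_simps)
qed (auto intro: smooth1.intros)

lemma smooth1_derivative:
 "f \<in> smooth1 ==> \<exists>f'\<in>smooth1. \<forall>t. (f has_real_derivative f' t) (at t)"
proof (induction rule: smooth1.induct)
 case (base k a b)
 let ?f' = "%t. a * (flat_exp (k + 2) (a * t + b) + (- real k) * flat_exp (k + 1) (a * t + b))"
 have "?f' \<in> smooth1" by (intro smooth1.intros)
 moreover have "((%t. flat_exp k (a * t + b)) has_real_derivative ?f' t) (at t)" for t
 proof -
  have "((%t. a * t + b) has_real_derivative a) (at t)" by (auto intro!: derivative_eq_intros)
  from DERIV_chain2[OF flat_exp_derivative this] show ?thesis by (simp add: algebra_simps)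
 qed
 ultimately show ?case by (intro bexI[of _ ?f']) auto
next
 case (const c)
 show ?case by (rule bexI[of _ "%_. 0"]) (auto intro: smooth1.intros)
next
 case (add f g)
 then obtain f' g' where "f' \<in> smooth1" "g' \<in> smooth1" "\<forall>t. (f has_real_derivative f' t) (at t)" "\<forall>t. (g has_real_derivative g' t) (at t)"
  by blast
 then show ?case by (intro bexI[of _ "%t. f' t + g' t"]) (auto intro: smooth1.intros DERIV_add)
next
 case (mult f g)
 then obtain f' g' where *: "f' \<in> smooth1" "g' \<in> smooth1" "\<forall>t. (f has_real_derivative f' t) (at t)" "\<forall>t. (g has_real_derivative g' t) (at t)"
  by blast
 have "(%t. f' t * g t + g' t * f t) \<in> smooth1"
  using * mult by (intro smooth1.intros)
 then show ?case using * by (intro bexI[of _ "%t. f' t * g t + g' t * f t"]) (auto intro: DERIV_mult)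
qed

section \<open>Smooth kernels on three-dimensional space as products of one-variable
  functions\<close>

definition sprod :: "(real^3 => real) set" where
 "sprod = {%x. f (x $ 1) * g (x $ 2) * h (x $ 3) | f g h. f \<in> smooth1 \<and> g \<in> smooth1 \<and> h \<in> smooth1}"

lemma sprodI: "f \<in> smooth1 ==> g \<in> smooth1 ==> h \<in> smooth1 ==> (%x. f (x $ 1) * g (x $ 2) * h (x $ 3)) \<in> sprod"
 unfolding sprod_def by blast

lemma has_derivative_vec_nth_comp:
 fixes f :: "real => real"
 assumes "(f has_real_derivative f') (at (x $ i))"
 shows "((%x::real^3. f (x $ i)) has_derivative (%v. v $ i * f')) (at x)"
proof -
 have "((%x::real^3. x $ i) has_derivative (%v. v $ i)) (at x)"
  by (rule bounded_linear_imp_has_derivative[OF bounded_linear_vec_nth])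
 from has_derivative_compose[OF this assms[unfolded has_field_derivative_def]]
 show ?thesis by (simp add: mult.commute)
qed

lemma sprod_derivative:
 assumes "\<phi> \<in> sprod"
 shows "\<exists>D::3 => real^3 => real. (\<forall>j. D j \<in> sprod) \<and>
  (\<forall>x. (\<phi> has_derivative (%v. v $ 1 * D 1 x + v $ 2 * D 2 x + v $ 3 * D 3 x)) (at x))"
proof -
 obtain f g h where p: "\<phi> = (%x. f (x $ 1) * g (x $ 2) * h (x $ 3))" "f \<in> smooth1" "g \<in> smooth1" "h \<in> smooth1"
  using assms unfolding sprod_def by blast
 obtain f' where f': "f' \<in> smooth1" "\<And>t. (f has_real_derivative f' t) (at t)" using smooth1_derivative[OF p(2)] by blast
 obtain g' where g': "g' \<in> smooth1" "\<And>t. (g has_real_derivative g' t) (at t)" using smooth1_derivative[OF p(3)] by blast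
 obtain h' where h': "h' \<in> smooth1" "\<And>t. (h has_real_derivative h' t) (at t)" using smooth1_derivative[OF p(4)] by blast
 define D where "D j = (if j = (1::3) then (%x::real^3. f' (x $ 1) * g (x $ 2) * h (x $ 3))
   else if j = 2 then (%x. f (x $ 1) * g' (x $ 2) * h (x $ 3)) else (%x. f (x $ 1) * g (x $ 2) * h' (x $ 3)))" for j
 have "D j \<in> sprod" for j
  unfolding D_def using sprodI[OF f'(1) p(3,4)] sprodI[OF p(2) g'(1) p(4)] sprodI[OF p(2,3) h'(1)] by simp
 moreover have "(\<phi> has_derivative (%v. v $ 1 * D 1 x + v $ 2 * D 2 x + v $ 3 * D 3 x)) (at x)" for x
  unfolding p(1)
  by (rule has_derivative_eq_rhs[OF has_derivative_mult[OF has_derivative_mult[OF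
    has_derivative_vec_nth_comp[OF f'(2)] has_derivative_vec_nth_comp[OF g'(2)]] has_derivative_vec_nth_comp[OF h'(2)]]])
    (simp add: D_def algebra_simps)
 ultimately show ?thesis by (intro exI[of _ D] conjI allI)
qed

text \<open>A partial derivative acts on one factor and leaves a product of the same kind, so the
  induction over \<open>higher_partials\<close> never leaves \<open>sprod\<close>. This is why the
  kernels are products and not radial functions.\<close>

lemma sprod_smooth_fun:
 assumes "\<phi> \<in> sprod"
 shows "smooth_fun \<phi>"
proof -
 have "g \<in> sprod" if "g \<in> higher_partials \<phi>" for g
  using that
 proof induction
  case base
  then show ?case using assms .
 next
  case (step g i)
  from sprod_derivative[OF step.IH]
  obtain D :: "3 => real^3 => real" where D': "\<forall>j. D j \<in> sprod" "\<forall>x. (g has_derivative (%v. v $ 1 * D 1 x + v $ 2 * D 2 x + v $ 3 * D 3 x)) (at x)"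
   by (elim exE conjE)
 note D = D'[rule_format]
  have e: "frechet_derivative g (at x) = (%v. v $ 1 * D 1 x + v $ 2 * D 2 x + v $ 3 * D 3 x)" for x
   by (rule frechet_derivative_at[OF D(2), symmetric])
  obtain j where j: "i = axis j 1" using step.hyps by (auto simp: Basis_vec_def)
  have "(%x. frechet_derivative g (at x) i) = D j"
   unfolding e j using exhaust_3[of j] by (auto simp: axis_def)
  then show ?case using D(1) by simp
 qed
 moreover have "g differentiable_on UNIV" if "g \<in> sprod" for g
  unfolding differentiable_on_def differentiable_def
  using sprod_derivative[OF that] has_derivative_at_withinI by blast
 ultimately show ?thesis by (auto simp: smooth_fun_def)
qed

lemma sprod_shift:
 assumes "\<phi> \<in> sprod"
 shows "(%y. \<phi> (y - x)) \<in> sprod"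
proof -
 obtain f g h where p: "\<phi> = (%x. f (x $ 1) * g (x $ 2) * h (x $ 3))" "f \<in> smooth1" "g \<in> smooth1" "h \<in> smooth1"
  using assms unfolding sprod_def by blast
 have "(%t. f (t - x $ 1)) \<in> smooth1" "(%t. g (t - x $ 2)) \<in> smooth1" "(%t. h (t - x $ 3)) \<in> smooth1"
  using smooth1_affine[of f 1 "- x $ 1"] smooth1_affine[of g 1 "- x $ 2"] smooth1_affine[of h 1 "- x $ 3"] p by simp_all
 from sprodI[OF this] show ?thesis unfolding p(1) by simp
qed

lemma sprod_continuous: "\<phi> \<in> sprod ==> cont \<phi>"
proof -
 assume "\<phi> \<in> sprod"
 from sprod_derivative[OF this]
 obtain D :: "3 => real^3 => real"
  where D: "\<forall>x. (\<phi> has_derivative (%v. v $ 1 * D 1 x + v $ 2 * D 2 x + v $ 3 * D 3 x)) (at x)"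
  by (elim exE conjE)
 have "isCont \<phi> x" for x by (rule has_derivative_continuous[OF D[rule_format, of x]])
 then show ?thesis by (simp add: continuous_at_imp_continuous_on)
qed

text \<open>The centre may be off the origin: the mollified function at x then samples only points
  near x + c, which close to the boundary can be steered into the domain.\<close>

definition kernel :: "real^3 => real => (real^3 => real) => bool" where
 "kernel c \<rho> k \<longleftrightarrow> k \<in> sprod \<and> (\<forall>x. 0 <= k x) \<and> (\<forall>x. k x \<noteq> 0 --> dist c x < \<rho>) \<and> (LBINT x. k x) = 1"

lemma kernel_ccs: "kernel c \<rho> k ==> ccs k"
proof (rule ccsI[where R="norm c + \<rho>"])
 assume k: "kernel c \<rho> k"
 show "cont k" using k sprod_continuous by (auto simp: kernel_def)
 show "k x = 0" if "norm c + \<rho> < norm x" for x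
  using k that norm_triangle_sub[of x c] by (auto simp: kernel_def dist_norm norm_minus_commute)
qed

lemma kernel_exists:
 assumes \<rho>: "\<rho> > 0"
 obtains k where "kernel c \<rho> k"
proof -
 \<comment> \<open>The support will lie in a cube of half side \<rho>/2 about c; it fits into the
   ball because 3/4 < 1.\<close>
 define w where "w = 2 / \<rho>"
 have w: "w > 0" using \<rho> by (simp add: w_def)
 define e where "e i t = flat_exp 0 (w * t + (1 - w * c $ i)) * flat_exp 0 ((- w) * t + (1 + w * c $ i))" for i t
 have es: "e i \<in> smooth1" for i unfolding e_def by (intro smooth1.intros)
 have e0: "e i t \<ge> 0" for i t by (simp add: e_def flat_exp_def)
 have ez: "e i t \<noteq> 0 \<longleftrightarrow> \<bar>w * (t - c $ i)\<bar> < 1" for i t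
  by (auto simp: e_def flat_exp_def algebra_simps abs_less_iff)
 define q where "q = (%x::real^3. e 1 (x $ 1) * e 2 (x $ 2) * e 3 (x $ 3))"
 have qs: "q \<in> sprod" unfolding q_def by (rule sprodI[OF es es es])
 have q0: "q x \<ge> 0" for x by (simp add: q_def e0)
 have qsup: "dist c x < \<rho>" if "q x \<noteq> 0" for x
 proof -
  have "\<bar>(x - c) $ i\<bar> < \<rho>/2" for i
  proof -
   have "e i (x $ i) \<noteq> 0" using that exhaust_3[of i] by (auto simp: q_def)
   then have "w * \<bar>x $ i - c $ i\<bar> < 1" using ez[of i "x $ i"] w by (simp add: abs_mult)
   then show ?thesis using \<rho> by (simp add: w_def field_simps)
  qed
  then have "((x - c) $ i)^2 < (\<rho>/2)^2" for i
   using \<rho> by (metis abs_ge_zero power2_abs power_strict_mono zero_less_numeral)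
  from this[of 1] this[of 2] this[of 3]
  have "(norm (x - c))^2 < 3 * (\<rho>/2)^2"
   by (simp only: power2_norm_eq_inner inner_vec_def sum_3 inner_real_def flip: power2_eq_square)
  also have "... <= \<rho>^2" by (simp add: power_divide)
  finally have "norm (x - c) < \<rho>" using \<rho> by (meson less_imp_le power2_less_imp_less)
  then show ?thesis by (simp add: dist_norm norm_minus_commute)
 qed
 have qccs: "ccs q"
 proof (rule ccsI[where R="norm c + \<rho>"])
  show "cont q" by (rule sprod_continuous[OF qs])
  show "q x = 0" if "norm c + \<rho> < norm x" for x
   using qsup[of x] that norm_triangle_sub[of x c] by (auto simp: dist_norm norm_minus_commute)
 qed
 have i: "L1 q" by (rule ccs_integrable[OF qccs])
 have "(LBINT x. q x) > 0"
 proof (rule ccontr)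
  assume "\<not> ?thesis"
  moreover have "(LBINT x. q x) \<ge> 0" by (rule Bochner_Integration.integral_nonneg) (rule q0)
  ultimately have "(LBINT x. q x) = 0" by simp
  then have "AE x in lborel. q x = 0" using integral_nonneg_eq_0_iff_AE[OF i] q0 by auto
  then have "AE x in lborel. x \<notin> {x. q x \<noteq> 0}" by auto
  moreover have op: "open {x. q x \<noteq> 0}"
   using open_Collect_neq[OF sprod_continuous[OF qs] continuous_on_const[of UNIV 0]] by simp
  ultimately have "{x. q x \<noteq> 0} \<in> null_sets lborel"
   using AE_iff_null_sets[of "{x. q x \<noteq> 0}" lborel] by auto
  then have "negligible {x. q x \<noteq> 0}"
   using null_sets_completionI negligible_iff_null_sets by blast
  then have "{x. q x \<noteq> 0} = {}" using op open_not_negligible by blast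
  moreover have "q c \<noteq> 0" using ez by (simp add: q_def)
  ultimately show False by auto
 qed
 then obtain N where N: "N = (LBINT x. q x)" "N > 0" by blast
 define k where "k = (%x. q x / N)"
 have "k = (%x. (%t. (1/N) * e 1 t) (x $ 1) * e 2 (x $ 2) * e 3 (x $ 3))"
  by (auto simp: k_def q_def)
 moreover have e1: "(%t. (1/N) * e 1 t) \<in> smooth1" using es by (intro smooth1.intros)
 ultimately have "k \<in> sprod" using sprodI[OF e1 es es] by simp
 then have "kernel c \<rho> k" unfolding kernel_def using q0 N qsup by (auto simp: k_def)
 then show ?thesis using that by blast
qed

lemma kernel_derivative:
 assumes "kernel c \<rho> k"
 shows "\<exists>D::3 => real^3 => real. (\<forall>j. ccs (D j)) \<and>
  (\<forall>x. (k has_derivative (%v. v $ 1 * D 1 x + v $ 2 * D 2 x + v $ 3 * D 3 x)) (at x)) \<and>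
  (\<forall>j x y. pd j (%y. k (y - x)) y = D j (y - x))"
proof -
 have ks: "k \<in> sprod" using assms by (simp add: kernel_def)
 from sprod_derivative[OF ks]
 obtain D :: "3 => real^3 => real" where D': "\<forall>j. D j \<in> sprod" "\<forall>x. (k has_derivative (%v. v $ 1 * D 1 x + v $ 2 * D 2 x + v $ 3 * D 3 x)) (at x)"
  by (elim exE conjE)
 note D = D'[rule_format]
 have "D j x = 0" if "norm c + \<rho> < norm x" for j x
 proof -
  have "((%_. 0) has_derivative (%_. 0)) (at x)" by simp
  then have "(k has_derivative (%_. 0)) (at x)"
  proof (rule has_derivative_transform_within_open)
   show "open {x. norm c + \<rho> < norm x}" by (intro open_Collect_less continuous_intros)
   show "0 = k x" if "x \<in> {x. norm c + \<rho> < norm x}" for x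
    using assms that norm_triangle_sub[of x c] by (auto simp: kernel_def dist_norm norm_minus_commute)
  qed (use that in auto)
  then have "(%v::real^3. v $ 1 * D 1 x + v $ 2 * D 2 x + v $ 3 * D 3 x) = (%_. 0)"
   using D(2) has_derivative_unique by blast
  then have "(axis j 1 :: real^3) $ 1 * D 1 x + (axis j 1 :: real^3) $ 2 * D 2 x + (axis j 1 :: real^3) $ 3 * D 3 x = 0"
   by (rule fun_cong)
  then show ?thesis using exhaust_3[of j] by (auto simp: axis_def)
 qed
 then have "ccs (D j)" for j by (intro ccsI[where R="norm c + \<rho>"] sprod_continuous D) auto
 moreover have "pd j (%y. k (y - x)) y = D j (y - x)" for j x y
 proof -
  have "((%y. y - x) has_derivative (%v. v)) (at y)" by (auto intro!: derivative_eq_intros)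
  from has_derivative_compose[OF this D(2)]
  have "((%y. k (y - x)) has_derivative (%v. v $ 1 * D 1 (y - x) + v $ 2 * D 2 (y - x) + v $ 3 * D 3 (y - x))) (at y)" .
  then have "frechet_derivative (%y. k (y - x)) (at y) = (%v. v $ 1 * D 1 (y - x) + v $ 2 * D 2 (y - x) + v $ 3 * D 3 (y - x))"
   by (rule frechet_derivative_at[symmetric])
  then show ?thesis unfolding pd_def using exhaust_3[of j] by (auto simp: axis_def)
 qed
 ultimately show ?thesis using D(2) by (intro exI[of _ D] conjI allI)
qed

lemma kernel_test_fun:
 assumes k: "kernel c \<rho> k" and sub: "cball (x + c) \<rho> \<subseteq> U"
 shows "test_fun U (%y. k (y - x))"
proof -
 have s: "closure {y. k (y - x) \<noteq> 0} \<subseteq> cball (x + c) \<rho>"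
 proof (rule closure_minimal)
  show "{y. k (y - x) \<noteq> 0} \<subseteq> cball (x + c) \<rho>"
  proof clarsimp
   fix y assume "k (y - x) \<noteq> 0"
   then have "dist c (y - x) < \<rho>" using k by (auto simp: kernel_def)
   then show "dist (x + c) y <= \<rho>" by (simp add: dist_norm algebra_simps)
  qed
 qed simp
 then have "compact (closure {y. k (y - x) \<noteq> 0})"
  by (meson bounded_cball bounded_subset closed_closure compact_eq_bounded_closed)
 moreover have "smooth_fun (%y. k (y - x))"
  by (rule sprod_smooth_fun[OF sprod_shift]) (use k in \<open>simp add: kernel_def\<close>)
 moreover have "closure {y. k (y - x) \<noteq> 0} \<subseteq> U" using s sub by (rule order_trans)
 ultimately show ?thesis unfolding test_fun_def by (intro conjI)
qed

text \<open>Sobolev functions arrive as Lebesgue measurable functions on a set, whereas products and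
  Fubini are handled for Borel functions on the whole space. Off a negligible set f is a limit of
  continuous functions, and the pointwise \<open>lim\<close> of those is Borel.\<close>

lemma lebesgue_on_borel_rep:
 fixes f :: "'a::euclidean_space => 'b::euclidean_space"
 assumes S: "S \<in> sets borel" and f: "f \<in> borel_measurable (lebesgue_on S)"
 shows "\<exists>g \<in> BM. (AE x in lborel. x \<in> S --> f x = g x) \<and> (\<forall>x. x \<notin> S --> g x = 0)"
proof -
 have SL: "S \<in> sets lebesgue" using S by simp
 have "f measurable_on S" using measurable_on_iff_borel_measurable[OF SL] f by blast
 then obtain N g where N: "negligible N" and g: "\<And>n. cont (g n)"
  and lim: "\<And>x. x \<notin> N ==> (%n. g n x) \<longlonglongrightarrow> (if x \<in> S then f x else 0)"
  unfolding measurable_on_def by blast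
 define G where "G x = indicator S x *\<^sub>R lim (%n. g n x)" for x
 have "g n \<in> BM" for n by (rule borel_measurable_continuous_onI[OF g])
 then have "(%x. lim (%n. g n x)) \<in> BM" by (rule borel_measurable_lim_metric)
 then have G: "G \<in> BM" unfolding G_def using S by measurable
 have "AE x in lebesgue. x \<notin> N"
  using N by (intro AE_not_in) (simp add: negligible_iff_null_sets)
 then have "AE x in lborel. x \<notin> N" by (simp add: AE_completion_iff)
 then have "AE x in lborel. x \<in> S --> f x = G x"
 proof eventually_elim
  case (elim x)
  then show ?case using limI[OF lim[OF elim]] by (simp add: G_def)
 qed
 then show ?thesis using G by (intro bexI[of _ G]) (auto simp: G_def)
qed

lemma lebesgue_on_transfer:
 fixes F :: "'a::euclidean_space => 'b::euclidean_space"
 assumes S: "S \<in> sets borel" and g: "g \<in> BM"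
  and ae: "AE x in lborel. x \<in> S --> F x = g x"
 shows "F \<in> borel_measurable (lebesgue_on S)"
  and "integral\<^sup>L (lebesgue_on S) F = (LBINT x. indicator S x *\<^sub>R g x)"
  and "integrable (lebesgue_on S) F \<longleftrightarrow> L1 (%x. indicator S x *\<^sub>R g x)"
proof -
 let ?g = "%x. indicator S x *\<^sub>R g x" and ?F = "%x. indicator S x *\<^sub>R F x"
 have SL: "S \<in> sets lebesgue" using S by simp
 have SI: "S \<inter> space lebesgue \<in> sets lebesgue" using S by simp
 have gb: "?g \<in> BM" using g S by measurable
 then have gl: "?g \<in> borel_measurable lborel" by simp
 then have gL: "?g \<in> borel_measurable lebesgue" by (rule measurable_completion)
 have "AE x in lborel. ?g x = ?F x" using ae by eventually_elim (auto simp: indicator_def)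
 then have aeL: "AE x in lebesgue. ?g x = ?F x" by (rule AE_completion)
 have FL: "?F \<in> borel_measurable lebesgue" by (rule borel_measurable_AE[OF gL aeL])
 show "F \<in> borel_measurable (lebesgue_on S)"
  using FL SI by (simp add: borel_measurable_restrict_space_iff)
 have "integral\<^sup>L (lebesgue_on S) F = integral\<^sup>L lebesgue ?F" by (rule integral_restrict_space[OF SI])
 also have "... = integral\<^sup>L lebesgue ?g" by (rule integral_cong_AE[OF FL gL]) (use aeL in \<open>auto elim: eventually_mono\<close>)
 also have "... = integral\<^sup>L lborel ?g" by (rule integral_completion[OF gl])
 finally show "integral\<^sup>L (lebesgue_on S) F = (LBINT x. ?g x)" .
 have "integrable (lebesgue_on S) F \<longleftrightarrow> integrable lebesgue ?F" by (rule integrable_restrict_space[OF SI])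
 also have "... \<longleftrightarrow> integrable lebesgue ?g" by (rule integrable_cong_AE[OF FL gL]) (use aeL in \<open>auto elim: eventually_mono\<close>)
 also have "... \<longleftrightarrow> L1 ?g" by (rule integrable_completion[OF gl])
 finally show "integrable (lebesgue_on S) F \<longleftrightarrow> L1 ?g" .
qed

section \<open>The p-th power of the L^p norm as an extended number, and density of compactly
  supported functions\<close>

definition pN :: "nat => ('a::euclidean_space => 'b::euclidean_space) => ennreal" where
 "pN p f = (\<integral>\<^sup>+x. ennreal (norm (f x) ^ p) \<partial>lborel)"

lemma power_sum_le:
 fixes a b :: real
 assumes "0 <= a" "0 <= b"
 shows "(a + b) ^ p <= 2 ^ p * (a ^ p + b ^ p)"
proof -
 have "(a + b) ^ p <= (2 * max a b) ^ p" using assms by (intro power_mono) auto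
 also have "... = 2 ^ p * (max a b) ^ p" by (simp add: power_mult_distrib)
 also have "(max a b) ^ p <= a ^ p + b ^ p" using assms by (auto simp: max_def)
 finally show ?thesis by simp
qed

lemma pN_add_le:
 assumes [measurable]: "f \<in> BM" "g \<in> BM"
 shows "pN p (%x. f x + g x) <= 2 ^ p * (pN p f + pN p g)"
proof -
 have "pN p (%x. f x + g x) <= (\<integral>\<^sup>+x. 2 ^ p * (ennreal (norm (f x) ^ p) + ennreal (norm (g x) ^ p)) \<partial>lborel)"
  unfolding pN_def
 proof (rule nn_integral_mono)
  fix x
  have "norm (f x + g x) ^ p <= (norm (f x) + norm (g x)) ^ p" by (intro power_mono norm_triangle_ineq) auto
  also have "... <= 2 ^ p * (norm (f x) ^ p + norm (g x) ^ p)" by (rule power_sum_le) auto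
  finally have "ennreal (norm (f x + g x) ^ p) <= ennreal (2 ^ p * (norm (f x) ^ p + norm (g x) ^ p))"
   by (rule ennreal_leI)
  then show "ennreal (norm (f x + g x) ^ p) <= 2 ^ p * (ennreal (norm (f x) ^ p) + ennreal (norm (g x) ^ p))"
   by (simp add: ennreal_mult' ennreal_plus flip: ennreal_power)
 qed
 also have "... = 2 ^ p * (pN p f + pN p g)"
  unfolding pN_def by (simp add: nn_integral_cmult nn_integral_add)
 finally show ?thesis .
qed

lemma pN_minus_commute: "pN p (%x. f x - g x) = pN p (%x. g x - f x)"
 unfolding pN_def by (simp add: norm_minus_commute)

lemma pN_dominated:
 fixes f :: "'a::euclidean_space => 'b::euclidean_space"
 assumes [measurable]: "f \<in> BM" "\<And>n. g n \<in> BM" "w \<in> BM"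
  and p: "p \<ge> 1"
  and w: "(\<integral>\<^sup>+x. w x \<partial>lborel) < \<infinity>"
  and bd: "\<And>n x. ennreal (norm (f x - g n x) ^ p) <= w x"
  and lim: "AE x in lborel. (%n. g n x) \<longlonglongrightarrow> f x"
 shows "(%n. pN p (%x. f x - g n x)) \<longlonglongrightarrow> 0"
proof -
 have "(%n. \<integral>\<^sup>+x. ennreal (norm (f x - g n x) ^ p) \<partial>lborel) \<longlonglongrightarrow> (\<integral>\<^sup>+x. 0 \<partial>(lborel::'a measure))"
 proof (rule nn_integral_dominated_convergence[where w=w])
  show "AE x in lborel. (%n. ennreal (norm (f x - g n x) ^ p)) \<longlonglongrightarrow> 0"
   using lim
  proof eventually_elim
   case (elim x)
   have "(%n. norm (f x - g n x) ^ p) \<longlonglongrightarrow> norm (f x - f x) ^ p" by (intro tendsto_intros elim)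
   then have "(%n. ennreal (norm (f x - g n x) ^ p)) \<longlonglongrightarrow> ennreal (norm (f x - f x) ^ p)" by (rule tendsto_ennrealI)
   then show ?case using p by (simp add: power_0_left)
  qed
 qed (use w bd in auto)
 then show ?thesis by (simp add: pN_def)
qed

text \<open>Truncation in size and in space gives a bounded function h, to which some continuous
  functions converge almost everywhere. These may be unbounded and spread out, so they are projected
  to the ball of radius R and multiplied by a cutoff. Both operations leave h unchanged and provide
  a common majorant.\<close>

lemma pN_dense_ccs:
 fixes f :: "'a::euclidean_space => 'b::euclidean_space"
 assumes f: "f \<in> BM" and fin: "pN p f < \<infinity>" and p: "p \<ge> 1" and e: "0 < e"
 shows "\<exists>g. ccs g \<and> pN p (%x. f x - g x) < ennreal e"
proof -
 note [measurable] = f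
 define r where "r = e / (4 * 2 ^ p)"
 define e' where "e' = ennreal r"
 have r: "0 < r" using e by (simp add: r_def)
 then have e': "0 < e'" by (simp add: e'_def)
 define fR where "fR n x = (if norm x <= real n \<and> norm (f x) <= real n then f x else 0)" for n x
 have fRm[measurable]: "fR n \<in> BM" for n unfolding fR_def by measurable
 have "(%n. pN p (%x. f x - fR n x)) \<longlonglongrightarrow> 0"
 proof (rule pN_dominated[OF f fRm _ p, where w="%x. ennreal (norm (f x) ^ p)"])
  show "ennreal (norm (f x - fR n x) ^ p) <= ennreal (norm (f x) ^ p)" for n x
   using p by (auto simp: fR_def intro!: ennreal_leI)
  show "AE x in lborel. (%n. fR n x) \<longlonglongrightarrow> f x"
  proof (intro AE_I2)
   fix x
   obtain n0 :: nat where n0: "max (norm x) (norm (f x)) <= real n0" using real_arch_simple by blast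
   have "eventually (%n. fR n x = f x) sequentially"
    by (rule eventually_sequentiallyI[of n0]) (use n0 in \<open>auto simp: fR_def\<close>)
   then show "(%n. fR n x) \<longlonglongrightarrow> f x" by (rule tendsto_eventually)
  qed
 qed (use fin in \<open>auto simp: pN_def\<close>)
 then have "eventually (%n. pN p (%x. f x - fR n x) < e') sequentially" using e' by (rule order_tendstoD(2))
 from eventually_happens'[OF sequentially_bot this]
 obtain n where n: "pN p (%x. f x - fR n x) < e'" by (elim exE)
 define R where "R = real n"
 have R0: "R \<ge> 0" by (simp add: R_def)
 define h where "h = fR n"
 have h: "norm (h x) <= R" "norm x > R ==> h x = 0" for x using R0 by (auto simp: h_def fR_def R_def)
 have [measurable]: "h \<in> BM" by (simp add: h_def)
 have "h \<in> borel_measurable lebesgue" by (rule measurable_completion) simp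
 then have "h measurable_on UNIV" by (rule lebesgue_measurable_imp_measurable_on) simp
 then obtain N g where N: "negligible N" and g: "\<And>n. cont (g n)"
  and lim: "\<And>x. x \<notin> N ==> (%n. g n x) \<longlonglongrightarrow> h x"
  unfolding measurable_on_def by auto
 define P :: "'b => 'b" where "P = closest_point (cball 0 R)"
 have cb: "convex (cball (0::'b) R)" "closed (cball (0::'b) R)" "cball (0::'b) R \<noteq> {}" using R0 by auto
 have Pc: "cont P" unfolding P_def by (rule continuous_on_closest_point[OF cb])
 have Pb: "norm (P y) <= R" for y using closest_point_in_set[OF cb(2,3), of y] by (simp add: P_def)
 have Pid: "norm y <= R ==> P y = y" for y unfolding P_def by (rule closest_point_self) simp
 define th where "th x = max 0 (min 1 (R + 1 - norm x))" for x :: 'a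
 have th: "0 <= th x" "th x <= 1" "norm x <= R ==> th x = 1" "R + 1 < norm x ==> th x = 0" for x
  by (auto simp: th_def)
 define H where "H m x = th x *\<^sub>R P (g m x)" for m x
 have Hc: "cont (H m)" for m
  unfolding H_def th_def by (intro continuous_intros continuous_on_compose2[OF Pc g]) auto
 have Hccs: "ccs (H m)" for m by (rule ccsI[OF Hc, where R="R + 1"]) (simp add: H_def th)
 have [measurable]: "H m \<in> BM" for m by (rule borel_measurable_continuous_onI[OF Hc])
 have [measurable]: "cball (0::'a) (R + 1) \<in> sets borel" by simp
 have "(%m. pN p (%x. h x - H m x)) \<longlonglongrightarrow> 0"
 proof (rule pN_dominated[OF _ _ _ p, where w="%x. ennreal ((2 * R) ^ p) * indicator (cball 0 (R + 1)) x"])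
  show "ennreal (norm (h x - H m x) ^ p) <= ennreal ((2 * R) ^ p) * indicator (cball 0 (R + 1)) x" for m x
  proof (cases "norm x <= R + 1")
   case True
   have "norm (H m x) <= 1 * R"
   proof -
    have "\<bar>th x\<bar> * norm (P (g m x)) <= 1 * R"
     using th[of x] Pb[of "g m x"] by (intro mult_mono) auto
    then show ?thesis by (simp add: H_def)
   qed
   then have "norm (h x - H m x) <= 2 * R" using h(1)[of x] norm_triangle_ineq4[of "h x" "H m x"] by linarith
   then have "norm (h x - H m x) ^ p <= (2 * R) ^ p" by (rule power_mono) simp
   then show ?thesis using True by (simp add: ennreal_leI)
  next
   case False
   then show ?thesis using h(2)[of x] th(4)[of x] p by (simp add: H_def)
  qed
  have "(\<integral>\<^sup>+x. ennreal ((2 * R) ^ p) * indicator (cball 0 (R + 1)) x \<partial>(lborel::'a measure))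
    = ennreal ((2 * R) ^ p) * emeasure lborel (cball (0::'a) (R + 1))"
   by (rule nn_integral_cmult_indicator) simp
  also have "... < \<infinity>" using emeasure_bounded_finite[OF bounded_cball, of "0::'a" "R + 1"] by (simp add: ennreal_mult_less_top)
  finally show "(\<integral>\<^sup>+x. ennreal ((2 * R) ^ p) * indicator (cball 0 (R + 1)) x \<partial>(lborel::'a measure)) < \<infinity>" .
  have "AE x in lebesgue. x \<notin> N" using N by (intro AE_not_in) (simp add: negligible_iff_null_sets)
  then have "AE x in lborel. x \<notin> N" by (simp add: AE_completion_iff)
  then show "AE x in lborel. (%m. H m x) \<longlonglongrightarrow> h x"
  proof eventually_elim
   case (elim x)
   have "isCont P (h x)" using Pc by (simp add: continuous_on_eq_continuous_at)
   then have "(%m. P (g m x)) \<longlonglongrightarrow> P (h x)" using lim[OF elim] by (rule isCont_tendsto_compose)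
   then have "(%m. H m x) \<longlonglongrightarrow> th x *\<^sub>R P (h x)" unfolding H_def by (intro tendsto_intros)
   moreover have "th x *\<^sub>R P (h x) = h x"
    using h[of x] th(3)[of x] Pid[of "h x"] by (cases "norm x <= R") auto
   ultimately show ?case by simp
  qed
 qed measurable
 then have "eventually (%m. pN p (%x. h x - H m x) < e') sequentially" using e' by (rule order_tendstoD(2))
 from eventually_happens'[OF sequentially_bot this]
 obtain m where m: "pN p (%x. h x - H m x) < e'" by (elim exE)
 have "pN p (%x. f x - H m x) = pN p (%x. (f x - h x) + (h x - H m x))" by simp
 also have "... <= 2 ^ p * (pN p (%x. f x - h x) + pN p (%x. h x - H m x))"
  by (rule pN_add_le) measurable
 also have "... <= 2 ^ p * (e' + e')" using m n by (intro mult_left_mono add_mono) (auto simp: h_def)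
 also have "... = ennreal (2 ^ p * (r + r))"
  using r by (simp add: e'_def ennreal_mult' flip: ennreal_plus ennreal_power)
 also have "... < ennreal e" using e by (intro ennreal_lessI) (auto simp: r_def field_simps)
 finally show ?thesis using Hccs by blast
qed

text \<open>A correlation, not a convolution: \<open>y \<mapsto> k (y - x)\<close> is itself the
  test function to be inserted into the definition of a weak derivative.\<close>

definition mol :: "(real^3 => real) => (real^3 => 'b::euclidean_space) => real^3 => 'b" where
 "mol k f x = (LBINT y. k (y - x) *\<^sub>R f y)"

lemma ccs_uniform:
 fixes \<phi> :: "'a::euclidean_space => 'b::real_normed_vector"
 assumes "ccs \<phi>" and e: "0 < e"
 shows "\<exists>d>0. \<forall>x y. dist x y < d --> dist (\<phi> x) (\<phi> y) < e"
proof -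
 obtain R where R: "\<And>x. R < norm x ==> \<phi> x = 0" using ccs_bound[OF assms(1)] by metis
 have "uniformly_continuous_on (cball 0 (R + 1)) \<phi>"
  by (rule compact_uniformly_continuous[OF continuous_on_subset[OF ccs_continuous[OF assms(1)]]]) auto
 then obtain d where d: "d > 0" "\<And>x y. x \<in> cball 0 (R + 1) ==> y \<in> cball 0 (R + 1) ==> dist y x < d ==> dist (\<phi> y) (\<phi> x) < e"
  unfolding uniformly_continuous_on_def using e by meson
 have "dist (\<phi> x) (\<phi> y) < e" if "dist x y < min d 1" for x y
 proof (cases "norm x <= R + 1 \<and> norm y <= R + 1")
  case True
  then show ?thesis using d(2)[of y x] that by simp
 next
  case False
  have "\<bar>norm x - norm y\<bar> < 1" using that norm_triangle_ineq3[of x y] by (simp add: dist_norm)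
  then have "norm x > R" "norm y > R" using False by auto
  then show ?thesis using R e by simp
 qed
 then show ?thesis using d(1) by (intro exI[of _ "min d 1"]) auto
qed

lemma ccs_bounded:
 fixes \<phi> :: "'a::euclidean_space => 'b::real_normed_vector"
 assumes "ccs \<phi>"
 obtains B where "B > 0" "\<And>x. norm (\<phi> x) <= B"
proof -
 obtain R where R: "\<And>x. R < norm x ==> \<phi> x = 0" using ccs_bound[OF assms] by metis
 have "compact (\<phi> ` cball 0 R)"
  by (rule compact_continuous_image[OF continuous_on_subset[OF ccs_continuous[OF assms]]]) auto
 then obtain B where B: "B > 0" "\<And>y. y \<in> \<phi> ` cball 0 R ==> norm y <= B"
  by (meson bounded_pos compact_imp_bounded)
 have "norm (\<phi> x) <= B" for x
  using R[of x] B by (cases "norm x <= R") (auto simp: less_imp_le)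
 then show ?thesis using that B(1) by blast
qed

lemma ccs_mult_integrable:
 fixes \<phi> :: "'a::euclidean_space => real" and f :: "'a => 'b::euclidean_space"
 assumes "ccs \<phi>" and f: "L1 f"
 shows "L1 (%y. \<phi> (y - x) *\<^sub>R f y)"
proof -
 obtain B where B: "\<And>x. norm (\<phi> x) <= B" using ccs_bounded[OF assms(1)] by metis
 have cm: "\<phi> \<in> BM" by (rule borel_measurable_continuous_onI[OF ccs_continuous[OF assms(1)]])
 have [measurable]: "(%y. \<phi> (y - x)) \<in> BM"
  by (rule measurable_compose[OF _ cm]) measurable
 have [measurable]: "f \<in> BM" using f by auto
 show ?thesis
 proof (rule Bochner_Integration.integrable_bound)
  show "L1 (%y. B * norm (f y))" using f by simp
  show "(%y. \<phi> (y - x) *\<^sub>R f y) \<in> borel_measurable lborel" by measurable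
  show "AE y in lborel. norm (\<phi> (y - x) *\<^sub>R f y) <= norm (B * norm (f y))"
   using B by (intro AE_I2) (simp add: mult_right_mono abs_mult order_trans[OF mult_right_mono[OF B norm_ge_zero]] , metis B abs_ge_self mult_right_mono norm_ge_zero order_trans real_norm_def)
 qed
qed

lemma mol_continuous:
 fixes f :: "real^3 => 'b::euclidean_space"
 assumes k: "ccs k" and f: "L1 f"
 shows "cont (mol k f)"
proof -
 define F where "F = (LBINT y. norm (f y))"
 have F0: "F \<ge> 0" by (simp add: F_def)
 have "\<exists>d>0. \<forall>x'. dist x' x < d --> dist (mol k f x') (mol k f x) < e" if e: "e > 0" for x e
 proof -
  obtain d where d: "d > 0" "\<And>x y. dist x y < d ==> dist (k x) (k y) < e / (F + 1)"
   using ccs_uniform[OF k, of "e / (F + 1)"] e F0 by auto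
  have "dist (mol k f x') (mol k f x) < e" if "dist x' x < d" for x'
  proof -
   have "mol k f x' - mol k f x = (LBINT y. (k (y - x') - k (y - x)) *\<^sub>R f y)"
    unfolding mol_def using ccs_mult_integrable[OF k f] by (simp add: scaleR_left_diff_distrib)
   also have "norm ... <= (LBINT y. e / (F + 1) * norm (f y))"
   proof (rule Bochner_Integration.integral_norm_bound_integral)
    show "L1 (%y. (k (y - x') - k (y - x)) *\<^sub>R f y)"
     using ccs_mult_integrable[OF k f] by (simp add: scaleR_left_diff_distrib)
    show "L1 (%y. e / (F + 1) * norm (f y))" using f by simp
    fix y
    have "\<bar>k (y - x') - k (y - x)\<bar> <= e / (F + 1)"
     using d(2)[of "y - x'" "y - x"] that by (simp add: dist_norm norm_minus_commute)
    then show "norm ((k (y - x') - k (y - x)) *\<^sub>R f y) <= e / (F + 1) * norm (f y)"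
     by (simp add: mult_right_mono del: times_divide_eq_left)
   qed
   also have "... = e * (F / (F + 1))" by (simp add: F_def)
   also have "... < e * 1" using e F0 by (intro mult_strict_left_mono) auto
   finally show ?thesis by (simp add: dist_norm)
  qed
  then show ?thesis using d(1) by blast
 qed
 then show ?thesis by (simp add: continuous_on_iff)
qed

text \<open>The functions \<open>D j\<close> are uniformly continuous, so the Taylor remainder of k
  is o(|v|) uniformly in the base point and can be integrated against any integrable f. The minus
  sign comes from the argument y - x.\<close>

lemma mol_has_derivative:
 fixes f :: "real^3 => 'b::euclidean_space" and D :: "3 => real^3 => real"
 assumes k: "ccs k" and D: "\<And>j. ccs (D j)"
  and d: "\<And>x. (k has_derivative (%v. v $ 1 * D 1 x + v $ 2 * D 2 x + v $ 3 * D 3 x)) (at x)"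
  and f: "L1 f"
 shows "(mol k f has_derivative (%v. - (v $ 1 *\<^sub>R mol (D 1) f x + v $ 2 *\<^sub>R mol (D 2) f x + v $ 3 *\<^sub>R mol (D 3) f x))) (at x)"
proof -
 define F where "F = (LBINT y. norm (f y))"
 have F0: "F \<ge> 0" by (simp add: F_def)
 let ?L = "%v::real^3. - (v $ 1 *\<^sub>R mol (D 1) f x + v $ 2 *\<^sub>R mol (D 2) f x + v $ 3 *\<^sub>R mol (D 3) f x)"
 have lin: "bounded_linear ?L"
  by (intro bounded_linear_minus bounded_linear_add bounded_linear_scaleR_const bounded_linear_vec_nth)
 have "\<exists>d>0. \<forall>y. norm (y - x) < d --> norm (mol k f y - mol k f x - ?L (y - x)) <= e * norm (y - x)" if e: "e > 0" for e
 proof -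
  define e' where "e' = e / (3 * (F + 1))"
  have e': "e' > 0" using e F0 by (simp add: e'_def)
  have "\<exists>d>0. \<forall>x y. dist x y < d --> dist (D j x) (D j y) < e'" for j by (rule ccs_uniform[OF D e'])
  then obtain dj where dj: "\<And>j. dj j > 0" "\<And>j x y. dist x y < dj j ==> dist (D j x) (D j y) < e'" by metis
  define d0 where "d0 = min (dj 1) (min (dj 2) (dj 3))"
  have d0: "d0 > 0" using dj by (simp add: d0_def)
  have rem: "\<bar>k (z - v) - k z + (v $ 1 * D 1 z + v $ 2 * D 2 z + v $ 3 * D 3 z)\<bar> <= 3 * e' * norm v" if v: "norm v < d0" for z v
  proof -
   define g where "g t = k (z - t *\<^sub>R v)" for t :: real
   have gd: "(g has_real_derivative - (v $ 1 * D 1 (z - t *\<^sub>R v) + v $ 2 * D 2 (z - t *\<^sub>R v) + v $ 3 * D 3 (z - t *\<^sub>R v))) (at t)" for t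
   proof -
    have "((%t. z - t *\<^sub>R v) has_derivative (%s. - (s *\<^sub>R v))) (at t)" by (auto intro!: derivative_eq_intros)
    from has_derivative_compose[OF this d]
    have "(g has_derivative (%s. (- (s *\<^sub>R v)) $ 1 * D 1 (z - t *\<^sub>R v) + (- (s *\<^sub>R v)) $ 2 * D 2 (z - t *\<^sub>R v) + (- (s *\<^sub>R v)) $ 3 * D 3 (z - t *\<^sub>R v))) (at t)"
     by (simp add: g_def[abs_def])
    moreover have "(%s. (- (s *\<^sub>R v)) $ 1 * D 1 (z - t *\<^sub>R v) + (- (s *\<^sub>R v)) $ 2 * D 2 (z - t *\<^sub>R v) + (- (s *\<^sub>R v)) $ 3 * D 3 (z - t *\<^sub>R v))
     = (*) (- (v $ 1 * D 1 (z - t *\<^sub>R v) + v $ 2 * D 2 (z - t *\<^sub>R v) + v $ 3 * D 3 (z - t *\<^sub>R v)))"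
     by (auto simp: algebra_simps)
    ultimately show ?thesis by (simp add: has_field_derivative_def)
   qed
   obtain t where t: "0 < t" "t < 1" "g 1 - g 0 = (1 - 0) * - (v $ 1 * D 1 (z - t *\<^sub>R v) + v $ 2 * D 2 (z - t *\<^sub>R v) + v $ 3 * D 3 (z - t *\<^sub>R v))"
    using MVT2[of 0 1 g, OF zero_less_one gd] by blast
   have c: "\<bar>v $ j * (D j z - D j (z - t *\<^sub>R v))\<bar> <= norm v * e'" for j
   proof -
    have "norm (t *\<^sub>R v) <= 1 * norm v" unfolding norm_scaleR using t by (intro mult_right_mono) auto
    then have "dist z (z - t *\<^sub>R v) < d0" using v by (simp add: dist_norm)
    moreover have "d0 <= dj j" using exhaust_3[of j] by (auto simp: d0_def)
    ultimately have "\<bar>D j z - D j (z - t *\<^sub>R v)\<bar> <= e'" using dj(2)[of z "z - t *\<^sub>R v" j] by (simp add: dist_norm)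
    then show ?thesis unfolding abs_mult using component_le_norm_cart[of v j] by (intro mult_mono) auto
   qed
   have "k (z - v) - k z + (v $ 1 * D 1 z + v $ 2 * D 2 z + v $ 3 * D 3 z)
    = v $ 1 * (D 1 z - D 1 (z - t *\<^sub>R v)) + v $ 2 * (D 2 z - D 2 (z - t *\<^sub>R v)) + v $ 3 * (D 3 z - D 3 (z - t *\<^sub>R v))"
    using t(3) by (simp add: g_def algebra_simps)
   moreover have "\<bar>a + b + c\<bar> <= 3 * e' * n" if "\<bar>a\<bar> <= n * e'" "\<bar>b\<bar> <= n * e'" "\<bar>c\<bar> <= n * e'" for a b c n :: real
   proof -
    have "\<bar>a + b + c\<bar> <= n * e' + n * e' + n * e'" using that by linarith
    then show ?thesis by (simp add: mult_ac)
   qed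
   ultimately show ?thesis using c[of 1] c[of 2] c[of 3] by metis
  qed
  have "norm (mol k f y - mol k f x - ?L (y - x)) <= e * norm (y - x)" if y: "norm (y - x) < d0" for y
  proof -
   define v where "v = y - x"
   note i = ccs_mult_integrable[OF k f] ccs_mult_integrable[OF D f]
   have ik: "L1 (%w. (k (w - x - v) - k (w - x) + (v $ 1 * D 1 (w - x) + v $ 2 * D 2 (w - x) + v $ 3 * D 3 (w - x))) *\<^sub>R f w)"
   proof -
    have "L1 (%w. k (w - y) *\<^sub>R f w - k (w - x) *\<^sub>R f w + (v $ 1 *\<^sub>R (D 1 (w - x) *\<^sub>R f w) + v $ 2 *\<^sub>R (D 2 (w - x) *\<^sub>R f w) + v $ 3 *\<^sub>R (D 3 (w - x) *\<^sub>R f w)))"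
     using i by (intro Bochner_Integration.integrable_add Bochner_Integration.integrable_diff integrable_scaleR_right)
    then show ?thesis by (simp add: v_def algebra_simps)
   qed
   have "mol k f y - mol k f x - ?L v
    = (LBINT w. (k (w - x - v) - k (w - x) + (v $ 1 * D 1 (w - x) + v $ 2 * D 2 (w - x) + v $ 3 * D 3 (w - x))) *\<^sub>R f w)"
   proof -
    have "(LBINT w. (k (w - x - v) - k (w - x) + (v $ 1 * D 1 (w - x) + v $ 2 * D 2 (w - x) + v $ 3 * D 3 (w - x))) *\<^sub>R f w)
     = (LBINT w. k (w - y) *\<^sub>R f w - k (w - x) *\<^sub>R f w + (v $ 1 *\<^sub>R (D 1 (w - x) *\<^sub>R f w) + v $ 2 *\<^sub>R (D 2 (w - x) *\<^sub>R f w) + v $ 3 *\<^sub>R (D 3 (w - x) *\<^sub>R f w)))"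
     by (simp add: v_def algebra_simps)
    also have "... = mol k f y - mol k f x + (v $ 1 *\<^sub>R mol (D 1) f x + v $ 2 *\<^sub>R mol (D 2) f x + v $ 3 *\<^sub>R mol (D 3) f x)"
     unfolding mol_def
     by (simp only: i Bochner_Integration.integral_add Bochner_Integration.integral_diff integral_scaleR_right
      Bochner_Integration.integrable_add Bochner_Integration.integrable_diff integrable_scaleR_right simp_thms)
    finally show ?thesis by simp
   qed
   also have "norm ... <= (LBINT w. 3 * e' * norm v * norm (f w))"
   proof (rule Bochner_Integration.integral_norm_bound_integral[OF ik])
    show "L1 (%w. 3 * e' * norm v * norm (f w))" using f by simp
    show "norm ((k (w - x - v) - k (w - x) + (v $ 1 * D 1 (w - x) + v $ 2 * D 2 (w - x) + v $ 3 * D 3 (w - x))) *\<^sub>R f w) <= 3 * e' * norm v * norm (f w)" for w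
     unfolding norm_scaleR by (rule mult_right_mono) (use rem[of v "w - x"] y in \<open>auto simp: v_def\<close>)
   qed
   also have "... = 3 * e' * norm v * F" by (simp add: F_def)
   also have "... = e * norm v * (F / (F + 1))" using F0 by (simp add: e'_def field_simps)
   also have "... <= e * norm v * 1" using e F0 by (intro mult_left_mono) auto
   finally show ?thesis by (simp add: v_def)
  qed
  then show ?thesis using d0 by blast
 qed
 then show ?thesis using lin by (simp add: has_derivative_at_alt)
qed

text \<open>Convexity of the p-th power as a tangent line inequality, by Bernoulli. Integrated
  against a kernel, with m the weighted mean, it becomes Jensen's inequality in
  \<open>mol_jensen\<close>.\<close>

lemma power_tangent:
 fixes a m :: real
 assumes "0 <= a" "0 <= m" "p \<ge> 1"
 shows "m ^ p + real p * m ^ (p - 1) * (a - m) <= a ^ p"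
proof (cases "m = 0")
 case True
 then show ?thesis using assms by (cases "p = 1") (auto simp: power_0_left)
next
 case False
 then have m: "m > 0" using assms by simp
 have "1 + real p * (a / m - 1) <= (1 + (a / m - 1)) ^ p"
  by (rule Bernoulli_inequality) (use assms m in simp)
 then have "m ^ p * (1 + real p * (a / m - 1)) <= m ^ p * (a / m) ^ p"
  using m by (intro mult_left_mono) auto
 moreover have "m ^ p * (a / m) ^ p = a ^ p" using m by (simp add: power_divide)
 moreover have "m ^ p * (1 + real p * (a / m - 1)) = m ^ p + real p * m ^ (p - 1) * (a - m)"
 proof -
  obtain q where q: "p = Suc q" using assms(3) by (cases p) auto
  show ?thesis unfolding q using m by (simp add: field_simps)
 qed
 ultimately show ?thesis by simp
qed

section \<open>Mollification as a contraction and an approximate identity in L^p\<close>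

lemma kernel_measurable: "kernel c \<rho> k ==> k \<in> BM"
 by (rule borel_measurable_continuous_onI[OF ccs_continuous[OF kernel_ccs]])

lemma kernel_integral_shift: "kernel c \<rho> k ==> (LBINT y. k (y - x)) = 1"
 using integral_lborel_shift[of k "- x"] by (simp add: kernel_def)

lemma kernel_integrable_shift: "kernel c \<rho> k ==> L1 (%y. k (y - x))"
 using kernel_integral_shift[of c \<rho> k x] not_integrable_integral_eq by fastforce

lemma nn_integral_lborel_affine:
 fixes f :: "'a::euclidean_space => ennreal"
 assumes [measurable]: "f \<in> BM" and c: "c \<noteq> 0"
 shows "(\<integral>\<^sup>+x. f x \<partial>lborel) = ennreal (\<bar>c\<bar> ^ DIM('a)) * (\<integral>\<^sup>+x. f (t + c *\<^sub>R x) \<partial>lborel)"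
proof -
 have "(\<integral>\<^sup>+x. f x \<partial>lborel) = (\<integral>\<^sup>+x. f x \<partial>density (distr lborel borel (%x. t + c *\<^sub>R x)) (%_. ennreal (\<bar>c\<bar> ^ DIM('a))))"
  using arg_cong[OF lborel_affine[OF c, of t], of "%M. nn_integral M f"] by simp
 also have "... = (\<integral>\<^sup>+x. ennreal (\<bar>c\<bar> ^ DIM('a)) * f x \<partial>distr lborel borel (%x. t + c *\<^sub>R x))"
  by (rule nn_integral_density) measurable
 also have "... = (\<integral>\<^sup>+x. ennreal (\<bar>c\<bar> ^ DIM('a)) * f (t + c *\<^sub>R x) \<partial>lborel)"
  by (rule nn_integral_distr) measurable
 also have "... = ennreal (\<bar>c\<bar> ^ DIM('a)) * (\<integral>\<^sup>+x. f (t + c *\<^sub>R x) \<partial>lborel)"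
  by (rule nn_integral_cmult) measurable
 finally show ?thesis .
qed

lemma nn_integral_lborel_shift:
 fixes f :: "'a::euclidean_space => ennreal"
 assumes "f \<in> BM"
 shows "(\<integral>\<^sup>+x. f (x + t) \<partial>lborel) = (\<integral>\<^sup>+x. f x \<partial>lborel)"
 using nn_integral_lborel_affine[OF assms, of 1 t] by (simp add: add.commute)

lemma kernel_nn_integral_reflect:
 assumes k: "kernel c \<rho> k"
 shows "(\<integral>\<^sup>+x. ennreal (k (y - x)) \<partial>lborel) = 1"
proof -
 note [measurable] = kernel_measurable[OF k]
 have "(\<integral>\<^sup>+x. ennreal (k x) \<partial>lborel) = ennreal (LBINT x. k x)"
  by (rule nn_integral_eq_integral[OF ccs_integrable[OF kernel_ccs[OF k]]]) (use k in \<open>auto simp: kernel_def\<close>)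
 also have "... = 1" using k by (simp add: kernel_def)
 finally have "(\<integral>\<^sup>+x. ennreal (k x) \<partial>lborel) = 1" .
 then show ?thesis using nn_integral_lborel_affine[of "%x. ennreal (k x)" "-1" y] by simp
qed

lemma mol_jensen:
 fixes f :: "real^3 => 'b::euclidean_space"
 assumes k: "kernel c \<rho> k" and f: "L1 f" and fp: "L1 (%x. norm (f x) ^ p)" and p: "p \<ge> 1"
 shows "norm (mol k f x) ^ p <= (LBINT y. k (y - x) * norm (f y) ^ p)"
proof -
 define m where "m = (LBINT y. k (y - x) * norm (f y))"
 have k0: "k y \<ge> 0" for y using k by (simp add: kernel_def)
 have i1: "L1 (%y. k (y - x) * norm (f y))"
  using ccs_mult_integrable[OF kernel_ccs[OF k], of "%y. norm (f y)" x] f by simp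
 have ip: "L1 (%y. k (y - x) * norm (f y) ^ p)"
  using ccs_mult_integrable[OF kernel_ccs[OF k] fp, of x] by simp
 note i0 = kernel_integrable_shift[OF k, of x]
 have m0: "m \<ge> 0" unfolding m_def using k0 by (intro Bochner_Integration.integral_nonneg) auto
 have "norm (mol k f x) <= (LBINT y. norm (k (y - x) *\<^sub>R f y))" unfolding mol_def by (rule integral_norm_bound)
 also have "... = m" unfolding m_def using k0 by simp
 finally have "norm (mol k f x) ^ p <= m ^ p" by (rule power_mono) simp
 also have "m ^ p = (LBINT y. m ^ p * k (y - x) + real p * m ^ (p - 1) * (k (y - x) * norm (f y) - m * k (y - x)))"
  using i0 i1 kernel_integral_shift[OF k, of x] by (simp add: m_def[symmetric])
 also have "... <= (LBINT y. k (y - x) * norm (f y) ^ p)"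
 proof (rule integral_mono)
  show "L1 (%y. m ^ p * k (y - x) + real p * m ^ (p - 1) * (k (y - x) * norm (f y) - m * k (y - x)))"
   using i0 i1 by simp
  show "m ^ p * k (y - x) + real p * m ^ (p - 1) * (k (y - x) * norm (f y) - m * k (y - x)) <= k (y - x) * norm (f y) ^ p" for y
   using mult_left_mono[OF power_tangent[of "norm (f y)" m p] k0[of "y - x"]] m0 p by (simp add: algebra_simps)
 qed (rule ip)
 finally show ?thesis .
qed

lemma mol_measurable:
 fixes f :: "real^3 => 'b::euclidean_space"
 assumes "ccs k" "L1 f"
 shows "mol k f \<in> BM"
 by (rule borel_measurable_continuous_onI[OF mol_continuous[OF assms]])

lemma pN_finite_iff:
 fixes f :: "'a::euclidean_space => 'b::euclidean_space"
 assumes [measurable]: "f \<in> BM"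
 shows "pN p f < \<infinity> \<longleftrightarrow> L1 (%x. norm (f x) ^ p)"
 unfolding pN_def by (simp add: integrable_iff_bounded)

lemma pN_mol_le:
 fixes f :: "real^3 => 'b::euclidean_space"
 assumes k: "kernel c \<rho> k" and f: "L1 f" and p: "p \<ge> 1"
 shows "pN p (mol k f) <= pN p f"
proof (cases "pN p f < \<infinity>")
 case True
 have fm[measurable]: "f \<in> BM" using f by auto
 note km[measurable] = kernel_measurable[OF k]
 have fp: "L1 (%x. norm (f x) ^ p)" using True pN_finite_iff[OF fm] by blast
 have k0: "k y \<ge> 0" for y using k by (simp add: kernel_def)
 have "pN p (mol k f) <= (\<integral>\<^sup>+x. (\<integral>\<^sup>+y. ennreal (k (y - x)) * ennreal (norm (f y) ^ p) \<partial>lborel) \<partial>lborel)"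
  unfolding pN_def
 proof (rule nn_integral_mono)
  fix x
  have ip: "L1 (%y. k (y - x) * norm (f y) ^ p)"
   using ccs_mult_integrable[OF kernel_ccs[OF k] fp, of x] by simp
  have "ennreal (norm (mol k f x) ^ p) <= ennreal (LBINT y. k (y - x) * norm (f y) ^ p)"
   by (rule ennreal_leI[OF mol_jensen[OF k f fp p]])
  also have "... = (\<integral>\<^sup>+y. ennreal (k (y - x) * norm (f y) ^ p) \<partial>lborel)"
   by (rule nn_integral_eq_integral[symmetric, OF ip]) (use k0 in auto)
  finally show "ennreal (norm (mol k f x) ^ p) <= (\<integral>\<^sup>+y. ennreal (k (y - x)) * ennreal (norm (f y) ^ p) \<partial>lborel)"
   using k0 by (simp add: ennreal_mult')
 qed
 also have "... = (\<integral>\<^sup>+y. (\<integral>\<^sup>+x. ennreal (k (y - x)) * ennreal (norm (f y) ^ p) \<partial>lborel) \<partial>lborel)"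
  by (rule lborel_pair.Fubini') measurable
 also have "... = (\<integral>\<^sup>+y. ennreal (norm (f y) ^ p) \<partial>lborel)"
  by (simp add: nn_integral_multc kernel_nn_integral_reflect[OF k])
 finally show ?thesis by (simp add: pN_def)
next
 case False
 then show ?thesis by (simp add: not_less top_unique)
qed

lemma pN_mol_converges:
 fixes f :: "real^3 => 'b::euclidean_space"
 assumes k: "\<And>n. kernel (c n) (\<rho> n) (k n)" and cr: "(%n. norm (c n) + \<rho> n) \<longlonglongrightarrow> 0"
  and f: "L1 f" and fin: "pN p f < \<infinity>" and p: "p \<ge> 1" and e: "0 < e"
 shows "\<forall>\<^sub>F n in sequentially. pN p (%x. mol (k n) f x - f x) < ennreal e"
proof -
 have fm[measurable]: "f \<in> BM" using f by auto
 \<comment> \<open>Two applications of the quasi-triangle inequality turn three errors r into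
   \<open>2^p * (r + 2^p * (r + r))\<close>, which is e/2.\<close>
 define r where "r = e / (2 * 2 ^ p * (1 + 2 * 2 ^ p))"
 have r: "r > 0" using e unfolding r_def by (intro divide_pos_pos mult_pos_pos add_pos_nonneg) auto
 obtain g where g: "ccs g" "pN p (%x. f x - g x) < ennreal r"
  using pN_dense_ccs[OF fm fin p r] by blast
 have gi: "L1 g" by (rule ccs_integrable[OF g(1)])
 have gm[measurable]: "g \<in> BM" using gi by auto
 obtain R where R: "R > 0" "\<And>x. R < norm x ==> g x = 0" using ccs_bound[OF g(1)] by metis
 define V where "V = measure lborel (cball (0::real^3) (R + 1))"
 have V0: "V \<ge> 0" by (simp add: V_def)
 \<comment> \<open>The cap at 1 bounds the p-th power of the uniform error by the error itself, and
   V is the volume of the ball on which that error lives.\<close>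
 define e1 where "e1 = min 1 (r / (V + 1))"
 have e1: "e1 > 0" using r V0 by (simp add: e1_def)
 obtain d where d: "d > 0" "\<And>x y. dist x y < d ==> dist (g x) (g y) < e1" using ccs_uniform[OF g(1) e1] by blast
 have "eventually (%n. norm (c n) + \<rho> n < min d 1) sequentially" using cr d(1) by (intro order_tendstoD(2)) auto
 then show ?thesis
 proof eventually_elim
  case (elim n)
  note km[measurable] = kernel_measurable[OF k[of n]]
  have k0: "k n y \<ge> 0" for y using k[of n] by (simp add: kernel_def)
  have ks: "norm z < min d 1" if "k n z \<noteq> 0" for z
  proof -
   have "dist (c n) z < \<rho> n" using that k[of n] by (simp add: kernel_def)
   then show ?thesis using elim norm_triangle_sub[of z "c n"] by (simp add: dist_norm norm_minus_commute)
  qed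
  note mm = mol_measurable[OF kernel_ccs[OF k[of n]]]
  have [measurable]: "mol (k n) f \<in> BM" "mol (k n) g \<in> BM"
   using mm f gi by auto
  have pt: "norm (mol (k n) g x - g x) <= e1 * indicator (cball 0 (R + 1)) x" for x
  proof -
   have "mol (k n) g x - g x = (LBINT y. k n (y - x) *\<^sub>R (g y - g x))"
    using ccs_mult_integrable[OF kernel_ccs[OF k[of n]] gi, of x] kernel_integrable_shift[OF k[of n], of x]
     kernel_integral_shift[OF k[of n], of x]
    by (simp add: mol_def scaleR_diff_right)
   also have "norm ... <= (LBINT y. k n (y - x) * (e1 * indicator (cball 0 (R + 1)) x))"
   proof (rule Bochner_Integration.integral_norm_bound_integral)
    show "L1 (%y. k n (y - x) *\<^sub>R (g y - g x))"
     using ccs_mult_integrable[OF kernel_ccs[OF k[of n]] gi, of x] kernel_integrable_shift[OF k[of n], of x]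
     by (simp add: scaleR_diff_right)
    show "L1 (%y. k n (y - x) * (e1 * indicator (cball 0 (R + 1)) x))"
     using kernel_integrable_shift[OF k[of n], of x] by simp
    fix y
    show "norm (k n (y - x) *\<^sub>R (g y - g x)) <= k n (y - x) * (e1 * indicator (cball 0 (R + 1)) x)"
    proof (cases "k n (y - x) = 0")
     case False
     then have yx: "norm (y - x) < min d 1" by (rule ks)
     have "norm (g y - g x) <= e1 * indicator (cball 0 (R + 1)) x"
     proof (cases "norm x <= R + 1")
      case True
      have "dist (g y) (g x) < e1" by (rule d(2)) (use yx in \<open>simp add: dist_norm\<close>)
      then show ?thesis using True by (simp add: dist_norm)
     next
      case False
      then have "norm x > R" "norm y > R" using yx norm_triangle_sub[of x y] by (auto simp: norm_minus_commute)
      then show ?thesis using R e1 by simp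
     qed
     then show ?thesis using k0 by (simp add: mult_left_mono)
    qed simp
   qed
   also have "... = e1 * indicator (cball 0 (R + 1)) x" using kernel_integral_shift[OF k[of n], of x] by simp
   finally show ?thesis .
  qed
  have A: "pN p (%x. mol (k n) g x - g x) <= ennreal r"
  proof -
   have "pN p (%x. mol (k n) g x - g x) <= (\<integral>\<^sup>+x. ennreal e1 * indicator (cball (0::real^3) (R + 1)) x \<partial>lborel)"
    unfolding pN_def
   proof (rule nn_integral_mono)
    fix x :: "real^3"
    have "norm (mol (k n) g x - g x) ^ p <= (e1 * indicator (cball 0 (R + 1)) x) ^ p"
     by (rule power_mono[OF pt]) simp
    also have "... <= (e1 * indicator (cball 0 (R + 1)) x) ^ 1"
     using p e1 by (intro power_decreasing) (auto simp: e1_def indicator_def)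
    finally show "ennreal (norm (mol (k n) g x - g x) ^ p) <= ennreal e1 * indicator (cball 0 (R + 1)) x"
     using pt[of x] p by (cases "norm x <= R + 1") (auto simp: ennreal_leI)
   qed
   also have "... = ennreal e1 * emeasure lborel (cball (0::real^3) (R + 1))" by (rule nn_integral_cmult_indicator) simp
   also have "... = ennreal (e1 * V)"
    using emeasure_bounded_finite[OF bounded_cball, of "0::real^3" "R + 1"] e1
    by (simp add: V_def emeasure_eq_ennreal_measure ennreal_mult' top.not_eq_extremum)
   also have "... <= ennreal r"
   proof (rule ennreal_leI)
    have "e1 * V <= r / (V + 1) * V" using V0 by (intro mult_right_mono) (auto simp: e1_def)
    also have "... = r * (V / (V + 1))" by simp
    also have "... <= r * 1" using V0 r by (intro mult_left_mono) auto
    finally show "e1 * V <= r" by simp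
   qed
   finally show ?thesis .
  qed
  have md: "mol (k n) f x - mol (k n) g x = mol (k n) (%x. f x - g x) x" for x
   using ccs_mult_integrable[OF kernel_ccs[OF k[of n]] f, of x] ccs_mult_integrable[OF kernel_ccs[OF k[of n]] gi, of x]
   by (simp add: mol_def scaleR_diff_right)
  have B: "pN p (%x. mol (k n) f x - mol (k n) g x) <= ennreal r"
  proof -
   have "pN p (mol (k n) (%x. f x - g x)) <= pN p (%x. f x - g x)"
    by (rule pN_mol_le[OF k _ p]) (use f gi in simp)
   then show ?thesis unfolding md using g(2) by (simp add: less_imp_le order_trans)
  qed
  have C: "pN p (%x. mol (k n) g x - f x) <= 2 ^ p * (ennreal r + ennreal r)"
  proof -
   have "pN p (%x. mol (k n) g x - f x) = pN p (%x. (mol (k n) g x - g x) + (g x - f x))" by simp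
   also have "... <= 2 ^ p * (pN p (%x. mol (k n) g x - g x) + pN p (%x. g x - f x))" by (rule pN_add_le) measurable
   also have "... <= 2 ^ p * (ennreal r + ennreal r)"
    using A g(2) by (intro mult_left_mono add_mono) (auto simp: pN_minus_commute[of p g f])
   finally show ?thesis .
  qed
  have "pN p (%x. mol (k n) f x - f x) = pN p (%x. (mol (k n) f x - mol (k n) g x) + (mol (k n) g x - f x))" by simp
  also have "... <= 2 ^ p * (pN p (%x. mol (k n) f x - mol (k n) g x) + pN p (%x. mol (k n) g x - f x))"
   by (rule pN_add_le) measurable
  also have "... <= 2 ^ p * (ennreal r + 2 ^ p * (ennreal r + ennreal r))"
   by (intro mult_left_mono add_mono B C) auto
  also have "... = ennreal (2 ^ p * (r + 2 ^ p * (r + r)))"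
  proof -
   have t: "(2 ^ p :: ennreal) = ennreal (2 ^ p)" by (simp flip: ennreal_power)
   have 1: "ennreal r + ennreal r = ennreal (r + r)" by (rule ennreal_plus[symmetric]) (use r in auto)
   have 2: "ennreal (2 ^ p) * ennreal (r + r) = ennreal (2 ^ p * (r + r))" by (rule ennreal_mult[symmetric]) (use r in auto)
   have 3: "ennreal r + ennreal (2 ^ p * (r + r)) = ennreal (r + 2 ^ p * (r + r))"
    by (rule ennreal_plus[symmetric]) (use r in auto)
   have 4: "ennreal (2 ^ p) * ennreal (r + 2 ^ p * (r + r)) = ennreal (2 ^ p * (r + 2 ^ p * (r + r)))"
    by (rule ennreal_mult[symmetric]) (use r in auto)
   show ?thesis unfolding t 1 2 3 4 ..
  qed
  also have "... < ennreal e"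
  proof (rule ennreal_lessI[OF e])
   have "2 ^ p * (r + 2 ^ p * (r + r)) = r * (2 ^ p * (1 + 2 * 2 ^ p))" by (simp add: algebra_simps)
   also have "... = e / 2"
   proof -
    have "x / (2 * a * b) * (a * b) = x / 2" if "a > 0" "b > 0" for x a b :: real using that by simp
    from this[of "2 ^ p" "1 + 2 * 2 ^ p" e] show ?thesis by (simp add: r_def add_pos_pos)
   qed
   finally show "2 ^ p * (r + 2 ^ p * (r + r)) < e" using e by simp
  qed
  finally show ?case .
 qed
qed

section \<open>Weak derivatives\<close>

text \<open>A compact exhaustion of an open set. The bound on the norm makes it compact also for an
  unbounded U such as the whole space.\<close>

definition inn :: "(real^3) set => real => (real^3) set" where
 "inn U \<eta> = {x. ball x \<eta> \<subseteq> U \<and> norm x <= 1 / \<eta>}"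

lemma inn_subset: "0 < \<eta> ==> inn U \<eta> \<subseteq> U"
 by (auto simp: inn_def)

lemma inn_compact:
 assumes "0 < \<eta>"
 shows "compact (inn U \<eta>)"
proof -
 have "closed (inn U \<eta>)"
  unfolding closed_sequential_limits
 proof (intro allI impI, elim conjE)
  fix X x assume X: "\<forall>n. X n \<in> inn U \<eta>" and lim: "X \<longlonglongrightarrow> x"
  have "ball x \<eta> \<subseteq> U"
  proof
   fix y assume "y \<in> ball x \<eta>"
   then have "dist x y < \<eta>" by simp
   moreover have "(%n. dist (X n) y) \<longlonglongrightarrow> dist x y" by (intro tendsto_intros lim)
   ultimately have "eventually (%n. dist (X n) y < \<eta>) sequentially" by (intro order_tendstoD(2))
   from eventually_happens'[OF sequentially_bot this] obtain n where "dist (X n) y < \<eta>" by blast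
   moreover have "ball (X n) \<eta> \<subseteq> U" using X by (simp add: inn_def)
   ultimately show "y \<in> U" by auto
  qed
  moreover have "norm x <= 1 / \<eta>"
   by (rule LIMSEQ_le_const2[OF tendsto_norm[OF lim]]) (use X in \<open>auto simp: inn_def\<close>)
  ultimately show "x \<in> inn U \<eta>" by (simp add: inn_def)
 qed
 moreover have "bounded (inn U \<eta>)" unfolding bounded_iff by (auto simp: inn_def)
 ultimately show ?thesis by (simp add: compact_eq_bounded_closed)
qed

lemma inn_step:
 assumes "0 < \<eta>" "\<eta> <= 1" "x \<in> inn U \<eta>" "norm v <= \<eta> / 2"
 shows "x + v \<in> inn U (\<eta>/2)"
proof -
 have "ball (x + v) (\<eta>/2) \<subseteq> ball x \<eta>"
 proof
  fix y assume "y \<in> ball (x + v) (\<eta>/2)"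
  then have "norm (x + v - y) < \<eta>/2" by (simp add: dist_norm)
  moreover have "norm (x - y) <= norm (x + v - y) + norm v" by (metis add_diff_cancel_right' add_diff_eq diff_add_eq norm_triangle_ineq4)
  ultimately show "y \<in> ball x \<eta>" using assms(4) by (simp add: dist_norm)
 qed
 moreover have "norm (x + v) <= 1 / (\<eta>/2)"
 proof -
  have "norm (x + v) <= 1/\<eta> + \<eta>/2" using assms by (intro order_trans[OF norm_triangle_ineq] add_mono) (auto simp: inn_def)
  also have "\<eta>/2 <= 1/\<eta>" using assms mult_mono[of \<eta> 1 \<eta> 1] by (simp add: field_simps)
  finally show ?thesis by simp
 qed
 ultimately show ?thesis using assms(3) by (auto simp: inn_def)
qed

lemma inn_exhaust:
 assumes "open U" "x \<in> U"
 shows "\<exists>n::nat. x \<in> inn U (1 / (real n + 1))"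
proof -
 obtain e where e: "e > 0" "ball x e \<subseteq> U" using assms openE by blast
 obtain n :: nat where n: "real n > max (1/e) (norm x)" using reals_Archimedean2 by blast
 have "1/e < real n + 1" "norm x <= real n + 1" using n by auto
 then have "1 / (real n + 1) < e" using e by (simp add: field_simps)
 then have "x \<in> inn U (1 / (real n + 1))" using e n by (auto simp: inn_def)
 then show ?thesis by blast
qed

lemma test_fun_C1:
 assumes "test_fun U \<phi>"
 shows "(\<phi> has_derivative frechet_derivative \<phi> (at x)) (at x)"
  and "cont (pd j \<phi>)" and "ccs \<phi>" and "ccs (pd j \<phi>)"
  and "x \<notin> U ==> \<phi> x = 0" "x \<notin> U ==> pd j \<phi> x = 0"
proof -
 have s: "smooth_fun \<phi>" and K: "compact (closure {x. \<phi> x \<noteq> 0})" and KU: "closure {x. \<phi> x \<noteq> 0} \<subseteq> U"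
  using assms by (auto simp: test_fun_def)
 have d: "\<phi> differentiable at x" for x
  using s higher_partials.base[of \<phi>] by (auto simp: smooth_fun_def differentiable_on_def)
 then show D: "(\<phi> has_derivative frechet_derivative \<phi> (at x)) (at x)" for x
  by (simp add: frechet_derivative_works)
 have "pd j \<phi> \<in> higher_partials \<phi>" for j
 proof -
  have "(axis j 1 :: real^3) \<in> Basis" by simp
  from higher_partials.step[OF higher_partials.base this, of \<phi>]
  have "(%x. frechet_derivative \<phi> (at x) (axis j 1)) \<in> higher_partials \<phi>" .
  moreover have "(%x. frechet_derivative \<phi> (at x) (axis j 1)) = pd j \<phi>" by (rule ext) (simp add: pd_def)
  ultimately show ?thesis by simp
 qed
 then show pc: "cont (pd j \<phi>)" for j
  using s by (auto simp: smooth_fun_def intro: differentiable_imp_continuous_on)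
 have z: "frechet_derivative \<phi> (at x) = (%_. 0)" if "x \<notin> closure {x. \<phi> x \<noteq> 0}" for x
 proof -
  have "((%_. 0) has_derivative (%_. 0)) (at x)" by simp
  then have "(\<phi> has_derivative (%_. 0)) (at x)"
  proof (rule has_derivative_transform_within_open)
   show "open (- closure {x. \<phi> x \<noteq> 0})" by (rule open_Compl[OF closed_closure])
   show "0 = \<phi> x" if "x \<in> - closure {x. \<phi> x \<noteq> 0}" for x
    using that closure_subset[of "{x. \<phi> x \<noteq> 0}"] by auto
  qed (use that in auto)
  then show ?thesis using frechet_derivative_at by metis
 qed
 obtain R where R: "\<And>x. x \<in> closure {x. \<phi> x \<noteq> 0} ==> norm x <= R"
  using compact_imp_bounded[OF K] unfolding bounded_iff by blast
 have \<phi>0: "\<phi> x = 0" if "x \<notin> closure {x. \<phi> x \<noteq> 0}" for x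
  using that closure_subset[of "{x. \<phi> x \<noteq> 0}"] by auto
 have cc: "cont \<phi>" using D by (auto intro!: continuous_at_imp_continuous_on has_derivative_continuous)
 have nR: "x \<notin> closure {x. \<phi> x \<noteq> 0}" if "R < norm x" for x using R[of x] that by linarith
 show "ccs \<phi>" by (rule ccsI[OF cc \<phi>0[OF nR]])
 show "ccs (pd j \<phi>)" by (rule ccsI[OF pc, where R=R]) (simp add: pd_def z nR)
 have nU: "x \<notin> closure {x. \<phi> x \<noteq> 0}" if "x \<notin> U" using KU that by (rule contra_subsetD)
 show "\<phi> x = 0" if "x \<notin> U" by (rule \<phi>0[OF nU[OF that]])
 show "pd j \<phi> x = 0" if "x \<notin> U" by (simp only: pd_def z[OF nU[OF that]])
qed

text \<open>Kernels translated to x are test functions, so the mollified difference vanishes on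
  \<open>inn U \<eta>\<close>; it also converges to the difference in L^1. Integrability is only
  local, which is why everything is first cut down to the compact set
  \<open>inn U (\<eta>/2)\<close>.\<close>

lemma weak_partial_unique:
 fixes v w :: "real^3 => 'b::euclidean_space"
 assumes U: "open U" and v: "weak_partial U u j v" and w: "weak_partial U u j w"
 shows "AE x in lborel. x \<in> U --> v x = w x"
proof -
 have "AE x in lborel. x \<in> inn U \<eta> --> v x = w x" if \<eta>: "0 < \<eta>" "\<eta> <= 1" for \<eta>
 proof -
  define K where "K = inn U (\<eta>/2)"
  have K: "compact K" "K \<subseteq> U" using \<eta> inn_compact inn_subset by (auto simp: K_def)
  have KB: "K \<in> sets borel" using K by (simp add: borel_compact)
  have iv: "integrable (lebesgue_on K) v" "integrable (lebesgue_on K) w"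
   using v w K by (auto simp: weak_partial_def)
  have "v \<in> borel_measurable (lebesgue_on K)" using iv(1) by auto
  from lebesgue_on_borel_rep[OF KB this]
  obtain v' where v': "v' \<in> BM" "AE x in lborel. x \<in> K --> v x = v' x" "\<And>x. x \<notin> K ==> v' x = 0" by blast
  have "w \<in> borel_measurable (lebesgue_on K)" using iv(2) by auto
  from lebesgue_on_borel_rep[OF KB this]
  obtain w' where w': "w' \<in> BM" "AE x in lborel. x \<in> K --> w x = w' x" "\<And>x. x \<notin> K ==> w' x = 0" by blast
  have eq: "(%x. indicator K x *\<^sub>R v' x) = v'" "(%x. indicator K x *\<^sub>R w' x) = w'"
   using v'(3) w'(3) by (auto simp: indicator_def)
  have i': "L1 v'" "L1 w'"
   using lebesgue_on_transfer(3)[OF KB v'(1,2)] lebesgue_on_transfer(3)[OF KB w'(1,2)] iv by (simp_all add: eq)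
  define d where "d x = v' x - w' x" for x
  have di: "L1 d" unfolding d_def using i' by simp
  have dm: "d \<in> BM" using di by auto
  have UB: "U \<in> sets borel" using U by simp
  \<comment> \<open>All radii are below \<eta>/2, so that kernels centred in
    \<open>inn U \<eta>\<close> only see K, where the representatives agree with v and w.\<close>
  have "\<exists>k. \<forall>n. kernel 0 (\<eta> / (2 * (real n + 2))) (k n)"
   by (rule choice) (use kernel_exists \<eta> in \<open>metis add_pos_pos divide_pos_pos mult_pos_pos of_nat_0_le_iff add_nonneg_pos zero_less_numeral\<close>)
  then obtain k where k: "\<And>n. kernel 0 (\<eta> / (2 * (real n + 2))) (k n)" by blast
  have rho: "(%n. norm (0::real^3) + \<eta> / (2 * (real n + 2))) \<longlonglongrightarrow> 0"
   using LIMSEQ_ignore_initial_segment[OF lim_const_over_n[of "\<eta>/2"], of 2] by (simp add: mult_ac add_ac)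
  have zero: "mol (k n) d x = 0" if x: "x \<in> inn U \<eta>" for n x
  proof -
   have rn: "\<eta> / (2 * (real n + 2)) < \<eta>/2"
    by (intro divide_strict_left_mono) (use \<eta> in auto)
   have "cball (x + 0) (\<eta> / (2 * (real n + 2))) \<subseteq> U"
   proof
    fix y assume "y \<in> cball (x + 0) (\<eta> / (2 * (real n + 2)))"
    then have "dist x y <= \<eta> / (2 * (real n + 2))" by simp
    also have "... < \<eta>" using rn \<eta> by linarith
    finally have "y \<in> ball x \<eta>" by simp
    moreover have "ball x \<eta> \<subseteq> U" using x by (simp add: inn_def)
    ultimately show "y \<in> U" by blast
   qed
   then have tf: "test_fun U (%y. k n (y - x))" by (rule kernel_test_fun[OF k])
   have sK: "y \<in> K" if "k n (y - x) \<noteq> 0" for y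
   proof -
    have "dist 0 (y - x) < \<eta> / (2 * (real n + 2))" using k[of n] that by (simp add: kernel_def del: dist_0_norm)
    then have "norm (y - x) <= \<eta>/2" using rn unfolding dist_0_norm by linarith
    from inn_step[OF \<eta> x this] show ?thesis by (simp add: K_def)
   qed
   have km: "(%y. k n (y - x)) \<in> BM"
    by (rule borel_measurable_continuous_onI[OF continuous_on_shift_comp[OF ccs_continuous[OF kernel_ccs[OF k]]]]) (intro continuous_intros)
   have tr: "(\<integral>y. k n (y - x) *\<^sub>R f y \<partial>lebesgue_on U) = (LBINT y. k n (y - x) *\<^sub>R f' y)"
    if f': "f' \<in> BM" "AE y in lborel. y \<in> K --> f y = f' y" for f f' :: "real^3 => 'b"
   proof -
    have g: "(%y. k n (y - x) *\<^sub>R f' y) \<in> BM" using km f'(1) by measurable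
    have "AE y in lborel. y \<in> U --> k n (y - x) *\<^sub>R f y = k n (y - x) *\<^sub>R f' y"
     using f'(2) by eventually_elim (use sK in auto)
    from lebesgue_on_transfer(2)[OF UB g this]
    have "(\<integral>y. k n (y - x) *\<^sub>R f y \<partial>lebesgue_on U) = (LBINT y. indicator U y *\<^sub>R k n (y - x) *\<^sub>R f' y)" .
    also have "(%y. indicator U y *\<^sub>R k n (y - x) *\<^sub>R f' y) = (%y. k n (y - x) *\<^sub>R f' y)"
     using sK K(2) by (force simp: indicator_def)
    finally show ?thesis .
   qed
   have "(LBINT y. k n (y - x) *\<^sub>R v' y) = (LBINT y. k n (y - x) *\<^sub>R w' y)"
    unfolding tr[OF v'(1,2), symmetric] tr[OF w'(1,2), symmetric]
    using conjunct2[OF v[unfolded weak_partial_def], rule_format, OF tf]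
     conjunct2[OF w[unfolded weak_partial_def], rule_format, OF tf] by simp
   then show ?thesis
    unfolding mol_def d_def scaleR_diff_right
    using ccs_mult_integrable[OF kernel_ccs[OF k[of n]] i'(1), of x] ccs_mult_integrable[OF kernel_ccs[OF k[of n]] i'(2), of x] by simp
  qed
  have small: "(\<integral>\<^sup>+x. ennreal (norm (d x)) * indicator (inn U \<eta>) x \<partial>lborel) <= 0"
  proof (rule ennreal_le_epsilon)
   fix e :: real assume e: "e > 0"
   have fin: "pN 1 d < \<infinity>" using di unfolding pN_finite_iff[OF dm] by simp
   from pN_mol_converges[OF k rho di fin order_refl e]
   have "\<exists>n. pN 1 (%x. mol (k n) d x - d x) < ennreal e" by (rule eventually_happens'[OF sequentially_bot])
   then obtain n where n: "pN 1 (%x. mol (k n) d x - d x) < ennreal e" by blast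
   have "(\<integral>\<^sup>+x. ennreal (norm (d x)) * indicator (inn U \<eta>) x \<partial>lborel) <= pN 1 (%x. mol (k n) d x - d x)"
    unfolding pN_def by (rule nn_integral_mono) (auto simp: indicator_def zero)
   then show "(\<integral>\<^sup>+x. ennreal (norm (d x)) * indicator (inn U \<eta>) x \<partial>lborel) <= 0 + ennreal e" using n by simp
  qed
  have IB: "inn U \<eta> \<in> sets borel" using inn_compact[OF \<eta>(1)] by (simp add: borel_compact)
  have "AE x in lborel. ennreal (norm (d x)) * indicator (inn U \<eta>) x = 0"
   using small dm IB by (subst (asm) le_zero_eq, subst (asm) nn_integral_0_iff_AE) auto
  then show ?thesis using v'(2) w'(2)
  proof eventually_elim
   case (elim x)
   show ?case
   proof
    assume x: "x \<in> inn U \<eta>"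
    have "x \<in> K" using inn_step[OF \<eta> x, of 0] \<eta> by (simp add: K_def)
    then show "v x = w x" using elim x by (simp add: d_def)
   qed
  qed
 qed
 then have "AE x in lborel. \<forall>n::nat. x \<in> inn U (1 / (real n + 1)) --> v x = w x"
  by (subst AE_all_countable) auto
 then show ?thesis by eventually_elim (use inn_exhaust[OF U] in blast)
qed

text \<open>By translation invariance \<open>F (x + e) - F x\<close> has integral 0. Written as an
  integral along the segment from x to x + e, with the order exchanged, every slice contributes the
  same value.\<close>

lemma integral_partial_eq_0:
 fixes F :: "real^3 => 'b::euclidean_space"
 assumes F: "ccs F" and d: "\<And>x. (F has_derivative dF x) (at x)" and c: "cont (%x. dF x e)"
  and z: "\<And>x. R < norm x ==> dF x e = 0"
 shows "(LBINT x. dF x e) = 0"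
proof -
 note cs = continuous_on_shift_comp[OF c]
 obtain b where "cball (0::real^3) (R + norm e) \<subseteq> cbox (-b) b"
  using bounded_subset_cbox_symmetric[OF bounded_cball] by metis
 then have b: "R + norm e < norm x" if "x \<notin> cbox (-b) b" for x using that by (force simp: subset_iff not_less)
 have z': "dF (x + t *\<^sub>R e) e = 0" if "x \<notin> cbox (-b) b" "t \<in> cbox 0 1" for x t
 proof (rule z)
  have "norm (t *\<^sub>R e) <= 1 * norm e" unfolding norm_scaleR using that by (intro mult_right_mono) auto
  then show "R < norm (x + t *\<^sub>R e)" using b[OF that(1)] norm_triangle_ineq4[of "x + t *\<^sub>R e" "t *\<^sub>R e"] by simp
 qed
 have ftc: "integral (cbox 0 1) (%t. dF (x + t *\<^sub>R e) e) = F (x + e) - F x" for x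
 proof -
  have "((%t. dF (x + t *\<^sub>R e) e) has_integral (F (x + 1 *\<^sub>R e) - F (x + 0 *\<^sub>R e))) {0..1}"
  proof (rule fundamental_theorem_of_calculus)
   fix t :: real
   have p: "((%t. x + t *\<^sub>R e) has_vector_derivative e) (at t within {0..1})"
    using has_vector_derivative_add[OF has_vector_derivative_const[of x]
     has_vector_derivative_scaleR[OF DERIV_ident has_vector_derivative_const[of e]]] by simp
   show "((%t. F (x + t *\<^sub>R e)) has_vector_derivative dF (x + t *\<^sub>R e) e) (at t within {0..1})"
    using vector_derivative_diff_chain_within[OF p has_derivative_at_withinI[OF d]] by (simp add: o_def)
  qed simp
  then show ?thesis by (simp add: integral_unique)
 qed
 have Fs: "L1 (%x. F (x + e))"
 proof (rule ccs_integrable)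
  obtain S where S: "\<And>x. S < norm x ==> F x = 0" using ccs_bound[OF F] by metis
  show "ccs (%x. F (x + e))"
  proof (rule ccsI[where R="S + norm e"])
   show "cont (%x. F (x + e))" by (rule continuous_on_shift_comp[OF ccs_continuous[OF F]]) (intro continuous_intros)
   show "F (x + e) = 0" if "S + norm e < norm x" for x
    using S[of "x + e"] that norm_triangle_ineq4[of "x + e" e] by simp
  qed
 qed
 have "0 = (LBINT x. F (x + e) - F x)"
  using Fs ccs_integrable[OF F] integral_lborel_shift[of F e] by simp
 also have "... = (LBINT x. integral (cbox 0 1) (%t. dF (x + t *\<^sub>R e) e))" by (simp only: ftc)
 also have "... = integral (cbox 0 1) (%t. \<integral>x. dF (x + t *\<^sub>R e) e \<partial>lborel)"
  by (rule integral_lborel_swap[where a="-b" and b=b]) (use z' in \<open>auto simp: case_prod_beta intro!: cs continuous_intros\<close>)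
 also have "... = integral (cbox 0 (1::real)) (%t. \<integral>x. dF x e \<partial>lborel)"
  by (simp only: integral_lborel_shift[of "%x. dF x e"])
 also have "... = (LBINT x. dF x e)" by simp
 finally show ?thesis by simp
qed

lemma weak_partial_C1:
 fixes f :: "real^3 => 'b::euclidean_space"
 assumes U: "open U" and d: "\<And>x. (f has_derivative df x) (at x)" and c: "cont (%x. df x (axis j 1))"
 shows "weak_partial U f j (%x. df x (axis j 1))"
 unfolding weak_partial_def
proof (intro conjI allI impI, goal_cases)
 have cf: "cont f" using d by (auto intro!: continuous_at_imp_continuous_on has_derivative_continuous)
 have ci: "integrable (lebesgue_on K) g" if "compact K" "cont g" for K and g :: "real^3 => 'b"
 proof -
  have KB: "K \<in> sets borel" using that by (simp add: borel_compact)
  have gm: "g \<in> BM" by (rule borel_measurable_continuous_onI[OF that(2)])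
  have "L1 (%x. indicator K x *\<^sub>R g x)"
   by (rule borel_integrable_compact[OF that(1) continuous_on_subset[OF that(2)]]) simp
  then show ?thesis using lebesgue_on_transfer(3)[OF KB gm, of g] by simp
 qed
 {
  case (1 K) then show ?case using ci cf by blast
 next
  case (2 K) then show ?case using ci c by blast
 next
  case (3 \<phi>)
  note T = test_fun_C1[OF 3]
  define e where "e = (axis j 1 :: real^3)"
  have pd: "pd j \<phi> x = frechet_derivative \<phi> (at x) e" for x by (simp add: pd_def e_def)
  define dF where "dF x v = \<phi> x *\<^sub>R df x v + frechet_derivative \<phi> (at x) v *\<^sub>R f x" for x v
  have dF: "((%x. \<phi> x *\<^sub>R f x) has_derivative dF x) (at x)" for x
   unfolding dF_def[abs_def] by (rule has_derivative_scaleR[OF T(1) d])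
  have ccs: "ccs (%x. \<phi> x *\<^sub>R g x)" "ccs (%x. pd j \<phi> x *\<^sub>R g x)" if "cont g" for g :: "real^3 => 'b"
  proof -
   obtain R1 where "\<And>x. R1 < norm x ==> \<phi> x = 0" using ccs_bound[OF T(3)] by metis
   then show "ccs (%x. \<phi> x *\<^sub>R g x)" by (intro ccsI[where R=R1] continuous_intros ccs_continuous[OF T(3)] that) simp
   obtain R2 where "\<And>x. R2 < norm x ==> pd j \<phi> x = 0" using ccs_bound[OF T(4)] by metis
   then show "ccs (%x. pd j \<phi> x *\<^sub>R g x)" by (intro ccsI[where R=R2] continuous_intros T(2) that) simp
  qed
  note i = ccs_integrable[OF ccs(1)[OF c]] ccs_integrable[OF ccs(2)[OF cf]]
  have e1: "dF x e = \<phi> x *\<^sub>R df x (axis j 1) + pd j \<phi> x *\<^sub>R f x" for x by (simp add: dF_def e_def pd_def)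
  obtain R1 where R1: "\<And>x. R1 < norm x ==> \<phi> x = 0" using ccs_bound[OF T(3)] by metis
  obtain R2 where R2: "\<And>x. R2 < norm x ==> pd j \<phi> x = 0" using ccs_bound[OF T(4)] by metis
  have "(LBINT x. dF x e) = 0"
  proof (rule integral_partial_eq_0[OF ccs(1)[OF cf] dF, where R="max R1 R2"])
   show "cont (%x. dF x e)" unfolding e1 by (intro continuous_intros ccs_continuous[OF T(3)] T(2) c cf)
   show "dF x e = 0" if "max R1 R2 < norm x" for x unfolding e1 using R1 R2 that by simp
  qed
  then have "(LBINT x. pd j \<phi> x *\<^sub>R f x) = - (LBINT x. \<phi> x *\<^sub>R df x (axis j 1))"
   unfolding e1 using i by (simp add: add_eq_0_iff)
  moreover have "(\<integral>x. g x \<partial>lebesgue_on U) = (LBINT x. g x)" if "ccs g" "\<And>x. x \<notin> U ==> g x = 0" for g :: "real^3 => 'b"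
  proof -
   have gm: "g \<in> BM" by (rule borel_measurable_continuous_onI[OF ccs_continuous[OF that(1)]])
   have "(\<integral>x. g x \<partial>lebesgue_on U) = (LBINT x. indicator U x *\<^sub>R g x)"
    by (rule lebesgue_on_transfer(2)[OF _ gm]) (use U in auto)
   also have "(%x. indicator U x *\<^sub>R g x) = g" using that(2) by (auto simp: indicator_def)
   finally show ?thesis .
  qed
  ultimately show ?case using ccs(1)[OF c] ccs(2)[OF cf] T(5,6) by simp
 }
qed

section \<open>Sobolev embedding on domains with a cone property\<close>

lemma ennreal_power_sum_le: "(a + b) ^ p <= 2 ^ p * (a ^ p + b ^ p)" for a b :: ennreal
proof -
 have "a + b <= 2 * max a b" unfolding mult_2 by (intro add_mono) auto
 then have "(a + b) ^ p <= (2 * max a b) ^ p" by (intro power_mono) auto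
 also have "... = 2 ^ p * (max a b) ^ p" by (simp add: power_mult_distrib)
 also have "(max a b) ^ p <= a ^ p + b ^ p" by (auto simp: max_def)
 finally show ?thesis by (simp add: mult_left_mono)
qed

lemma nn_integral_square_le:
 fixes h :: "'a => ennreal"
 assumes [measurable]: "h \<in> borel_measurable M" "A \<in> sets M"
 shows "(\<integral>\<^sup>+x. h x * indicator A x \<partial>M)^2 <= emeasure M A * (\<integral>\<^sup>+x. (h x)^2 * indicator A x \<partial>M)"
proof -
 have "(\<integral>\<^sup>+x. h x * indicator A x \<partial>M)^2 = (\<integral>\<^sup>+x. (h x * indicator A x) * indicator A x \<partial>M)^2"
  by (rule arg_cong[where f="%z. z^2"], rule nn_integral_cong) (simp add: indicator_def)
 also have "... <= (\<integral>\<^sup>+x. (h x * indicator A x)^2 \<partial>M) * (\<integral>\<^sup>+x. (indicator A x)^2 \<partial>M)"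
  by (rule Cauchy_Schwarz_nn_integral) measurable
 also have "(\<integral>\<^sup>+x. (indicator A x :: ennreal)^2 \<partial>M) = (\<integral>\<^sup>+x. indicator A x \<partial>M)"
  by (rule nn_integral_cong) (simp add: indicator_def)
 also have "(\<integral>\<^sup>+x. (h x * indicator A x)^2 \<partial>M) = (\<integral>\<^sup>+x. (h x)^2 * indicator A x \<partial>M)"
  by (rule nn_integral_cong) (simp add: indicator_def)
 finally show ?thesis by (simp add: mult.commute)
qed

text \<open>Parametrising the segment from \<open>x\<close> to \<open>x + b\<close> by \<open>x + t^4 b\<close> distributes the singularity of the
 gradient potential so that an \<open>L^2\<close> gradient gives an \<open>L^4\<close> bound without singular integrals.\<close>
lemma gradient_potential_bound:
 fixes v :: "real^3 => 'b::euclidean_space" and f :: "real^3 => real"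
 assumes [measurable]: "v \<in> BM" "f \<in> BM" "D \<in> sets borel"
  and f0: "\<And>x. 0 <= f x" and \<beta>: "0 <= \<beta>"
  and H: "\<And>x b. x \<in> D ==> b \<in> ball c \<rho> ==> ennreal (norm (v x)) <= ennreal (norm (v (x + b)))
    + (\<integral>\<^sup>+t. ennreal (\<beta> * t^3 * f (x + t^4 *\<^sub>R b)) * indicator {0<..<1} t \<partial>lborel)"
 defines "m \<equiv> emeasure lborel (ball c \<rho>)"
 shows "m^4 * (\<integral>\<^sup>+x. ennreal (norm (v x) ^ 4) * indicator D x \<partial>lborel)
   <= 16 * ((m + pN 2 v)^4 * emeasure lborel D + ennreal (\<beta>^4) * m^3 * (pN 2 f)^2)"
proof -
 let ?B = "ball c \<rho>" and ?I = "{0<..<1::real}"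
 have [measurable]: "?B \<in> sets borel" by simp
 define F where "F = pN 2 f"
 have Feq: "F = (\<integral>\<^sup>+x. (ennreal (f x))^2 \<partial>lborel)"
  unfolding F_def pN_def by (rule nn_integral_cong) (use f0 in \<open>simp add: ennreal_power\<close>)
 define A1 where "A1 x = (\<integral>\<^sup>+b. ennreal (norm (v (x + b))) * indicator ?B b \<partial>lborel)" for x
 define A2 where "A2 x = (\<integral>\<^sup>+b. (\<integral>\<^sup>+t. ennreal (\<beta> * t^3 * f (x + t^4 *\<^sub>R b)) * indicator ?I t \<partial>lborel) * indicator ?B b \<partial>lborel)" for x
 define N where "N t x = (\<integral>\<^sup>+b. ennreal (f (x + t^4 *\<^sub>R b)) * indicator ?B b \<partial>lborel)" for t x
 define Q where "Q t x = (\<integral>\<^sup>+b. (ennreal (f (x + t^4 *\<^sub>R b)))^2 * indicator ?B b \<partial>lborel)" for t x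
 have step1: "m * ennreal (norm (v x)) <= A1 x + A2 x" if x: "x \<in> D" for x
 proof -
  have "m * ennreal (norm (v x)) = (\<integral>\<^sup>+b. ennreal (norm (v x)) * indicator ?B b \<partial>lborel)"
   by (simp add: m_def nn_integral_cmult_indicator mult.commute)
  also have "... <= (\<integral>\<^sup>+b. (ennreal (norm (v (x + b))) * indicator ?B b +
    (\<integral>\<^sup>+t. ennreal (\<beta> * t^3 * f (x + t^4 *\<^sub>R b)) * indicator ?I t \<partial>lborel) * indicator ?B b) \<partial>lborel)"
   by (rule nn_integral_mono) (use H[OF x] in \<open>auto simp: indicator_def\<close>)
  also have "... = A1 x + A2 x" unfolding A1_def A2_def by (rule nn_integral_add) measurable
  finally show ?thesis .
 qed
 have step2: "A1 x <= m + pN 2 v" for x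
 proof -
  have "A1 x <= (\<integral>\<^sup>+b. (indicator ?B b + ennreal (norm (v (b + x)) ^ 2)) \<partial>lborel)"
   unfolding A1_def
  proof (rule nn_integral_mono)
   fix b
   have "norm (v (x + b)) <= 1 + norm (v (b + x)) ^ 2"
   proof -
    have "2 * norm (v (b + x)) <= 1 + norm (v (b + x)) ^ 2" using sum_squares_bound[of 1 "norm (v (b + x))"] by simp
    then show ?thesis by (simp add: add.commute) (smt (verit) norm_ge_zero)
   qed
   then have "ennreal (norm (v (x + b))) <= ennreal (1 + norm (v (b + x)) ^ 2)" by (rule ennreal_leI)
   then show "ennreal (norm (v (x + b))) * indicator ?B b <= indicator ?B b + ennreal (norm (v (b + x)) ^ 2)"
    by (auto simp: indicator_def)
  qed
  also have "... = m + (\<integral>\<^sup>+b. ennreal (norm (v (b + x)) ^ 2) \<partial>lborel)"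
   unfolding m_def by (subst nn_integral_add) auto
  also have "(\<integral>\<^sup>+b. ennreal (norm (v (b + x)) ^ 2) \<partial>lborel) = pN 2 v"
   unfolding pN_def by (rule nn_integral_lborel_shift) measurable
  finally show ?thesis .
 qed
 have A2eq: "A2 x = (\<integral>\<^sup>+t. ennreal (\<beta> * t^3) * N t x * indicator ?I t \<partial>lborel)" for x
 proof -
  have "A2 x = (\<integral>\<^sup>+b. (\<integral>\<^sup>+t. ennreal (\<beta> * t^3 * f (x + t^4 *\<^sub>R b)) * indicator ?I t * indicator ?B b \<partial>lborel) \<partial>lborel)"
   unfolding A2_def by (subst nn_integral_multc) auto
  also have "... = (\<integral>\<^sup>+t. (\<integral>\<^sup>+b. ennreal (\<beta> * t^3 * f (x + t^4 *\<^sub>R b)) * indicator ?I t * indicator ?B b \<partial>lborel) \<partial>lborel)"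
   by (rule lborel_pair.Fubini') measurable
  also have "... = (\<integral>\<^sup>+t. ennreal (\<beta> * t^3) * N t x * indicator ?I t \<partial>lborel)"
  proof (rule nn_integral_cong)
   fix t :: real
   have "(\<integral>\<^sup>+b. ennreal (\<beta> * t^3 * f (x + t^4 *\<^sub>R b)) * indicator ?I t * indicator ?B b \<partial>lborel)
    = (\<integral>\<^sup>+b. (ennreal (\<beta> * t^3) * indicator ?I t) * (ennreal (f (x + t^4 *\<^sub>R b)) * indicator ?B b) \<partial>lborel)"
    by (rule nn_integral_cong) (use f0 \<beta> in \<open>auto simp: indicator_def ennreal_mult'\<close>)
   also have "... = ennreal (\<beta> * t^3) * indicator ?I t * N t x"
    unfolding N_def by (rule nn_integral_cmult) measurable
   finally show "(\<integral>\<^sup>+b. ennreal (\<beta> * t^3 * f (x + t^4 *\<^sub>R b)) * indicator ?I t * indicator ?B b \<partial>lborel)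
    = ennreal (\<beta> * t^3) * N t x * indicator ?I t" by (simp add: mult_ac)
  qed
  finally show ?thesis .
 qed
 have [measurable]: "(%x. A2 x) \<in> BM" unfolding A2_def by measurable
 have [measurable]: "(%(x,t). N t x) \<in> borel_measurable (borel \<Otimes>\<^sub>M borel)" unfolding N_def by measurable
 have [measurable]: "(%(x,t). Q t x) \<in> borel_measurable (borel \<Otimes>\<^sub>M borel)" unfolding Q_def by measurable
 \<comment> \<open>Cauchy-Schwarz twice on the unit interval, whose measure is 1.\<close>
 have step3: "(A2 x)^4 <= (\<integral>\<^sup>+t. (ennreal (\<beta> * t^3) * N t x)^4 * indicator ?I t \<partial>lborel)" for x
 proof -
  have I1: "emeasure lborel ?I = 1" by simp
  have "(A2 x)^2 <= emeasure lborel ?I * (\<integral>\<^sup>+t. (ennreal (\<beta> * t^3) * N t x)^2 * indicator ?I t \<partial>lborel)"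
   unfolding A2eq by (rule nn_integral_square_le) measurable
  then have "((A2 x)^2)^2 <= (\<integral>\<^sup>+t. (ennreal (\<beta> * t^3) * N t x)^2 * indicator ?I t \<partial>lborel)^2"
   unfolding I1 by (intro power_mono) auto
  also have "... <= emeasure lborel ?I * (\<integral>\<^sup>+t. ((ennreal (\<beta> * t^3) * N t x)^2)^2 * indicator ?I t \<partial>lborel)"
   by (rule nn_integral_square_le) measurable
  finally show ?thesis unfolding I1 by (simp flip: power_mult)
 qed
 \<comment> \<open>Cauchy-Schwarz on the ball yields two factors Q. One is estimated uniformly in x:
   the substitution y = x + t^4 b has Jacobian t^12, which is exactly the fourth power of t^3. The
   other factor is kept and integrated over x.\<close>
 have step4: "(ennreal (\<beta> * t^3) * N t x)^4 <= ennreal (\<beta>^4) * m^2 * F * Q t x" if t: "t \<in> ?I" for t x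
 proof -
  have t0: "t > 0" using t by simp
  have n2: "(N t x)^2 <= m * Q t x"
   unfolding N_def Q_def m_def by (rule nn_integral_square_le) measurable
  have q: "ennreal (t^12) * Q t x <= F"
  proof -
   have "F = ennreal (\<bar>t^4\<bar> ^ DIM(real^3)) * (\<integral>\<^sup>+b. (ennreal (f (x + t^4 *\<^sub>R b)))^2 \<partial>lborel)"
    unfolding Feq by (rule nn_integral_lborel_affine) (use t0 in auto)
   also have "\<bar>t^4\<bar> ^ DIM(real^3) = t^12" using t0 by (simp flip: power_mult)
   finally have "F = ennreal (t^12) * (\<integral>\<^sup>+b. (ennreal (f (x + t^4 *\<^sub>R b)))^2 \<partial>lborel)" .
   moreover have "Q t x <= (\<integral>\<^sup>+b. (ennreal (f (x + t^4 *\<^sub>R b)))^2 \<partial>lborel)"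
    unfolding Q_def by (rule nn_integral_mono) (simp add: indicator_def)
   ultimately show ?thesis by (simp add: mult_left_mono)
  qed
  have "(ennreal (\<beta> * t^3) * N t x)^4 = ennreal (\<beta>^4) * ennreal (t^12) * ((N t x)^2)^2"
   using \<beta> t0 by (simp add: power_mult_distrib ennreal_power ennreal_mult' flip: power_mult)
  also have "... <= ennreal (\<beta>^4) * ennreal (t^12) * (m * Q t x)^2"
   using n2 by (intro mult_left_mono power_mono) auto
  also have "... = ennreal (\<beta>^4) * m^2 * (ennreal (t^12) * Q t x) * Q t x"
   by (simp add: power_mult_distrib power2_eq_square mult_ac)
  also have "... <= ennreal (\<beta>^4) * m^2 * F * Q t x"
   using q by (intro mult_right_mono mult_left_mono) auto
  finally show ?thesis .
 qed
 have step5: "(\<integral>\<^sup>+x. Q t x \<partial>lborel) = m * F" for t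
 proof -
  have "(\<integral>\<^sup>+x. Q t x \<partial>lborel) = (\<integral>\<^sup>+b. (\<integral>\<^sup>+x. (ennreal (f (x + t^4 *\<^sub>R b)))^2 * indicator ?B b \<partial>lborel) \<partial>lborel)"
   unfolding Q_def by (rule lborel_pair.Fubini') measurable
  also have "... = (\<integral>\<^sup>+b. F * indicator ?B b \<partial>lborel)"
  proof (rule nn_integral_cong)
   fix b
   have "(\<integral>\<^sup>+x. (ennreal (f (x + t^4 *\<^sub>R b)))^2 * indicator ?B b \<partial>lborel) = (\<integral>\<^sup>+x. (ennreal (f (x + t^4 *\<^sub>R b)))^2 \<partial>lborel) * indicator ?B b"
    by (rule nn_integral_multc) measurable
   also have "(\<integral>\<^sup>+x. (ennreal (f (x + t^4 *\<^sub>R b)))^2 \<partial>lborel) = F"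
    unfolding Feq by (rule nn_integral_lborel_shift[where f="%x. (ennreal (f x))^2"]) measurable
   finally show "(\<integral>\<^sup>+x. (ennreal (f (x + t^4 *\<^sub>R b)))^2 * indicator ?B b \<partial>lborel) = F * indicator ?B b" .
  qed
  also have "... = F * m" unfolding m_def by (rule nn_integral_cmult_indicator) simp
  finally show ?thesis by (simp add: mult.commute)
 qed
 have step6: "(\<integral>\<^sup>+x. (A2 x)^4 \<partial>lborel) <= ennreal (\<beta>^4) * m^3 * F^2"
 proof -
  have "(\<integral>\<^sup>+x. (A2 x)^4 \<partial>lborel) <= (\<integral>\<^sup>+x. (\<integral>\<^sup>+t. (ennreal (\<beta>^4) * m^2 * F) * (Q t x * indicator ?I t) \<partial>lborel) \<partial>lborel)"
  proof (rule nn_integral_mono)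
   fix x :: "real^3"
   have "(\<integral>\<^sup>+t. (ennreal (\<beta> * t^3) * N t x)^4 * indicator ?I t \<partial>lborel)
     <= (\<integral>\<^sup>+t. (ennreal (\<beta>^4) * m^2 * F) * (Q t x * indicator ?I t) \<partial>lborel)"
    by (rule nn_integral_mono) (use step4 in \<open>auto simp: indicator_def\<close>)
   then show "(A2 x)^4 <= (\<integral>\<^sup>+t. (ennreal (\<beta>^4) * m^2 * F) * (Q t x * indicator ?I t) \<partial>lborel)"
    using step3[of x] by (rule order_trans[rotated])
  qed
  also have "... = (\<integral>\<^sup>+t. (\<integral>\<^sup>+x. (ennreal (\<beta>^4) * m^2 * F) * (Q t x * indicator ?I t) \<partial>lborel) \<partial>lborel)"
   by (rule lborel_pair.Fubini') measurable
  also have "... = (\<integral>\<^sup>+t. (ennreal (\<beta>^4) * m^2 * F) * (m * F) * indicator ?I t \<partial>lborel)"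
  proof (rule nn_integral_cong)
   fix t :: real
   have "(\<integral>\<^sup>+x. (ennreal (\<beta>^4) * m^2 * F) * (Q t x * indicator ?I t) \<partial>lborel)
    = (ennreal (\<beta>^4) * m^2 * F) * (\<integral>\<^sup>+x. Q t x * indicator ?I t \<partial>lborel)" by (rule nn_integral_cmult) measurable
   also have "(\<integral>\<^sup>+x. Q t x * indicator ?I t \<partial>lborel) = (\<integral>\<^sup>+x. Q t x \<partial>lborel) * indicator ?I t"
    by (rule nn_integral_multc) measurable
   finally show "(\<integral>\<^sup>+x. (ennreal (\<beta>^4) * m^2 * F) * (Q t x * indicator ?I t) \<partial>lborel)
    = (ennreal (\<beta>^4) * m^2 * F) * (m * F) * indicator ?I t" by (simp add: step5 mult.assoc)
  qed
  also have "... = (ennreal (\<beta>^4) * m^2 * F) * (m * F)"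
   by (subst nn_integral_cmult_indicator) auto
  also have "... = ennreal (\<beta>^4) * m^3 * F^2" by (simp add: power2_eq_square power3_eq_cube mult_ac)
  finally show ?thesis .
 qed
 have "m^4 * (\<integral>\<^sup>+x. ennreal (norm (v x) ^ 4) * indicator D x \<partial>lborel)
   = (\<integral>\<^sup>+x. m^4 * (ennreal (norm (v x) ^ 4) * indicator D x) \<partial>lborel)"
  by (rule nn_integral_cmult[symmetric]) measurable
 also have "... <= (\<integral>\<^sup>+x. 16 * ((m + pN 2 v)^4 * indicator D x + (A2 x)^4) \<partial>lborel)"
 proof (rule nn_integral_mono)
  fix x
  show "m^4 * (ennreal (norm (v x) ^ 4) * indicator D x) <= 16 * ((m + pN 2 v)^4 * indicator D x + (A2 x)^4)"
  proof (cases "x \<in> D")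
   case True
   have "m^4 * ennreal (norm (v x) ^ 4) = (m * ennreal (norm (v x)))^4" by (simp add: power_mult_distrib ennreal_power)
   also have "... <= ((m + pN 2 v) + A2 x)^4"
    by (intro power_mono order_trans[OF step1[OF True]] add_mono step2) auto
   also have "... <= 2^4 * ((m + pN 2 v)^4 + (A2 x)^4)" by (rule ennreal_power_sum_le)
   finally show ?thesis using True by simp
  qed simp
 qed
 also have "... = 16 * (\<integral>\<^sup>+x. ((m + pN 2 v)^4 * indicator D x + (A2 x)^4) \<partial>lborel)"
  by (rule nn_integral_cmult) measurable
 also have "(\<integral>\<^sup>+x. ((m + pN 2 v)^4 * indicator D x + (A2 x)^4) \<partial>lborel)
   = (\<integral>\<^sup>+x. (m + pN 2 v)^4 * indicator D x \<partial>lborel) + (\<integral>\<^sup>+x. (A2 x)^4 \<partial>lborel)"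
  by (rule nn_integral_add) measurable
 also have "(\<integral>\<^sup>+x. (m + pN 2 v)^4 * indicator D x \<partial>lborel) = (m + pN 2 v)^4 * emeasure lborel D"
  by (subst nn_integral_cmult_indicator) auto
 also have "16 * ((m + pN 2 v)^4 * emeasure lborel D + (\<integral>\<^sup>+x. (A2 x)^4 \<partial>lborel))
   <= 16 * ((m + pN 2 v)^4 * emeasure lborel D + ennreal (\<beta>^4) * m^3 * F^2)"
  by (intro mult_left_mono add_left_mono step6) auto
 finally show ?thesis by (simp add: F_def)
qed

text \<open>The functions live on the whole space but are tested only inside U; their values
  elsewhere do not matter, since test functions and their derivatives vanish there.\<close>

definition weak_deriv :: "(real^3) set => (real^3 => 'b::euclidean_space) => (3 => real^3 => 'b) => bool" where
 "weak_deriv U u g \<longleftrightarrow> (\<forall>j \<phi>. test_fun U \<phi> -->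
   (LBINT x. pd j \<phi> x *\<^sub>R u x) = - (LBINT x. \<phi> x *\<^sub>R g j x))"

text \<open>Differentiation always falls on the kernel, so the derivative exists everywhere. Where
  the ball of the kernel fits into U the translated kernel is a test function, and the derivative
  can be moved over to u.\<close>

lemma mol_derivative_weak:
 fixes u :: "real^3 => 'b::euclidean_space"
 assumes k: "kernel c \<rho> k" and u: "L1 u" and w: "weak_deriv U u g"
 obtains L where "\<And>x. (mol k u has_derivative L x) (at x)" "\<And>v. cont (%x. L x v)"
  "\<And>x v. cball (x + c) \<rho> \<subseteq> U ==> L x v = v $ 1 *\<^sub>R mol k (g 1) x + v $ 2 *\<^sub>R mol k (g 2) x + v $ 3 *\<^sub>R mol k (g 3) x"
proof -
 from kernel_derivative[OF k]
 obtain D :: "3 => real^3 => real" where D': "\<forall>j. ccs (D j)"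
  "\<forall>x. (k has_derivative (%v. v $ 1 * D 1 x + v $ 2 * D 2 x + v $ 3 * D 3 x)) (at x)"
  "\<forall>j x y. pd j (%y. k (y - x)) y = D j (y - x)"
  by (elim exE conjE)
 note D = D'[rule_format]
 define L where "L x v = - (v $ 1 *\<^sub>R mol (D 1) u x + v $ 2 *\<^sub>R mol (D 2) u x + v $ 3 *\<^sub>R mol (D 3) u x)" for x and v :: "real^3"
 have "(mol k u has_derivative L x) (at x)" for x
  unfolding L_def[abs_def] by (rule mol_has_derivative[OF kernel_ccs[OF k] D(1,2) u])
 moreover have "cont (%x. L x v)" for v
  unfolding L_def by (intro continuous_intros mol_continuous[OF D(1) u])
 moreover have "L x v = v $ 1 *\<^sub>R mol k (g 1) x + v $ 2 *\<^sub>R mol k (g 2) x + v $ 3 *\<^sub>R mol k (g 3) x"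
  if sub: "cball (x + c) \<rho> \<subseteq> U" for x v
 proof -
  have "mol (D j) u x = - mol k (g j) x" for j
  proof -
   have "(LBINT y. pd j (%y. k (y - x)) y *\<^sub>R u y) = - (LBINT y. k (y - x) *\<^sub>R g j y)"
    using w kernel_test_fun[OF k sub] unfolding weak_deriv_def by blast
   then show ?thesis unfolding mol_def D(3) .
  qed
  then show ?thesis by (simp add: L_def)
 qed
 ultimately show ?thesis by (rule that)
qed

lemma ennreal_norm_le_segment:
 fixes v :: "real^3 => 'b::euclidean_space"
 assumes d: "\<And>t. 0 <= t ==> t <= 1 ==> (v has_derivative L (x + t *\<^sub>R b)) (at (x + t *\<^sub>R b))"
  and bd: "\<And>t. 0 <= t ==> t <= 1 ==> norm (L (x + t *\<^sub>R b) b) <= \<beta> * f (x + t *\<^sub>R b)"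
  and fc: "cont f" and f0: "\<And>x. 0 <= f x" and \<beta>: "0 <= \<beta>"
  and Lc: "cont (%x. L x b)" and lin: "\<And>x. linear (L x)"
 shows "ennreal (norm (v x)) <= ennreal (norm (v (x + b)))
    + (\<integral>\<^sup>+t. ennreal (4 * \<beta> * t^3 * f (x + t^4 *\<^sub>R b)) * indicator {0<..<1} t \<partial>lborel)"
proof -
 note cs = continuous_on_shift_comp[OF fc] continuous_on_shift_comp[OF Lc]
 define F where "F t = 4 * \<beta> * t^3 * f (x + t^4 *\<^sub>R b)" for t :: real
 have Fc: "continuous_on {0..1} F" unfolding F_def by (intro continuous_intros cs)
 have F0: "0 <= F t" if "0 <= t" for t using that f0 \<beta> by (simp add: F_def)
 define G where "G t = (4 * t^3) *\<^sub>R L (x + t^4 *\<^sub>R b) b" for t :: real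
 have Gi: "(G has_integral (v (x + 1^4 *\<^sub>R b) - v (x + 0^4 *\<^sub>R b))) {0..1}"
 proof (rule fundamental_theorem_of_calculus)
  fix t :: real assume t: "t \<in> {0..1}"
  have "((%t. t^4) has_real_derivative 4 * t^3) (at t within {0..1})"
   by (auto intro!: derivative_eq_intros)
  from has_vector_derivative_add[OF has_vector_derivative_const[of x]
     has_vector_derivative_scaleR[OF this has_vector_derivative_const[of b]]]
  have p: "((%t. x + t^4 *\<^sub>R b) has_vector_derivative (4 * t^3) *\<^sub>R b) (at t within {0..1})" by simp
  have "0 <= t^4" "t^4 <= 1" using t by (auto intro: power_le_one)
  from vector_derivative_diff_chain_within[OF p has_derivative_at_withinI[OF d[OF this]]]
  show "((%t. v (x + t^4 *\<^sub>R b)) has_vector_derivative G t) (at t within {0..1})"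
   by (simp add: o_def G_def linear_cmul[OF lin])
 qed simp
 have Gb: "norm (G t) <= F t" if "t \<in> {0..1}" for t
 proof -
  have "0 <= t^4" "t^4 <= 1" using that by (auto intro: power_le_one)
  from bd[OF this] have "(4 * t^3) * norm (L (x + t^4 *\<^sub>R b) b) <= (4 * t^3) * (\<beta> * f (x + t^4 *\<^sub>R b))"
   using that by (intro mult_left_mono) auto
  then show ?thesis using that by (simp add: G_def F_def mult_ac)
 qed
 have "norm (v (x + b) - v x) <= integral {0..1} F"
  using Henstock_Kurzweil_Integration.integral_norm_bound_integral[OF has_integral_integrable[OF Gi] integrable_continuous_interval[OF Fc] Gb]
   integral_unique[OF Gi] by simp
 then have A: "norm (v x) <= norm (v (x + b)) + integral {0..1} F"
  using norm_triangle_ineq4[of "v (x + b)" "v (x + b) - v x"] by simp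
 have "integral {0..1} F \<ge> 0" by (rule integral_nonneg[OF integrable_continuous_interval[OF Fc]]) (use F0 in auto)
 have si: "set_integrable lborel {0..1} F"
  unfolding set_integrable_def by (rule borel_integrable_compact[OF compact_Icc Fc])
 have "ennreal (integral {0..1} F) = ennreal (set_lebesgue_integral lborel {0..1} F)"
  by (simp add: set_borel_integral_eq_integral(2)[OF si])
 also have "... = (\<integral>\<^sup>+t. ennreal (indicator {0..1} t *\<^sub>R F t) \<partial>lborel)"
  unfolding set_lebesgue_integral_def
  by (rule nn_integral_eq_integral[symmetric]) (use si F0 in \<open>auto simp: set_integrable_def indicator_def\<close>)
 also have "... = (\<integral>\<^sup>+t. ennreal (F t) * indicator {0<..<1} t \<partial>lborel)"
 proof (rule nn_integral_cong_AE)
  have "AE t in lborel. t \<noteq> (0::real)" "AE t in lborel. t \<noteq> (1::real)" by (rule AE_lborel_singleton)+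
  then show "AE t in lborel. ennreal (indicator {0..1} t *\<^sub>R F t) = ennreal (F t) * indicator {0<..<1} t"
   by eventually_elim (auto simp: indicator_def)
 qed
 finally have B: "ennreal (integral {0..1} F) = (\<integral>\<^sup>+t. ennreal (F t) * indicator {0<..<1} t \<partial>lborel)" .
 have "ennreal (norm (v x)) <= ennreal (norm (v (x + b)) + integral {0..1} F)" by (rule ennreal_leI[OF A])
 also have "... = ennreal (norm (v (x + b))) + ennreal (integral {0..1} F)"
  by (rule ennreal_plus) (use \<open>integral {0..1} F \<ge> 0\<close> in auto)
 finally show ?thesis unfolding B F_def .
qed

text \<open>Kernels centred at \<epsilon> c with radius \<epsilon> \<rho>/2 look into the cone: a
  point sampled from x + t b is x plus t + \<epsilon> times a convex combination of two vectors of
  \<open>ball c \<rho>\<close>, and it stays in U because t + \<epsilon> <= 2. Hence the mollified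
  functions obey the potential estimate on D uniformly in \<epsilon>, even near the boundary, and
  Fatou's lemma along an almost everywhere convergent subsequence carries the bound to u.\<close>

lemma L4_on_cone_domain:
 fixes u :: "real^3 => 'b::euclidean_space"
 assumes u: "L1 u" "L1 (%x. (norm (u x))^2)"
  and g: "\<And>j. L1 (g j)" "\<And>j. L1 (%x. (norm (g j x))^2)"
  and w: "weak_deriv U u g" and D: "D \<in> sets borel" "bounded D" and \<rho>: "0 < \<rho>"
  and cone: "\<And>x t b. x \<in> D ==> 0 < t ==> t <= 2 ==> b \<in> ball c \<rho> ==> x + t *\<^sub>R b \<in> U"
 shows "L1 (%x. indicator D x * norm (u x) ^ 4)"
proof -
 define m where "m = emeasure lborel (ball c \<rho>)"
 have m: "m \<noteq> 0" "m < \<infinity>"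
 proof -
  have "\<not> negligible (ball c \<rho>)" using \<rho> open_not_negligible[of "ball c \<rho>"] by auto
  then have "ball c \<rho> \<notin> null_sets lebesgue" using negligible_iff_null_sets by blast
  then show "m \<noteq> 0" using null_sets_completionI[of "ball c \<rho>" lborel] by (auto simp: m_def null_sets_def)
  show "m < \<infinity>" unfolding m_def using emeasure_bounded_finite[OF bounded_ball] by simp
 qed
 have um: "u \<in> BM" and gm: "g j \<in> BM" for j using u g by auto
 note [measurable] = um gm D(1)
 define \<beta> where "\<beta> = norm c + \<rho>"
 have \<beta>0: "\<beta> \<ge> 0" using \<rho> by (simp add: \<beta>_def)
 define Gs where "Gs = pN 2 (g 1) + pN 2 (g 2) + pN 2 (g 3)"
 have pf: "pN 2 u < \<infinity>" "pN 2 (g j) < \<infinity>" for j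
  using pN_finite_iff[OF um, of 2] pN_finite_iff[OF gm, of 2] u g by auto
 define X where "X = 16 * ((m + pN 2 u)^4 * emeasure lborel D + ennreal ((4 * \<beta>)^4) * m^3 * (16 * Gs)^2)"
 have eD: "emeasure lborel D < \<infinity>" by (rule emeasure_bounded_finite[OF D(2)])
 have Xfin: "X < \<infinity>"
  using m pf eD unfolding X_def Gs_def
  by (auto simp: ennreal_mult_less_top power_less_top_ennreal ennreal_add_less_top less_top[symmetric] power_eq_top_ennreal ennreal_mult_eq_top_iff)
 have bound: "m^4 * (\<integral>\<^sup>+x. ennreal (norm (mol k u x) ^ 4) * indicator D x \<partial>lborel) <= X"
  if k: "kernel (\<epsilon> *\<^sub>R c) (\<epsilon> * \<rho> / 2) k" and \<epsilon>: "0 < \<epsilon>" "\<epsilon> <= 1" for k \<epsilon>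
 proof -
  obtain L where L: "\<And>x. (mol k u has_derivative L x) (at x)" "\<And>v. cont (%x. L x v)"
   "\<And>x v. cball (x + \<epsilon> *\<^sub>R c) (\<epsilon> * \<rho> / 2) \<subseteq> U ==> L x v = v $ 1 *\<^sub>R mol k (g 1) x + v $ 2 *\<^sub>R mol k (g 2) x + v $ 3 *\<^sub>R mol k (g 3) x"
   using mol_derivative_weak[OF k u(1) w] by blast
  have lin: "linear (L x)" for x using L(1) has_derivative_linear by blast
  define f where "f x = norm (mol k (g 1) x) + norm (mol k (g 2) x) + norm (mol k (g 3) x)" for x
  have gc: "cont (mol k (g j))" for j by (rule mol_continuous[OF kernel_ccs[OF k] g(1)])
  have fc: "cont f" unfolding f_def by (intro continuous_intros gc)
  have fm: "f \<in> BM" by (rule borel_measurable_continuous_onI[OF fc])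
  have f0: "0 <= f x" for x by (simp add: f_def)
  have vm: "mol k u \<in> BM" by (rule mol_measurable[OF kernel_ccs[OF k] u(1)])
  have H: "ennreal (norm (mol k u x)) <= ennreal (norm (mol k u (x + b)))
    + (\<integral>\<^sup>+t. ennreal (4 * \<beta> * t^3 * f (x + t^4 *\<^sub>R b)) * indicator {0<..<1} t \<partial>lborel)"
   if x: "x \<in> D" and b: "b \<in> ball c \<rho>" for x b
  proof (rule ennreal_norm_le_segment[where L=L, OF L(1) _ fc f0 \<beta>0 L(2) lin])
   fix t :: real assume t: "0 <= t" "t <= 1"
   have nb: "norm b <= \<beta>" using b norm_triangle_sub[of b c] by (simp add: \<beta>_def dist_norm norm_minus_commute)
   have sub: "cball ((x + t *\<^sub>R b) + \<epsilon> *\<^sub>R c) (\<epsilon> * \<rho> / 2) \<subseteq> U"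
   proof
    fix z assume "z \<in> cball ((x + t *\<^sub>R b) + \<epsilon> *\<^sub>R c) (\<epsilon> * \<rho> / 2)"
    then have z: "norm ((x + t *\<^sub>R b) + \<epsilon> *\<^sub>R c - z) <= \<epsilon> * \<rho> / 2" by (simp add: dist_norm)
    define e where "e = (z - x - t *\<^sub>R b) /\<^sub>R \<epsilon>"
    have ze: "z = x + t *\<^sub>R b + \<epsilon> *\<^sub>R e" using \<epsilon> by (simp add: e_def)
    have "\<epsilon> * norm (c - e) <= \<epsilon> * (\<rho> / 2)"
    proof -
     have "(x + t *\<^sub>R b) + \<epsilon> *\<^sub>R c - z = \<epsilon> *\<^sub>R (c - e)" unfolding ze by (simp add: algebra_simps)
     then show ?thesis using z \<epsilon> by simp
    qed
    then have "e \<in> ball c \<rho>" using \<epsilon> \<rho> by (simp add: dist_norm)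
    then have "(t / (t + \<epsilon>)) *\<^sub>R b + (\<epsilon> / (t + \<epsilon>)) *\<^sub>R e \<in> ball c \<rho>"
     using b t \<epsilon> by (intro convexD[OF convex_ball]) (auto simp: add_divide_distrib[symmetric])
    from cone[OF x _ _ this, of "t + \<epsilon>"] t \<epsilon>
    show "z \<in> U" unfolding ze by (simp add: scaleR_add_right add.assoc)
   qed
   have "norm (L (x + t *\<^sub>R b) b) <= norm (b $ 1 *\<^sub>R mol k (g 1) (x + t *\<^sub>R b)) + norm (b $ 2 *\<^sub>R mol k (g 2) (x + t *\<^sub>R b)) + norm (b $ 3 *\<^sub>R mol k (g 3) (x + t *\<^sub>R b))"
    unfolding L(3)[OF sub] by (meson norm_triangle_ineq norm_triangle_mono order_refl)
   also have "... <= norm b * norm (mol k (g 1) (x + t *\<^sub>R b)) + norm b * norm (mol k (g 2) (x + t *\<^sub>R b)) + norm b * norm (mol k (g 3) (x + t *\<^sub>R b))"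
    unfolding norm_scaleR real_norm_def using component_le_norm_cart[of b] by (intro add_mono mult_right_mono) auto
   also have "... = norm b * f (x + t *\<^sub>R b)" by (simp add: f_def algebra_simps)
   also have "... <= \<beta> * f (x + t *\<^sub>R b)" by (rule mult_right_mono[OF nb f0])
   finally show "norm (L (x + t *\<^sub>R b) b) <= \<beta> * f (x + t *\<^sub>R b)" .
  qed
  have "m^4 * (\<integral>\<^sup>+x. ennreal (norm (mol k u x) ^ 4) * indicator D x \<partial>lborel)
   <= 16 * ((m + pN 2 (mol k u))^4 * emeasure lborel D + ennreal ((4 * \<beta>)^4) * m^3 * (pN 2 f)^2)"
   unfolding m_def by (rule gradient_potential_bound[OF vm fm D(1) f0 _ H]) (use \<beta>0 in simp)
  also have "... <= X"
   unfolding X_def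
  proof (intro mult_left_mono add_mono mult_right_mono power_mono order_refl)
   show "pN 2 (mol k u) <= pN 2 u" by (rule pN_mol_le[OF k u(1)]) simp
   have mm: "mol k (g j) \<in> BM" for j by (rule mol_measurable[OF kernel_ccs[OF k] g(1)])
   note [measurable] = mm
   have pe: "pN 2 f = pN 2 (%x. (norm (mol k (g 1) x) + norm (mol k (g 2) x)) + norm (mol k (g 3) x))"
    by (simp add: f_def[abs_def])
   have pn: "pN 2 (%x. norm (mol k (g j) x)) <= pN 2 (g j)" for j
   proof -
    have "pN 2 (%x. norm (mol k (g j) x)) = pN 2 (mol k (g j))" by (simp add: pN_def)
    also have "... <= pN 2 (g j)" by (rule pN_mol_le[OF k g(1)]) simp
    finally show ?thesis .
   qed
   have "pN 2 f <= 2^2 * (pN 2 (%x. norm (mol k (g 1) x) + norm (mol k (g 2) x)) + pN 2 (%x. norm (mol k (g 3) x)))"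
    unfolding pe by (rule pN_add_le) measurable
   also have "... <= 2^2 * (2^2 * (pN 2 (%x. norm (mol k (g 1) x)) + pN 2 (%x. norm (mol k (g 2) x))) + pN 2 (%x. norm (mol k (g 3) x)))"
    by (intro mult_left_mono add_right_mono pN_add_le) auto
   also have "... <= 2^2 * (2^2 * (pN 2 (g 1) + pN 2 (g 2)) + 2^2 * pN 2 (g 3))"
   proof (intro mult_left_mono add_mono pn)
    have "pN 2 (%x. norm (mol k (g 3) x)) <= 1 * pN 2 (g 3)" using pn by simp
    also have "... <= 2^2 * pN 2 (g 3)" by (intro mult_right_mono) (auto simp: one_le_power)
    finally show "pN 2 (%x. norm (mol k (g 3) x)) <= 2^2 * pN 2 (g 3)" .
   qed auto
   also have "... = 16 * Gs" by (simp add: Gs_def algebra_simps)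
   finally show "pN 2 f <= 16 * Gs" .
  qed auto
  finally show ?thesis .
 qed
 define \<epsilon> where "\<epsilon> n = 1 / real (Suc n)" for n
 have \<epsilon>: "0 < \<epsilon> n" "\<epsilon> n <= 1" for n by (auto simp: \<epsilon>_def)
 have \<epsilon>lim: "\<epsilon> \<longlonglongrightarrow> 0" unfolding \<epsilon>_def using LIMSEQ_Suc[OF lim_const_over_n[of 1]] by simp
 have "\<forall>n. \<exists>k. kernel (\<epsilon> n *\<^sub>R c) (\<epsilon> n * \<rho> / 2) k"
 proof
  fix n
  have "0 < \<epsilon> n * \<rho> / 2" using \<epsilon>(1)[of n] \<rho> by simp
  then obtain k where "kernel (\<epsilon> n *\<^sub>R c) (\<epsilon> n * \<rho> / 2) k" by (rule kernel_exists)
  then show "\<exists>k. kernel (\<epsilon> n *\<^sub>R c) (\<epsilon> n * \<rho> / 2) k" by blast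
 qed
 from choice[OF this] obtain k where k: "\<And>n. kernel (\<epsilon> n *\<^sub>R c) (\<epsilon> n * \<rho> / 2) (k n)" by blast
 have lim0: "(%n. norm (\<epsilon> n *\<^sub>R c) + \<epsilon> n * \<rho> / 2) \<longlonglongrightarrow> 0"
 proof -
  have "(%n. norm (\<epsilon> n *\<^sub>R c) + \<epsilon> n * \<rho> / 2) \<longlonglongrightarrow> norm ((0::real) *\<^sub>R c) + 0 * \<rho> / 2"
   by (intro tendsto_intros \<epsilon>lim) simp_all
  then show ?thesis by simp
 qed
 have mi: "L1 (%x. mol (k n) u x - u x)" for n
 proof -
  have "pN 1 (mol (k n) u) <= pN 1 u" by (rule pN_mol_le[OF k u(1)]) simp
  moreover have "pN 1 u < \<infinity>" using u(1) unfolding pN_finite_iff[OF um] by simp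
  ultimately have "pN 1 (mol (k n) u) < \<infinity>" by (rule le_less_trans)
  then have "L1 (%x. norm (mol (k n) u x))"
   using pN_finite_iff[OF mol_measurable[OF kernel_ccs[OF k] u(1)], of 1] by simp
  then have "L1 (mol (k n) u)"
   using mol_measurable[OF kernel_ccs[OF k] u(1)] by (simp add: integrable_norm_iff)
  then show ?thesis using u(1) by simp
 qed
 have L1: "(%n. \<integral>x. norm (mol (k n) u x - u x) \<partial>lborel) \<longlonglongrightarrow> 0"
 proof (rule order_tendstoI)
  show "\<forall>\<^sub>F n in sequentially. a < (LBINT x. norm (mol (k n) u x - u x))" if "a < 0" for a
   by (rule always_eventually) (use that in \<open>auto intro: less_le_trans\<close>)
  fix e :: real assume e: "0 < e"
  have "pN 1 u < \<infinity>" using u(1) unfolding pN_finite_iff[OF um] by simp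
  from pN_mol_converges[OF k lim0 u(1) this order_refl e]
  show "\<forall>\<^sub>F n in sequentially. (LBINT x. norm (mol (k n) u x - u x)) < e"
  proof eventually_elim
   case (elim n)
   have "ennreal (LBINT x. norm (mol (k n) u x - u x)) = pN 1 (%x. mol (k n) u x - u x)"
    unfolding pN_def using nn_integral_eq_integral[OF integrable_norm[OF mi[of n]]] by simp
   then have "ennreal (LBINT x. norm (mol (k n) u x - u x)) < ennreal e" using elim by simp
   then show ?case by (subst (asm) ennreal_less_iff) auto
  qed
 qed
 from tendsto_L1_AE_subseq[OF mi L1] obtain r where r: "strict_mono r"
  "AE x in lborel. (%n. mol (k (r n)) u x - u x) \<longlonglongrightarrow> 0" by blast
 have mm: "mol (k n) u \<in> BM" for n by (rule mol_measurable[OF kernel_ccs[OF k] u(1)])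
 note [measurable] = mm
 have "(\<integral>\<^sup>+x. m^4 * (ennreal (norm (u x) ^ 4) * indicator D x) \<partial>lborel)
   <= (\<integral>\<^sup>+x. liminf (%n. m^4 * (ennreal (norm (mol (k (r n)) u x) ^ 4) * indicator D x)) \<partial>lborel)"
 proof (rule nn_integral_mono_AE)
  show "AE x in lborel. m^4 * (ennreal (norm (u x) ^ 4) * indicator D x)
   <= liminf (%n. m^4 * (ennreal (norm (mol (k (r n)) u x) ^ 4) * indicator D x))"
   using r(2)
  proof eventually_elim
   case (elim x)
   from tendsto_add[OF elim tendsto_const[of "u x"]]
   have "(%n. mol (k (r n)) u x) \<longlonglongrightarrow> u x" by simp
   then have "(%n. norm (mol (k (r n)) u x) ^ 4) \<longlonglongrightarrow> norm (u x) ^ 4" by (intro tendsto_intros)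
   then have "(%n. ennreal (norm (mol (k (r n)) u x) ^ 4)) \<longlonglongrightarrow> ennreal (norm (u x) ^ 4)" by (rule tendsto_ennrealI)
   then have "(%n. m^4 * (ennreal (norm (mol (k (r n)) u x) ^ 4) * indicator D x)) \<longlonglongrightarrow> m^4 * (ennreal (norm (u x) ^ 4) * indicator D x)"
   proof (cases "x \<in> D")
    case True
    have "m^4 < top" using m(2) by (simp add: power_less_top_ennreal)
    from ennreal_tendsto_cmult[OF this \<open>(%n. ennreal (norm (mol (k (r n)) u x) ^ 4)) \<longlonglongrightarrow> ennreal (norm (u x) ^ 4)\<close>]
    show ?thesis using True by simp
   qed simp
   then show ?case by (simp add: lim_imp_Liminf)
  qed
 qed
 also have "... <= liminf (%n. \<integral>\<^sup>+x. m^4 * (ennreal (norm (mol (k (r n)) u x) ^ 4) * indicator D x) \<partial>lborel)"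
  by (rule nn_integral_liminf) measurable
 also have "... <= X"
 proof (rule order_trans[OF Liminf_le_Limsup Limsup_bounded])
  show "\<forall>\<^sub>F n in sequentially. (\<integral>\<^sup>+x. m^4 * (ennreal (norm (mol (k (r n)) u x) ^ 4) * indicator D x) \<partial>lborel) <= X"
  proof (rule always_eventually, rule allI)
   fix n
   have "(\<integral>\<^sup>+x. m^4 * (ennreal (norm (mol (k (r n)) u x) ^ 4) * indicator D x) \<partial>lborel)
    = m^4 * (\<integral>\<^sup>+x. ennreal (norm (mol (k (r n)) u x) ^ 4) * indicator D x \<partial>lborel)"
    by (rule nn_integral_cmult) measurable
   also have "... <= X" by (rule bound[OF k \<epsilon>])
   finally show "(\<integral>\<^sup>+x. m^4 * (ennreal (norm (mol (k (r n)) u x) ^ 4) * indicator D x) \<partial>lborel) <= X" .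
  qed
 qed simp
 finally have "(\<integral>\<^sup>+x. m^4 * (ennreal (norm (u x) ^ 4) * indicator D x) \<partial>lborel) <= X" .
 moreover have "(\<integral>\<^sup>+x. m^4 * (ennreal (norm (u x) ^ 4) * indicator D x) \<partial>lborel)
   = m^4 * (\<integral>\<^sup>+x. ennreal (norm (u x) ^ 4) * indicator D x \<partial>lborel)"
  by (rule nn_integral_cmult) measurable
 ultimately have "m^4 * (\<integral>\<^sup>+x. ennreal (norm (u x) ^ 4) * indicator D x \<partial>lborel) <= X" by (simp only:)
 from le_less_trans[OF this Xfin] m(1)
 have "(\<integral>\<^sup>+x. ennreal (norm (u x) ^ 4) * indicator D x \<partial>lborel) < \<infinity>"
  unfolding infinity_ennreal_def ennreal_mult_less_top by (elim disjE conjE) (simp_all only: power_eq_0_iff simp_thms ennreal_zero_less_top)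
 moreover have "(\<integral>\<^sup>+x. ennreal (norm (u x) ^ 4) * indicator D x \<partial>lborel) = (\<integral>\<^sup>+x. ennreal (norm (indicator D x * norm (u x) ^ 4)) \<partial>lborel)"
  by (rule nn_integral_cong) (simp add: indicator_def)
 ultimately show ?thesis by (subst integrable_iff_bounded) auto
qed

section \<open>The cone property at a smooth boundary\<close>

lemma smooth_fun_lipschitz_on_cball:
 fixes g :: "'a::euclidean_space => real"
 assumes g: "smooth_fun g"
 obtains M where "0 <= M" "\<And>x y. x \<in> cball 0 r ==> y \<in> cball 0 r ==> \<bar>g x - g y\<bar> <= M * norm (x - y)"
proof -
 let ?D = "%x. frechet_derivative g (at x)"
 have d: "(g has_derivative ?D x) (at x)" for x
  using g higher_partials.base[of g] by (auto simp: smooth_fun_def differentiable_on_def frechet_derivative_works[symmetric])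
 have pc: "cont (%x. ?D x i)" if "i \<in> Basis" for i
  using g higher_partials.step[OF higher_partials.base that, of g]
  by (auto simp: smooth_fun_def intro: differentiable_imp_continuous_on)
 define S where "S x = (\<Sum>i\<in>Basis. \<bar>?D x i\<bar>)" for x
 have "continuous_on (cball 0 r) S"
  unfolding S_def by (intro continuous_intros continuous_on_subset[OF pc]) auto
 then have "compact (S ` cball 0 r)" by (rule compact_continuous_image) simp
 then obtain M where M: "M > 0" "\<And>y. y \<in> S ` cball 0 r ==> norm y <= M"
  by (meson bounded_pos compact_imp_bounded)
 have on: "onorm (?D x) <= M" if "x \<in> cball 0 r" for x
 proof (rule onorm_bound)
  fix v
  have lin: "linear (?D x)" using d has_derivative_linear by blast
  have "?D x (\<Sum>i\<in>Basis. (v \<bullet> i) *\<^sub>R i) = (\<Sum>i\<in>Basis. (v \<bullet> i) * ?D x i)"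
   by (simp add: linear_sum[OF lin] linear_cmul[OF lin])
  then have "norm (?D x v) = \<bar>\<Sum>i\<in>Basis. (v \<bullet> i) * ?D x i\<bar>" by (simp add: euclidean_representation)
  also have "... <= (\<Sum>i\<in>Basis. \<bar>(v \<bullet> i) * ?D x i\<bar>)" by (rule sum_abs)
  also have "... = (\<Sum>i\<in>Basis. \<bar>v \<bullet> i\<bar> * \<bar>?D x i\<bar>)" by (simp add: abs_mult)
  also have "... <= (\<Sum>i\<in>Basis. norm v * \<bar>?D x i\<bar>)"
   by (intro sum_mono mult_right_mono Basis_le_norm) auto
  also have "... = norm v * S x" by (simp add: S_def sum_distrib_left)
  also have "... <= norm v * M" using M(2)[of "S x"] that by (intro mult_left_mono) auto
  finally show "norm (?D x v) <= M * norm v" by (simp add: mult.commute)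
 qed (use M in simp)
 have "\<bar>g x - g y\<bar> <= M * norm (x - y)" if "x \<in> cball 0 r" "y \<in> cball 0 r" for x y
  using differentiable_bound[OF convex_cball has_derivative_at_withinI[OF d] on that] by simp
 then show ?thesis using that M(1) by (meson less_imp_le)
qed

lemma norm_vector2_le:
 fixes y :: "real^3"
 shows "norm (vector [y $ 1, y $ 2] :: real^2) <= norm y"
 by (simp add: norm_eq_sqrt_inner inner_vec_def sum_2 sum_3)

text \<open>Near a boundary point, in rotated coordinates, \<Omega> lies below a graph with
  Lipschitz constant M. Descending at rate \<tau> with a deviation of at most \<rho> stays below the
  graph as soon as (1 + M) \<rho> < \<tau>.\<close>

lemma boundary_cone:
 assumes sb: "smooth_boundary \<Omega>" and p: "p \<in> frontier \<Omega>"
 shows "\<exists>r>0. \<exists>c \<rho>. 0 < \<rho> \<and> (\<forall>x\<in>\<Omega> \<inter> ball p r. \<forall>t b. 0 < t --> t <= 2 --> b \<in> ball c \<rho> --> x + t *\<^sub>R b \<in> \<Omega>)"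
proof -
 obtain R :: "real^3 => real^3" and r0 and g :: "real^2 => real" where R: "orthogonal_transformation R" and r0: "r0 > 0"
  and g: "smooth_fun g"
  and ch: "\<And>x. x \<in> ball p r0 ==> x \<in> \<Omega> \<longleftrightarrow> (R (x - p)) $ 3 < g (vector [(R (x - p)) $ 1, (R (x - p)) $ 2])"
  using sb p unfolding smooth_boundary_def by metis
 obtain M where M: "0 <= M" "\<And>x y. x \<in> cball 0 r0 ==> y \<in> cball 0 r0 ==> \<bar>g x - g y\<bar> <= M * norm (x - y)"
  using smooth_fun_lipschitz_on_cball[OF g] by metis
 have lin: "linear R" and nR: "\<And>x. norm (R x) = norm x"
  using R by (auto simp: orthogonal_transformation_linear orthogonal_transformation_norm)
 \<comment> \<open>This value keeps the displacement \<open>2 * (\<tau> + \<rho>)\<close> below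
   \<open>r0/2\<close>, so the end point remains in the chart; \<rho> is chosen to make
   \<open>(1 + M) * \<rho> = \<tau>/2\<close>.\<close>
 define \<tau> where "\<tau> = r0 / 8"
 define \<rho> where "\<rho> = \<tau> / (2 * (1 + M))"
 have \<tau>: "\<tau> > 0" using r0 by (simp add: \<tau>_def)
 have \<rho>: "0 < \<rho>" "(1 + M) * \<rho> = \<tau> / 2" "\<rho> <= \<tau> / 2"
 proof -
  have gen: "a * (\<tau> / (2 * a)) = \<tau> / 2" if "a > 0" for a using that by simp
  show "0 < \<rho>" "(1 + M) * \<rho> = \<tau> / 2" using \<tau> M(1) gen[of "1 + M"] by (auto simp: \<rho>_def simp del: times_divide_eq_right)
  then show "\<rho> <= \<tau> / 2" using M(1) by (smt (verit) mult_le_cancel_right1)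
 qed
 obtain c where c: "R c = - (\<tau> *\<^sub>R axis 3 1)" using orthogonal_transformation_surj[OF R] by (metis surjD)
 have nc: "norm c = \<tau>" using nR[of c] \<tau> by (simp add: c)
 have "x + t *\<^sub>R b \<in> \<Omega>" if x: "x \<in> \<Omega>" "x \<in> ball p (r0/2)" and t: "0 < t" "t <= 2" and b: "b \<in> ball c \<rho>" for x t b
 proof -
  have bc: "norm (b - c) < \<rho>" using b by (simp add: dist_norm norm_minus_commute)
  have nb: "norm b <= \<tau> + \<rho>" using bc nc norm_triangle_sub[of b c] by simp
  have tb: "norm (t *\<^sub>R b) <= 2 * (\<tau> + \<rho>)" unfolding norm_scaleR using t nb \<rho> \<tau> by (intro mult_mono) auto
  have xp: "norm (x - p) < r0 / 2" using x by (simp add: dist_norm norm_minus_commute)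
  have xtp: "norm (x + t *\<^sub>R b - p) < r0"
  proof -
   have "norm (x + t *\<^sub>R b - p) <= norm (x - p) + norm (t *\<^sub>R b)"
    using norm_triangle_ineq[of "x - p" "t *\<^sub>R b"] by (simp add: algebra_simps)
   also have "... < r0/2 + 2 * (\<tau> + \<rho>)" using xp tb by linarith
   also have "... <= r0" using \<rho>(3) r0 by (simp add: \<tau>_def)
   finally show ?thesis .
  qed
  define y where "y = R (x - p)"
  define w where "w = R b"
  have yw: "R (x + t *\<^sub>R b - p) = y + t *\<^sub>R w"
  proof -
   have "x + t *\<^sub>R b - p = (x - p) + t *\<^sub>R b" by simp
   then show ?thesis by (simp only: y_def w_def linear_add[OF lin] linear_cmul[OF lin])
  qed
  have wc: "norm (w + \<tau> *\<^sub>R axis 3 1) < \<rho>"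
  proof -
   have "w + \<tau> *\<^sub>R axis 3 1 = R (b - c)" unfolding w_def linear_diff[OF lin] c by simp
   then show ?thesis using bc nR by simp
  qed
  have w3: "w $ 3 <= - \<tau> + \<rho>"
   using component_le_norm_cart[of "w + \<tau> *\<^sub>R axis 3 1" 3] wc by (simp add: axis_def)
  let ?q = "%z::real^3. (vector [z $ 1, z $ 2] :: real^2)"
  have q: "norm (?q w) <= \<rho>"
  proof -
   have "?q w = ?q (w + \<tau> *\<^sub>R axis 3 1)" by (simp add: axis_def)
   then show ?thesis using norm_vector2_le[of "w + \<tau> *\<^sub>R axis 3 1"] wc by simp
  qed
  have qa: "?q (y + t *\<^sub>R w) - ?q y = t *\<^sub>R ?q w" by (simp add: vec_eq_iff forall_2)
  have ny: "norm y = norm (x - p)" unfolding y_def by (rule nR)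
  have nyw: "norm (y + t *\<^sub>R w) = norm (x + t *\<^sub>R b - p)" unfolding yw[symmetric] by (rule nR)
  have in1: "?q y \<in> cball 0 r0"
   unfolding mem_cball dist_0_norm using norm_vector2_le[of y] xp r0 ny by linarith
  have in2: "?q (y + t *\<^sub>R w) \<in> cball 0 r0"
   unfolding mem_cball dist_0_norm using norm_vector2_le[of "y + t *\<^sub>R w"] xtp nyw by linarith
  have nq: "norm (?q y - ?q (y + t *\<^sub>R w)) = t * norm (?q w)"
  proof -
   have "norm (?q y - ?q (y + t *\<^sub>R w)) = norm (t *\<^sub>R ?q w)" unfolding qa[symmetric] by (rule norm_minus_commute)
   then show ?thesis using t by (simp only: norm_scaleR real_norm_def abs_of_pos)
  qed
  have "g (?q y) - g (?q (y + t *\<^sub>R w)) <= M * norm (?q y - ?q (y + t *\<^sub>R w))" using M(2)[OF in1 in2] by linarith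
  also have "... = M * (t * norm (?q w))" by (simp only: nq)
  also have "... <= M * (t * \<rho>)" using q M(1) t by (intro mult_left_mono) auto
  finally have G: "g (?q y) <= g (?q (y + t *\<^sub>R w)) + M * (t * \<rho>)" by simp
  have "x \<in> ball p r0" using x r0 by simp
  then have y3: "y $ 3 < g (?q y)" using ch[of x] x(1) by (simp add: y_def)
  have "(y + t *\<^sub>R w) $ 3 <= y $ 3 + t * (- \<tau> + \<rho>)" using mult_left_mono[OF w3, of t] t by simp
  also have "... < g (?q (y + t *\<^sub>R w)) + M * (t * \<rho>) + t * (- \<tau> + \<rho>)" using y3 G by linarith
  also have "... = g (?q (y + t *\<^sub>R w)) + t * ((1 + M) * \<rho> - \<tau>)" by (simp add: algebra_simps)
  also have "... <= g (?q (y + t *\<^sub>R w))" unfolding \<rho>(2) using t \<tau> by (simp add: mult_le_0_iff)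
  finally have "(y + t *\<^sub>R w) $ 3 < g (?q (y + t *\<^sub>R w))" .
  moreover have "x + t *\<^sub>R b \<in> ball p r0" using xtp by (simp add: dist_norm norm_minus_commute)
  ultimately show ?thesis using ch[of "x + t *\<^sub>R b"] by (simp only: yw)
 qed
 then show ?thesis using r0 \<rho>(1) by (intro exI[of _ "r0/2"] conjI exI[of _ c] exI[of _ \<rho>]) auto
qed

text \<open>Every point of the closure has a neighbourhood with a common cone: a small ball of
  directions about 0 in the interior, the downward cone at the boundary. Finitely many of these
  neighbourhoods cover the closure.\<close>

lemma L4_on_smooth_domain:
 fixes u :: "real^3 => 'b::euclidean_space"
 assumes \<Omega>: "bounded \<Omega>" "open \<Omega>" "smooth_boundary \<Omega>"
  and u: "L1 u" "L1 (%x. (norm (u x))^2)"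
  and g: "\<And>j. L1 (g j)" "\<And>j. L1 (%x. (norm (g j x))^2)"
  and w: "weak_deriv \<Omega> u g" and z: "\<And>x. x \<notin> \<Omega> ==> u x = 0"
 shows "L1 (%x. norm (u x) ^ 4)"
proof -
 have loc: "\<exists>r>0. L1 (%x. indicator (\<Omega> \<inter> ball p r) x * norm (u x) ^ 4)" if p: "p \<in> closure \<Omega>" for p
 proof (cases "p \<in> \<Omega>")
  case True
  then obtain r where r: "r > 0" "ball p r \<subseteq> \<Omega>" using \<Omega>(2) openE by blast
  have cone: "x + t *\<^sub>R b \<in> \<Omega>" if "x \<in> \<Omega> \<inter> ball p (r/2)" "0 < t" "t <= 2" "b \<in> ball 0 (r/4)" for x t b
  proof -
   have "norm (t *\<^sub>R b) <= 2 * (r/4)" unfolding norm_scaleR using that r by (intro mult_mono) auto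
   moreover have "norm (p - x) < r/2" using that by (simp add: dist_norm)
   ultimately have "norm (p - (x + t *\<^sub>R b)) < r"
    using norm_triangle_ineq4[of "p - x" "t *\<^sub>R b"] by (simp add: algebra_simps)
   then show ?thesis using r(2) by (auto simp: dist_norm)
  qed
  have "L1 (%x. indicator (\<Omega> \<inter> ball p (r/2)) x * norm (u x) ^ 4)"
   by (rule L4_on_cone_domain[where c=0 and \<rho>="r/4", OF u g w _ _ _ cone]) (use \<Omega> r in auto)
  then show ?thesis using r by (intro exI[of _ "r/2"]) auto
 next
  case False
  then have "p \<in> frontier \<Omega>" using p \<Omega>(2) by (simp add: frontier_def interior_open)
  from boundary_cone[OF \<Omega>(3) this]
  obtain r c \<rho> where r: "r > 0" "0 < \<rho>" "\<And>x t b. x \<in> \<Omega> \<inter> ball p r ==> 0 < t ==> t <= 2 ==> b \<in> ball c \<rho> ==> x + t *\<^sub>R b \<in> \<Omega>"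
   by blast
  have "L1 (%x. indicator (\<Omega> \<inter> ball p r) x * norm (u x) ^ 4)"
   by (rule L4_on_cone_domain[OF u g w _ _ r(2,3)]) (use \<Omega> in auto)
  then show ?thesis using r by blast
 qed
 then obtain r where r: "\<And>p. p \<in> closure \<Omega> ==> r p > 0"
  "\<And>p. p \<in> closure \<Omega> ==> L1 (%x. indicator (\<Omega> \<inter> ball p (r p)) x * norm (u x) ^ 4)" by metis
 have comp: "compact (closure \<Omega>)" using \<Omega>(1) by (simp add: compact_closure)
 have "closure \<Omega> \<subseteq> (\<Union>p\<in>closure \<Omega>. ball p (r p))" using r(1) by force
 then obtain T where T: "T \<subseteq> closure \<Omega>" "finite T" "closure \<Omega> \<subseteq> (\<Union>p\<in>T. ball p (r p))"
  using compactE_image[OF comp, of "closure \<Omega>" "%p. ball p (r p)"] by auto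
 have um: "u \<in> BM" using u(1) by auto
 show ?thesis
 proof (rule Bochner_Integration.integrable_bound)
  show "L1 (%x. \<Sum>p\<in>T. indicator (\<Omega> \<inter> ball p (r p)) x * norm (u x) ^ 4)"
   by (intro Bochner_Integration.integrable_sum r(2)) (use T in auto)
  show "(%x. norm (u x) ^ 4) \<in> borel_measurable lborel" using um by measurable
  show "AE x in lborel. norm (norm (u x) ^ 4) <= norm (\<Sum>p\<in>T. indicator (\<Omega> \<inter> ball p (r p)) x * norm (u x) ^ 4)"
  proof (rule AE_I2)
   fix x
   have nn: "0 <= (\<Sum>p\<in>T. indicator (\<Omega> \<inter> ball p (r p)) x * norm (u x) ^ 4)" by (intro sum_nonneg) auto
   have "norm (u x) ^ 4 <= (\<Sum>p\<in>T. indicator (\<Omega> \<inter> ball p (r p)) x * norm (u x) ^ 4)"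
   proof (cases "x \<in> \<Omega>")
    case True
    then obtain p where p: "p \<in> T" "x \<in> ball p (r p)" using T(3) closure_subset by blast
    have "norm (u x) ^ 4 = indicator (\<Omega> \<inter> ball p (r p)) x * norm (u x) ^ 4" using p True by simp
    also have "... <= (\<Sum>p\<in>T. indicator (\<Omega> \<inter> ball p (r p)) x * norm (u x) ^ 4)"
     by (rule member_le_sum[OF p(1)]) (use T in auto)
    finally show ?thesis .
   qed (use z nn in simp)
   then show "norm (norm (u x) ^ 4) <= norm (\<Sum>p\<in>T. indicator (\<Omega> \<inter> ball p (r p)) x * norm (u x) ^ 4)"
    using nn by simp
  qed
 qed
qed

section \<open>Lower bound for the Ginzburg--Landau energy\<close>

lemma indicator_scaleR_absorb:
 fixes f :: "'a => 'b::real_vector"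
 assumes "\<And>x. x \<notin> U ==> f x = 0"
 shows "(%x. indicator U x *\<^sub>R f x) = f"
proof
 fix x show "indicator U x *\<^sub>R f x = f x" using assms[of x] by (cases "x \<in> U") auto
qed

text \<open>A function and its gradient in the form that mollification needs: Borel, integrable on
  the whole space, extended by 0. The extension may jump at the boundary, so the weak derivative is
  claimed only inside U.\<close>

definition sobolev_rep :: "(real^3) set => (real^3 => 'b::euclidean_space) => (3 => real^3 => 'b) => bool" where
 "sobolev_rep U u g \<longleftrightarrow> L1 u \<and> L1 (%x. (norm (u x))^2) \<and>
   (\<forall>j. L1 (g j)) \<and> (\<forall>j. L1 (%x. (norm (g j x))^2)) \<and>
   (\<forall>x. x \<notin> U --> u x = 0) \<and> (\<forall>j x. x \<notin> U --> g j x = 0) \<and> weak_deriv U u g"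

lemma integrable_of_square:
 fixes u :: "real^3 => 'b::euclidean_space"
 assumes u: "u \<in> BM" and u2: "L1 (%x. (norm (u x))^2)"
  and U: "U \<in> sets borel" "bounded U" and z: "\<And>x. x \<notin> U ==> u x = 0"
 shows "L1 u"
proof (rule Bochner_Integration.integrable_bound)
 have "L1 (indicator U :: real^3 => real)"
  using U emeasure_bounded_finite[OF U(2)] by (simp add: integrable_indicator_iff)
 then show "L1 (%x. indicator U x + (norm (u x))^2)" using u2 by simp
 show "u \<in> borel_measurable lborel" using u by simp
 show "AE x in lborel. norm (u x) <= norm (indicator U x + (norm (u x))^2)"
 proof (rule AE_I2)
  fix x
  have "norm (u x) <= indicator U x + (norm (u x))^2"
  proof (cases "x \<in> U")
   case True
   have "2 * norm (u x) <= 1 + (norm (u x))^2" using sum_squares_bound[of 1 "norm (u x)"] by simp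
   then have "norm (u x) <= 1 + (norm (u x))^2" using norm_ge_zero[of "u x"] by linarith
   then show ?thesis using True by simp
  qed (use z in simp)
  then show "norm (u x) <= norm (indicator U x + (norm (u x))^2)" by simp
 qed
qed

lemma L2_rep:
 fixes f :: "real^3 => 'b::euclidean_space"
 assumes U: "U \<in> sets borel" "bounded U" and f: "L2 U f"
 shows "\<exists>u. L1 u \<and> L1 (%x. (norm (u x))^2) \<and> (\<forall>x. x \<notin> U --> u x = 0)
  \<and> (AE x in lborel. x \<in> U --> f x = u x)"
proof -
 from lebesgue_on_borel_rep[OF U(1), of f] f obtain u where u: "u \<in> BM"
  "AE x in lborel. x \<in> U --> f x = u x" "\<And>x. x \<notin> U ==> u x = 0" unfolding L2_def by blast
 have m: "(%x. (norm (u x))^2) \<in> BM" using u(1) by measurable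
 have ae: "AE x in lborel. x \<in> U --> (norm (f x))^2 = (norm (u x))^2" using u(2) by eventually_elim auto
 have "L1 (%x. indicator U x *\<^sub>R (norm (u x))^2)"
  using lebesgue_on_transfer(3)[OF U(1) m ae] f by (simp add: L2_def)
 also have "(%x. indicator U x *\<^sub>R (norm (u x))^2) = (%x. (norm (u x))^2)" by (rule indicator_scaleR_absorb) (simp add: u(3))
 finally have i2: "L1 (%x. (norm (u x))^2)" .
 show ?thesis using integrable_of_square[OF u(1) i2 U u(3)] i2 u by blast
qed

text \<open>\<open>wgrad\<close> is an arbitrary choice among weak gradients, of which only the
  defining equation is known; uniqueness transfers the square integrability of G to it. The weak
  gradient is taken on the larger V (the whole space for vector potentials), the representatives on
  the bounded U.\<close>

lemma sobolev_repI:
 fixes \<psi> :: "real^3 => 'b::euclidean_space"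
 assumes U: "open U" "bounded U" and V: "U \<subseteq> V" "open V" and \<psi>: "L2 U \<psi>" and G: "weak_grad V \<psi> G" "\<And>j. L2 U (G j)"
  and W: "weak_grad V \<psi> W"
 shows "\<exists>u g. sobolev_rep U u g \<and> (AE x in lborel. x \<in> U --> \<psi> x = u x) \<and> (\<forall>j. AE x in lborel. x \<in> U --> W j x = g j x)"
proof -
 have UB: "U \<in> sets borel" and VB: "V \<in> sets borel" using U V by auto
 from L2_rep[OF UB U(2) \<psi>] obtain u where u: "L1 u" "L1 (%x. (norm (u x))^2)"
  "\<And>x. x \<notin> U ==> u x = 0" "AE x in lborel. x \<in> U --> \<psi> x = u x" by blast
 have "\<forall>j. \<exists>u. L1 u \<and> L1 (%x. (norm (u x))^2) \<and> (\<forall>x. x \<notin> U --> u x = 0)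
  \<and> (AE x in lborel. x \<in> U --> G j x = u x)" using L2_rep[OF UB U(2) G(2)] by blast
 from choice[OF this] obtain g where g: "\<And>j. L1 (g j)" "\<And>j. L1 (%x. (norm (g j x))^2)"
  "\<And>j x. x \<notin> U ==> g j x = 0" "\<And>j. AE x in lborel. x \<in> U --> G j x = g j x" by blast
 have WG: "AE x in lborel. x \<in> U --> W j x = g j x" for j
 proof -
  have "AE x in lborel. x \<in> V --> W j x = G j x"
   by (rule weak_partial_unique[OF V(2)]) (use G(1) W in \<open>auto simp: weak_grad_def\<close>)
  then show ?thesis using g(4)[of j] by eventually_elim (use V in auto)
 qed
 have "weak_deriv U u g"
  unfolding weak_deriv_def
 proof (intro allI impI)
  fix j \<phi> assume tf: "test_fun U \<phi>"
  then have tfV: "test_fun V \<phi>" using V by (auto simp: test_fun_def)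
  note T = test_fun_C1[OF tf]
  have tr: "(\<integral>x. q x *\<^sub>R f x \<partial>lebesgue_on V) = (LBINT x. q x *\<^sub>R f' x)"
   if q: "cont q" "\<And>x. x \<notin> U ==> q x = 0" and f': "L1 f'" "AE x in lborel. x \<in> U --> f x = f' x"
   for q :: "real^3 => real" and f f' :: "real^3 => 'b"
  proof -
   have qm: "q \<in> BM" by (rule borel_measurable_continuous_onI[OF q(1)])
   have fm: "f' \<in> BM" using f'(1) by auto
   have gm: "(%x. q x *\<^sub>R f' x) \<in> BM" using qm fm by measurable
   have "AE x in lborel. x \<in> V --> q x *\<^sub>R f x = q x *\<^sub>R f' x" using f'(2) by eventually_elim (use q in auto)
   from lebesgue_on_transfer(2)[OF VB gm this]
   have "(\<integral>x. q x *\<^sub>R f x \<partial>lebesgue_on V) = (LBINT x. indicator V x *\<^sub>R q x *\<^sub>R f' x)" .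
   also have "(%x. indicator V x *\<^sub>R q x *\<^sub>R f' x) = (%x. q x *\<^sub>R f' x)"
   proof
    fix x show "indicator V x *\<^sub>R q x *\<^sub>R f' x = q x *\<^sub>R f' x"
     using q(2)[of x] V(1) by (cases "x \<in> V") auto
   qed
   finally show ?thesis .
  qed
  have "weak_partial V \<psi> j (G j)" using G(1) by (simp add: weak_grad_def)
  from conjunct2[OF this[unfolded weak_partial_def], rule_format, OF tfV]
  have "(\<integral>x. pd j \<phi> x *\<^sub>R \<psi> x \<partial>lebesgue_on V) = - (\<integral>x. \<phi> x *\<^sub>R G j x \<partial>lebesgue_on V)" .
  then show "(LBINT x. pd j \<phi> x *\<^sub>R u x) = - (LBINT x. \<phi> x *\<^sub>R g j x)"
   using tr[OF T(2) T(6) u(1,4)] tr[OF ccs_continuous[OF T(3)] T(5) g(1,4)] by simp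
 qed
 then have "sobolev_rep U u g" unfolding sobolev_rep_def using u g by blast
 then show ?thesis using u(4) WG by blast
qed

lemma H1_rep:
 assumes \<Omega>: "open \<Omega>" "bounded \<Omega>" and \<psi>: "H1 \<Omega> \<psi>"
 shows "\<exists>u g. sobolev_rep \<Omega> u g \<and> (AE x in lborel. x \<in> \<Omega> --> \<psi> x = u x) \<and>
  (\<forall>j. AE x in lborel. x \<in> \<Omega> --> wgrad \<Omega> \<psi> j x = g j x)"
proof -
 obtain G where G: "weak_grad \<Omega> \<psi> G" "\<And>j. L2 \<Omega> (G j)" and L: "L2 \<Omega> \<psi>" using \<psi> unfolding H1_def by blast
 have W: "weak_grad \<Omega> \<psi> (wgrad \<Omega> \<psi>)" unfolding wgrad_def by (rule someI[of _ G]) (rule G(1))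
 show ?thesis by (rule sobolev_repI[OF \<Omega> order_refl \<Omega>(1) L G W])
qed

text \<open>Splitting a Bochner integral requires integrability of each product; the support of the
  test function reduces this to a compact set, where local integrability is available.\<close>

lemma weak_partial_add:
 fixes u v :: "real^3 => 'b::euclidean_space"
 assumes U: "open U" and u: "weak_partial U u j u'" and v: "weak_partial U v j v'"
 shows "weak_partial U (%x. u x + v x) j (%x. u' x + v' x)"
proof -
 have ti: "integrable (lebesgue_on U) (%x. q x *\<^sub>R f x)"
  if q: "cont q" "\<And>x. x \<notin> K ==> q x = 0" and K: "compact K" "K \<subseteq> U" and f: "integrable (lebesgue_on K) f"
  for q :: "real^3 => real" and f :: "real^3 => 'b" and K
 proof -
  have KB: "K \<in> sets borel" using K by (simp add: borel_compact)
  from lebesgue_on_borel_rep[OF KB borel_measurable_integrable[OF f]]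
  obtain f' where f': "f' \<in> BM" "AE x in lborel. x \<in> K --> f x = f' x" "\<And>x. x \<notin> K ==> f' x = 0" by blast
  have "L1 (%x. indicator K x *\<^sub>R f' x)" using lebesgue_on_transfer(3)[OF KB f'(1,2)] f by blast
  also have "(%x. indicator K x *\<^sub>R f' x) = f'" by (rule indicator_scaleR_absorb[OF f'(3)])
  finally have fi: "L1 f'" .
  have qc: "ccs q"
  proof -
   obtain R where "\<And>x. x \<in> K ==> norm x <= R" using compact_imp_bounded[OF K(1)] unfolding bounded_iff by blast
   then show ?thesis by (intro ccsI[OF q(1), where R=R]) (meson leD q(2))
  qed
  have qi: "L1 (%x. q x *\<^sub>R f' x)" using ccs_mult_integrable[OF qc fi, of 0] by simp
  have UB: "U \<in> sets borel" using U by simp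
  have "AE x in lborel. x \<in> U --> q x *\<^sub>R f x = q x *\<^sub>R f' x" using f'(2) by eventually_elim (use q in auto)
  from lebesgue_on_transfer(3)[OF UB borel_measurable_integrable[OF qi, simplified] this]
  have "integrable (lebesgue_on U) (%x. q x *\<^sub>R f x) \<longleftrightarrow> L1 (%x. indicator U x *\<^sub>R q x *\<^sub>R f' x)" .
  also have "(%x. indicator U x *\<^sub>R q x *\<^sub>R f' x) = (%x. q x *\<^sub>R f' x)"
  proof
   fix x show "indicator U x *\<^sub>R q x *\<^sub>R f' x = q x *\<^sub>R f' x" using q(2)[of x] K(2) by (cases "x \<in> U") auto
  qed
  finally show ?thesis using qi by simp
 qed
 show ?thesis
  unfolding weak_partial_def
 proof (intro conjI allI impI, goal_cases)
  case (1 K) then show ?case using u v by (auto simp: weak_partial_def)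
 next
  case (2 K) then show ?case using u v by (auto simp: weak_partial_def)
 next
  case (3 \<phi>)
  define K where "K = closure {x. \<phi> x \<noteq> 0}"
  have K: "compact K" "K \<subseteq> U" using 3 by (auto simp: test_fun_def K_def)
  have "test_fun K \<phi>" using 3 by (auto simp: test_fun_def K_def)
  note T = test_fun_C1[OF this]
  have iK: "integrable (lebesgue_on K) u" "integrable (lebesgue_on K) v" "integrable (lebesgue_on K) u'" "integrable (lebesgue_on K) v'"
   using u v K by (auto simp: weak_partial_def)
  note i = ti[OF T(2) T(6) K iK(1)] ti[OF T(2) T(6) K iK(2)]
   ti[OF ccs_continuous[OF T(3)] T(5) K iK(3)] ti[OF ccs_continuous[OF T(3)] T(5) K iK(4)]
  from conjunct2[OF u[unfolded weak_partial_def], rule_format, OF 3] conjunct2[OF v[unfolded weak_partial_def], rule_format, OF 3]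
  show ?case unfolding scaleR_add_right using i by simp
 qed
qed

lemma L2_mono:
 fixes f :: "real^3 => 'b::euclidean_space"
 assumes f: "L2 V f" and UV: "U \<subseteq> V" "U \<in> sets borel" "V \<in> sets borel"
 shows "L2 U f"
proof -
 have V: "V \<inter> space lebesgue \<in> sets lebesgue" and U: "U \<inter> space lebesgue \<in> sets lebesgue" using UV by auto
 have "f \<in> borel_measurable (lebesgue_on V)" "integrable (lebesgue_on V) (%x. (norm (f x))^2)"
  using f by (auto simp: L2_def)
 then have 1: "(%x. indicator V x *\<^sub>R f x) \<in> borel_measurable lebesgue"
  "integrable lebesgue (%x. indicator V x *\<^sub>R (norm (f x))^2)"
  using borel_measurable_restrict_space_iff[OF V, of f] integrable_restrict_space[OF V, of "%x. (norm (f x))^2"] by auto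
 have UL: "U \<in> sets lebesgue" using UV by simp
 have eq: "(%x. indicator U x *\<^sub>R indicator V x *\<^sub>R k x) = (%x. indicator U x *\<^sub>R k x)" for k :: "real^3 => 'c::real_vector"
  using UV(1) by (intro ext) (auto simp: indicator_def)
 have "(%x. indicator U x *\<^sub>R indicator V x *\<^sub>R f x) \<in> borel_measurable lebesgue"
  by (intro borel_measurable_scaleR borel_measurable_indicator UL 1)
 moreover have "integrable lebesgue (%x. indicator U x *\<^sub>R indicator V x *\<^sub>R (norm (f x))^2)"
  by (rule integrable_mult_indicator[OF UL 1(2)])
 ultimately have "(%x. indicator U x *\<^sub>R f x) \<in> borel_measurable lebesgue"
  "integrable lebesgue (%x. indicator U x *\<^sub>R (norm (f x))^2)" unfolding eq by blast+
 then show ?thesis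
  using borel_measurable_restrict_space_iff[OF U, of f] integrable_restrict_space[OF U, of "%x. (norm (f x))^2"]
  unfolding L2_def by blast
qed

lemma L2_add:
 fixes f g :: "real^3 => 'b::euclidean_space"
 assumes f: "L2 U f" and g: "L2 U g"
 shows "L2 U (%x. f x + g x)"
proof -
 have m: "f \<in> borel_measurable (lebesgue_on U)" "g \<in> borel_measurable (lebesgue_on U)"
  and i: "integrable (lebesgue_on U) (%x. (norm (f x))^2)" "integrable (lebesgue_on U) (%x. (norm (g x))^2)"
  using f g by (auto simp: L2_def)
 note [measurable] = m
 have "integrable (lebesgue_on U) (%x. (norm (f x + g x))^2)"
 proof (rule Bochner_Integration.integrable_bound)
  show "integrable (lebesgue_on U) (%x. 2^2 * ((norm (f x))^2 + (norm (g x))^2))" using i by simp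
  show "(%x. (norm (f x + g x))^2) \<in> borel_measurable (lebesgue_on U)" by measurable
  show "AE x in lebesgue_on U. norm ((norm (f x + g x))^2) <= norm (2^2 * ((norm (f x))^2 + (norm (g x))^2))"
  proof (rule AE_I2)
   fix x
   have "(norm (f x + g x))^2 <= (norm (f x) + norm (g x))^2" by (intro power_mono norm_triangle_ineq) auto
   also have "... <= 2^2 * ((norm (f x))^2 + (norm (g x))^2)" by (rule power_sum_le) auto
   finally show "norm ((norm (f x + g x))^2) <= norm (2^2 * ((norm (f x))^2 + (norm (g x))^2))" by simp
  qed
 qed
 then show ?thesis unfolding L2_def by (intro conjI) measurable
qed

lemma L2_continuous:
 fixes f :: "real^3 => 'b::euclidean_space"
 assumes c: "cont f" and U: "U \<in> sets borel" "bounded U"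
 shows "L2 U f"
proof -
 obtain a where a: "U \<subseteq> cbox (-a) a" using bounded_subset_cbox_symmetric[OF U(2)] by metis
 have fm: "f \<in> BM" by (rule borel_measurable_continuous_onI[OF c])
 have fm2: "(%x. (norm (f x))^2) \<in> BM" using fm by measurable
 have K: "cbox (-a) a \<in> sets borel" by simp
 have "L1 (%x. indicator (cbox (-a) a) x *\<^sub>R (norm (f x))^2)"
  by (rule borel_integrable_compact) (auto intro!: continuous_intros continuous_on_subset[OF c])
 then have "L2 (cbox (-a) a) f"
  using lebesgue_on_transfer(1)[OF K fm, of f] lebesgue_on_transfer(3)[OF K fm2, of "%x. (norm (f x))^2"]
  by (simp add: L2_def)
 then show ?thesis by (rule L2_mono[OF _ a U(1) K])
qed

lemma F_field_linear: "linear (%x. F_field x $ j)"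
proof -
 have "j = 1 \<or> j = 2 \<or> j = 3" by (rule exhaust_3)
 then show ?thesis
  by (elim disjE; simp only:; intro linearI; simp add: F_field_def add_divide_distrib diff_divide_distrib)
qed

lemma F_field_weak_partial: "weak_partial UNIV (%x. F_field x $ j) k (%x. F_field (axis k 1) $ j)"
proof -
 have "((%x. F_field x $ j) has_derivative (%v. F_field v $ j)) (at x)" for x
  by (rule linear_imp_has_derivative[OF F_field_linear])
 from weak_partial_C1[OF open_UNIV this] show ?thesis by simp
qed

text \<open>Write A as F plus an element of the homogeneous space: F is linear with constant
  gradient, and the remainder is locally square integrable with a globally square integrable
  gradient. The ball of radius 2 R leaves room for the cones of the L^4 estimate on the ball of
  radius R.\<close>

lemma potential_rep:
 assumes A: "Hdot1_div_F A" and R: "R > 0"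
 shows "\<exists>a d. sobolev_rep (ball 0 (2 * R)) a d \<and> (AE x in lborel. x \<in> ball 0 (2 * R) --> A x $ j = a x) \<and>
   (\<forall>k. AE x in lborel. x \<in> ball 0 (2 * R) --> wgrad UNIV (%y. A y $ j) k x = d k x) \<and>
   L1 (%x. indicator (ball 0 R) x * norm (a x) ^ 4)"
  and "\<exists>G. (\<forall>k. L2 UNIV (G k)) \<and> (\<forall>k. AE x in lborel. wgrad UNIV (%y. A y $ j) k x = G k x + F_field (axis k 1) $ j)"
proof -
 let ?w = "%x. A x $ j - F_field x $ j" and ?B = "ball (0::real^3) (2 * R)"
 from A have "Hdot1 ?w" by (auto simp: Hdot1_div_F_def)
 then obtain G where w: "\<And>K. compact K ==> L2 K ?w" and G: "weak_grad UNIV ?w G" "\<And>k. L2 UNIV (G k)"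
  unfolding Hdot1_def by blast
 define G' where "G' k x = G k x + F_field (axis k 1) $ j" for k x
 have G'w: "weak_grad UNIV (%x. A x $ j) G'"
  unfolding weak_grad_def
 proof
  fix k
  have "weak_partial UNIV ?w k (G k)" using G(1) by (simp add: weak_grad_def)
  from weak_partial_add[OF open_UNIV this F_field_weak_partial[of j k]] show "weak_partial UNIV (%x. A x $ j) k (G' k)" by (simp add: G'_def[abs_def])
 qed
 define W where "W = wgrad UNIV (%y. A y $ j)"
 have W: "weak_grad UNIV (%y. A y $ j) W" unfolding W_def wgrad_def by (rule someI[of _ G']) (rule G'w)
 have Fc: "cont (%x. F_field x $ j)" by (rule linear_continuous_on[OF linear_conv_bounded_linear[THEN iffD1, OF F_field_linear]])
 have B: "?B \<in> sets borel" "bounded ?B" by auto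
 have wB: "L2 ?B ?w" by (rule L2_mono[OF w[of "cball 0 (2 * R)"]]) auto
 have AB: "L2 ?B (%x. A x $ j)" using L2_add[OF wB L2_continuous[OF Fc B]] by simp
 have G'B: "L2 ?B (G' k)" for k
  unfolding G'_def by (rule L2_add[OF L2_mono[OF G(2)] L2_continuous[OF continuous_on_const B]]) auto
 from sobolev_repI[OF open_ball bounded_ball subset_UNIV open_UNIV AB G'w G'B W]
 obtain a d where ad: "sobolev_rep ?B a d" "AE x in lborel. x \<in> ?B --> A x $ j = a x" "\<forall>k. AE x in lborel. x \<in> ?B --> W k x = d k x" by blast
 have "L1 (%x. indicator (ball 0 R) x * norm (a x) ^ 4)"
 proof (rule L4_on_cone_domain[where g=d and c=0 and \<rho>="R/2" and U="?B"])
  show "x + t *\<^sub>R b \<in> ?B" if "x \<in> ball 0 R" "0 < t" "t <= 2" "b \<in> ball 0 (R/2)" for x b :: "real^3" and t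
  proof -
   have "norm (t *\<^sub>R b) <= 2 * (R/2)" unfolding norm_scaleR using that R by (intro mult_mono) auto
   then show ?thesis using that norm_triangle_ineq[of x "t *\<^sub>R b"] by simp
  qed
 qed (use ad(1) R in \<open>auto simp: sobolev_rep_def\<close>)
 then show "\<exists>a d. sobolev_rep ?B a d \<and> (AE x in lborel. x \<in> ?B --> A x $ j = a x) \<and>
   (\<forall>k. AE x in lborel. x \<in> ?B --> wgrad UNIV (%y. A y $ j) k x = d k x) \<and>
   L1 (%x. indicator (ball 0 R) x * norm (a x) ^ 4)"
  using ad unfolding W_def by blast
 have "AE x in lborel. W k x = G k x + F_field (axis k 1) $ j" for k
 proof -
  have "AE x in lborel. x \<in> UNIV --> W k x = G' k x"
   by (rule weak_partial_unique[OF open_UNIV]) (use W G'w in \<open>auto simp: weak_grad_def\<close>)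
  then show ?thesis by (simp add: G'_def)
 qed
 then show "\<exists>G. (\<forall>k. L2 UNIV (G k)) \<and> (\<forall>k. AE x in lborel. wgrad UNIV (%y. A y $ j) k x = G k x + F_field (axis k 1) $ j)"
  using G(2) unfolding W_def by blast
qed

lemma curl_norm2:
 "(norm (curlA A x - beta_vec))^2 =
   (wgrad UNIV (%y. A y $ 3) 2 x - wgrad UNIV (%y. A y $ 2) 3 x)^2 +
   (wgrad UNIV (%y. A y $ 1) 3 x - wgrad UNIV (%y. A y $ 3) 1 x)^2 +
   (wgrad UNIV (%y. A y $ 2) 1 x - wgrad UNIV (%y. A y $ 1) 2 x - 1)^2"
 by (simp only: power2_norm_eq_inner inner_vec_def sum_3)
   (simp add: curlA_def beta_vec_def Let_def power2_eq_square)

text \<open>The curl of F is \<open>beta_vec\<close>, so in the difference the constant parts cancel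
  and only the square integrable parts G of the gradients remain.\<close>

lemma curl_integrable:
 assumes A: "Hdot1_div_F A"
 shows "integrable lebesgue (%x. (norm (curlA A x - beta_vec))^2)"
proof -
 have "\<forall>j. \<exists>G. (\<forall>k. L2 UNIV (G k)) \<and> (\<forall>k. AE x in lborel. wgrad UNIV (%y. A y $ j) k x = G k x + F_field (axis k 1) $ j)"
  using potential_rep(2)[OF A zero_less_one] by blast
 from choice[OF this] obtain G where G: "\<And>j k. L2 UNIV (G j k)"
  "\<And>j k. AE x in lborel. wgrad UNIV (%y. A y $ j) k x = G j k x + F_field (axis k 1) $ j" by blast
 have Gm: "G j k \<in> borel_measurable lebesgue" and Gi: "integrable lebesgue (%x. (G j k x)^2)" for j k
  using G(1)[of j k] by (simp_all add: L2_def lebesgue_on_UNIV_eq)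
 note [measurable] = Gm
 have d2: "integrable lebesgue (%x. (G j k x - G l m x)^2)" for j k l m
 proof (rule Bochner_Integration.integrable_bound)
  show "integrable lebesgue (%x. 2 * ((G j k x)^2 + (G l m x)^2))" using Gi by simp
  show "(%x. (G j k x - G l m x)^2) \<in> borel_measurable lebesgue" by measurable
  show "AE x in lebesgue. norm ((G j k x - G l m x)^2) <= norm (2 * ((G j k x)^2 + (G l m x)^2))"
  proof (rule AE_I2)
   fix x
   have "0 <= (G j k x + G l m x)^2" by simp
   then have "(G j k x - G l m x)^2 <= 2 * ((G j k x)^2 + (G l m x)^2)" by (simp add: power2_eq_square algebra_simps)
   then show "norm ((G j k x - G l m x)^2) <= norm (2 * ((G j k x)^2 + (G l m x)^2))" by simp
  qed
 qed
 define S where "S x = (G 3 2 x - G 2 3 x)^2 + (G 1 3 x - G 3 1 x)^2 + (G 2 1 x - G 1 2 x)^2" for x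
 have Si: "integrable lebesgue S" unfolding S_def by (intro Bochner_Integration.integrable_add d2)
 have ae: "AE x in lebesgue. S x = (norm (curlA A x - beta_vec))^2"
 proof (rule AE_completion)
  show "AE x in lborel. S x = (norm (curlA A x - beta_vec))^2"
   using G(2)[of 3 2] G(2)[of 2 3] G(2)[of 1 3] G(2)[of 3 1] G(2)[of 2 1] G(2)[of 1 2]
   by eventually_elim (simp add: curl_norm2 S_def F_field_def axis_def)
 qed
 have "S \<in> borel_measurable lebesgue" using Si by auto
 note Sm = this borel_measurable_AE[OF this ae]
 show ?thesis using integrable_cong_AE[OF Sm ae] Si by blast
qed

text \<open>Only the horizontal covariant derivatives and the third component of the field are kept.
  Every piece is shown to be integrable, the product of potential and order parameter and the
  quartic term by the L^4 bounds; otherwise the energy integral could take the default value 0 and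
  the inequality would fail.\<close>

lemma GL_energy_lower_rep:
 assumes \<Omega>: "bounded \<Omega>" "open \<Omega>" "smooth_boundary \<Omega>" and R: "R > 0" "\<Omega> \<subseteq> ball 0 R"
  and \<psi>: "H1 \<Omega> \<psi>" and A: "Hdot1_div_F A"
 shows "\<exists>u g (a :: 3 => real^3 => real) (d :: 3 => 3 => real^3 => real). sobolev_rep \<Omega> u g \<and> (\<forall>j. sobolev_rep (ball 0 (2 * R)) (a j) (d j)) \<and>
   L1 (%x. norm (u x) ^ 4) \<and> (\<forall>j. L1 (%x. indicator (ball 0 R) x * norm (a j x) ^ 4)) \<and>
   (\<forall>\<kappa> H U. U \<in> sets borel --> U \<subseteq> \<Omega> -->
    L1 (%x. indicator U x * ((cmod (g 1 x - \<i> * of_real (\<kappa> * H * a 1 x) * u x))^2 + (cmod (g 2 x - \<i> * of_real (\<kappa> * H * a 2 x) * u x))^2)) \<and>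
    L1 (%x. indicator U x * (1 - (cmod (u x))\<^sup>2)^2) \<and>
    L1 (%x. indicator U x * (d 2 1 x - d 1 2 x - 1)^2) \<and>
    (LBINT x. indicator U x * ((cmod (g 1 x - \<i> * of_real (\<kappa> * H * a 1 x) * u x))^2 + (cmod (g 2 x - \<i> * of_real (\<kappa> * H * a 2 x) * u x))^2))
    + \<kappa>^2/2 * (LBINT x. indicator U x * (1 - (cmod (u x))\<^sup>2)^2)
    + \<kappa>^2 * H^2 * (LBINT x. indicator U x * (d 2 1 x - d 1 2 x - 1)^2) <= GL_energy \<Omega> \<kappa> H \<psi> A)"
proof -
 from H1_rep[OF \<Omega>(2,1) \<psi>] obtain u g where ug: "sobolev_rep \<Omega> u g" "AE x in lborel. x \<in> \<Omega> --> \<psi> x = u x"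
  "\<And>j. AE x in lborel. x \<in> \<Omega> --> wgrad \<Omega> \<psi> j x = g j x" by blast
 have "\<forall>j. (\<exists>ad. sobolev_rep (ball 0 (2 * R)) (fst ad) (snd ad) \<and> (AE x in lborel. x \<in> ball 0 (2 * R) --> A x $ j = fst ad x) \<and>
   (\<forall>k. AE x in lborel. x \<in> ball 0 (2 * R) --> wgrad UNIV (%y. A y $ j) k x = snd ad k x) \<and>
   L1 (%x. indicator (ball 0 R) x * norm (fst ad x) ^ 4))" (is "\<forall>j. ?P j")
 proof
  fix j
  from potential_rep(1)[OF A R(1), of j] obtain a d where ad: "sobolev_rep (ball 0 (2 * R)) a d"
   "AE x in lborel. x \<in> ball 0 (2 * R) --> A x $ j = a x"
   "\<forall>k. AE x in lborel. x \<in> ball 0 (2 * R) --> wgrad UNIV (%y. A y $ j) k x = d k x"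
   "L1 (%x. indicator (ball 0 R) x * norm (a x) ^ 4)" by (elim exE conjE)
  show "?P j" by (rule exI[of _ "(a, d)"]) (simp only: fst_conv snd_conv ad simp_thms)
 qed
 from choice[OF this] obtain ad where ad: "\<And>j. sobolev_rep (ball 0 (2 * R)) (fst (ad j)) (snd (ad j))"
   "\<And>j. AE x in lborel. x \<in> ball 0 (2 * R) --> A x $ j = fst (ad j) x"
   "\<And>j k. AE x in lborel. x \<in> ball 0 (2 * R) --> wgrad UNIV (%y. A y $ j) k x = snd (ad j) k x"
   "\<And>j. L1 (%x. indicator (ball 0 R) x * norm (fst (ad j) x) ^ 4)" by blast
 define a where "a j = fst (ad j)" for j
 define d where "d j = snd (ad j)" for j
 note ad = ad[folded a_def d_def]
 have \<Omega>B: "\<Omega> \<in> sets borel" using \<Omega> by simp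
 have R2: "x \<in> ball 0 (2 * R)" "x \<in> ball 0 R" if "x \<in> \<Omega>" for x using R that by auto
 have i: "L1 u" "L1 (g j)" "L1 (%x. (norm (g j x))^2)"
  "L1 (a k)" "L1 (d k j)" "L1 (%x. (norm (d k j x))^2)" for j k
  using ug(1) ad(1)[of k] by (auto simp: sobolev_rep_def)
 have um: "u \<in> BM" and gm: "g j \<in> BM" and am: "a j \<in> BM"
  and dm: "d j k \<in> BM" for j k using i by auto
 note [measurable] = um gm am dm
 have u4: "L1 (%x. norm (u x) ^ 4)"
  by (rule L4_on_smooth_domain[OF \<Omega>, where g=g]) (use ug(1) in \<open>auto simp: sobolev_rep_def\<close>)
 have one: "L1 (%x. indicator \<Omega> x :: real)"
  using \<Omega>B emeasure_bounded_finite[OF \<Omega>(1)] by (simp add: integrable_indicator_iff)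
 have ki: "L1 (%x. indicator U x * (cmod (g j x - \<i> * of_real (\<kappa> * H * a j x) * u x))^2)"
  and pi: "L1 (%x. indicator U x * (1 - (cmod (u x))\<^sup>2)^2)"
  if U: "U \<in> sets borel" "U \<subseteq> \<Omega>" for j \<kappa> H U
 proof -
  note [measurable] = U(1)
  show "L1 (%x. indicator U x * (cmod (g j x - \<i> * of_real (\<kappa> * H * a j x) * u x))^2)"
  proof (rule Bochner_Integration.integrable_bound)
   show "L1 (%x. 2 * (norm (g j x))^2 + (\<kappa> * H)^2 * (indicator (ball 0 R) x * norm (a j x) ^ 4 + norm (u x) ^ 4))"
    using i(3)[of j] ad(4)[of j] u4 by simp
   show "(%x. indicator U x * (cmod (g j x - \<i> * of_real (\<kappa> * H * a j x) * u x))^2) \<in> borel_measurable lborel" by measurable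
   show "AE x in lborel. norm (indicator U x * (cmod (g j x - \<i> * of_real (\<kappa> * H * a j x) * u x))^2)
    <= norm (2 * (norm (g j x))^2 + (\<kappa> * H)^2 * (indicator (ball 0 R) x * norm (a j x) ^ 4 + norm (u x) ^ 4))"
   proof (rule AE_I2)
    fix x
    have nn: "0 <= 2 * (norm (g j x))^2 + (\<kappa> * H)^2 * (indicator (ball 0 R) x * norm (a j x) ^ 4 + norm (u x) ^ 4)"
     by (intro add_nonneg_nonneg mult_nonneg_nonneg) auto
    show "norm (indicator U x * (cmod (g j x - \<i> * of_real (\<kappa> * H * a j x) * u x))^2)
     <= norm (2 * (norm (g j x))^2 + (\<kappa> * H)^2 * (indicator (ball 0 R) x * norm (a j x) ^ 4 + norm (u x) ^ 4))"
    proof (cases "x \<in> U")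
     case True
     then have xR: "x \<in> ball 0 R" using U R2 by blast
     define G where "G = norm (g j x)"
     define B where "B = \<bar>\<kappa> * H\<bar> * (\<bar>a j x\<bar> * norm (u x))"
     have "cmod (g j x - \<i> * of_real (\<kappa> * H * a j x) * u x) <= G + B"
      by (rule order_trans[OF norm_triangle_ineq4]) (simp add: G_def B_def norm_mult abs_mult)
     then have "(cmod (g j x - \<i> * of_real (\<kappa> * H * a j x) * u x))^2 <= (G + B)^2" by (intro power_mono) auto
     also have "... <= 2 * G^2 + 2 * B^2" using sum_squares_bound[of G B] by (simp add: power2_sum)
     also have "2 * B^2 <= (\<kappa> * H)^2 * (norm (a j x) ^ 4 + norm (u x) ^ 4)"
     proof -
      have "2 * (\<bar>a j x\<bar>\<^sup>2 * (norm (u x))^2) <= (\<bar>a j x\<bar>\<^sup>2)^2 + ((norm (u x))^2)^2"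
       using sum_squares_bound[of "\<bar>a j x\<bar>\<^sup>2" "(norm (u x))^2"] by (simp add: mult.assoc)
      then have "(\<kappa> * H)^2 * (2 * (\<bar>a j x\<bar>\<^sup>2 * (norm (u x))^2)) <= (\<kappa> * H)^2 * (norm (a j x) ^ 4 + norm (u x) ^ 4)"
       by (intro mult_left_mono) (simp_all flip: power_mult)
      then show ?thesis by (simp add: B_def power_mult_distrib mult_ac)
     qed
     finally show ?thesis using True xR nn by (simp add: G_def)
    qed (use nn in simp)
   qed
  qed
  show "L1 (%x. indicator U x * (1 - (cmod (u x))\<^sup>2)^2)"
  proof (rule Bochner_Integration.integrable_bound)
   show "L1 (%x. indicator \<Omega> x + norm (u x) ^ 4)" using one u4 by simp
   show "(%x. indicator U x * (1 - (cmod (u x))\<^sup>2)^2) \<in> borel_measurable lborel" by measurable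
   show "AE x in lborel. norm (indicator U x * (1 - (cmod (u x))\<^sup>2)^2) <= norm (indicator \<Omega> x + norm (u x) ^ 4)"
   proof (rule AE_I2)
    fix x
    have "(1 - (cmod (u x))\<^sup>2)^2 <= 1 + norm (u x) ^ 4"
     by (simp add: power2_diff flip: power_mult)
    then show "norm (indicator U x * (1 - (cmod (u x))\<^sup>2)^2) <= norm (indicator \<Omega> x + norm (u x) ^ 4)"
     using U(2) by (auto simp: indicator_def)
   qed
  qed
 qed
 have di: "L1 (%x. indicator U x * (d 2 1 x - d 1 2 x - 1)^2)" if U: "U \<in> sets borel" "U \<subseteq> \<Omega>" for U
 proof (rule Bochner_Integration.integrable_bound)
  note [measurable] = U(1)
  show "L1 (%x. 3 * ((norm (d 2 1 x))^2 + (norm (d 1 2 x))^2 + indicator \<Omega> x))" using i one by simp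
  show "(%x. indicator U x * (d 2 1 x - d 1 2 x - 1)^2) \<in> borel_measurable lborel" by measurable
  show "AE x in lborel. norm (indicator U x * (d 2 1 x - d 1 2 x - 1)^2) <= norm (3 * ((norm (d 2 1 x))^2 + (norm (d 1 2 x))^2 + indicator \<Omega> x))"
  proof (rule AE_I2)
   fix x
   have "(p - q - 1)^2 <= 3 * (p^2 + q^2 + 1)" for p q :: real
   proof -
    have "3 * (p^2 + q^2 + 1) - (p - q - 1)\<^sup>2 = (p + q)^2 + (p + 1)^2 + (q - 1)^2" by algebra
    then show ?thesis by (smt (verit) zero_le_power2)
   qed
   from this[of "d 2 1 x" "d 1 2 x"]
   show "norm (indicator U x * (d 2 1 x - d 1 2 x - 1)^2) <= norm (3 * ((norm (d 2 1 x))^2 + (norm (d 1 2 x))^2 + indicator \<Omega> x))"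
    using U(2) by (auto simp: indicator_def)
  qed
 qed
 have main: "(LBINT x. indicator U x * ((cmod (g 1 x - \<i> * of_real (\<kappa> * H * a 1 x) * u x))^2 + (cmod (g 2 x - \<i> * of_real (\<kappa> * H * a 2 x) * u x))^2))
    + \<kappa>^2/2 * (LBINT x. indicator U x * (1 - (cmod (u x))\<^sup>2)^2)
    + \<kappa>^2 * H^2 * (LBINT x. indicator U x * (d 2 1 x - d 1 2 x - 1)^2) <= GL_energy \<Omega> \<kappa> H \<psi> A"
  if U: "U \<in> sets borel" "U \<subseteq> \<Omega>" for \<kappa> H U
 proof -
  define k where "k j x = (cmod (g j x - \<i> * of_real (\<kappa> * H * a j x) * u x))^2" for j x
  define q where "q x = (\<Sum>j\<in>UNIV. k j x) + \<kappa>^2/2 * (1 - (cmod (u x))\<^sup>2)^2" for x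
  have q3: "q x = k 1 x + k 2 x + k 3 x + \<kappa>^2/2 * (1 - (cmod (u x))\<^sup>2)^2" for x by (simp add: q_def sum_3)
  have qm: "q \<in> BM" unfolding q_def k_def by measurable
  note kI = ki[OF U, of _ \<kappa> H, folded k_def] and k\<Omega> = ki[OF \<Omega>B order_refl, of _ \<kappa> H, folded k_def]
  let ?F = "%x. (\<Sum>j\<in>UNIV. (cmod (wgrad \<Omega> \<psi> j x - \<i> * of_real (\<kappa> * H * A x $ j) * \<psi> x))^2) + \<kappa>^2 / 2 * (1 - (cmod (\<psi> x))\<^sup>2)^2"
  have ae: "AE x in lborel. x \<in> \<Omega> --> ?F x = q x"
   using ug(2) ug(3)[of 1] ug(3)[of 2] ug(3)[of 3] ad(2)[of 1] ad(2)[of 2] ad(2)[of 3]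
   by eventually_elim (use R2 in \<open>auto simp: q_def k_def sum_3\<close>)
  have I1: "integral\<^sup>L (lebesgue_on \<Omega>) ?F = (LBINT x. indicator \<Omega> x *\<^sub>R q x)"
   by (rule lebesgue_on_transfer(2)[OF \<Omega>B qm ae])
  have qeq: "(%x. indicator \<Omega> x *\<^sub>R q x) = (%x. indicator \<Omega> x * k 1 x + indicator \<Omega> x * k 2 x + indicator \<Omega> x * k 3 x
   + \<kappa>^2/2 * (indicator \<Omega> x * (1 - (cmod (u x))\<^sup>2)^2))"
   by (simp add: q3 fun_eq_iff algebra_simps)
  have q\<Omega>: "L1 (%x. indicator \<Omega> x *\<^sub>R q x)" unfolding qeq
   using k\<Omega>[of 1] k\<Omega>[of 2] k\<Omega>[of 3] pi[OF \<Omega>B order_refl] by simp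
  have "(LBINT x. indicator U x * (k 1 x + k 2 x)) + \<kappa>^2/2 * (LBINT x. indicator U x * (1 - (cmod (u x))\<^sup>2)^2)
   = (LBINT x. indicator U x * (k 1 x + k 2 x) + \<kappa>^2/2 * (indicator U x * (1 - (cmod (u x))\<^sup>2)^2))"
   using kI[of 1] kI[of 2] pi[OF U] by (simp add: distrib_left)
  also have "... <= (LBINT x. indicator \<Omega> x *\<^sub>R q x)"
  proof (rule integral_mono)
   show "L1 (%x. indicator U x * (k 1 x + k 2 x) + \<kappa>^2/2 * (indicator U x * (1 - (cmod (u x))\<^sup>2)^2))"
    using kI[of 1] kI[of 2] pi[OF U] by (simp add: distrib_left)
   fix x
   have nn: "0 <= k 1 x" "0 <= k 2 x" "0 <= k 3 x" "0 <= \<kappa>^2/2 * (1 - (cmod (u x))\<^sup>2)^2" by (auto simp: k_def)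
   show "indicator U x * (k 1 x + k 2 x) + \<kappa>^2/2 * (indicator U x * (1 - (cmod (u x))\<^sup>2)^2) <= indicator \<Omega> x *\<^sub>R q x"
    using nn U(2) by (cases "x \<in> U"; cases "x \<in> \<Omega>") (auto simp: q3)
  qed (rule q\<Omega>)
  finally have E1: "(LBINT x. indicator U x * (k 1 x + k 2 x)) + \<kappa>^2/2 * (LBINT x. indicator U x * (1 - (cmod (u x))\<^sup>2)^2)
   <= integral\<^sup>L (lebesgue_on \<Omega>) ?F" unfolding I1 .
  have dmm: "(%x. indicator U x * (d 2 1 x - d 1 2 x - 1)^2) \<in> borel_measurable lborel" using di[OF U] by (rule borel_measurable_integrable)
  have E2: "(LBINT x. indicator U x * (d 2 1 x - d 1 2 x - 1)^2) <= (\<integral>x. (norm (curlA A x - beta_vec))^2 \<partial>lebesgue)"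
   unfolding integral_completion[OF dmm, symmetric]
  proof (rule integral_mono_AE)
   show "integrable lebesgue (%x. indicator U x * (d 2 1 x - d 1 2 x - 1)^2)" using integrable_completion[OF dmm] di[OF U] by blast
   show "integrable lebesgue (%x. (norm (curlA A x - beta_vec))^2)" by (rule curl_integrable[OF A])
   show "AE x in lebesgue. indicator U x * (d 2 1 x - d 1 2 x - 1)^2 <= (norm (curlA A x - beta_vec))^2"
   proof (rule AE_completion)
    show "AE x in lborel. indicator U x * (d 2 1 x - d 1 2 x - 1)^2 <= (norm (curlA A x - beta_vec))^2"
     using ad(3)[of 2 1] ad(3)[of 1 2]
    proof eventually_elim
     case (elim x)
     show ?case
     proof (cases "x \<in> U")
      case True
      then have "x \<in> ball 0 (2 * R)" using U(2) R2 by blast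
      then show ?thesis using elim True by (simp add: curl_norm2)
     qed simp
    qed
   qed
  qed
  have "\<kappa>^2 * H^2 * (LBINT x. indicator U x * (d 2 1 x - d 1 2 x - 1)^2) <= \<kappa>^2 * H^2 * (\<integral>x. (norm (curlA A x - beta_vec))^2 \<partial>lebesgue)"
   by (rule mult_left_mono[OF E2]) simp
  with E1 show ?thesis unfolding GL_energy_def k_def by linarith
 qed
 have ki12: "L1 (%x. indicator U x * ((cmod (g 1 x - \<i> * of_real (\<kappa> * H * a 1 x) * u x))^2 + (cmod (g 2 x - \<i> * of_real (\<kappa> * H * a 2 x) * u x))^2))"
  if U: "U \<in> sets borel" "U \<subseteq> \<Omega>" for \<kappa> H U
  using ki[OF U, of 1 \<kappa> H] ki[OF U, of 2 \<kappa> H] by (simp add: distrib_left)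
 show ?thesis
  by (intro exI[of _ u] exI[of _ g] exI[of _ a] exI[of _ d] conjI allI impI ug(1) ad(1) u4 ad(4) ki12 pi di main)
qed

section \<open>Convergence of mollifications in L^p and of their products\<close>

definition Lp_conv :: "nat => (nat => real^3 => 'b::euclidean_space) => (real^3 => 'b) => bool" where
 "Lp_conv p F f \<longleftrightarrow> (\<forall>e>0. \<forall>\<^sub>F n in sequentially. pN p (%x. F n x - f x) < ennreal e)"

lemma Lp_convD: "Lp_conv p F f ==> 0 < e ==> \<forall>\<^sub>F n in sequentially. pN p (%x. F n x - f x) < ennreal e"
 by (simp add: Lp_conv_def)

lemma Lp_conv_mono:
 fixes F :: "nat => real^3 => 'b::euclidean_space" and G :: "nat => real^3 => 'c::euclidean_space"
 assumes G: "Lp_conv p G g" and le: "\<forall>\<^sub>F n in sequentially. \<forall>x. norm (F n x - f x) <= C * norm (G n x - g x)" and C: "0 < C"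
  and [measurable]: "\<And>n. G n \<in> BM" "g \<in> BM"
 shows "Lp_conv p F f"
 unfolding Lp_conv_def
proof (intro allI impI)
 fix e :: real assume e: "0 < e"
 have "\<forall>\<^sub>F n in sequentially. pN p (%x. G n x - g x) < ennreal (e / C ^ p)" using e C by (intro Lp_convD[OF G]) simp
 with le show "\<forall>\<^sub>F n in sequentially. pN p (%x. F n x - f x) < ennreal e"
 proof eventually_elim
  case (elim n)
  have "pN p (%x. F n x - f x) <= (\<integral>\<^sup>+x. ennreal (C ^ p) * ennreal (norm (G n x - g x) ^ p) \<partial>lborel)"
   unfolding pN_def
  proof (rule nn_integral_mono)
   fix x
   have "norm (F n x - f x) ^ p <= (C * norm (G n x - g x)) ^ p" using elim(1) by (intro power_mono) auto
   then show "ennreal (norm (F n x - f x) ^ p) <= ennreal (C ^ p) * ennreal (norm (G n x - g x) ^ p)"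
    using C by (simp add: power_mult_distrib ennreal_mult'[symmetric])
  qed
  also have "... = ennreal (C ^ p) * pN p (%x. G n x - g x)" unfolding pN_def by (rule nn_integral_cmult) measurable
  also have "... < ennreal (C ^ p) * ennreal (e / C ^ p)" using elim(2) C by (intro ennreal_mult_strict_left_mono) auto
  also have "... = ennreal e" using C e by (simp add: ennreal_mult'[symmetric])
  finally show ?case .
 qed
qed

lemma Lp_conv_add:
 fixes F G :: "nat => real^3 => 'b::euclidean_space"
 assumes F: "Lp_conv p F f" and G: "Lp_conv p G g"
  and [measurable]: "\<And>n. F n \<in> BM" "f \<in> BM"
   "\<And>n. G n \<in> BM" "g \<in> BM"
 shows "Lp_conv p (%n x. F n x + G n x) (%x. f x + g x)"
 unfolding Lp_conv_def
proof (intro allI impI)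
 fix e :: real assume e: "0 < e"
 define t where "t = e / 2 ^ Suc p"
 have t: "t > 0" using e by (simp add: t_def)
 have p2: "(2::ennreal) ^ p = ennreal (2 ^ p)" by (metis ennreal_numeral ennreal_power zero_le_numeral)
 from Lp_convD[OF F t] Lp_convD[OF G t] show "\<forall>\<^sub>F n in sequentially. pN p (%x. F n x + G n x - (f x + g x)) < ennreal e"
 proof eventually_elim
  case (elim n)
  have "pN p (%x. F n x + G n x - (f x + g x)) = pN p (%x. (F n x - f x) + (G n x - g x))" by (simp add: algebra_simps)
  also have "... <= 2 ^ p * (pN p (%x. F n x - f x) + pN p (%x. G n x - g x))" by (rule pN_add_le) measurable
  also have "... < 2 ^ p * (ennreal t + ennreal t)"
   unfolding p2 using elim by (intro ennreal_mult_strict_left_mono add_strict_mono) auto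
  also have "... = ennreal (2 ^ p * (t + t))" using t
   unfolding p2 by (simp add: ennreal_mult'[symmetric] ennreal_plus[symmetric] del: ennreal_plus)
  also have "2 ^ p * (t + t) = e" by (simp add: t_def)
  finally show ?case .
 qed
qed

lemma Lp_conv_integral:
 fixes F :: "nat => real^3 => 'b::euclidean_space"
 assumes c: "Lp_conv 2 F f" and fi: "L1 (%x. (norm (f x))^2)"
  and [measurable]: "\<And>n. F n \<in> BM" "f \<in> BM" and e: "0 < e"
 shows "\<forall>\<^sub>F n in sequentially. L1 (%x. (norm (F n x))^2) \<and> (LBINT x. (norm (F n x))^2) <= (LBINT x. (norm (f x))^2) + e"
proof -
 define I where "I = (LBINT x. (norm (f x))^2)"
 have I: "0 <= I" by (simp add: I_def)
 \<comment> \<open>Young's inequality with weight t: the surplus t of the limit integral costs at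
   most e/2, and the error, multiplied by 1 + 1/t, costs e/2.\<close>
 define t where "t = e / (2 * (I + 1))"
 have t: "t > 0" using e I by (simp add: t_def)
 define s where "s = (e/2) / (1 + 1/t)"
 have s: "s > 0" using e t by (simp add: s_def add_pos_pos)
 from Lp_convD[OF c s] show ?thesis
 proof eventually_elim
  case (elim n)
  let ?d = "%x. F n x - f x"
  have fin: "pN 2 ?d < \<infinity>" unfolding infinity_ennreal_def by (rule order.strict_trans[OF elim ennreal_less_top])
  have di: "L1 (%x. norm (?d x) ^ 2)" using fin by (subst (asm) pN_finite_iff) auto
  have "pN 2 ?d = ennreal (LBINT x. norm (?d x) ^ 2)" unfolding pN_def by (rule nn_integral_eq_integral[OF di]) simp
  then have dl: "(LBINT x. norm (?d x) ^ 2) <= s" using elim s by (simp add: ennreal_less_iff)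
  have pt: "(norm (F n x))^2 <= (1 + t) * (norm (f x))^2 + (1 + 1/t) * (norm (?d x))^2" for x
  proof -
   have y: "(a + b)^2 <= (1 + t) * a^2 + (1 + 1/t) * b^2" for a b :: real
   proof -
    have "(1 + t) * a^2 + (1 + 1/t) * b^2 - (a + b)\<^sup>2 = (t * a - b)^2 / t"
     using t by (simp add: field_simps power2_eq_square)
    then show ?thesis using t by (smt (verit) divide_nonneg_pos zero_le_power2)
   qed
   have "(norm (F n x))^2 <= (norm (f x) + norm (?d x))^2"
    using norm_triangle_ineq[of "f x" "?d x"] by (intro power_mono) auto
   then show ?thesis using y order_trans by blast
  qed
  have ri: "L1 (%x. (1 + t) * (norm (f x))^2 + (1 + 1/t) * (norm (?d x))^2)" using fi di by simp
  have Fi: "L1 (%x. (norm (F n x))^2)"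
  proof (rule Bochner_Integration.integrable_bound[OF ri])
   show "(%x. (norm (F n x))^2) \<in> borel_measurable lborel" by measurable
   show "AE x in lborel. norm ((norm (F n x))^2) <= norm ((1 + t) * (norm (f x))^2 + (1 + 1/t) * (norm (?d x))^2)"
    using pt by (intro AE_I2) (smt (verit) real_norm_def zero_le_power2)
  qed
  have "(LBINT x. (norm (F n x))^2) <= (LBINT x. (1 + t) * (norm (f x))^2 + (1 + 1/t) * (norm (?d x))^2)"
   by (rule integral_mono[OF Fi ri pt])
  also have "... = (1 + t) * I + (1 + 1/t) * (LBINT x. norm (?d x) ^ 2)" using fi di by (simp add: I_def)
  also have "... <= (1 + t) * I + (1 + 1/t) * s" using dl t by (intro add_left_mono mult_left_mono) auto
  also have "(1 + 1/t) * s = e/2"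
  proof -
   have "q * (e/2 / q) = e/2" if "q > 0" for q using that by simp
   then show ?thesis using t by (simp only: s_def add_pos_pos zero_less_one zero_less_divide_1_iff)
  qed
  also have "(1 + t) * I <= I + e/2"
  proof -
   have "t * I <= t * (I + 1)" using t by simp
   also have "... = e/2"
   proof -
    have "e / (2 * q) * q = e/2" if "q > 0" for q using that by simp
    then show ?thesis unfolding t_def using I by (simp only: add_nonneg_pos zero_less_one)
   qed
   finally show ?thesis by (simp add: algebra_simps)
  qed
  finally show ?case using Fi by (simp add: I_def)
 qed
qed

text \<open>The difference of the products splits into two mixed terms and a product of errors.
  Young's inequality with weight t leaves a small multiple of the fourth powers of the limits and a
  large multiple of those of the errors.\<close>

lemma Lp_conv_scaleR:
 fixes F :: "nat => real^3 => real" and G :: "nat => real^3 => 'b::euclidean_space"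
 assumes F: "Lp_conv 4 F f" and G: "Lp_conv 4 G g"
  and fg: "L1 (%x. norm (f x) ^ 4)" "L1 (%x. norm (g x) ^ 4)"
  and [measurable]: "\<And>n. F n \<in> BM" "f \<in> BM"
   "\<And>n. G n \<in> BM" "g \<in> BM"
 shows "Lp_conv 2 (%n x. F n x *\<^sub>R G n x) (%x. f x *\<^sub>R g x)"
 unfolding Lp_conv_def
proof (intro allI impI)
 fix e :: real assume e: "0 < e"
 define I where "I = (LBINT x. norm (f x) ^ 4 + norm (g x) ^ 4)"
 have I: "0 <= I" by (simp add: I_def)
 define t where "t = e / (6 * (I + 1))"
 have t: "t > 0" using e I by (simp add: t_def)
 define s where "s = e / (18 * (1 + 1/t))"
 have s: "s > 0" using e t by (simp add: s_def add_pos_pos)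
 from Lp_convD[OF F s] Lp_convD[OF G s]
 show "\<forall>\<^sub>F n in sequentially. pN 2 (%x. F n x *\<^sub>R G n x - f x *\<^sub>R g x) < ennreal e"
 proof eventually_elim
  case (elim n)
  define X where "X x = norm (F n x - f x)" for x
  define Y where "Y x = norm (G n x - g x)" for x
  have [measurable]: "X \<in> BM" "Y \<in> BM" unfolding X_def[abs_def] Y_def[abs_def] by measurable
  have pt: "norm (F n x *\<^sub>R G n x - f x *\<^sub>R g x) ^ 2 <= 3 * t * (norm (f x) ^ 4 + norm (g x) ^ 4) + 3 * (1 + 1/t) * (X x ^ 4 + Y x ^ 4)" for x
  proof -
   define a where "a = norm (f x)"
   define b where "b = norm (g x)"
   have nn: "0 <= a" "0 <= b" "0 <= X x" "0 <= Y x" by (auto simp: a_def b_def X_def Y_def)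
   have "F n x *\<^sub>R G n x - f x *\<^sub>R g x = (F n x - f x) *\<^sub>R g x + f x *\<^sub>R (G n x - g x) + (F n x - f x) *\<^sub>R (G n x - g x)"
    by (simp add: algebra_simps)
   then have "norm (F n x *\<^sub>R G n x - f x *\<^sub>R g x) <= X x * b + a * Y x + X x * Y x"
    by (smt (verit) X_def Y_def a_def b_def norm_scaleR norm_triangle_ineq real_norm_def)
   then have "norm (F n x *\<^sub>R G n x - f x *\<^sub>R g x) ^ 2 <= (X x * b + a * Y x + X x * Y x)^2" by (intro power_mono) auto
   also have "... <= 3 * ((X x * b)^2 + (a * Y x)^2 + (X x * Y x)^2)"
   proof -
    have "(p + q + r)^2 <= 3 * (p^2 + q^2 + r^2)" for p q r :: real
    proof -
     have "3 * (p^2 + q^2 + r^2) - (p + q + r)\<^sup>2 = (p - q)^2 + (p - r)^2 + (q - r)^2" by algebra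
     then show ?thesis by (smt (verit) zero_le_power2)
    qed
    then show ?thesis by blast
   qed
   also have "... <= 3 * ((1/t * X x ^ 4 + t * b ^ 4) + (1/t * Y x ^ 4 + t * a ^ 4) + (X x ^ 4 + Y x ^ 4))"
   proof -
    have y: "(p * q)^2 <= 1/w * p ^ 4 + w * q ^ 4" if "w > 0" for p q w :: real
    proof -
     have "1/w * p ^ 4 + w * q ^ 4 - 2 * (p * q)^2 = (p^2 - w * q^2)^2 / w"
      using that by (simp add: field_simps power2_eq_square power4_eq_xxxx)
     then have "2 * (p * q)^2 <= 1/w * p ^ 4 + w * q ^ 4" using that by (smt (verit) divide_nonneg_pos zero_le_power2)
     then show ?thesis by (smt (verit) zero_le_power2)
    qed
    show ?thesis using y[OF t, of "X x" b] y[OF t, of "Y x" a] y[OF zero_less_one, of "X x" "Y x"]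
     by (simp add: mult.commute)
   qed
   finally show ?thesis by (simp add: a_def b_def algebra_simps)
  qed
  have "pN 2 (%x. F n x *\<^sub>R G n x - f x *\<^sub>R g x) <= (\<integral>\<^sup>+x. ennreal (3 * t) * ennreal (norm (f x) ^ 4 + norm (g x) ^ 4) + ennreal (3 * (1 + 1/t)) * (ennreal (X x ^ 4) + ennreal (Y x ^ 4)) \<partial>lborel)"
   unfolding pN_def
  proof (rule nn_integral_mono)
   fix x
   have "ennreal (3 * t) * ennreal (norm (f x) ^ 4 + norm (g x) ^ 4) + ennreal (3 * (1 + 1/t)) * (ennreal (X x ^ 4) + ennreal (Y x ^ 4))
    = ennreal (3 * t * (norm (f x) ^ 4 + norm (g x) ^ 4) + 3 * (1 + 1/t) * (X x ^ 4 + Y x ^ 4))"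
    using t by (simp add: ennreal_mult'[symmetric] ennreal_plus[symmetric] del: ennreal_plus)
   then show "ennreal (norm (F n x *\<^sub>R G n x - f x *\<^sub>R g x) ^ 2) <= ennreal (3 * t) * ennreal (norm (f x) ^ 4 + norm (g x) ^ 4) + ennreal (3 * (1 + 1/t)) * (ennreal (X x ^ 4) + ennreal (Y x ^ 4))"
    using ennreal_leI[OF pt[of x]] by simp
  qed
  also have "... = ennreal (3 * t) * (\<integral>\<^sup>+x. ennreal (norm (f x) ^ 4 + norm (g x) ^ 4) \<partial>lborel) + ennreal (3 * (1 + 1/t)) * ((\<integral>\<^sup>+x. ennreal (X x ^ 4) \<partial>lborel) + (\<integral>\<^sup>+x. ennreal (Y x ^ 4) \<partial>lborel))"
   by (simp add: nn_integral_add nn_integral_cmult del: ennreal_plus)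
  also have "(\<integral>\<^sup>+x. ennreal (norm (f x) ^ 4 + norm (g x) ^ 4) \<partial>lborel) = ennreal I"
   unfolding I_def by (rule nn_integral_eq_integral) (use fg in auto)
  also have "(\<integral>\<^sup>+x. ennreal (X x ^ 4) \<partial>lborel) = pN 4 (%x. F n x - f x)" by (simp add: pN_def X_def)
  also have "(\<integral>\<^sup>+x. ennreal (Y x ^ 4) \<partial>lborel) = pN 4 (%x. G n x - g x)" by (simp add: pN_def Y_def)
  also have "ennreal (3 * t) * ennreal I + ennreal (3 * (1 + 1/t)) * (pN 4 (%x. F n x - f x) + pN 4 (%x. G n x - g x))
    <= ennreal (3 * t) * ennreal I + ennreal (3 * (1 + 1/t)) * (ennreal s + ennreal s)"
   using elim by (intro add_left_mono mult_left_mono add_mono) auto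
  also have "... = ennreal (3 * t * I + 3 * (1 + 1/t) * (s + s))"
   using t s I by (simp add: ennreal_mult'[symmetric] ennreal_plus[symmetric] del: ennreal_plus)
  also have "... < ennreal e"
  proof (rule ennreal_lessI[OF e])
   have "3 * t * I <= 3 * t * (I + 1)" using t by simp
   also have "... = e/2"
   proof -
    have "I + 1 \<noteq> 0" using I by simp
    then show ?thesis unfolding t_def by (simp only: times_divide_eq_right nonzero_divide_eq_eq) (simp add: divide_simps)
   qed
   finally have "3 * t * I <= e/2" .
   moreover have "3 * (1 + 1/t) * (s + s) = e/3"
   proof -
    have "3 * q * (e / (18 * q) + e / (18 * q)) = e/3" if "q > 0" for q using that by (simp add: field_simps)
    then show ?thesis using t by (simp only: s_def add_pos_pos zero_less_one zero_less_divide_1_iff)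
   qed
   ultimately show "3 * t * I + 3 * (1 + 1/t) * (s + s) < e" using e by simp
  qed
  finally show ?case .
 qed
qed

lemma Lp_conv_mol:
 fixes f :: "real^3 => 'b::euclidean_space"
 assumes k: "\<And>n. kernel 0 (1 / (real n + 1)) (k n)" and f: "L1 f" "L1 (%x. norm (f x) ^ p)" and p: "p \<ge> 1"
 shows "Lp_conv p (%n. mol (k n) f) f"
 unfolding Lp_conv_def
proof (intro allI impI)
 fix e :: real assume e: "0 < e"
 have m: "f \<in> BM" using f(1) by auto
 show "\<forall>\<^sub>F n in sequentially. pN p (%x. mol (k n) f x - f x) < ennreal e"
 proof (rule pN_mol_converges[OF k _ f(1) _ p e])
  show "(%n. norm (0::real^3) + 1 / (real n + 1)) \<longlonglongrightarrow> 0"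
   using LIMSEQ_inverse_real_of_nat by (simp add: inverse_eq_divide add.commute)
  show "pN p f < \<infinity>" using f(2) pN_finite_iff[OF m] by blast
 qed
qed

lemma weak_deriv_indicator:
 fixes a :: "real^3 => 'b::euclidean_space"
 assumes a: "weak_deriv V a d" and BV: "B \<subseteq> V"
 shows "weak_deriv B (%x. indicator B x *\<^sub>R a x) d"
 unfolding weak_deriv_def
proof (intro allI impI)
 fix j \<phi> assume t: "test_fun B \<phi>"
 then have tV: "test_fun V \<phi>" using BV by (auto simp: test_fun_def)
 have "pd j \<phi> x *\<^sub>R indicator B x *\<^sub>R a x = pd j \<phi> x *\<^sub>R a x" for x
  using test_fun_C1(6)[OF t, of x j] by (cases "x \<in> B") auto
 then show "(LBINT x. pd j \<phi> x *\<^sub>R indicator B x *\<^sub>R a x) = - (LBINT x. \<phi> x *\<^sub>R d j x)"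
  using a tV unfolding weak_deriv_def by (simp only:)
qed

text \<open>On \<open>inn \<Omega> \<eta>\<close> a kernel of radius below \<eta> stays inside
  \<Omega>, so there the gradient of a mollified function is the mollified gradient, and covariant
  derivatives, potential term and field converge in L^2. One index is taken at which the energy has
  grown by at most 1, which is negligible against h L. The competing potentials absorb the factor
  \<kappa> H.\<close>

lemma C1_competitor:
 assumes \<Omega>: "bounded \<Omega>" "open \<Omega>" "smooth_boundary \<Omega>"
  and \<psi>: "H1 \<Omega> \<psi>" and A: "Hdot1_div_F A" and \<eta>: "0 < \<eta>" and kH: "0 < \<kappa>" "0 < H"
 defines "U \<equiv> inn \<Omega> \<eta>"
 shows "\<exists>u du a1 a2 da1 da2. (\<forall>x. (u has_derivative du x) (at x)) \<and> (\<forall>v. cont (%x. du x v)) \<and>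
  (\<forall>x. (a1 has_derivative da1 x) (at x)) \<and> (\<forall>v. cont (%x. da1 x v)) \<and>
  (\<forall>x. (a2 has_derivative da2 x) (at x)) \<and> (\<forall>v. cont (%x. da2 x v)) \<and>
  (LBINT x. indicator U x * ((cmod (du x ex1 - \<i> * of_real (a1 x) * u x))^2 + (cmod (du x ex2 - \<i> * of_real (a2 x) * u x))^2))
  + \<kappa>^2/2 * (LBINT x. indicator U x * (1 - (cmod (u x))\<^sup>2)^2)
  + (LBINT x. indicator U x * (da2 x ex1 - da1 x ex2 - \<kappa> * H)^2) <= GL_energy \<Omega> \<kappa> H \<psi> A + 1"
proof -
 define h where "h = \<kappa> * H"
 have h: "0 < h" using kH by (simp add: h_def)
 have Uc: "compact U" and U\<Omega>: "U \<subseteq> \<Omega>" unfolding U_def using \<eta> by (auto intro: inn_compact dest: inn_subset)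
 have Ub[measurable]: "U \<in> sets borel" using Uc by (auto intro: borel_compact)
 obtain R where R: "R > 0" "\<Omega> \<subseteq> ball 0 R" using bounded_subset_ballD[OF \<Omega>(1), of 0] by blast
 obtain w g a' d where w: "sobolev_rep \<Omega> w g" and a': "\<forall>j. sobolev_rep (ball 0 (2 * R)) (a' j) (d j)"
  and w4: "L1 (%x. norm (w x) ^ 4)" and a4: "\<forall>j::3. L1 (%x. indicator (ball 0 R) x * norm (a' j x) ^ 4)"
  and low: "\<forall>\<kappa> H U. U \<in> sets borel --> U \<subseteq> \<Omega> -->
    L1 (%x. indicator U x * ((cmod (g 1 x - \<i> * of_real (\<kappa> * H * a' 1 x) * w x))^2 + (cmod (g 2 x - \<i> * of_real (\<kappa> * H * a' 2 x) * w x))^2)) \<and>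
    L1 (%x. indicator U x * (1 - (cmod (w x))\<^sup>2)^2) \<and>
    L1 (%x. indicator U x * (d 2 1 x - d 1 2 x - 1)^2) \<and>
    (LBINT x. indicator U x * ((cmod (g 1 x - \<i> * of_real (\<kappa> * H * a' 1 x) * w x))^2 + (cmod (g 2 x - \<i> * of_real (\<kappa> * H * a' 2 x) * w x))^2))
    + \<kappa>^2/2 * (LBINT x. indicator U x * (1 - (cmod (w x))\<^sup>2)^2)
    + \<kappa>^2 * H^2 * (LBINT x. indicator U x * (d 2 1 x - d 1 2 x - 1)^2) <= GL_energy \<Omega> \<kappa> H \<psi> A"
  using GL_energy_lower_rep[OF \<Omega> R \<psi> A] by (elim exE conjE)
 note low = low[rule_format, OF Ub U\<Omega>, of \<kappa> H, folded h_def]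
 define a where "a j x = indicator (ball 0 R) x *\<^sub>R a' j x" for j x
 have wi: "L1 w" and gi: "L1 (g j)" "L1 (%x. norm (g j x) ^ 2)"
  and ai': "L1 (a' j)" and di: "L1 (d j l)" "L1 (%x. norm (d j l x) ^ 2)"
  and ww: "weak_deriv \<Omega> w g" and aw': "weak_deriv (ball 0 (2 * R)) (a' j) (d j)" for j l
  using w a' by (auto simp: sobolev_rep_def)
 have ai: "L1 (a j)" for j unfolding a_def[abs_def] by (rule integrable_mult_indicator) (use ai' in auto)
 have aw: "weak_deriv (ball 0 R) (a j) (d j)" for j
  unfolding a_def[abs_def] by (rule weak_deriv_indicator[OF aw']) (use R in auto)
 have "norm (a j x) ^ 4 = indicator (ball 0 R) x * norm (a' j x) ^ 4" for j x by (simp add: a_def indicator_def)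
 then have ai4: "L1 (%x. norm (a j x) ^ 4)" for j using a4 by simp
 have aa': "a j x = a' j x" if "x \<in> U" for j x using that U\<Omega> R by (auto simp: a_def)
 have [measurable]: "w \<in> BM" "g j \<in> BM" "a j \<in> BM"
  "a' j \<in> BM" "d j l \<in> BM" for j l
  using wi gi ai ai' di by auto
 have "\<forall>n. \<exists>k. kernel 0 (1 / (real n + 1)) k"
 proof
  fix n
  have "0 < 1 / (real n + 1)" by simp
  then show "\<exists>k. kernel 0 (1 / (real n + 1)) k" by (rule kernel_exists) blast
 qed
 from choice[OF this] obtain k where k: "\<And>n. kernel 0 (1 / (real n + 1)) (k n)" by blast
 have km[measurable]: "mol (k n) f \<in> BM" if "L1 f" for n and f :: "real^3 => 'b::euclidean_space"
  using mol_measurable[OF kernel_ccs[OF k] that] .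
 note [measurable] = km[OF wi] km[OF ai] km[OF gi(1)] km[OF di(1)]
 define X where "X j n x = - (\<i> * h) * (mol (k n) (a j) x *\<^sub>R mol (k n) w x)" for j n x
 have cw: "Lp_conv 4 (%n. mol (k n) w) w" by (rule Lp_conv_mol[OF k wi w4]) simp
 have ca: "Lp_conv 4 (%n. mol (k n) (a j)) (a j)" for j by (rule Lp_conv_mol[OF k ai ai4]) simp
 have cg: "Lp_conv 2 (%n. mol (k n) (g j)) (g j)" for j by (rule Lp_conv_mol[OF k gi]) simp
 have cd: "Lp_conv 2 (%n. mol (k n) (d j l)) (d j l)" for j l by (rule Lp_conv_mol[OF k di]) simp
 have caw: "Lp_conv 2 (%n x. mol (k n) (a j) x *\<^sub>R mol (k n) w x) (%x. a j x *\<^sub>R w x)" for j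
  by (rule Lp_conv_scaleR[OF ca cw ai4 w4]) measurable
 have cX: "Lp_conv 2 (X j) (%x. - (\<i> * h) * (a j x *\<^sub>R w x))" for j
 proof (rule Lp_conv_mono[OF caw[of j], where C=h])
  show "\<forall>\<^sub>F n in sequentially. \<forall>x. norm (X j n x - - (\<i> * h) * (a j x *\<^sub>R w x)) <= h * norm (mol (k n) (a j) x *\<^sub>R mol (k n) w x - a j x *\<^sub>R w x)"
  proof (intro always_eventually allI)
   fix n x
   have "X j n x - - (\<i> * h) * (a j x *\<^sub>R w x) = - (\<i> * h) * (mol (k n) (a j) x *\<^sub>R mol (k n) w x - a j x *\<^sub>R w x)"
    by (simp add: X_def algebra_simps)
   then show "norm (X j n x - - (\<i> * h) * (a j x *\<^sub>R w x)) <= h * norm (mol (k n) (a j) x *\<^sub>R mol (k n) w x - a j x *\<^sub>R w x)"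
    using h by (simp only: norm_mult norm_minus_cancel norm_ii norm_of_real)
  qed
 qed (use h in measurable)
 have [measurable]: "X j n \<in> BM" for j n unfolding X_def[abs_def] by measurable
 have cgX: "Lp_conv 2 (%n x. mol (k n) (g j) x + X j n x) (%x. g j x + - (\<i> * h) * (a j x *\<^sub>R w x))" for j
  by (rule Lp_conv_add[OF cg cX]) measurable
 have L: "\<forall>n. \<exists>L. (\<forall>x. (mol (k n) f has_derivative L x) (at x)) \<and> (\<forall>v. cont (%x. L x v)) \<and>
   (\<forall>x v. cball x (1 / (real n + 1)) \<subseteq> V --> L x v = v $ 1 *\<^sub>R mol (k n) (D 1) x + v $ 2 *\<^sub>R mol (k n) (D 2) x + v $ 3 *\<^sub>R mol (k n) (D 3) x)"
  if f: "L1 f" "weak_deriv V f D" for f :: "real^3 => 'b::euclidean_space" and D V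
 proof
  fix n
  show "\<exists>L. (\<forall>x. (mol (k n) f has_derivative L x) (at x)) \<and> (\<forall>v. cont (%x. L x v)) \<and>
   (\<forall>x v. cball x (1 / (real n + 1)) \<subseteq> V --> L x v = v $ 1 *\<^sub>R mol (k n) (D 1) x + v $ 2 *\<^sub>R mol (k n) (D 2) x + v $ 3 *\<^sub>R mol (k n) (D 3) x)"
  proof (rule mol_derivative_weak[OF k[of n] f], intro exI conjI allI impI)
   fix L x v
   assume "\<And>x v. cball (x + 0) (1 / (real n + 1)) \<subseteq> V ==> L x v = v $ 1 *\<^sub>R mol (k n) (D 1) x + v $ 2 *\<^sub>R mol (k n) (D 2) x + v $ 3 *\<^sub>R mol (k n) (D 3) x"
    and "cball x (1 / (real n + 1)) \<subseteq> V"
   then show "L x v = v $ 1 *\<^sub>R mol (k n) (D 1) x + v $ 2 *\<^sub>R mol (k n) (D 2) x + v $ 3 *\<^sub>R mol (k n) (D 3) x" by simp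
  qed
 qed
 from choice[OF L[OF wi ww]] obtain du where du: "\<And>n x. (mol (k n) w has_derivative du n x) (at x)" "\<And>n v. cont (%x. du n x v)"
  "\<And>n x v. cball x (1 / (real n + 1)) \<subseteq> \<Omega> ==> du n x v = v $ 1 *\<^sub>R mol (k n) (g 1) x + v $ 2 *\<^sub>R mol (k n) (g 2) x + v $ 3 *\<^sub>R mol (k n) (g 3) x" by blast
 have "\<exists>da. (\<forall>n x. (mol (k n) (a j) has_derivative da n x) (at x)) \<and> (\<forall>n v. cont (%x. da n x v)) \<and>
  (\<forall>n x v. cball x (1 / (real n + 1)) \<subseteq> ball 0 R --> da n x v = v $ 1 *\<^sub>R mol (k n) (d j 1) x + v $ 2 *\<^sub>R mol (k n) (d j 2) x + v $ 3 *\<^sub>R mol (k n) (d j 3) x)" for j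
  using choice[OF L[OF ai aw], of j] by blast
 then have "\<forall>j. \<exists>da. (\<forall>n x. (mol (k n) (a j) has_derivative da n x) (at x)) \<and> (\<forall>n v. cont (%x. da n x v)) \<and>
  (\<forall>n x v. cball x (1 / (real n + 1)) \<subseteq> ball 0 R --> da n x v = v $ 1 *\<^sub>R mol (k n) (d j 1) x + v $ 2 *\<^sub>R mol (k n) (d j 2) x + v $ 3 *\<^sub>R mol (k n) (d j 3) x)" ..
 from choice[OF this] obtain da where da: "\<And>j n x. (mol (k n) (a j) has_derivative da j n x) (at x)" "\<And>j n v. cont (%x. da j n x v)"
  "\<And>j n x v. cball x (1 / (real n + 1)) \<subseteq> ball 0 R ==> da j n x v = v $ 1 *\<^sub>R mol (k n) (d j 1) x + v $ 2 *\<^sub>R mol (k n) (d j 2) x + v $ 3 *\<^sub>R mol (k n) (d j 3) x" by blast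
 have small: "\<forall>\<^sub>F n in sequentially. 1 / (real n + 1) < \<eta>"
  using order_tendstoD(2)[OF LIMSEQ_inverse_real_of_nat \<eta>] by (simp add: inverse_eq_divide add.commute)
 have onU: "cball x (1 / (real n + 1)) \<subseteq> \<Omega>" "cball x (1 / (real n + 1)) \<subseteq> ball 0 R" if "1 / (real n + 1) < \<eta>" "x \<in> U" for n x
  using that R by (force simp: U_def inn_def)+
 have duU: "du n x (axis j 1) = mol (k n) (g j) x" and daU: "da i n x (axis j 1) = mol (k n) (d i j) x"
  if "1 / (real n + 1) < \<eta>" "x \<in> U" for n x i j
  using du(3)[OF onU(1)[OF that]] da(3)[OF onU(2)[OF that]] exhaust_3[of j] by (auto simp: axis_def)
 define C where "C j n x = indicator U x *\<^sub>R (du n x (axis j 1) - \<i> * of_real (h * mol (k n) (a j) x) * mol (k n) w x)" for j n x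
 define C' where "C' j x = indicator U x *\<^sub>R (g j x - \<i> * of_real (h * a' j x) * w x)" for j x
 have [measurable]: "(%x. du n x v) \<in> BM" "(%x. da j n x v) \<in> BM" for j n v
  using borel_measurable_continuous_onI[OF du(2)] borel_measurable_continuous_onI[OF da(2)] .
 have CC: "Lp_conv 2 (C j) (C' j)" for j
 proof (rule Lp_conv_mono[OF cgX[of j], where C=1])
  show "\<forall>\<^sub>F n in sequentially. \<forall>x. norm (C j n x - C' j x) <= 1 * norm (mol (k n) (g j) x + X j n x - (g j x + - (\<i> * h) * (a j x *\<^sub>R w x)))"
   using small
  proof eventually_elim
   case (elim n)
   show ?case
   proof
    fix x
    show "norm (C j n x - C' j x) <= 1 * norm (mol (k n) (g j) x + X j n x - (g j x + - (\<i> * h) * (a j x *\<^sub>R w x)))"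
    proof (cases "x \<in> U")
     case True
     have "C j n x - C' j x = mol (k n) (g j) x + X j n x - (g j x + - (\<i> * h) * (a j x *\<^sub>R w x))"
      using True by (simp add: C_def C'_def X_def duU[OF elim True] aa' scaleR_conv_of_real algebra_simps)
     then show ?thesis by simp
    qed (simp add: C_def C'_def)
   qed
  qed
 qed measurable
 define P where "P n x = indicator U x * (1 - (cmod (mol (k n) w x))\<^sup>2)" for n x
 define P' where "P' x = indicator U x * (1 - (cmod (w x))\<^sup>2)" for x
 have cn: "Lp_conv 4 (%n x. cmod (mol (k n) w x)) (%x. cmod (w x))"
  by (rule Lp_conv_mono[OF cw, where C=1]) (auto simp: norm_triangle_ineq3 intro!: always_eventually)
 have cnn: "Lp_conv 2 (%n x. cmod (mol (k n) w x) *\<^sub>R cmod (mol (k n) w x)) (%x. cmod (w x) *\<^sub>R cmod (w x))"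
  by (rule Lp_conv_scaleR[OF cn cn]) (use w4 in simp_all)
 have CP: "Lp_conv 2 P P'"
  by (rule Lp_conv_mono[OF cnn, where C=1]) (auto simp: P_def P'_def indicator_def power2_eq_square intro!: always_eventually)
 define M where "M n x = indicator U x * (h * da 2 n x ex1 - h * da 1 n x ex2 - h)" for n x
 define M' where "M' x = indicator U x * (h * d 2 1 x - h * d 1 2 x - h)" for x
 have cm: "Lp_conv 2 (%n x. - mol (k n) (d 1 2) x) (%x. - d 1 2 x)"
  by (rule Lp_conv_mono[OF cd[of 1 2], where C=1]) (auto intro!: always_eventually)
 have cdd: "Lp_conv 2 (%n x. mol (k n) (d 2 1) x + - mol (k n) (d 1 2) x) (%x. d 2 1 x + - d 1 2 x)"
  by (rule Lp_conv_add[OF cd cm]) measurable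
 have CM: "Lp_conv 2 M M'"
 proof (rule Lp_conv_mono[OF cdd, where C=h])
  show "\<forall>\<^sub>F n in sequentially. \<forall>x. norm (M n x - M' x) <= h * norm (mol (k n) (d 2 1) x + - mol (k n) (d 1 2) x - (d 2 1 x + - d 1 2 x))"
   using small
  proof eventually_elim
   case (elim n)
   show ?case
   proof
    fix x
    show "norm (M n x - M' x) <= h * norm (mol (k n) (d 2 1) x + - mol (k n) (d 1 2) x - (d 2 1 x + - d 1 2 x))"
    proof (cases "x \<in> U")
     case True
     have "M n x - M' x = h * (mol (k n) (d 2 1) x + - mol (k n) (d 1 2) x - (d 2 1 x + - d 1 2 x))"
      using True by (simp add: M_def M'_def daU[OF elim True] algebra_simps)
     then show ?thesis using h by (simp add: abs_mult)
    qed (use h in \<open>simp add: M_def M'_def\<close>)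
   qed
  qed
 qed (use h in measurable)
 have [measurable]: "C j n \<in> BM" "C' j \<in> BM" "P n \<in> BM"
  "P' \<in> BM" "M n \<in> BM" "M' \<in> BM" for j n
  unfolding C_def[abs_def] C'_def[abs_def] P_def[abs_def] P'_def[abs_def] M_def[abs_def] M'_def[abs_def] by measurable
 have M'eq: "(norm (M' x))^2 = h^2 * (indicator U x * (d 2 1 x - d 1 2 x - 1)^2)" for x
 proof -
  have "h * d 2 1 x - h * d 1 2 x - h = h * (d 2 1 x - d 1 2 x - 1)" by (simp add: algebra_simps)
  then show ?thesis by (simp add: M'_def indicator_def power_mult_distrib)
 qed
 have ind2: "(norm (indicator U x *\<^sub>R z))^2 = indicator U x * (norm z)^2" for x :: "real^3" and z :: complex
  by (simp add: indicator_def)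
 have ind2r: "(norm (indicator U x * z))^2 = indicator U x * z^2" for x :: "real^3" and z :: real
  by (cases "x \<in> U") simp_all
 have C'eq: "(norm (C' 1 x))^2 + (norm (C' 2 x))^2 = indicator U x * ((cmod (g 1 x - \<i> * of_real (h * a' 1 x) * w x))^2 + (cmod (g 2 x - \<i> * of_real (h * a' 2 x) * w x))^2)" for x
  unfolding C'_def ind2 by (simp only: distrib_left)
 have P'eq: "(norm (P' x))^2 = indicator U x * (1 - (cmod (w x))\<^sup>2)^2" for x unfolding P'_def by (rule ind2r)
 have C'i: "L1 (%x. (norm (C' j x))^2)" if j: "j = 1 \<or> j = 2" for j
 proof (rule Bochner_Integration.integrable_bound)
  show "L1 (%x. (norm (C' 1 x))^2 + (norm (C' 2 x))^2)" unfolding C'eq by (rule low[THEN conjunct1])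
  show "(%x. (norm (C' j x))^2) \<in> borel_measurable lborel" by measurable
  show "AE x in lborel. norm ((norm (C' j x))^2) <= norm ((norm (C' 1 x))^2 + (norm (C' 2 x))^2)"
   using j by (intro AE_I2) (elim disjE, simp_all)
 qed
 have P'i: "L1 (%x. (norm (P' x))^2)" unfolding P'eq by (rule low[THEN conjunct2, THEN conjunct1])
 have M'i: "L1 (%x. (norm (M' x))^2)" unfolding M'eq by (rule integrable_mult_right[OF low[THEN conjunct2, THEN conjunct2, THEN conjunct1]])
 have gen: "K + b * Q + N <= G + 1" if "K = Kn" "Kn <= K' + 2 * e" "Q = Qn" "b * Qn <= b * Q' + b * e" "N = Nn" "N' = W"
   "3 * e + b * e = 1" "K' + b * Q' + W <= G" "Nn <= N' + e" for K Kn K' Q Qn Q' N Nn N' W b e G :: real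
 proof -
  have "b * Q = b * Qn" using that(3) by simp
  then show ?thesis using that by linarith
 qed
 \<comment> \<open>Two kinetic terms and the field term cost e each, the potential term costs
   \<open>\<kappa>^2/2 * e\<close>; the sum is 1.\<close>
 define e where "e = 1 / (3 + \<kappa>^2/2)"
 have e: "e > 0" using kH by (simp add: e_def add_pos_pos)
 have ev: "\<forall>\<^sub>F n in sequentially. L1 (%x. (norm (F n x))^2) \<and> (LBINT x. (norm (F n x))^2) <= (LBINT x. (norm (f x))^2) + e"
  if "Lp_conv 2 F f" "L1 (%x. (norm (f x))^2)" "\<And>n. F n \<in> BM" "f \<in> BM"
  for F and f :: "real^3 => 'b::euclidean_space" using Lp_conv_integral[OF that e] .
 have "\<forall>\<^sub>F n in sequentially.
   (L1 (%x. (norm (C 1 n x))^2) \<and> (LBINT x. (norm (C 1 n x))^2) <= (LBINT x. (norm (C' 1 x))^2) + e) \<and>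
   (L1 (%x. (norm (C 2 n x))^2) \<and> (LBINT x. (norm (C 2 n x))^2) <= (LBINT x. (norm (C' 2 x))^2) + e) \<and>
   (L1 (%x. (norm (P n x))^2) \<and> (LBINT x. (norm (P n x))^2) <= (LBINT x. (norm (P' x))^2) + e) \<and>
   (L1 (%x. (norm (M n x))^2) \<and> (LBINT x. (norm (M n x))^2) <= (LBINT x. (norm (M' x))^2) + e)"
  by (intro eventually_conj ev CC CP CM C'i P'i M'i) auto
 from eventually_happens'[OF sequentially_bot this] obtain n where
   n: "L1 (%x. (norm (C 1 n x))^2)" "(LBINT x. (norm (C 1 n x))^2) <= (LBINT x. (norm (C' 1 x))^2) + e"
   "L1 (%x. (norm (C 2 n x))^2)" "(LBINT x. (norm (C 2 n x))^2) <= (LBINT x. (norm (C' 2 x))^2) + e"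
   "(LBINT x. (norm (P n x))^2) <= (LBINT x. (norm (P' x))^2) + e"
   "(LBINT x. (norm (M n x))^2) <= (LBINT x. (norm (M' x))^2) + e" by (elim exE conjE)
 have "(LBINT x. indicator U x * ((cmod (du n x ex1 - \<i> * of_real (h * mol (k n) (a 1) x) * mol (k n) w x))^2 + (cmod (du n x ex2 - \<i> * of_real (h * mol (k n) (a 2) x) * mol (k n) w x))^2))
   = (LBINT x. (norm (C 1 n x))^2 + (norm (C 2 n x))^2)"
  unfolding C_def ind2 by (simp only: distrib_left)
 moreover have "(LBINT x. (norm (C 1 n x))^2 + (norm (C 2 n x))^2) <= (LBINT x. (norm (C' 1 x))^2 + (norm (C' 2 x))^2) + 2 * e"
  using n(1-4) C'i[of 1] C'i[of 2] by simp
 moreover have "(LBINT x. indicator U x * (1 - (cmod (mol (k n) w x))\<^sup>2)^2) = (LBINT x. (norm (P n x))^2)"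
  unfolding P_def ind2r ..
 moreover have "\<kappa>^2/2 * (LBINT x. (norm (P n x))^2) <= \<kappa>^2/2 * (LBINT x. (norm (P' x))^2) + \<kappa>^2/2 * e"
  using mult_left_mono[OF n(5), of "\<kappa>^2/2"] by (simp add: distrib_left)
 moreover have "(LBINT x. indicator U x * (h * da 2 n x ex1 - h * da 1 n x ex2 - h)^2) = (LBINT x. (norm (M n x))^2)"
  unfolding M_def ind2r ..
 moreover have "(LBINT x. (norm (M' x))^2) = \<kappa>^2 * H^2 * (LBINT x. indicator U x * (d 2 1 x - d 1 2 x - 1)^2)"
  unfolding M'eq by (simp add: h_def power_mult_distrib)
 moreover have "3 * e + \<kappa>^2/2 * e = 1"
 proof -
  have "3 + \<kappa>^2/2 \<noteq> 0" using zero_le_power2[of \<kappa>] by linarith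
  then have "(3 + \<kappa>^2/2) * e = 1" unfolding e_def by (metis nonzero_mult_div_cancel_left times_divide_eq_right mult_1_right)
  then show ?thesis by (simp only: distrib_right)
 qed
 moreover note low[THEN conjunct2, THEN conjunct2, THEN conjunct2] n(6)
 ultimately have fin: "(LBINT x. indicator U x * ((cmod (du n x ex1 - \<i> * of_real (h * mol (k n) (a 1) x) * mol (k n) w x))^2 + (cmod (du n x ex2 - \<i> * of_real (h * mol (k n) (a 2) x) * mol (k n) w x))^2))
  + \<kappa>^2/2 * (LBINT x. indicator U x * (1 - (cmod (mol (k n) w x))\<^sup>2)^2)
  + (LBINT x. indicator U x * (h * da 2 n x ex1 - h * da 1 n x ex2 - h)^2) <= GL_energy \<Omega> \<kappa> H \<psi> A + 1"
  unfolding C'eq P'eq by (rule gen)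
 show ?thesis
 proof (rule exI[of _ "mol (k n) w"], rule exI[of _ "du n"], rule exI[of _ "%x. h * mol (k n) (a 1) x"],
   rule exI[of _ "%x. h * mol (k n) (a 2) x"], rule exI[of _ "%x v. h * da 1 n x v"], rule exI[of _ "%x v. h * da 2 n x v"],
   intro conjI allI)
  show "((%x. h * mol (k n) (a 1) x) has_derivative (%v. h * da 1 n x v)) (at x)" for x by (rule has_derivative_mult_right[OF da(1)])
  show "((%x. h * mol (k n) (a 2) x) has_derivative (%v. h * da 2 n x v)) (at x)" for x by (rule has_derivative_mult_right[OF da(1)])
 qed (use fin in \<open>auto simp: h_def[symmetric] intro: du continuous_on_mult_left da(2)\<close>)
qed

text \<open>Both cutoffs truncate \<open>m * d - a\<close> to [0, 1], with d the distance to the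
  complement, a = 3 for \<zeta> and a = 1 for \<xi>. A step of length 1/m changes
  \<open>m * d\<close> by at most 1, so from above 3 one stays above 2, where \<xi> = 1; and \<xi>
  \<noteq> 0 means d > 1/m. For large m the integral of \<zeta> approaches the volume.\<close>

lemma cutoff_exists:
 assumes \<Omega>: "open \<Omega>" "bounded \<Omega>" and c: "0 < c"
 shows "\<exists>(\<zeta> :: real^3 => real) (\<xi> :: real^3 => real) \<epsilon> m. 0 < \<epsilon> \<and> 0 < m \<and> ccs \<zeta> \<and> (\<forall>x. 0 <= \<zeta> x) \<and> (\<forall>x. \<zeta> x <= 1) \<and> (\<forall>x y. \<bar>\<zeta> x - \<zeta> y\<bar> <= m * norm (x - y)) \<and>
   ccs \<xi> \<and> (\<forall>x. 0 <= \<xi> x) \<and> (\<forall>x. \<xi> x <= 1) \<and> (\<forall>x. \<xi> x \<noteq> 0 --> x \<in> inn \<Omega> \<epsilon>) \<and>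
   (\<forall>x v. \<zeta> x \<noteq> 0 --> norm v <= 1/m --> \<xi> (x + v) = 1) \<and> measure lebesgue \<Omega> - c < (LBINT x. \<zeta> x)"
proof -
 define d where "d x = infdist x (- \<Omega>)" for x
 have ne: "- \<Omega> \<noteq> {}" using \<Omega>(2) not_bounded_UNIV by (metis Compl_eq_Diff_UNIV Diff_eq_empty_iff top.extremum_uniqueI)
 have d0: "d x = 0" if "x \<notin> \<Omega>" for x using that by (simp add: d_def)
 have dp: "0 < d x" if "x \<in> \<Omega>" for x
  using that closed_Compl[OF \<Omega>(1)] ne in_closed_iff_infdist_zero[of "- \<Omega>" x] infdist_nonneg[of x "- \<Omega>"] by (auto simp: d_def)
 have dn: "0 <= d x" for x by (simp add: d_def infdist_nonneg)
 have dl: "\<bar>d x - d y\<bar> <= norm (x - y)" for x y unfolding d_def using infdist_triangle_abs[of x "- \<Omega>" y] by (simp add: dist_norm)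
 have dc: "cont d" unfolding d_def by (intro continuous_intros)
 define f where "f a m x = max 0 (min 1 (m * d x - a))" for a m :: real and x
 have f01: "0 <= f a m x" "f a m x <= 1" for a m x by (auto simp: f_def)
 have fz: "x \<in> \<Omega>" if "f a m x \<noteq> 0" "0 <= a" for a m x using that d0[of x] by (cases "x \<in> \<Omega>") (auto simp: f_def)
 have fc: "cont (f a m)" for a m unfolding f_def by (intro continuous_intros dc)
 obtain R where R: "R > 0" "\<Omega> \<subseteq> ball 0 R" using bounded_subset_ballD[OF \<Omega>(2), of 0] by blast
 have fs: "ccs (f a m)" if "0 <= a" for a m
  by (rule ccsI[OF fc, of R]) (use fz[OF _ that] R in force)
 have fl: "\<bar>f a m x - f a m y\<bar> <= m * norm (x - y)" if "0 < m" for a m x y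
 proof -
  have "\<bar>f a m x - f a m y\<bar> <= \<bar>m * d x - m * d y\<bar>" unfolding f_def by (auto simp: max_def min_def abs_if)
  also have "... = m * \<bar>d x - d y\<bar>" using that by (simp add: abs_mult right_diff_distrib[symmetric])
  also have "... <= m * norm (x - y)" using that dl by (intro mult_left_mono) auto
  finally show ?thesis .
 qed
 have \<Omega>m: "\<Omega> \<in> sets borel" using \<Omega>(1) by simp
 have lim: "(%n. \<integral>x. f 3 (real n) x \<partial>lborel) \<longlonglongrightarrow> (LBINT x. indicator \<Omega> x)"
 proof (rule integral_dominated_convergence)
  show "L1 (%x. indicator \<Omega> x :: real)"
   using \<Omega>m emeasure_bounded_finite[OF \<Omega>(2)] by (simp add: integrable_indicator_iff)
  show "AE x in lborel. (%n. f 3 (real n) x) \<longlonglongrightarrow> indicator \<Omega> x"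
  proof (rule AE_I2)
   fix x show "(%n. f 3 (real n) x) \<longlonglongrightarrow> indicator \<Omega> x"
   proof (cases "x \<in> \<Omega>")
    case True
    have "\<forall>\<^sub>F n in sequentially. 4 / d x <= real n" using real_arch_simple eventually_sequentially
     by (metis dual_order.trans of_nat_mono)
    then have "\<forall>\<^sub>F n in sequentially. f 3 (real n) x = 1"
     by eventually_elim (use dp[OF True] in \<open>simp add: f_def field_simps\<close>)
    then show ?thesis using True by (simp add: tendsto_eventually)
   next
    case False
    then have "f 3 (real n) x = 0" for n by (simp add: f_def d0)
    then show ?thesis using False by simp
   qed
  qed
  show "AE x in lborel. norm (f 3 (real n) x) <= indicator \<Omega> x" for n
  proof (rule AE_I2)
   fix x show "norm (f 3 (real n) x) <= indicator \<Omega> x"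
    using f01[of 3 "real n" x] fz[of 3 "real n" x] by (cases "x \<in> \<Omega>") auto
  qed
  show "f 3 (real n) \<in> borel_measurable lborel" for n using borel_measurable_continuous_onI[OF fc] by simp
 qed (use \<Omega>m in simp)
 have me: "(LBINT x. indicator \<Omega> x) = measure lebesgue \<Omega>" using \<Omega>m by simp
 have "\<forall>\<^sub>F n in sequentially. measure lebesgue \<Omega> - c < (LBINT x. f 3 (real n) x)"
  using order_tendstoD(1)[OF lim[unfolded me], of "measure lebesgue \<Omega> - c"] c by simp
 then have "\<forall>\<^sub>F n in sequentially. 0 < n \<and> measure lebesgue \<Omega> - c < (LBINT x. f 3 (real n) x)"
  using eventually_gt_at_top[of 0] by eventually_elim simp
 from eventually_happens'[OF sequentially_bot this] obtain n where n: "0 < n" "measure lebesgue \<Omega> - c < (LBINT x. f 3 (real n) x)" by blast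
 define m where "m = real n"
 have m: "0 < m" using n by (simp add: m_def)
 define \<epsilon> where "\<epsilon> = min (1/m) (1/R)"
 have \<epsilon>: "0 < \<epsilon>" using m R by (simp add: \<epsilon>_def)
 have inU: "x \<in> inn \<Omega> \<epsilon>" if "f 1 m x \<noteq> 0" for x
 proof -
  have "m * d x > 1" using that by (auto simp: f_def max_def split: if_splits)
  then have "d x > 1/m" using m by (simp add: field_simps)
  have "ball x \<epsilon> \<subseteq> \<Omega>"
  proof
   fix y assume "y \<in> ball x \<epsilon>"
   then have "norm (x - y) < 1/m" by (simp add: \<epsilon>_def dist_norm)
   then have "d y > 0" using \<open>d x > 1/m\<close> dl[of x y] by linarith
   then show "y \<in> \<Omega>" using d0[of y] by (cases "y \<in> \<Omega>") auto
  qed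
  moreover have "norm x <= 1 / \<epsilon>"
  proof -
   have "norm x <= R" using fz[OF that] R by force
   moreover have "R * \<epsilon> <= 1" using R m by (simp add: \<epsilon>_def min_def field_simps)
   ultimately show ?thesis using \<epsilon> by (simp add: field_simps) (smt (verit) mult_right_mono mult.commute)
  qed
  ultimately show ?thesis by (simp add: inn_def)
 qed
 have sep: "f 1 m (x + v) = 1" if "f 3 m x \<noteq> 0" "norm v <= 1/m" for x v
 proof -
  have "m * d x > 3" using that(1) by (auto simp: f_def max_def split: if_splits)
  moreover have "m * d x <= m * (d (x + v) + 1/m)" using dl[of x "x + v"] that(2) m by (intro mult_left_mono) auto
  ultimately have "m * d (x + v) > 2" using m by (simp add: distrib_left)
  then show ?thesis by (simp add: f_def)
 qed
 show ?thesis
  by (rule exI[of _ "f 3 m"], rule exI[of _ "f 1 m"], rule exI[of _ \<epsilon>], rule exI[of _ m])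
    (use \<epsilon> m fs f01 fl[OF m] inU sep n in \<open>auto simp: m_def\<close>)
qed

text \<open>A single small \<tau> serves as flux threshold \<eta>, as Young parameter \<gamma> and
  as modulus cutoff \<delta> of the locale, so that later only one limit has to be taken. The smooth
  competitor disappears from the statement; its energy excess is the 1 in E.\<close>

lemma energy_lower_bound:
 fixes \<zeta> \<xi> :: "real^3 => real"
 assumes \<Omega>: "bounded \<Omega>" "open \<Omega>" "smooth_boundary \<Omega>"
  and \<psi>: "H1 \<Omega> \<psi>" and A: "Hdot1_div_F A" and kH: "0 < \<kappa>" "0 < H"
  and \<zeta>: "ccs \<zeta>" "\<And>x. 0 <= \<zeta> x" "\<And>x. \<zeta> x <= 1" "\<And>x y. \<bar>\<zeta> x - \<zeta> y\<bar> <= \<Lambda> * norm (x - y)"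
  and \<xi>: "ccs \<xi>" "\<And>x. 0 <= \<xi> x" "\<And>x. \<xi> x <= 1" "\<And>x. \<xi> x \<noteq> 0 ==> x \<in> inn \<Omega> \<epsilon>"
  and sep: "\<And>x v. \<zeta> x \<noteq> 0 ==> norm v <= r1 ==> \<xi> (x + v) = 1"
  and p: "0 < \<epsilon>" "0 <= \<Lambda>" "0 < \<tau>" "\<tau> <= 1/2" "pi * (\<kappa> * H) * r1^2 <= \<tau>/2" "1/\<kappa> <= r0" "r0 <= r1" "0 < \<nu>"
 defines "E \<equiv> GL_energy \<Omega> \<kappa> H \<psi> A + 1" and "h \<equiv> \<kappa> * H" and "Z \<equiv> (LBINT x. \<zeta> x)"
  and "K \<equiv> pi\<^sup>2/\<tau> + pi^2 + pi" and "V \<equiv> (LINT x:inn \<Omega> \<epsilon>|lborel. (1::real))"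
 shows "0 <= E \<and> (2 * pi * (pi - \<tau>) * h * Z - 2 * pi * (pi * \<Lambda> * (V + 4) + (Z + pi^2) / 2) * (\<nu> * h + E / (\<nu> * h))) * ln (r1 / r0)
   - 16 * pi * K / \<tau>^2 * E / (\<kappa> * r0) - (4 * K / \<tau>^2 + 1) * pi^2 * E * r1^2 / 2
   <= 2 * pi^2 * (1 + \<tau>) * E / (1 - \<tau>)^2"
proof -
 define U where "U = inn \<Omega> \<epsilon>"
 obtain u du a1 a2 da1 da2 where c: "\<forall>x. (u has_derivative du x) (at x)" "\<forall>v. cont (%x. du x v)"
  "\<forall>x. (a1 has_derivative da1 x) (at x)" "\<forall>v. cont (%x. da1 x v)"
  "\<forall>x. (a2 has_derivative da2 x) (at x)" "\<forall>v. cont (%x. da2 x v)"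
  and e: "(LBINT x. indicator U x * ((cmod (du x ex1 - \<i> * of_real (a1 x) * u x))^2 + (cmod (du x ex2 - \<i> * of_real (a2 x) * u x))^2))
  + \<kappa>^2/2 * (LBINT x. indicator U x * (1 - (cmod (u x))\<^sup>2)^2)
  + (LBINT x. indicator U x * (da2 x ex1 - da1 x ex2 - \<kappa> * H)^2) <= E"
  unfolding U_def E_def using C1_competitor[OF \<Omega> \<psi> A p(1) kH] by (elim exE conjE)
 have Uc: "compact U" using inn_compact[OF p(1)] by (simp add: U_def)
 interpret gl_config u du a1 a2 da1 da2 \<zeta> \<xi> U h \<kappa> r1 \<Lambda> \<tau>
 proof
  show "U \<in> sets borel" "bounded U" using Uc by (auto intro: borel_compact compact_imp_bounded)
  show "\<xi> x \<noteq> 0 ==> x \<in> U" for x using \<xi>(4) by (simp add: U_def)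
  show "0 < h" using kH by (simp add: h_def)
 qed (use c \<zeta> \<xi> sep p kH in blast)+
 have E: "IU kin + \<kappa>^2/2 * IU (%x. (pot x)^2) + IU (%x. (mag x)^2) <= E"
  using e[folded h_def] unfolding IU_def kin_def cov1_def cov2_def pot_def mag_def set_lebesgue_integral_def real_scaleR_def .
 have nn: "0 <= IU f" if "\<And>x. 0 <= f x" for f
  unfolding IU_def set_lebesgue_integral_def by (rule integral_nonneg_AE) (use that in auto)
 have n: "0 <= IU kin" "0 <= \<kappa>^2/2 * IU (%x. (pot x)^2)" "0 <= IU (%x. (mag x)^2)"
  by (intro mult_nonneg_nonneg nn; simp add: kin_def)+
 have kE: "IU kin <= E" using E n by linarith
 have V: "V = IU (%_. 1)" unfolding IU_def unfolding V_def U_def ..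
 have "\<tau> <= 1" using p by simp
 from kinetic_lower_bound[OF E p(3) this p(5)[folded h_def] p(3) p(6,7,8,2), folded Z_def K_def V]
 have "(2 * pi * (pi - \<tau>) * h * Z - 2 * pi * (pi * \<Lambda> * (V + 4) + (Z + pi^2) / 2) * (\<nu> * h + E / (\<nu> * h))) * ln (r1 / r0)
   - 16 * pi * K / \<tau>^2 * E / (\<kappa> * r0) - (4 * K / \<tau>^2 + 1) * pi^2 * E * r1^2 / 2
   <= 2 * pi^2 * (1 + \<tau>) * IU kin / (1 - \<tau>)^2" .
 also have "... <= 2 * pi^2 * (1 + \<tau>) * E / (1 - \<tau>)^2" using kE p by (intro divide_right_mono mult_left_mono) auto
 finally show ?thesis using kE n by linarith
qed

text \<open>The parameters are fixed in the order cutoff, \<tau>, M, and only then \<kappa> grows.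
  The errors contain the energy E itself; arguing by contradiction, a small energy gives E <= B h L,
  after which every error is a small fraction of h L.\<close>

lemma energy_liminf:
 fixes H :: "real => real"
 assumes \<Omega>: "bounded \<Omega>" "open \<Omega>" "smooth_boundary \<Omega>" and Hp: "\<And>\<kappa>. 0 < \<kappa> ==> 0 < H \<kappa>"
 defines "h \<equiv> %\<kappa>. \<kappa> * H \<kappa>" and "L \<equiv> %\<kappa>. ln (\<kappa> / H \<kappa>)"
 assumes h: "filterlim h at_top at_top" and L: "filterlim L at_top at_top" and Lh: "((%\<kappa>. L \<kappa> / h \<kappa>) \<longlongrightarrow> 0) at_top" and c: "0 < c"
 shows "\<forall>\<^sub>F \<kappa> in at_top. \<forall>\<psi> A. H1 \<Omega> \<psi> \<and> Hdot1_div_F A --> (measure lebesgue \<Omega> - c) * (h \<kappa> * L \<kappa> / 2) <= GL_energy \<Omega> \<kappa> (H \<kappa>) \<psi> A"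
proof -
 define \<mu> where "\<mu> = measure lebesgue \<Omega>"
 have c4: "0 < c/4" using c by simp
 obtain \<zeta> \<xi> :: "real^3 => real" and \<epsilon> m where \<epsilon>: "0 < \<epsilon>" "0 < m" and \<zeta>: "ccs \<zeta>" "\<forall>x. 0 <= \<zeta> x" "\<forall>x. \<zeta> x <= 1" "\<forall>x y. \<bar>\<zeta> x - \<zeta> y\<bar> <= m * norm (x - y)"
  and \<xi>: "ccs \<xi>" "\<forall>x. 0 <= \<xi> x" "\<forall>x. \<xi> x <= 1" "\<forall>x. \<xi> x \<noteq> 0 --> x \<in> inn \<Omega> \<epsilon>"
  and sep: "\<forall>x v. \<zeta> x \<noteq> 0 --> norm v <= 1/m --> \<xi> (x + v) = 1" and Z0: "\<mu> - c/4 < (LBINT x. \<zeta> x)"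
  using cutoff_exists[OF \<Omega>(2,1) c4] unfolding \<mu>_def by (elim exE conjE)
 define Z where "Z = (LBINT x. \<zeta> x)"
 define V where "V = (LINT x:inn \<Omega> \<epsilon>|lborel. (1::real))"
 define W where "W = pi * m * (V + 4) + (Z + pi^2) / 2"
 define B where "B = \<mu> + 1"
 have "0 <= V" unfolding V_def set_lebesgue_integral_def by (rule integral_nonneg_AE) auto
 moreover have Zn: "0 <= Z" using \<zeta>(2) by (simp add: Z_def)
 ultimately have W: "0 <= W" unfolding W_def using \<epsilon> by (intro add_nonneg_nonneg mult_nonneg_nonneg divide_nonneg_nonneg) auto
 have B: "1 <= B" by (simp add: B_def \<mu>_def)
 \<comment> \<open>The inverse of the factor of E on the right of \<open>energy_lower_bound\<close>;
   at \<tau> = 0 it is \<open>1 / (2 * pi^2)\<close>, and the leading term becomes Z/2.\<close>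
 define q where "q \<tau> = (1 - \<tau>)^2 / (2 * pi^2 * (1 + \<tau>))" for \<tau> :: real
 have "((%\<tau>. q \<tau> * (pi * (pi - \<tau>) * Z)) \<longlongrightarrow> q 0 * (pi * (pi - 0) * Z)) (at_right 0)"
  unfolding q_def by (intro tendsto_intros) auto
 moreover have "q 0 * (pi * (pi - 0) * Z) = Z/2" by (simp add: q_def power2_eq_square)
 ultimately have "((%\<tau>. q \<tau> * (pi * (pi - \<tau>) * Z)) \<longlongrightarrow> Z/2) (at_right 0)" by (simp only:)
 then have "\<forall>\<^sub>F \<tau> in at_right 0. Z/2 - c/16 < q \<tau> * (pi * (pi - \<tau>) * Z)" by (rule order_tendstoD(1)) (use c in simp)
 moreover have "\<forall>\<^sub>F \<tau>::real in at_right 0. 0 < \<tau> \<and> \<tau> <= 1/2"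
  using eventually_at_right_less[of 0] eventually_at_right_real[of 0 "1/2"] by (auto elim: eventually_elim2)
 ultimately have "\<forall>\<^sub>F \<tau> in at_right 0. Z/2 - c/16 < q \<tau> * (pi * (pi - \<tau>) * Z) \<and> 0 < \<tau> \<and> \<tau> <= 1/2" by eventually_elim simp
 from eventually_happens'[OF _ this] obtain \<tau> where \<tau>: "Z/2 - c/16 < q \<tau> * (pi * (pi - \<tau>) * Z)" "0 < \<tau>" "\<tau> <= 1/2" by auto
 define K where "K = pi^2/\<tau> + pi^2 + pi"
 have K: "0 <= K" using \<tau> by (simp add: K_def)
 have q0: "0 < q \<tau>" using \<tau> by (simp add: q_def)
 define a2 where "a2 = 16 * pi * K / \<tau>^2"
 define a3 where "a3 = (4 * K / \<tau>^2 + 1) * pi^2"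
 have a: "0 <= a2" "0 <= a3" using K by (auto simp: a2_def a3_def)
 have "((%M. q \<tau> * (pi * (pi - \<tau>) * Z - pi * W * (1/M) - a2 * B * (1/M))) \<longlongrightarrow> q \<tau> * (pi * (pi - \<tau>) * Z - pi * W * 0 - a2 * B * 0)) at_top"
  by (intro tendsto_intros tendsto_divide_0[OF tendsto_const] filterlim_at_top_imp_at_infinity filterlim_ident)
 then have "\<forall>\<^sub>F M in at_top. Z/2 - c/16 < q \<tau> * (pi * (pi - \<tau>) * Z - pi * W * (1/M) - a2 * B * (1/M))"
  by (rule order_tendstoD(1)) (use \<tau> in simp)
 then have "\<forall>\<^sub>F M in at_top. Z/2 - c/16 < q \<tau> * (pi * (pi - \<tau>) * Z - pi * W * (1/M) - a2 * B * (1/M)) \<and> 1 <= M \<and> 2 * pi / \<tau> <= M"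
  using eventually_ge_at_top[of 1] eventually_ge_at_top[of "2 * pi / \<tau>"] by eventually_elim simp
 from eventually_happens'[OF _ this] obtain M where M: "Z/2 - c/16 < q \<tau> * (pi * (pi - \<tau>) * Z - pi * W * (1/M) - a2 * B * (1/M))"
  "1 <= M" "2 * pi / \<tau> <= M" by auto
 define \<nu> where "\<nu> = 1/M"
 have \<nu>: "0 < \<nu>" using M by (simp add: \<nu>_def)
 define g where "g \<kappa> = 1/2 - 2 * ln M / L \<kappa>" for \<kappa>
 \<comment> \<open>The lower bound divided by h L, with B h L inserted for E. Here g is
   \<open>ln (r1 / r0) / L\<close>, with limit 1/2. The terms with L/h and 1/h vanish in the limit;
   those with \<nu> = 1/M and \<open>a2 * B / M\<close> stay and are small by the choice of
   M.\<close>
 define Low where "Low \<kappa> = (2 * pi * (pi - \<tau>) * Z - 2 * pi * W * (\<nu> + B / \<nu> * (L \<kappa> / h \<kappa>))) * g \<kappa> - a2 * B / M - a3 * B / (2 * M^2) / h \<kappa>" for \<kappa>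
 have g: "(g \<longlongrightarrow> 1/2 - 0) at_top" unfolding g_def
  by (intro tendsto_intros tendsto_divide_0[OF tendsto_const] filterlim_at_top_imp_at_infinity L)
 have "((%\<kappa>. q \<tau> * Low \<kappa>) \<longlongrightarrow> q \<tau> * ((2 * pi * (pi - \<tau>) * Z - 2 * pi * W * (\<nu> + B / \<nu> * 0)) * (1/2 - 0) - a2 * B / M - 0)) at_top"
  unfolding Low_def by (intro tendsto_intros g Lh tendsto_divide_0[OF tendsto_const] filterlim_at_top_imp_at_infinity h)
 moreover have "(2 * pi * (pi - \<tau>) * Z - 2 * pi * W * (\<nu> + B / \<nu> * 0)) * (1/2 - 0) - a2 * B / M - 0 = pi * (pi - \<tau>) * Z - pi * W * (1/M) - a2 * B * (1/M)"
  by (simp add: \<nu>_def algebra_simps)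
 ultimately have "((%\<kappa>. q \<tau> * Low \<kappa>) \<longlongrightarrow> q \<tau> * (pi * (pi - \<tau>) * Z - pi * W * (1/M) - a2 * B * (1/M))) at_top" by (simp only:)
 from order_tendstoD(1)[OF this M(1)] have "\<forall>\<^sub>F \<kappa> in at_top. Z/2 - c/16 < q \<tau> * Low \<kappa>" .
 moreover have "\<forall>\<^sub>F \<kappa> in at_top. 0 < g \<kappa>" by (rule order_tendstoD(1)[OF g]) simp
 moreover have "\<forall>\<^sub>F \<kappa> in at_top. m^2 + 1 <= h \<kappa>" "\<forall>\<^sub>F \<kappa> in at_top. 1 + 4/c <= L \<kappa>"
  using h L by (auto simp: filterlim_at_top)
 moreover have "\<forall>\<^sub>F \<kappa>::real in at_top. 0 < \<kappa>" by (rule eventually_gt_at_top)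
 ultimately show ?thesis
 proof eventually_elim
  case (elim \<kappa>)
  have k: "0 < \<kappa>" "0 < H \<kappa>" using elim Hp by auto
  have h1: "1 <= h \<kappa>" "m^2 <= h \<kappa>" using elim(3) zero_le_power2[of m] by linarith+
  have L1: "1 <= L \<kappa>" "4/c <= L \<kappa>" using elim(4) c by (auto simp: add_increasing2 intro: order_trans[OF _ elim(4)])
  have "L \<kappa> <= h \<kappa> * L \<kappa>" using h1 L1 by simp
  then have hL: "1 <= h \<kappa> * L \<kappa>" "4/c <= h \<kappa> * L \<kappa>" using L1 by linarith+
  have hh: "h \<kappa> = \<kappa> * H \<kappa>" by (simp add: h_def)
  define N where "N = h \<kappa> * L \<kappa>"
  \<comment> \<open>M core sizes at the inner end, and at the outer end the fraction 1/M of the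
    spacing scale 1/sqrt h, whence ln (r1/r0) = L/2 - 2 ln M. The flux through the outer disc is
    pi/M^2, at most \<tau>/2 because M >= 2 pi/\<tau> and M >= 1.\<close>
  define r0 where "r0 = M / \<kappa>"
  define r1 where "r1 = 1 / (M * sqrt (h \<kappa>))"
  have sh: "0 < sqrt (h \<kappa>)" "m <= sqrt (h \<kappa>)" using h1 \<epsilon> by (auto intro: real_le_rsqrt)
  have r: "0 < r0" "0 < r1" using M k sh by (auto simp: r0_def r1_def)
  have r12: "r1^2 = 1 / (M^2 * h \<kappa>)" using h1 by (simp add: r1_def power_divide power_mult_distrib)
  have ln: "ln (r1 / r0) = L \<kappa> * g \<kappa>"
  proof -
   have "ln (sqrt (h \<kappa>)) = (ln \<kappa> + ln (H \<kappa>)) / 2" using k h1 by (simp add: ln_sqrt hh ln_mult)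
   then have "ln (r1 / r0) = (ln \<kappa> - ln (H \<kappa>)) / 2 - 2 * ln M"
    using M k sh r by (simp add: ln_div r0_def r1_def ln_mult field_simps)
   moreover have "L \<kappa> * g \<kappa> = L \<kappa> / 2 - 2 * ln M" using L1 by (simp add: g_def right_diff_distrib)
   moreover have "L \<kappa> = ln \<kappa> - ln (H \<kappa>)" using k by (simp add: L_def ln_div)
   ultimately show ?thesis by simp
  qed
  have "0 < ln (r1 / r0)" unfolding ln using L1 elim(2) by (intro mult_pos_pos) auto
  then have rr: "r0 <= r1" using r by (simp add: ln_gt_zero_iff)
  have r1m: "r1 <= 1/m"
  proof -
   have "m <= 1 * sqrt (h \<kappa>)" using sh by simp
   also have "... <= M * sqrt (h \<kappa>)" using M sh by (intro mult_right_mono) auto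
   finally show ?thesis unfolding r1_def using \<epsilon> by (simp add: frac_le)
  qed
  have pr: "pi * (\<kappa> * H \<kappa>) * r1^2 <= \<tau>/2"
  proof -
   have "2 * pi <= M * \<tau>" using M(3) \<tau> by (simp add: field_simps)
   also have "... <= M^2 * \<tau>" using M \<tau> by (simp add: power2_eq_square)
   finally show ?thesis unfolding hh[symmetric] r12 using h1 M by (simp add: field_simps)
  qed
  have r0k: "1/\<kappa> <= r0" using M k by (simp add: r0_def divide_right_mono)
  show ?case
  proof (intro allI impI)
   fix \<psi> A assume adm: "H1 \<Omega> \<psi> \<and> Hdot1_div_F A"
   define E where "E = GL_energy \<Omega> \<kappa> (H \<kappa>) \<psi> A + 1"
   have main: "0 <= E \<and> (2 * pi * (pi - \<tau>) * h \<kappa> * Z - 2 * pi * W * (\<nu> * h \<kappa> + E / (\<nu> * h \<kappa>))) * ln (r1 / r0)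
    - a2 * E / (\<kappa> * r0) - a3 * E * r1^2 / 2 <= 2 * pi^2 * (1 + \<tau>) * E / (1 - \<tau>)^2"
    unfolding E_def a2_def a3_def K_def W_def Z_def V_def hh
   proof (rule energy_lower_bound[OF \<Omega> _ _ k \<zeta>(1) _ _ _ \<xi>(1)])
    show "\<xi> (x + v) = 1" if "\<zeta> x \<noteq> 0" "norm v <= r1" for x v using sep that r1m by (meson order_trans)
   qed (use adm \<zeta> \<xi> \<epsilon> \<tau> \<nu> pr r0k rr in auto)
   show "(measure lebesgue \<Omega> - c) * (h \<kappa> * L \<kappa> / 2) <= GL_energy \<Omega> \<kappa> (H \<kappa>) \<psi> A"
   proof (rule ccontr)
    assume "\<not> ?thesis"
    then have less: "E - 1 < (\<mu> - c) * (N / 2)" by (simp add: E_def \<mu>_def N_def)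
    have N: "1 <= N" "4/c <= N" using hL by (auto simp: N_def)
    have "(\<mu> - c) * (N / 2) <= \<mu> * (N/2)" using c N by (intro mult_right_mono) auto
    also have "... <= \<mu> * N" using N by (intro mult_left_mono) (auto simp: \<mu>_def)
    finally have EN: "E <= B * N" using less N by (simp add: B_def algebra_simps)
    \<comment> \<open>This is the source of the ratio L/h: under the assumed bound, E/h is at most B
      L, which is small against h.\<close>
    have e1: "E / (\<nu> * h \<kappa>) <= h \<kappa> * (B / \<nu> * (L \<kappa> / h \<kappa>))"
     using divide_right_mono[OF EN, of "\<nu> * h \<kappa>"] \<nu> h1 by (simp add: N_def field_simps)
    have e2: "a2 * E / (\<kappa> * r0) <= N * (a2 * B / M)"
     using divide_right_mono[OF mult_left_mono[OF EN a(1)], of M] k M by (simp add: r0_def field_simps)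
    have e3: "a3 * E * r1^2 / 2 <= N * (a3 * B / (2 * M^2) / h \<kappa>)"
     using divide_right_mono[OF mult_left_mono[OF EN a(2)], of "2 * M^2 * h \<kappa>"] h1 M unfolding r12 by (simp add: field_simps)
    have "N * Low \<kappa> = (h \<kappa> * (2 * pi * (pi - \<tau>) * Z - 2 * pi * W * (\<nu> + B / \<nu> * (L \<kappa> / h \<kappa>)))) * (L \<kappa> * g \<kappa>) - N * (a2 * B / M) - N * (a3 * B / (2 * M^2) / h \<kappa>)"
     unfolding Low_def N_def by (simp only: right_diff_distrib mult_ac)
    also have "... <= (2 * pi * (pi - \<tau>) * h \<kappa> * Z - 2 * pi * W * (\<nu> * h \<kappa> + E / (\<nu> * h \<kappa>))) * (L \<kappa> * g \<kappa>) - a2 * E / (\<kappa> * r0) - a3 * E * r1^2 / 2"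
    proof -
     have "2 * pi * W * (\<nu> * h \<kappa> + E / (\<nu> * h \<kappa>)) <= 2 * pi * W * (\<nu> * h \<kappa> + h \<kappa> * (B / \<nu> * (L \<kappa> / h \<kappa>)))"
      using e1 W by (intro mult_left_mono) auto
     then have "h \<kappa> * (2 * pi * (pi - \<tau>) * Z - 2 * pi * W * (\<nu> + B / \<nu> * (L \<kappa> / h \<kappa>))) <= 2 * pi * (pi - \<tau>) * h \<kappa> * Z - 2 * pi * W * (\<nu> * h \<kappa> + E / (\<nu> * h \<kappa>))"
      by (simp only: right_diff_distrib distrib_left mult_ac)
     then have "h \<kappa> * (2 * pi * (pi - \<tau>) * Z - 2 * pi * W * (\<nu> + B / \<nu> * (L \<kappa> / h \<kappa>))) * (L \<kappa> * g \<kappa>) <= (2 * pi * (pi - \<tau>) * h \<kappa> * Z - 2 * pi * W * (\<nu> * h \<kappa> + E / (\<nu> * h \<kappa>))) * (L \<kappa> * g \<kappa>)"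
      using L1 elim(2) by (intro mult_right_mono mult_nonneg_nonneg) auto
     then show ?thesis using e2 e3 by linarith
    qed
    also have "... <= 2 * pi^2 * (1 + \<tau>) * E / (1 - \<tau>)^2" using main unfolding ln by (rule conjunct2)
    finally have "q \<tau> * (N * Low \<kappa>) <= q \<tau> * (2 * pi^2 * (1 + \<tau>) * E / (1 - \<tau>)^2)" using q0 by (intro mult_left_mono) auto
    also have "... = E"
    proof -
     have "x / y * (y * e / x) = e" if "x \<noteq> 0" "y \<noteq> 0" for x y e :: real using that by simp
     then show ?thesis unfolding q_def using \<tau> by simp
    qed
    finally have "N * (q \<tau> * Low \<kappa>) <= E" by (simp only: mult_ac)
    moreover have "N * (Z/2 - c/16) <= N * (q \<tau> * Low \<kappa>)" using elim(1) N by (intro mult_left_mono) auto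
    moreover have "N * (\<mu>/2 - c/4) <= N * (Z/2 - c/16)" using Z0 N c by (intro mult_left_mono) (auto simp: Z_def[symmetric])
    moreover have "1 <= N * (c/4)" using N(2) c by (simp add: field_simps)
    ultimately show False using less by (simp add: algebra_simps)
   qed
  qed
 qed
qed

section \<open>Vortex lattices and the upper bound\<close>

text \<open>The usual primitive, a multiple of \<open>arctan (r / p * tan (pi * y))\<close>, jumps
  at y = 1/2. The difference between pi y and that arctan is, by the addition formula,
  \<open>arctan (N y / M y)\<close> with M > 0, which is smooth on the whole line; G is the
  resulting continuous branch.\<close>

lemma integral_cos2_le:
 assumes A: "0 < A" and B: "0 <= B"
 shows "integral {0..1} (%y. 1 / (A + B * (cos (pi * y))^2)) <= 1 / (sqrt A * sqrt (A + B))"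
proof -
 define p r where "p = sqrt (A + B)" and "r = sqrt A"
 have p: "0 < p" "0 < r" "p^2 = A + B" "r^2 = A" using A B by (auto simp: p_def r_def)
 define M where "M y = p * (cos (pi * y))^2 + r * (sin (pi * y))^2" for y
 define N where "N y = (p - r) * (sin (pi * y) * cos (pi * y))" for y
 define G where "G y = (pi * y - arctan (N y / M y)) / (pi * p * r)" for y
 have D: "(G has_real_derivative 1 / (A + B * (cos (pi * y))^2)) (at y)" for y
 proof -
  define c s where "c = cos (pi * y)" and "s = sin (pi * y)"
  have cs: "c^2 + s^2 = 1" by (simp add: c_def s_def)
  have AB: "A + B * c^2 = p^2 * c^2 + r^2 * s^2" using cs p(3,4) by algebra
  have Mp: "0 < M y"
  proof (cases "c = 0")
   case True then show ?thesis using cs p by (simp add: M_def c_def[symmetric] s_def[symmetric])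
  next
   case False then show ?thesis using p by (simp add: M_def c_def[symmetric] s_def[symmetric] add_pos_nonneg)
  qed
  have dN: "(N has_real_derivative pi * ((p - r) * (c^2 - s\<^sup>2))) (at y)"
   unfolding N_def c_def s_def by (auto intro!: derivative_eq_intros simp: power2_eq_square algebra_simps)
  have dM: "(M has_real_derivative - (pi * (2 * (p - r) * (s * c)))) (at y)"
   unfolding M_def c_def s_def by (auto intro!: derivative_eq_intros simp: algebra_simps)
  have Ny: "N y = (p - r) * (s * c)" and My: "M y = p * c^2 + r * s^2" by (auto simp: N_def M_def c_def s_def)
  have e1: "(M y)^2 + (N y)^2 = A + B * c^2" unfolding AB Ny My using cs by algebra
  have e2: "pi * ((p - r) * (c^2 - s\<^sup>2)) * M y - N y * - (pi * (2 * (p - r) * (s * c))) = pi * ((p - r) * (p * c^2 - r * s^2))"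
   unfolding Ny My using cs by algebra
  have Q: "0 < A + B * c^2" using A B by (simp add: add_pos_nonneg)
  have "((%y. arctan (N y / M y)) has_real_derivative
    inverse (1 + (N y / M y)^2) * ((pi * ((p - r) * (c^2 - s\<^sup>2)) * M y - N y * - (pi * (2 * (p - r) * (s * c)))) / (M y * M y))) (at y)"
   by (rule DERIV_chain2[OF DERIV_arctan DERIV_divide[OF dN dM]]) (use Mp in simp)
  also have "inverse (1 + (N y / M y)^2) * ((pi * ((p - r) * (c^2 - s\<^sup>2)) * M y - N y * - (pi * (2 * (p - r) * (s * c)))) / (M y * M y))
   = pi * ((p - r) * (p * c^2 - r * s^2)) / (A + B * c^2)"
   unfolding e2 e1[symmetric] using Mp by (simp add: power_divide inverse_eq_divide divide_simps power2_eq_square)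
  finally have "(G has_real_derivative (pi * 1 - pi * ((p - r) * (p * c^2 - r * s^2)) / (A + B * c^2)) / (pi * p * r)) (at y)"
   unfolding G_def by (intro DERIV_cdivide DERIV_diff DERIV_cmult DERIV_ident)
  also have "pi * 1 - pi * ((p - r) * (p * c^2 - r * s^2)) / (A + B * c^2) = pi * p * r / (A + B * c^2)"
  proof -
   have "A + B * c^2 - (p - r) * (p * c^2 - r * s^2) = p * r" unfolding AB using cs by algebra
   then have "pi * (A + B * c^2) - pi * ((p - r) * (p * c^2 - r * s^2)) = pi * p * r" by (simp only: right_diff_distrib[symmetric] mult.assoc)
   then show ?thesis using Q by (simp add: field_simps)
  qed
  finally show ?thesis using p by (simp add: c_def)
 qed
 have "((%y. 1 / (A + B * (cos (pi * y))^2)) has_integral G 1 - G 0) {0..1}"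
  by (rule has_integral_antiderivative[OF D]) simp
 moreover have "G 1 - G 0 = 1 / (r * p)" using p by (simp add: G_def N_def)
 ultimately show ?thesis by (simp add: integral_unique p_def r_def)
qed

text \<open>With an extra factor \<open>sin (pi * x)\<close> both integrands have explicit
  primitives. Removing that factor costs at most 1 each, since 1 - sin <= |cos| <= sqrt A on the
  unit interval. The \<open>arsinh\<close> becomes the logarithm of the final energy.\<close>

lemma integral_inverse_sqrt_le:
 assumes t: "0 < t" and C1: "0 <= C1" and K: "0 <= K"
 defines "A \<equiv> %x. (cos (pi * x))^2 + t^2"
 shows "integral {0..1} (%x. C1 * (t^2 / (A x * sqrt (A x))) + K / sqrt (A x) + C2) <= 2 * C1 + K * (2/pi * arsinh (1/t) + 1) + C2"
proof -
 have Ap: "0 < A x" for x using t by (simp add: A_def add_nonneg_pos)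
 have Ac: "continuous_on S A" for S unfolding A_def by (intro continuous_intros)
 define F where "F x = - cos (pi * x) / (pi * sqrt (A x))" for x
 define G where "G x = arsinh (- cos (pi * x) / t) / pi" for x
 have dA: "(A has_real_derivative - 2 * pi * sin (pi * x) * cos (pi * x)) (at x)" for x
  unfolding A_def by (auto intro!: derivative_eq_intros)
 have dF: "(F has_real_derivative sin (pi * x) * (t^2 / (A x * sqrt (A x)))) (at x)" for x
 proof -
  have d1: "((%x. - cos (pi * x)) has_real_derivative pi * sin (pi * x)) (at x)" by (auto intro!: derivative_eq_intros)
  have d2: "((%x. pi * sqrt (A x)) has_real_derivative pi * (inverse (sqrt (A x)) / 2 * (- 2 * pi * sin (pi * x) * cos (pi * x)))) (at x)"
   by (rule DERIV_cmult[OF DERIV_chain2[OF DERIV_real_sqrt[OF Ap] dA]])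
  have *: "(F has_real_derivative (pi * sin (pi * x) * (pi * sqrt (A x)) - - cos (pi * x) * (pi * (inverse (sqrt (A x)) / 2 * (- 2 * pi * sin (pi * x) * cos (pi * x))))) / (pi * sqrt (A x) * (pi * sqrt (A x)))) (at x)"
   unfolding F_def by (rule DERIV_divide[OF d1 d2]) (use Ap[of x] in simp)
  have "(p * S * (p * r) - - C * (p * (inverse r / 2 * (- 2 * p * S * C)))) / (p * r * (p * r)) = S * (T / (a * r))"
   if "0 < r" "a = r * r" "T = r * r - C\<^sup>2" "0 < p" for p r S C T a :: real
   using that(1,4) unfolding that(2,3) by (simp add: field_simps power2_eq_square)
  note eq = this
  have sq: "A x = sqrt (A x) * sqrt (A x)" using Ap[of x] by simp
  have "t^2 = sqrt (A x) * sqrt (A x) - (cos (pi * x))\<^sup>2" unfolding sq[symmetric] by (simp add: A_def)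
  from *[unfolded eq[OF real_sqrt_gt_zero[OF Ap] sq this pi_gt_zero]] show ?thesis .
 qed
 have dG: "(G has_real_derivative sin (pi * x) / sqrt (A x)) (at x)" for x
 proof -
  have "(G has_real_derivative 1 / sqrt ((- cos (pi * x) / t)^2 + 1) * (pi * sin (pi * x) / t) / pi) (at x)"
   unfolding G_def by (rule DERIV_cdivide, rule DERIV_chain2[OF arsinh_real_has_field_derivative]) (use t in \<open>auto intro!: derivative_eq_intros\<close>)
  moreover have "sqrt ((- cos (pi * x) / t)^2 + 1) = sqrt (A x) / t"
  proof -
   have "(- cos (pi * x) / t)^2 + 1 = A x / t^2" using t by (simp add: A_def field_simps)
   then show ?thesis using t by (simp add: real_sqrt_divide)
  qed
  ultimately show ?thesis using t by simp
 qed
 have hF: "((%x. sin (pi * x) * (t^2 / (A x * sqrt (A x)))) has_integral F 1 - F 0) {0..1}" by (rule has_integral_antiderivative[OF dF]) simp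
 have hG: "((%x. sin (pi * x) / sqrt (A x)) has_integral G 1 - G 0) {0..1}" by (rule has_integral_antiderivative[OF dG]) simp
 have c: "((%x. C1 * (sin (pi * x) * (t^2 / (A x * sqrt (A x))) + 1) + K * (sin (pi * x) / sqrt (A x) + 1) + C2) has_integral
   C1 * ((F 1 - F 0) + (1 - 0)) + K * ((G 1 - G 0) + (1 - 0)) + C2 * (1 - 0)) {0..1}"
  by (intro has_integral_add has_integral_mult_right hF hG) (use has_integral_const_real[of _ 0 1] in auto)
 have "integral {0..1} (%x. C1 * (t^2 / (A x * sqrt (A x))) + K / sqrt (A x) + C2)
   <= C1 * ((F 1 - F 0) + (1 - 0)) + K * ((G 1 - G 0) + (1 - 0)) + C2 * (1 - 0)"
  unfolding integral_unique[OF c, symmetric]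
 proof (rule integral_le)
  show "(%x. C1 * (t^2 / (A x * sqrt (A x))) + K / sqrt (A x) + C2) integrable_on {0..1}"
   using Ap by (intro integrable_continuous_real continuous_intros Ac) (auto simp: less_imp_neq[symmetric])
  fix x :: real assume x: "x \<in> {0..1}"
  define S C a where "S = sin (pi * x)" and "C = cos (pi * x)" and "a = sqrt (A x)"
  have S: "0 <= S" unfolding S_def using x by (intro sin_ge_zero) auto
  have SC: "S^2 + C^2 = 1" by (simp add: S_def C_def)
  have a: "0 < a" "\<bar>C\<bar> <= a" "A x = a * a" "t^2 <= a * a" using Ap[of x] by (auto simp: a_def A_def C_def intro: real_le_rsqrt)
  have "S <= 1" by (simp add: S_def)
  then have "0 <= 2 * (S * (1 - S))" using S by simp
  also have "... = C^2 - (1 - S)\<^sup>2" using SC by algebra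
  finally have "\<bar>1 - S\<bar> <= \<bar>C\<bar>" by (simp add: abs_le_square_iff)
  then have sa: "1 - S <= a" using a(2) by linarith
  have "1 / a <= S / a + 1" using sa a by (simp add: field_simps)
  moreover have "t^2 / (a * a * a) <= S * (t^2 / (a * a * a)) + 1"
  proof -
   have "(1 - S) * t^2 <= a * (a * a)" using sa a by (intro mult_mono) auto
   then show ?thesis using a by (simp add: field_simps)
  qed
  ultimately have "C1 * (t^2 / (a * a * a)) + K * (1 / a) + C2 <= C1 * (S * (t^2 / (a * a * a)) + 1) + K * (S / a + 1) + C2"
   using C1 K by (intro add_mono mult_left_mono) auto
  then show "C1 * (t^2 / (A x * sqrt (A x))) + K / sqrt (A x) + C2 <= C1 * (sin (pi * x) * (t^2 / (A x * sqrt (A x))) + 1) + K * (sin (pi * x) / sqrt (A x) + 1) + C2"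
   unfolding a_def[symmetric] S_def[symmetric] unfolding a(3) by simp
 qed (use c in blast)
 also have "... <= C1 * 2 + K * (2/pi * arsinh (1/t) + 1) + C2"
 proof -
  have "1 / sqrt (1 + t^2) <= 1" by (simp add: divide_le_eq_1 add_pos_nonneg)
  moreover have "F 1 - F 0 = 2/pi * (1 / sqrt (1 + t^2))" by (simp add: F_def A_def)
  moreover have "2/pi <= 1" using pi_gt3 by simp
  ultimately have "F 1 - F 0 <= 1" by (smt (verit) mult_le_one divide_nonneg_nonneg real_sqrt_ge_zero zero_le_power2 pi_ge_zero)
  then have "C1 * ((F 1 - F 0) + (1 - 0)) <= C1 * 2" using C1 by (intro mult_left_mono) auto
  moreover have "G 1 - G 0 = 2/pi * arsinh (1/t)" using arsinh_minus_real[of "1/t"] by (simp add: G_def)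
  ultimately show ?thesis by simp
 qed
 finally show ?thesis by simp
qed

section \<open>Averages over translates of a periodic function\<close>

lemma nn_integral_periodic:
 fixes f :: "real => real"
 assumes c: "cont f" and per: "\<And>x. f (x + 1) = f x" "\<And>x. f (- x) = f x" and f: "\<And>x. 0 <= f x" and m: "integral {0..1} f <= m"
 shows "(\<integral>\<^sup>+b. ennreal (f (y - b)) * indicator {0..1} b \<partial>lborel) <= ennreal m"
proof -
 have "cont (%b. f (y - b))" by (rule continuous_on_compose2[OF c]) (auto intro: continuous_intros)
 then have "((%b. f (y - b)) has_integral integral {0..1} (%b. f (y - b))) {0..1}"
  by (intro integrable_integral integrable_continuous_real) (auto intro: continuous_on_subset)
 moreover have "(%b. f (y - b)) \<in> BM" by (rule borel_measurable_continuous_onI) fact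
 ultimately have "(\<integral>\<^sup>+b. ennreal (f (y - b)) * indicator {0..1} b \<partial>lborel) = ennreal (integral {0..1} (%b. f (y - b)))"
  using f by (intro nn_integral_has_integral_lebesgue') auto
 also have "integral {0..1} (%b. f (y - b)) = integral {0..1} (%b. f (b + - y))" using per(2)[of "y - b" for b] by simp
 also have "... = integral {0..1} f" by (rule integral_periodic_shift[OF c]) (use per in auto)
 finally show ?thesis using m by (simp add: ennreal_leI)
qed

text \<open>If every translate were above the mean by 1, integrating over the translates would
  contradict Fubini. The slack 1 avoids any question of attaining the mean and is of lower order
  than the logarithm.\<close>

lemma translate_average:
 fixes P :: "real^3 => real => real"
 assumes c: "cont (%(x, a). P x a)" and [measurable]: "\<Omega> \<in> sets borel"
  and PM: "\<And>x. (\<integral>\<^sup>+a. ennreal (P x a) * indicator {0..1} a \<partial>lborel) <= ennreal (M x)"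
  and I: "(\<integral>\<^sup>+x. ennreal (M x) * indicator \<Omega> x \<partial>lborel) <= ennreal I" "0 <= I"
 shows "\<exists>a. (\<integral>\<^sup>+x. ennreal (P x a) * indicator \<Omega> x \<partial>lborel) <= ennreal (I + 1)"
proof (rule ccontr)
 assume "\<not> ?thesis"
 then have big: "ennreal (I + 1) <= (\<integral>\<^sup>+x. ennreal (P x a) * indicator \<Omega> x \<partial>lborel)" for a by (meson linear)
 have "(%(x, a). P x a) \<in> BM" by (rule borel_measurable_continuous_onI[OF c])
 then have Pm[measurable]: "(%(x, a). P x a) \<in> borel_measurable (lborel \<Otimes>\<^sub>M lborel)" by (simp add: lborel_prod)
 have "ennreal (I + 1) = (\<integral>\<^sup>+a. ennreal (I + 1) * indicator {0..1::real} a \<partial>lborel)" by (simp add: nn_integral_cmult_indicator)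
 also have "... <= (\<integral>\<^sup>+a. (\<integral>\<^sup>+x. ennreal (P x a) * indicator \<Omega> x \<partial>lborel) * indicator {0..1} a \<partial>lborel)"
  using big by (intro nn_integral_mono mult_right_mono) auto
 also have "... = (\<integral>\<^sup>+a. (\<integral>\<^sup>+x. ennreal (P x a) * indicator \<Omega> x * indicator {0..1} a \<partial>lborel) \<partial>lborel)"
  by (intro nn_integral_cong nn_integral_multc[symmetric]) measurable
 also have "... = (\<integral>\<^sup>+x. (\<integral>\<^sup>+a. ennreal (P x a) * indicator \<Omega> x * indicator {0..1} a \<partial>lborel) \<partial>lborel)"
  by (rule lborel_pair.Fubini') measurable
 also have "... <= (\<integral>\<^sup>+x. ennreal (M x) * indicator \<Omega> x \<partial>lborel)"
  using PM by (intro nn_integral_mono) (auto simp: indicator_def)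
 also note I(1)
 finally show False using I(2) by simp
qed

text \<open>A raised cosine: a C^1 partition of unity under integer translates. This shape makes the
  squared modulus of the lattice function exactly 1 minus a product of two squared sines.\<close>

definition hat :: "real => real" where "hat x = (if x \<in> {-1..1} then (1 + cos (pi * x)) / 2 else 0)"
definition hat' :: "real => real" where "hat' x = (if x \<in> {-1..1} then - (pi / 2) * sin (pi * x) else 0)"

lemma hat_outside: "1 <= \<bar>x\<bar> ==> hat x = 0" "1 <= \<bar>x\<bar> ==> hat' x = 0"
proof -
 have "x = 1 \<or> x = - 1 \<or> x \<notin> {-1..1}" if "1 <= \<bar>x\<bar>" using that by auto
 then show "1 <= \<bar>x\<bar> ==> hat x = 0" "1 <= \<bar>x\<bar> ==> hat' x = 0" by (auto simp: hat_def hat'_def)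
qed

lemma hat_deriv: "(hat has_real_derivative hat' x) (at x)"
proof -
 have cl: "closure {y :: real. 1 < \<bar>y\<bar>} \<subseteq> {y. 1 <= \<bar>y\<bar>}"
  by (rule closure_minimal) (auto intro!: closed_Collect_le continuous_intros)
 have "((%x. if x \<in> {-1..1} then (1 + cos (pi * x)) / 2 else 0) has_vector_derivative
   (if x \<in> {-1..1} then - (pi / 2) * sin (pi * x) else 0)) (at x within UNIV)"
 proof (rule has_vector_derivative_If_within_closures[where T="{y. 1 < \<bar>y\<bar>}"])
  have "((%x. (1 + cos (pi * x)) / 2) has_real_derivative - (pi / 2) * sin (pi * x)) (at x)" by (auto intro!: derivative_eq_intros)
  then show "((%x. (1 + cos (pi * x)) / 2) has_vector_derivative - (pi / 2) * sin (pi * x)) (at x within B)" for B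
   by (simp add: has_real_derivative_iff_has_vector_derivative[symmetric] has_field_derivative_at_within)
  fix x :: real assume "x \<in> closure {-1..1}" "x \<in> closure {y. 1 < \<bar>y\<bar>}"
  then have "x = 1 \<or> x = - 1" using cl by auto
  then show "(1 + cos (pi * x)) / 2 = 0" "- (pi / 2) * sin (pi * x) = 0" by auto
 qed auto
 then show ?thesis unfolding hat_def[abs_def] hat'_def has_real_derivative_iff_has_vector_derivative .
qed

lemma hat_cont: "cont hat" "cont hat'"
proof -
 show "cont hat" using hat_deriv by (meson DERIV_continuous_on)
 have "closed {y :: real. 1 <= \<bar>y\<bar>}" by (intro closed_Collect_le continuous_intros)
 then have "continuous_on ({-1..1} \<union> {y. 1 <= \<bar>y\<bar>}) hat'"
  unfolding hat'_def by (intro continuous_on_cases) (auto intro!: continuous_intros simp: abs_if split: if_splits)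
 then show "cont hat'" by (rule continuous_on_subset) auto
qed

text \<open>The profile c and the coefficients m are free so that both partial derivatives have the
  same form: \<open>hat'\<close> as profile for X, an additional coefficient 2 pi i n for Y.
  Finitely many terms suffice on bounded sets.\<close>

definition lat :: "int => (real => real) => (int => complex) => real => real => complex" where
 "lat N c m X Y = (\<Sum>n\<in>{-N..N}. c (X - of_int n) *\<^sub>R (m n * cis (2 * pi * of_int n * Y)))"

lemma lat_cell:
 assumes X: "\<bar>X\<bar> < of_int N" and c: "\<And>x. 1 <= \<bar>x\<bar> ==> c x = 0"
 defines "n \<equiv> \<lfloor>X\<rfloor>" and "\<xi> \<equiv> X - of_int \<lfloor>X\<rfloor>"
 shows "lat N c m X Y = cis (2 * pi * of_int n * Y) * (c \<xi> *\<^sub>R m n + c (\<xi> - 1) *\<^sub>R (m (n + 1) * cis (2 * pi * Y)))"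
proof -
 let ?f = "%k. c (X - of_int k) *\<^sub>R (m k * cis (2 * pi * of_int k * Y))"
 \<comment> \<open>The strict bound on |X| puts the floor of X and its successor into the summation
   range; all other translates of the profile vanish at X.\<close>
 have nN: "-N <= n" "n + 1 <= N" using X unfolding n_def by linarith+
 have "lat N c m X Y = (\<Sum>k\<in>{n, n + 1}. ?f k)" unfolding lat_def
 proof (rule sum.mono_neutral_right)
  show "\<forall>k\<in>{-N..N} - {n, n + 1}. ?f k = 0"
  proof
   fix k assume "k \<in> {-N..N} - {n, n + 1}"
   then have "k < n \<or> n + 2 <= k" by auto
   then have "1 <= \<bar>X - of_int k\<bar>" unfolding n_def by linarith
   then show "?f k = 0" by (simp add: c)
  qed
 qed (use nN in auto)
 also have "... = cis (2 * pi * of_int n * Y) * (c \<xi> *\<^sub>R m n + c (\<xi> - 1) *\<^sub>R (m (n + 1) * cis (2 * pi * Y)))"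
 proof -
  have "2 * pi * of_int (n + 1) * Y = 2 * pi * of_int n * Y + 2 * pi * Y" by (simp add: algebra_simps)
  then have "cis (2 * pi * of_int (n + 1) * Y) = cis (2 * pi * of_int n * Y) * cis (2 * pi * Y)" by (simp add: cis_mult)
  moreover have "X - of_int (n + 1) = \<xi> - 1" "X - of_int n = \<xi>" by (auto simp: \<xi>_def n_def)
  ultimately show ?thesis by (simp add: algebra_simps scaleR_conv_of_real)
 qed
 finally show ?thesis .
qed

text \<open>D1 and D2 are the covariant derivatives for the potential (0, 2 pi X), which carries one
  flux quantum per unit cell; the zeros are the points with both coordinates half-integral. Near a
  zero the squared current behaves like pi^2 w, and this coefficient, kept sharp up to \<epsilon> in
  the third bound, fixes the coefficient of the logarithm.\<close>

lemma lattice_bounds: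
 fixes X Y :: real
 assumes X: "\<bar>X\<bar> < of_int N" and \<epsilon>: "0 < \<epsilon>"
 defines "g \<equiv> lat N hat (%_. 1) X Y" and "D1 \<equiv> lat N hat' (%_. 1) X Y"
  and "D2 \<equiv> lat N hat (%n. 2 * pi * of_int n * \<i>) X Y - \<i> * of_real (2 * pi * X) * lat N hat (%_. 1) X Y"
 defines "w \<equiv> (cmod g)\<^sup>2"
 shows "w = 1 - (sin (pi * X))\<^sup>2 * (sin (pi * Y))^2"
  and "(cmod D1)^2 + (cmod D2)^2 <= 5 * pi^2"
  and "(Im (cnj g * D1))^2 + (Im (cnj g * D2))^2 <= pi^2 * ((1 + \<epsilon>) * w + (1 + 1/\<epsilon>) * w^2)"
proof -
 define n where "n = \<lfloor>X\<rfloor>"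
 define \<xi> where "\<xi> = X - of_int n"
 have \<xi>: "0 <= \<xi>" "\<xi> < 1" unfolding \<xi>_def n_def by linarith+
 define C S u v \<omega> where "C = cos (pi * \<xi>)" and "S = sin (pi * \<xi>)" and "u = cos (2 * pi * Y)" and "v = sin (2 * pi * Y)"
  and "\<omega> = cis (2 * pi * of_int n * Y)"
 have CS: "C^2 + S^2 = 1" and uv: "u^2 + v^2 = 1" by (auto simp: C_def S_def u_def v_def)
 have e: "cis (2 * pi * Y) = Complex u v" by (simp add: u_def v_def cis.ctr)
 have "cos (pi * (\<xi> - 1)) = - C" "sin (pi * (\<xi> - 1)) = - S"
  by (simp_all add: C_def S_def right_diff_distrib cos_diff sin_diff)
 then have h: "hat \<xi> = (1 + C)/2" "hat (\<xi> - 1) = (1 - C)/2" "hat' \<xi> = - (pi/2) * S" "hat' (\<xi> - 1) = pi/2 * S"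
  using \<xi> by (auto simp: hat_def hat'_def C_def S_def)
 have cell: "lat N hat m X Y = \<omega> * (hat \<xi> *\<^sub>R m n + hat (\<xi> - 1) *\<^sub>R (m (n + 1) * cis (2 * pi * Y)))"
  "lat N hat' m X Y = \<omega> * (hat' \<xi> *\<^sub>R m n + hat' (\<xi> - 1) *\<^sub>R (m (n + 1) * cis (2 * pi * Y)))" for m
  unfolding \<omega>_def \<xi>_def n_def by (intro lat_cell[OF X] hat_outside; assumption)+
 define z where "z = Complex ((1 + C)/2 + (1 - C)/2 * u) ((1 - C)/2 * v)"
 define z1 where "z1 = Complex (pi/2 * S * (u - 1)) (pi/2 * S * v)"
 define z2 where "z2 = Complex (- (2 * pi * (1 - \<xi>) * ((1 - C)/2) * v)) (2 * pi * ((1 - \<xi>) * ((1 - C)/2) * u - \<xi> * ((1 + C)/2)))"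
 have g: "g = \<omega> * z" unfolding g_def cell(1) e h by (simp add: z_def complex_eq_iff)
 have "(- (pi/2) * S) *\<^sub>R 1 + (pi/2 * S) *\<^sub>R (1 * Complex u v) = z1" by (simp add: z1_def complex_eq_iff algebra_simps)
 then have D1: "D1 = \<omega> * z1" unfolding D1_def cell(2) e h by (simp only:)
 have D2: "D2 = \<omega> * z2"
 proof -
  have Xn: "X = \<xi> + of_int n" by (simp add: \<xi>_def)
  have "((1 + C)/2) *\<^sub>R (2 * pi * of_int n * \<i>) + ((1 - C)/2) *\<^sub>R (2 * pi * of_int (n + 1) * \<i> * Complex u v)
   - \<i> * of_real (2 * pi * X) * (((1 + C)/2) *\<^sub>R 1 + ((1 - C)/2) *\<^sub>R (1 * Complex u v)) = z2"
   unfolding Xn by (simp add: z2_def complex_eq_iff field_simps)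
  moreover have "\<omega> * a - k * l * (\<omega> * b) = \<omega> * (a - k * l * b)" for a b k l by (simp add: algebra_simps)
  ultimately show ?thesis unfolding D2_def cell(1) e h by (simp only:)
 qed
 have \<omega>1: "cmod \<omega> = 1" "cnj \<omega> * \<omega> = 1" by (simp_all add: \<omega>_def cis_cnj cis_mult)
 have q: "cnj g * (\<omega> * y) = cnj z * y" for y unfolding g complex_cnj_mult using \<omega>1(2) by (metis mult.assoc mult.commute mult.left_neutral)
 have wz: "w = 1 - S\<^sup>2 * (1 - u) / 2"
 proof -
  have "w = ((1 + C)/2 + (1 - C)/2 * u)^2 + ((1 - C)/2 * v)^2" by (simp add: w_def g norm_mult \<omega>1 cmod_power2 z_def)
  also have "... = 1 - S\<^sup>2 * (1 - u) / 2"
  proof -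
   have "((1 + C) + (1 - C) * u)^2 + ((1 - C) * v)^2 = 4 - 2 * (S^2 * (1 - u))" using CS uv by algebra
   then show ?thesis by (simp add: power2_eq_square field_simps)
  qed
  finally show ?thesis .
 qed
 have sX: "(sin (pi * X))^2 = S^2"
 proof -
  have "cos (2 * (pi * X)) = cos (2 * (pi * \<xi>))"
   using cos_int_2pin[of n] sin_int_2pin[of n] cos_add[of "2 * (pi * \<xi>)" "2 * pi * of_int n"] by (simp add: \<xi>_def algebra_simps)
  then show ?thesis unfolding cos_double_sin S_def by simp
 qed
 have sY: "(sin (pi * Y))^2 = (1 - u) / 2" using cos_double_sin[of "pi * Y"] by (simp add: u_def mult.assoc)
 show "w = 1 - (sin (pi * X))\<^sup>2 * (sin (pi * Y))^2" unfolding wz sX sY by simp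
 have u1: "\<bar>u\<bar> <= 1" and C1: "\<bar>C\<bar> <= 1" by (auto simp: u_def C_def)
 have S1: "S^2 <= 1" using CS zero_le_power2[of C] by linarith
 show "(cmod D1)^2 + (cmod D2)^2 <= 5 * pi^2"
 proof -
  have "(cmod z1)^2 = pi^2 * (S^2 * ((1 - u) / 2))" unfolding z1_def cmod_power2 complex.sel using uv by (simp add: field_simps) algebra
  also have "... <= pi^2 * (1 * 1)" using S1 u1 by (intro mult_left_mono mult_mono) auto
  finally have a: "(cmod z1)^2 <= pi^2" by simp
  define P Q where "P = (1 - \<xi>) * ((1 - C)/2)" and "Q = \<xi> * ((1 + C)/2)"
  have PQ: "0 <= P" "0 <= Q" "P + Q <= 1"
  proof -
   show "0 <= P" "0 <= Q" using \<xi> C1 by (auto simp: P_def Q_def)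
   have "P <= 1 * ((1 - C)/2)" "Q <= 1 * ((1 + C)/2)" unfolding P_def Q_def using \<xi> C1 by (intro mult_right_mono; simp)+
   then show "P + Q <= 1" by simp
  qed
  have "(cmod z2)^2 = 4 * pi^2 * ((P * v)^2 + (P * u - Q)^2)"
  proof -
   have "z2 = Complex (- (2 * pi * P * v)) (2 * pi * (P * u - Q))" by (simp add: z2_def P_def Q_def mult.assoc)
   then show ?thesis unfolding cmod_power2 by (simp add: power_mult_distrib distrib_left mult.assoc)
  qed
  also have "(P * v)^2 + (P * u - Q)^2 = (P + Q)^2 - 2 * (P * Q * (1 + u))" using uv by algebra
  also have "... <= 1" using PQ u1 power_mono[of "P + Q" 1 2] by (smt (verit) mult_nonneg_nonneg power_one)
  finally have "(cmod z2)^2 <= 4 * pi^2" by simp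
  with a show ?thesis unfolding D1 D2 norm_mult \<omega>1(1) mult_1 by linarith
 qed
 show "(Im (cnj g * D1))^2 + (Im (cnj g * D2))^2 <= pi^2 * ((1 + \<epsilon>) * w + (1 + 1/\<epsilon>) * w^2)"
 proof -
  \<comment> \<open>The contribution of the potential to the second current. As |y| <= w, it is of
    higher order at a zero and is separated from C by Young's inequality with weight
    \<epsilon>.\<close>
  define y where "y = (1 - 2 * \<xi>) * w"
  have f1: "(p + q * u) * (k/2 * s * v) - q * v * (k/2 * s * (u - 1)) = k * (s * v / 2)" if "p + q = 1" for p q u v k s :: real
  proof -
   have "(p + q * u) * (k/2 * s * v) - q * v * (k/2 * s * (u - 1)) = (p + q) * (k * (s * v / 2))" by (simp add: field_simps)
   then show ?thesis using that by simp
  qed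
  have f2: "(p + q * u) * (2 * k * ((1 - x) * q * u - x * p)) - q * v * - (2 * k * (1 - x) * q * v) = k * ((1 - 2 * x) * w - C)"
   if "p + q = 1" "C = p - q" "w = p^2 + q^2 + 2 * p * q * u" "u^2 + v^2 = 1" for p q u v k x w C :: real
   using that by algebra
  define p1 q1 where "p1 = (1 + C)/2" and "q1 = (1 - C)/2"
  have pq: "p1 + q1 = 1" "C = p1 - q1" by (simp_all add: p1_def q1_def field_simps)
  have im: "Im (cnj z * y) = Re z * Im y - Im z * Re y" for y by simp
  have rz: "Re z = p1 + q1 * u" "Im z = q1 * v" "Re z1 = pi/2 * S * (u - 1)" "Im z1 = pi/2 * S * v"
   "Re z2 = - (2 * pi * (1 - \<xi>) * q1 * v)" "Im z2 = 2 * pi * ((1 - \<xi>) * q1 * u - \<xi> * p1)"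
   by (simp_all only: z_def z1_def z2_def complex.sel p1_def q1_def)
  have i1: "Im (cnj g * D1) = pi * (S * v / 2)" unfolding D1 q im rz by (rule f1[OF pq(1)])
  have w2: "w = p1^2 + q1^2 + 2 * p1 * q1 * u"
  proof -
   have "S^2 = 4 * (p1 * q1)" "1 = (p1 + q1)^2" using CS pq by algebra+
   then show ?thesis unfolding wz by (simp add: field_simps power2_eq_square)
  qed
  have i2: "Im (cnj g * D2) = pi * (y - C)" unfolding D2 q im rz y_def by (rule f2[OF pq w2 uv])
  have Sv: "(S * v / 2)^2 + C^2 <= w"
  proof -
   have "4 * w - 4 * ((S * v / 2)^2 + C^2) = (S * (1 + u))^2" unfolding wz using CS uv by (simp add: field_simps) algebra
   then show ?thesis by (smt (verit) zero_le_power2)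
  qed
  have y2: "y^2 <= w^2"
  proof -
   have "(1 - 2 * \<xi>)^2 <= 1" using \<xi> by (simp add: abs_square_le_1)
   then have "(1 - 2 * \<xi>)^2 * w^2 <= 1 * w^2" by (intro mult_right_mono) auto
   then show ?thesis by (simp add: y_def power_mult_distrib)
  qed
  have "(y - C)^2 <= (1 + \<epsilon>) * C^2 + (1 + 1/\<epsilon>) * y^2"
  proof -
   have "(1 + \<epsilon>) * C^2 + (1 + 1/\<epsilon>) * y^2 - (y - C)\<^sup>2 = (\<epsilon> * C + y)^2 / \<epsilon>" using \<epsilon> by (simp add: field_simps power2_eq_square)
   then show ?thesis using \<epsilon> by (smt (verit) divide_nonneg_pos zero_le_power2)
  qed
  also have "... <= (1 + \<epsilon>) * C^2 + (1 + 1/\<epsilon>) * w^2" using y2 \<epsilon> by (intro add_left_mono mult_left_mono) auto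
  finally have "(S * v / 2)^2 + (y - C)^2 <= (1 + \<epsilon>) * ((S * v / 2)^2 + C^2) + (1 + 1/\<epsilon>) * w^2"
   using \<epsilon> by (simp add: distrib_left distrib_right) (smt (verit) mult_nonneg_nonneg zero_le_power2 zero_le_divide_iff)
  also have "... <= (1 + \<epsilon>) * w + (1 + 1/\<epsilon>) * w^2" using Sv \<epsilon> by (intro add_right_mono mult_left_mono) auto
  finally have "pi^2 * ((S * v / 2)^2 + (y - C)^2) <= pi^2 * ((1 + \<epsilon>) * w + (1 + 1/\<epsilon>) * w^2)" by (intro mult_left_mono) auto
  then show ?thesis unfolding i1 i2 power_mult_distrib by (simp only: distrib_left)
 qed
qed

text \<open>The real part of \<open>cnj g * D\<close> is eliminated through the identity that its
  square plus that of the imaginary part is \<open>|g|^2 |D|^2\<close>. The full gradient then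
  carries only the factor T^2, so away from the zeros the energy is that of the current.\<close>

lemma normalised_gradient:
 fixes g D :: complex
 assumes W: "W = (cmod g)^2 + T" "0 < W"
 shows "(cmod ((1 / sqrt W) *\<^sub>R D - (Re (cnj g * D) / (W * sqrt W)) *\<^sub>R g))^2 = (T^2 * (cmod D)^2 + ((cmod g)^2 + 2 * T) * (Im (cnj g * D))^2) / W ^ 3"
proof -
 obtain a b where g: "g = Complex a b" by (cases g)
 obtain c d where D: "D = Complex c d" by (cases D)
 have "(1 / sqrt W) *\<^sub>R D - (Re (cnj g * D) / (W * sqrt W)) *\<^sub>R g = (1 / (W * sqrt W)) *\<^sub>R (W *\<^sub>R D - Re (cnj g * D) *\<^sub>R g)"
  using W(2) by (simp add: scaleR_diff_right)
 then have "(cmod ((1 / sqrt W) *\<^sub>R D - (Re (cnj g * D) / (W * sqrt W)) *\<^sub>R g))^2 = (cmod (W *\<^sub>R D - Re (cnj g * D) *\<^sub>R g))^2 / W ^ 3"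
  using W(2) by (simp add: power_mult_distrib power_divide power2_eq_square power3_eq_cube)
 also have "(cmod (W *\<^sub>R D - Re (cnj g * D) *\<^sub>R g))^2 = T^2 * (cmod D)^2 + ((cmod g)^2 + 2 * T) * (Im (cnj g * D))^2"
  unfolding W(1) g D by (simp add: cmod_power2) algebra
 finally show ?thesis .
qed

text \<open>By \<open>lattice_bounds\<close> this is \<open>|g|^2 + t^2\<close>, the squared
  denominator of the regularised lattice function.\<close>

definition core :: "real => real => real => real" where
 "core t X Y = 1 + t^2 - (sin (pi * X))\<^sup>2 * (sin (pi * Y))^2"
text \<open>A bound for the energy density in units of \<open>h / (2 * pi)\<close>: a contribution
  concentrated in the cores, the part \<open>1 / core\<close> that produces the logarithm, and a
  constant.\<close>

definition dens :: "real => real => real => real => real" where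
 "dens \<epsilon> t X Y = (5 * pi^2 + 1) * (t^2 / (core t X Y)^2) + pi^2 * (1 + \<epsilon>) / core t X Y + pi^2 * (1 + 1/\<epsilon>)"

lemma lat_has_derivative:
 fixes f k :: "real^3 => real"
 assumes c: "\<And>x. (c has_real_derivative c' x) (at x)" and f: "(f has_derivative f') (at x)" and k: "(k has_derivative k') (at x)"
 shows "((%x. lat N c m (f x) (k x)) has_derivative
   (%v. f' v *\<^sub>R lat N c' m (f x) (k x) + k' v *\<^sub>R lat N c (%n. 2 * pi * of_int n * \<i> * m n) (f x) (k x))) (at x)"
proof -
 have "((%x. c (f x - of_int n) *\<^sub>R (m n * cis (2 * pi * of_int n * k x))) has_derivative
   (%v. c (f x - of_int n) *\<^sub>R (m n * (2 * pi * of_int n * k' v) *\<^sub>R (\<i> * cis (2 * pi * of_int n * k x)))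
    + (f' v * c' (f x - of_int n)) *\<^sub>R (m n * cis (2 * pi * of_int n * k x)))) (at x)" for n
  by (intro has_derivative_scaleR DERIV_compose_FDERIV[OF c] has_derivative_mult_right has_derivative_cis k has_derivative_eq_rhs[OF has_derivative_diff[OF f has_derivative_const]]) simp
 then have "((%x. lat N c m (f x) (k x)) has_derivative (%v. \<Sum>n\<in>{-N..N}. c (f x - of_int n) *\<^sub>R (m n * (2 * pi * of_int n * k' v) *\<^sub>R (\<i> * cis (2 * pi * of_int n * k x)))
    + (f' v * c' (f x - of_int n)) *\<^sub>R (m n * cis (2 * pi * of_int n * k x)))) (at x)"
  unfolding lat_def by (rule has_derivative_sum)
 then show ?thesis
  by (rule has_derivative_eq_rhs) (simp add: lat_def fun_eq_iff scaleR_sum_right sum.distrib scaleR_conv_of_real sum_distrib_left mult_ac add.commute)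
qed

lemma lat_continuous:
 fixes f k :: "real^3 => real"
 assumes c: "cont c" and f: "cont f" and k: "cont k"
 shows "cont (%x. lat N c m (f x) (k x))"
proof -
 have "cont (%x. c (f x - of_int n))" for n
  by (rule continuous_on_compose2[OF c]) (auto intro: continuous_intros f)
 then show ?thesis unfolding lat_def by (intro continuous_intros k)
qed

text \<open>The length s satisfies \<open>h * s^2 = 2 * pi\<close>, one flux quantum per cell, and t
  is the core size 1/\<kappa> measured in units of s. With this t the potential energy has the size
  of the core part of \<open>dens\<close>. The bound is claimed on a ball because only finitely many
  lattice terms are summed.\<close>

lemma vortex_lattice:
 assumes h: "0 < h" and \<kappa>: "0 < \<kappa>" and \<epsilon>: "0 < \<epsilon>"
 defines "s \<equiv> sqrt (2 * pi / h)" and "t \<equiv> sqrt (h / (2 * pi)) / \<kappa>"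
 shows "\<exists>\<psi> d\<psi>. (\<forall>x. (\<psi> has_derivative d\<psi> x) (at x)) \<and> (\<forall>v. cont (%x. d\<psi> x v)) \<and>
  (\<forall>x. norm x <= R --> (\<Sum>j\<in>UNIV. (cmod (d\<psi> x (axis j 1) - \<i> * of_real (h * F_field x $ j) * \<psi> x))^2) + \<kappa>^2/2 * (1 - (cmod (\<psi> x))\<^sup>2)^2
    <= h / (2 * pi) * dens \<epsilon> t (x $ 1 / s - a) (x $ 2 / s - b))"
proof -
 have s: "0 < s" "h * s^2 = 2 * pi" using h by (simp_all add: s_def)
 have t: "0 < t" "h / (2 * pi) = \<kappa>^2 * t^2" "h / (2 * pi) = 1 / s^2" using h \<kappa> by (simp_all add: t_def s_def power_divide)
 define N where "N = \<lceil>R / s + \<bar>a\<bar>\<rceil> + 1"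
 define f where "f x = x $ 1 / s - a" for x :: "real^3"
 define k where "k x = x $ 2 / s - b" for x :: "real^3"
 define G where "G x = lat N hat (%_. 1) (f x) (k x)" for x
 define GX where "GX x = lat N hat' (%_. 1) (f x) (k x)" for x
 define GY where "GY x = lat N hat (%n. 2 * pi * of_int n * \<i>) (f x) (k x)" for x
 define dG where "dG x v = (v $ 1 / s) *\<^sub>R GX x + (v $ 2 / s) *\<^sub>R GY x" for x and v :: "real^3"
 define W where "W x = (cmod (G x))^2 + t^2" for x
 \<comment> \<open>The gauge phase from the symmetric potential F to the one of the lattice: h F
   minus the gradient of \<open>th\<close> is (0, 2 pi f/s, 0), with the shift a included in
   f.\<close>
 define th where "th x = h * (s * a * x $ 2 - x $ 1 * x $ 2 / 2)" for x :: "real^3"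
 define dth where "dth x v = h * (s * a * v $ 2 - (x $ 1 * v $ 2 + v $ 1 * x $ 2) / 2)" for x v :: "real^3"
 define \<psi> where "\<psi> x = (1 / sqrt (W x)) *\<^sub>R (cis (th x) * G x)" for x
 define d\<psi> where "d\<psi> x v = (1 / sqrt (W x)) *\<^sub>R (cis (th x) * dG x v + (dth x v *\<^sub>R (\<i> * cis (th x))) * G x)
   + ((G x \<bullet> dG x v + dG x v \<bullet> G x) * - (1 / (2 * (W x * sqrt (W x))))) *\<^sub>R (cis (th x) * G x)" for x v
 have Wp: "0 < W x" for x using t by (simp add: W_def add_nonneg_pos)
 have n_der: "((%x :: real^3. x $ i) has_derivative (%v. v $ i)) (at x)" for i x by (rule bounded_linear_imp_has_derivative) (rule bounded_linear_vec_nth)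
 have dd: "((%x :: real^3. x $ i / s - b') has_derivative (%v. v $ i / s)) (at x)" for i x b'
  by (rule has_derivative_eq_rhs[OF has_derivative_diff[OF bounded_linear.has_derivative[OF bounded_linear_divide n_der] has_derivative_const]]) simp
 have G_der: "(G has_derivative dG x) (at x)" for x
  using lat_has_derivative[OF hat_deriv dd dd, of N "%_. 1" 1 a 2 b x] unfolding G_def[abs_def] dG_def[abs_def] GX_def GY_def f_def k_def by simp
 have W_der: "(W has_derivative (%v. G x \<bullet> dG x v + dG x v \<bullet> G x)) (at x)" for x
  using has_derivative_add[OF has_derivative_inner[OF G_der G_der] has_derivative_const[of "t^2"], of x] unfolding W_def[abs_def] power2_norm_eq_inner by simp
 have th_der: "(th has_derivative dth x) (at x)" for x
  unfolding th_def[abs_def] dth_def[abs_def]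
  by (intro has_derivative_mult_right has_derivative_diff bounded_linear.has_derivative[OF bounded_linear_divide] has_derivative_mult n_der)
 have sq: "((%y. 1 / sqrt y) has_real_derivative - (1 / (2 * (y * sqrt y)))) (at y)" if "0 < y" for y
  using that by (auto intro!: derivative_eq_intros simp: field_simps)
 have \<psi>_der: "(\<psi> has_derivative d\<psi> x) (at x)" for x
  unfolding \<psi>_def[abs_def] d\<psi>_def[abs_def]
  by (intro has_derivative_scaleR DERIV_compose_FDERIV[OF sq[OF Wp] W_der] has_derivative_mult G_der has_derivative_cis th_der)
 have cf: "cont f" "cont k" unfolding f_def k_def by (intro continuous_intros; use s in simp)+
 have cG: "cont G" "cont GX" "cont GY"
  unfolding G_def GX_def GY_def by (intro lat_continuous cf hat_cont)+
 have cth: "cont th" "cont (%x. dth x v)" and cdG: "cont (%x. dG x v)" and cW: "cont W" for v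
  unfolding th_def dth_def dG_def W_def by (intro continuous_intros cG; simp)+
 have cc: "cont (%x. d\<psi> x v)" for v
  unfolding d\<psi>_def using Wp by (intro continuous_intros cG cth cdG cW continuous_on_cis) (auto simp: less_imp_neq[symmetric])
 have bound: "(\<Sum>j\<in>UNIV. (cmod (d\<psi> x (axis j 1) - \<i> * of_real (h * F_field x $ j) * \<psi> x))^2) + \<kappa>^2/2 * (1 - (cmod (\<psi> x))\<^sup>2)^2
    <= h / (2 * pi) * dens \<epsilon> t (x $ 1 / s - a) (x $ 2 / s - b)" if x: "norm x <= R" for x
 proof -
  have "\<bar>f x\<bar> <= R / s + \<bar>a\<bar>"
  proof -
   have "\<bar>x $ 1\<bar> <= R" using component_le_norm_cart[of x 1] x by linarith
   then have "\<bar>x $ 1 / s\<bar> <= R / s" using s by (simp add: divide_right_mono)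
   then show ?thesis unfolding f_def by linarith
  qed
  then have XN: "\<bar>f x\<bar> < of_int N" unfolding N_def by linarith
  define D1 D2 where "D1 = GX x" and "D2 = GY x - \<i> * of_real (2 * pi * f x) * G x"
  define w where "w = (cmod (G x))^2"
  note lb = lattice_bounds[OF XN \<epsilon>, of "k x", folded G_def GX_def GY_def, folded D1_def D2_def w_def]
  have Wc: "W x = core t (f x) (k x)" using lb(1) by (simp add: W_def core_def w_def)
  have Ww: "W x = w + t^2" by (simp add: W_def w_def)
  have w0: "0 <= w" by (simp add: w_def)
  have D: "(cmod (d\<psi> x v - \<i> * of_real r * \<psi> x))^2 = (t ^ 4 * (cmod E)^2 + (w + 2 * t^2) * (Im (cnj (G x) * E))^2) / (W x) ^ 3"
   if E: "E = dG x v - \<i> * of_real (r - dth x v) * G x" for v r E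
  proof -
   have re: "(G x \<bullet> dG x v + dG x v \<bullet> G x) * - (1 / (2 * (W x * sqrt (W x)))) = - (Re (cnj (G x) * E) / (W x * sqrt (W x)))"
    unfolding E inner_complex_def using Wp[of x] by (simp add: field_simps)
   have "d\<psi> x v - \<i> * of_real r * \<psi> x = cis (th x) * ((1 / sqrt (W x)) *\<^sub>R E - (Re (cnj (G x) * E) / (W x * sqrt (W x))) *\<^sub>R G x)"
    unfolding d\<psi>_def \<psi>_def re by (simp add: E scaleR_conv_of_real algebra_simps)
   then have "(cmod (d\<psi> x v - \<i> * of_real r * \<psi> x))^2 = (cmod ((1 / sqrt (W x)) *\<^sub>R E - (Re (cnj (G x) * E) / (W x * sqrt (W x))) *\<^sub>R G x))^2"
    by (simp add: norm_mult)
   also have "... = ((t^2)^2 * (cmod E)^2 + ((cmod (G x))^2 + 2 * t^2) * (Im (cnj (G x) * E))^2) / (W x) ^ 3"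
    by (rule normalised_gradient) (use Wp in \<open>auto simp: W_def\<close>)
   finally show ?thesis by (simp add: w_def flip: power_mult)
  qed
  have E1: "(1/s) *\<^sub>R D1 = dG x (axis 1 1) - \<i> * of_real (h * F_field x $ 1 - dth x (axis 1 1)) * G x"
   by (simp add: dG_def D1_def dth_def F_field_def axis_def)
  have E2: "(1/s) *\<^sub>R D2 = dG x (axis 2 1) - \<i> * of_real (h * F_field x $ 2 - dth x (axis 2 1)) * G x"
  proof -
   have r: "h * F_field x $ 2 - dth x (axis 2 1) = 2 * pi * f x / s"
    using s unfolding s(2)[symmetric] by (simp add: f_def dth_def F_field_def axis_def field_simps power2_eq_square)
   show ?thesis unfolding r by (simp add: dG_def D2_def axis_def scaleR_conv_of_real diff_divide_distrib mult_ac)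
  qed
  have E3: "0 = dG x (axis 3 1) - \<i> * of_real (h * F_field x $ 3 - dth x (axis 3 1)) * G x"
   by (simp add: dG_def dth_def F_field_def axis_def)
  have Is: "(Im (cnj z * ((1/s) *\<^sub>R y)))^2 = (Im (cnj z * y))^2 / s^2" "(cmod ((1/s) *\<^sub>R y))^2 = (cmod y)^2 / s^2" for z y
   using s(1) by (simp_all add: power_divide)
  define P Q where "P = (cmod D1)^2 + (cmod D2)^2" and "Q = (Im (cnj (G x) * D1))^2 + (Im (cnj (G x) * D2))^2"
  have "(\<Sum>j\<in>UNIV. (cmod (d\<psi> x (axis j 1) - \<i> * of_real (h * F_field x $ j) * \<psi> x))^2) = (t ^ 4 * P + (w + 2 * t^2) * Q) / (W x) ^ 3 / s^2"
   unfolding sum_3 D[OF E1] D[OF E2] D[OF E3] Is P_def Q_def by (simp add: add_divide_distrib distrib_left mult.commute)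
  also have "... = (t ^ 4 * P + (w + 2 * t^2) * Q) / (W x) ^ 3 * (h / (2 * pi))" unfolding t(3) by simp
  finally have S1: "(\<Sum>j\<in>UNIV. (cmod (d\<psi> x (axis j 1) - \<i> * of_real (h * F_field x $ j) * \<psi> x))^2) = h / (2 * pi) * ((t ^ 4 * P + (w + 2 * t^2) * Q) / (W x) ^ 3)"
   by (simp only: mult.commute)
  have "(cmod (\<psi> x))^2 = w / W x" using Wp[of x] by (simp add: \<psi>_def norm_mult power_divide w_def)
  then have "1 - (cmod (\<psi> x))\<^sup>2 = t^2 / W x" using Wp[of x] by (simp add: Ww field_simps)
  then have S2: "\<kappa>^2/2 * (1 - (cmod (\<psi> x))\<^sup>2)^2 = h / (2 * pi) * (t^2 / (2 * (W x)^2))"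
   unfolding t(2) by (simp add: power2_eq_square)
  have main: "(t ^ 4 * P + (w + 2 * t^2) * Q) / (W x) ^ 3 + t^2 / (2 * (W x)^2) <= dens \<epsilon> t (f x) (k x)"
  proof -
   define V where "V = W x"
   have V: "0 < V" "w <= V" "t^2 <= V" using Wp[of x] w0 by (auto simp: V_def Ww)
   have "t ^ 4 * P / V ^ 3 <= 5 * pi^2 * (t^2 / V^2)"
   proof -
    have "t ^ 4 = t^2 * t^2" by (simp flip: power_add)
    moreover have "t^2 * t^2 * P <= (t^2 * V) * (5 * pi^2)" using V lb(2)[folded P_def] by (intro mult_mono) (auto simp: P_def)
    ultimately have "t ^ 4 * P <= (t^2 * V) * (5 * pi^2)" by simp
    then have "t ^ 4 * P / V ^ 3 <= (t^2 * V) * (5 * pi^2) / V ^ 3" using V by (intro divide_right_mono) auto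
    then show ?thesis using V by (simp add: power2_eq_square power3_eq_cube mult_ac)
   qed
   moreover have "(w + 2 * t^2) * Q / V ^ 3 <= pi^2 * (1 + \<epsilon>) / V + pi^2 * (1 + 1/\<epsilon>)"
   proof -
    have "(w + 2 * t^2) * w <= V^2" using zero_le_power2[of "t^2"] by (simp add: V_def Ww power2_eq_square algebra_simps)
    then have "pi^2 * ((1 + \<epsilon>) + (1 + 1/\<epsilon>) * w) * ((w + 2 * t^2) * w) <= pi^2 * ((1 + \<epsilon>) + (1 + 1/\<epsilon>) * V) * V^2"
     using \<epsilon> w0 V by (intro mult_mono add_left_mono mult_nonneg_nonneg add_nonneg_nonneg) auto
    moreover have "(w + 2 * t^2) * Q <= (w + 2 * t^2) * (pi^2 * ((1 + \<epsilon>) * w + (1 + 1/\<epsilon>) * w^2))"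
     using lb(3) w0 by (intro mult_left_mono) (auto simp: Q_def)
    moreover have "z * (p * (x * w + y * w^2)) = p * (x + y * w) * (z * w)" for x y z p by (simp add: power2_eq_square algebra_simps)
    ultimately have "(w + 2 * t^2) * Q <= pi^2 * ((1 + \<epsilon>) + (1 + 1/\<epsilon>) * V) * V^2" by (simp only:)
    then have "(w + 2 * t^2) * Q / V ^ 3 <= pi^2 * ((1 + \<epsilon>) + (1 + 1/\<epsilon>) * V) * V^2 / V ^ 3" using V by (intro divide_right_mono) auto
    also have "... = pi^2 * (1 + \<epsilon>) / V + pi^2 * (1 + 1/\<epsilon>)"
    proof -
     have "c * (x + y * V) * V^2 / V ^ 3 = c * x / V + c * y" for c x y using V by (simp add: power2_eq_square power3_eq_cube field_simps)
     then show ?thesis .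
    qed
    finally show ?thesis .
   qed
   moreover have "t^2 / (2 * V^2) <= t^2 / V^2" using V by (simp add: frac_le)
   ultimately show ?thesis unfolding dens_def Wc[symmetric] V_def[symmetric] by (simp add: add_divide_distrib distrib_right)
  qed
  have "h / (2 * pi) * ((t ^ 4 * P + (w + 2 * t^2) * Q) / (W x) ^ 3 + t^2 / (2 * (W x)^2)) <= h / (2 * pi) * dens \<epsilon> t (f x) (k x)"
   using h main by (intro mult_left_mono) auto
  then show ?thesis unfolding S1 S2 f_def k_def by (simp only: distrib_left)
 qed
 show ?thesis by (rule exI[of _ \<psi>], rule exI[of _ d\<psi>]) (use \<psi>_der cc bound in blast)
qed

section \<open>The potential F as competitor, and the energy at A = F\<close>

lemma F_admissible: "Hdot1_div_F F_field"
proof -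
 have fd0: "frechet_derivative (%_ :: real^3. 0 :: real) (at x) = (%_. 0)" for x by (rule frechet_derivative_at[symmetric]) simp
 have "g = (%_. 0)" if "g \<in> higher_partials (%_ :: real^3. 0 :: real)" for g
  using that by induction (simp_all add: fd0)
 then have "smooth_fun (%_ :: real^3. 0 :: real)" unfolding smooth_fun_def by (metis differentiable_on_const)
 then have t0: "test_fun UNIV (%_. 0)" by (simp add: test_fun_def)
 have pd0: "pd j (%_. 0) x = 0" for j x by (simp add: pd_def fd0)
 have "Hdot1 (%_. 0)" unfolding Hdot1_def
  by (intro conjI allI impI exI[of _ "%_ _. 0"] exI[of _ "%_ _. 0"]) (auto simp: L2_def weak_grad_def weak_partial_def t0 pd0)
 moreover have "(\<integral>x. (\<Sum>j\<in>UNIV. F_field x $ j * pd j \<phi> x) \<partial>lebesgue) = 0" if \<phi>: "test_fun UNIV \<phi>" for \<phi>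
 proof -
  have Fc: "cont (%x. F_field x $ j)" for j by (rule linear_continuous_on[OF linear_conv_bounded_linear[THEN iffD1, OF F_field_linear]])
  have "L1 (%x. pd j \<phi> x * F_field x $ j)" for j by (intro ccs_integrable ccs_mult_left test_fun_C1(4)[OF \<phi>] Fc)
  then have i: "integrable lebesgue (%x. F_field x $ j * pd j \<phi> x)" for j
   by (subst integrable_completion) (auto simp: mult.commute dest: borel_measurable_integrable)
  have "(\<integral>x. F_field x $ j * pd j \<phi> x \<partial>lebesgue) = 0" for j
  proof -
   have "F_field (axis j 1) $ j = 0" using exhaust_3[of j] by (auto simp: F_field_def axis_def)
   then show ?thesis
    using F_field_weak_partial[of j j] \<phi> by (simp add: weak_partial_def lebesgue_on_UNIV_eq mult.commute)
  qed
  then show ?thesis by (simp add: Bochner_Integration.integral_sum[OF i])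
 qed
 ultimately show ?thesis by (simp add: Hdot1_div_F_def)
qed

lemma wgrad_unique:
 fixes u :: "real^3 => 'b::euclidean_space"
 assumes U: "open U" and G: "weak_grad U u G"
 shows "AE x in lborel. x \<in> U --> wgrad U u j x = G j x"
proof -
 have "weak_grad U u (wgrad U u)" unfolding wgrad_def by (rule someI[of _ G]) (rule G)
 then show ?thesis using G by (intro weak_partial_unique[OF U]) (auto simp: weak_grad_def)
qed

lemma curl_F_field: "(\<integral>x. (norm (curlA F_field x - beta_vec))^2 \<partial>lebesgue) = 0"
proof -
 have "AE x in lborel. x \<in> UNIV --> wgrad UNIV (%y. F_field y $ j) k x = F_field (axis k 1) $ j" for j k
  by (rule wgrad_unique[OF open_UNIV]) (simp add: weak_grad_def F_field_weak_partial)
 then have w: "AE x in lborel. wgrad UNIV (%y. F_field y $ j) k x = F_field (axis k 1) $ j" for j k by simp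
 have "AE x in lborel. (norm (curlA F_field x - beta_vec))^2 = 0"
  using w[of 3 2] w[of 2 3] w[of 1 3] w[of 3 1] w[of 2 1] w[of 1 2]
  unfolding curl_norm2 by eventually_elim (simp add: F_field_def axis_def)
 then show ?thesis using AE_completion by (intro integral_eq_zero_AE) blast
qed

lemma GL_energy_F:
 assumes \<Omega>: "open \<Omega>" "bounded \<Omega>" and d: "\<And>x. (\<psi> has_derivative d\<psi> x) (at x)" and c: "\<And>v. cont (%x. d\<psi> x v)"
 shows "H1 \<Omega> \<psi>"
  and "GL_energy \<Omega> \<kappa> H \<psi> F_field = (LBINT x. indicator \<Omega> x *\<^sub>R ((\<Sum>j\<in>UNIV. (cmod (d\<psi> x (axis j 1) - \<i> * of_real (\<kappa> * H * F_field x $ j) * \<psi> x))^2)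
      + \<kappa>^2 / 2 * (1 - (cmod (\<psi> x))\<^sup>2)^2))"
proof -
 have B: "\<Omega> \<in> sets borel" using \<Omega> by simp
 have pc: "cont \<psi>" using d by (auto intro!: continuous_at_imp_continuous_on has_derivative_continuous)
 have wg: "weak_grad \<Omega> \<psi> (%j x. d\<psi> x (axis j 1))" unfolding weak_grad_def using weak_partial_C1[OF \<Omega>(1) d c] by blast
 show "H1 \<Omega> \<psi>" unfolding H1_def using wg L2_continuous[OF pc B \<Omega>(2)] L2_continuous[OF c B \<Omega>(2)] by blast
 have Fc: "cont (%x. F_field x $ j)" for j by (rule linear_continuous_on[OF linear_conv_bounded_linear[THEN iffD1, OF F_field_linear]])
 note w = wgrad_unique[OF \<Omega>(1) wg]
 show "GL_energy \<Omega> \<kappa> H \<psi> F_field = (LBINT x. indicator \<Omega> x *\<^sub>R ((\<Sum>j\<in>UNIV. (cmod (d\<psi> x (axis j 1) - \<i> * of_real (\<kappa> * H * F_field x $ j) * \<psi> x))^2)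
      + \<kappa>^2 / 2 * (1 - (cmod (\<psi> x))\<^sup>2)^2))"
  unfolding GL_energy_def curl_F_field mult_zero_right add_0_right
 proof (rule lebesgue_on_transfer(2)[OF B])
  show "(%x. (\<Sum>j\<in>UNIV. (cmod (d\<psi> x (axis j 1) - \<i> * of_real (\<kappa> * H * F_field x $ j) * \<psi> x))^2) + \<kappa>^2 / 2 * (1 - (cmod (\<psi> x))\<^sup>2)^2) \<in> BM"
   by (rule borel_measurable_continuous_onI) (intro continuous_intros c pc Fc)
 qed (use w[of 1] w[of 2] w[of 3] in \<open>eventually_elim, auto simp: sum_3\<close>)
qed

text \<open>Averaging the density in Y leaves at most M (X), and averaging that in X leaves at most
  m. The shifts are selected in the opposite order: first a for M, then b for the density with a
  fixed. Each selection loses 1, hence the summand 2.\<close>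

lemma energy_upper_bound:
 assumes \<Omega>: "open \<Omega>" "bounded \<Omega>" and kH: "0 < \<kappa>" "0 < H" and \<epsilon>: "0 < \<epsilon>"
 defines "h \<equiv> \<kappa> * H" and "t \<equiv> sqrt (\<kappa> * H / (2 * pi)) / \<kappa>"
 defines "m \<equiv> 2 * (5 * pi^2 + 1) + pi^2 * (1 + \<epsilon>) * (2/pi * arsinh (1/t) + 1) + pi^2 * (1 + 1/\<epsilon>)"
 shows "\<exists>\<psi>. H1 \<Omega> \<psi> \<and> GL_energy \<Omega> \<kappa> H \<psi> F_field <= h / (2 * pi) * (measure lebesgue \<Omega> * m + 2)"
proof -
 have h: "0 < h" using kH by (simp add: h_def)
 define s where "s = sqrt (2 * pi / h)"
 have s: "0 < s" using h by (simp add: s_def)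
 have t: "0 < t" using kH by (simp add: t_def)
 define C1 K C2 where "C1 = 5 * pi^2 + 1" and "K = pi^2 * (1 + \<epsilon>)" and "C2 = pi^2 * (1 + 1/\<epsilon>)"
 have C: "0 <= C1" "0 <= K" "0 <= C2" using \<epsilon> by (auto simp: C1_def K_def C2_def)
 define A where "A x = (cos (pi * x))^2 + t^2" for x
 have A: "0 < A x" for x using t by (simp add: A_def add_nonneg_pos)
 define M where "M x = C1 * (t^2 / (A x * sqrt (A x))) + K / sqrt (A x) + C2" for x
 have Mc: "cont M" unfolding M_def A_def
  using A by (intro continuous_intros) (auto simp: A_def less_imp_neq[symmetric])
 have M0: "0 <= M x" for x unfolding M_def using A[of x] C by (intro add_nonneg_nonneg mult_nonneg_nonneg divide_nonneg_nonneg) auto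
 have Mi: "integral {0..1} M <= m"
  using integral_inverse_sqrt_le[OF t C(1,2), of C2] unfolding M_def[abs_def] A_def m_def C1_def K_def C2_def by (simp add: mult_ac)
 have m0: "0 <= m" using Mi integral_nonneg[of M "{0..1}"] M0 Mc by (auto intro: order_trans integrable_continuous_real continuous_on_subset)
 have "cos (pi * (x + 1)) = - cos (pi * x)" "sin (pi * (x + 1)) = - sin (pi * x)" for x by (simp_all add: distrib_left)
 then have per: "M (x + 1) = M x" "M (- x) = M x" "core t X (y + 1) = core t X y" "core t X (- y) = core t X y" for x y X
  by (simp_all add: M_def A_def core_def)
 have core: "core t X Y = A X + (sin (pi * X))^2 * (cos (pi * Y))^2" for X Y
 proof -
  have "(sin (pi * X))^2 + (cos (pi * X))^2 = 1" "(sin (pi * Y))^2 + (cos (pi * Y))^2 = 1" by auto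
  then show ?thesis unfolding core_def A_def by algebra
 qed
 have cA: "A X <= core t X Y" for X Y by (simp add: core)
 have c0: "0 < core t X Y" for X Y using cA A less_le_trans by blast
 have d0: "0 <= dens \<epsilon> t X Y" for X Y
  unfolding dens_def using c0[of X Y] \<epsilon> by (intro add_nonneg_nonneg mult_nonneg_nonneg divide_nonneg_nonneg) auto
 have cc: "continuous_on S (%z. core t (p z) (q z))" if "continuous_on S p" "continuous_on S q" for S :: "'z::metric_space set" and p q
  unfolding core_def by (intro continuous_intros that)
 have dc: "continuous_on S (%z. dens \<epsilon> t (p z) (q z))" if "continuous_on S p" "continuous_on S q" for S :: "'z::metric_space set" and p q
  unfolding dens_def using c0 by (intro continuous_intros cc that) (auto simp: less_imp_neq[symmetric])
 have c1: "cont (dens \<epsilon> t X)" for X using dc[of UNIV "%_. X" "%y. y"] by simp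
 \<comment> \<open>In the square of 1/core one factor is replaced by the larger 1/A, which is
   constant in Y, so that only 1/core has to be integrated by \<open>integral_cos2_le\<close>. Since
   A + B >= 1, the second root can then be dropped.\<close>
 have dM: "integral {0..1} (dens \<epsilon> t X) <= M X" for X
 proof -
  define B where "B = (sin (pi * X))^2"
  define Q where "Q = C1 * (t^2 / A X) + K"
  have Q: "0 <= Q" unfolding Q_def using C A[of X] by (intro add_nonneg_nonneg mult_nonneg_nonneg divide_nonneg_nonneg) auto
  have AB: "1 <= A X + B" using sin_cos_squared_add[of "pi * X"] zero_le_power2[of t] unfolding A_def B_def by linarith
  have ii: "(%y. 1 / (A X + B * (cos (pi * y))^2)) integrable_on {0..1}"
   using A[of X] by (intro integrable_continuous_real continuous_intros) (auto simp: B_def add_pos_nonneg less_imp_neq[symmetric])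
  have Qi: "((%y. Q * (1 / (A X + B * (cos (pi * y))^2)) + C2) has_integral Q * integral {0..1} (%y. 1 / (A X + B * (cos (pi * y))^2)) + C2 * (1 - 0)) {0..1}"
   using has_integral_add[OF has_integral_mult_right[OF integrable_integral[OF ii], of Q] has_integral_const_real[of C2 0 1]] by simp
  have "integral {0..1} (dens \<epsilon> t X) <= integral {0..1} (%y. Q * (1 / (A X + B * (cos (pi * y))^2)) + C2)"
  proof (rule integral_le)
   show "dens \<epsilon> t X integrable_on {0..1}" by (intro integrable_continuous_real dc continuous_intros)
   fix y
   define W where "W = core t X y"
   have W: "A X <= W" "0 < W" using cA c0 by (auto simp: W_def)
   have "t^2 / (W * W) <= t^2 / (A X * W)" using W A[of X] by (intro divide_left_mono mult_right_mono mult_pos_pos) auto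
   then have "C1 * (t^2 / (W * W)) <= C1 * (t^2 / (A X * W))" using C by (intro mult_left_mono) auto
   moreover have "dens \<epsilon> t X y = C1 * (t^2 / (W * W)) + K * (1 / W) + C2"
    by (simp add: dens_def C1_def K_def C2_def W_def[symmetric] power2_eq_square)
   moreover have "Q * (1 / W) = C1 * (t^2 / (A X * W)) + K * (1 / W)" by (simp add: Q_def distrib_right add_divide_distrib)
   ultimately have "dens \<epsilon> t X y <= Q * (1 / W) + C2" by linarith
   then show "dens \<epsilon> t X y <= Q * (1 / (A X + B * (cos (pi * y))^2)) + C2" by (simp add: W_def core B_def)
  qed (use Qi in blast)
  also have "... = Q * integral {0..1} (%y. 1 / (A X + B * (cos (pi * y))^2)) + C2" using Qi by (simp add: integral_unique)
  also have "... <= Q * (1 / (sqrt (A X) * sqrt (A X + B))) + C2"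
   using Q by (intro add_right_mono mult_left_mono integral_cos2_le A) (simp add: B_def)
  also have "... <= Q * (1 / sqrt (A X)) + C2"
  proof -
   have "sqrt (A X) * 1 <= sqrt (A X) * sqrt (A X + B)" using AB A[of X] by (intro mult_left_mono) auto
   then show ?thesis using Q A[of X] AB by (intro add_right_mono mult_left_mono frac_le) auto
  qed
  also have "... = M X" by (simp add: Q_def M_def add_divide_distrib distrib_right)
  finally show ?thesis .
 qed
 have B: "\<Omega> \<in> sets borel" using \<Omega> by simp
 have fin: "emeasure lborel \<Omega> = ennreal (measure lebesgue \<Omega>)"
  using emeasure_eq_ennreal_measure[of lborel \<Omega>] emeasure_bounded_finite[OF \<Omega>(2)] B by (auto simp: less_top)
 have "\<exists>a. (\<integral>\<^sup>+x. ennreal (M (x $ 1 / s - a)) * indicator \<Omega> x \<partial>lborel) <= ennreal (measure lebesgue \<Omega> * m + 1)"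
 proof (rule translate_average[OF _ B])
  show "cont (%(x :: real^3, a). M (x $ 1 / s - a))"
   unfolding case_prod_beta using s by (intro continuous_on_compose2[OF Mc] continuous_intros) auto
  show "(\<integral>\<^sup>+a. ennreal (M (x $ 1 / s - a)) * indicator {0..1} a \<partial>lborel) <= ennreal m" for x :: "real^3"
   by (rule nn_integral_periodic[OF Mc per(1,2) M0 Mi])
  show "(\<integral>\<^sup>+x. ennreal m * indicator \<Omega> x \<partial>lborel) <= ennreal (measure lebesgue \<Omega> * m)"
   using B m0 by (simp add: nn_integral_cmult_indicator fin ennreal_mult'[symmetric] mult.commute)
 qed (use m0 in simp)
 then obtain a where a: "(\<integral>\<^sup>+x. ennreal (M (x $ 1 / s - a)) * indicator \<Omega> x \<partial>lborel) <= ennreal (measure lebesgue \<Omega> * m + 1)" by blast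
 have "\<exists>b. (\<integral>\<^sup>+x. ennreal (dens \<epsilon> t (x $ 1 / s - a) (x $ 2 / s - b)) * indicator \<Omega> x \<partial>lborel) <= ennreal (measure lebesgue \<Omega> * m + 1 + 1)"
 proof (rule translate_average[OF _ B _ a])
  show "cont (%(x :: real^3, b). dens \<epsilon> t (x $ 1 / s - a) (x $ 2 / s - b))"
   unfolding case_prod_beta using s by (intro dc continuous_intros) auto
  show "(\<integral>\<^sup>+b. ennreal (dens \<epsilon> t (x $ 1 / s - a) (x $ 2 / s - b)) * indicator {0..1} b \<partial>lborel) <= ennreal (M (x $ 1 / s - a))" for x :: "real^3"
   by (rule nn_integral_periodic[OF c1 _ _ d0 dM]) (simp_all add: dens_def per)
 qed (use m0 in simp)
 then obtain b where b: "(\<integral>\<^sup>+x. ennreal (dens \<epsilon> t (x $ 1 / s - a) (x $ 2 / s - b)) * indicator \<Omega> x \<partial>lborel) <= ennreal (measure lebesgue \<Omega> * m + 2)"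
  by (auto simp: add.assoc)
 obtain R where R: "\<Omega> \<subseteq> ball 0 R" using bounded_subset_ballD[OF \<Omega>(2), of 0] by blast
 obtain \<psi> d\<psi> where d: "\<forall>x. (\<psi> has_derivative d\<psi> x) (at x)" "\<forall>v. cont (%x. d\<psi> x v)"
  and bd: "\<forall>x. norm x <= R --> (\<Sum>j\<in>UNIV. (cmod (d\<psi> x (axis j 1) - \<i> * of_real (h * F_field x $ j) * \<psi> x))^2) + \<kappa>^2/2 * (1 - (cmod (\<psi> x))\<^sup>2)^2
    <= h / (2 * pi) * dens \<epsilon> t (x $ 1 / s - a) (x $ 2 / s - b)"
  using vortex_lattice[OF h kH(1) \<epsilon>, of R a b] unfolding s_def t_def h_def[symmetric] by (elim exE conjE)
 define q where "q x = (\<Sum>j\<in>UNIV. (cmod (d\<psi> x (axis j 1) - \<i> * of_real (h * F_field x $ j) * \<psi> x))^2) + \<kappa>^2/2 * (1 - (cmod (\<psi> x))\<^sup>2)^2" for x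
 have dm: "(%x :: real^3. dens \<epsilon> t (x $ 1 / s - a) (x $ 2 / s - b)) \<in> BM"
  by (rule borel_measurable_continuous_onI) (use s in \<open>intro dc continuous_intros; simp\<close>)
 have "(LBINT x. indicator \<Omega> x *\<^sub>R q x) <= h / (2 * pi) * (measure lebesgue \<Omega> * m + 2)"
 proof (rule integral_real_bounded)
  show "0 <= h / (2 * pi) * (measure lebesgue \<Omega> * m + 2)" using h m0 by simp
  have "(\<integral>\<^sup>+x. ennreal (indicator \<Omega> x *\<^sub>R q x) \<partial>lborel) <= (\<integral>\<^sup>+x. ennreal (h / (2 * pi)) * (ennreal (dens \<epsilon> t (x $ 1 / s - a) (x $ 2 / s - b)) * indicator \<Omega> x) \<partial>lborel)"
  proof (rule nn_integral_mono)
   fix x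
   show "ennreal (indicator \<Omega> x *\<^sub>R q x) <= ennreal (h / (2 * pi)) * (ennreal (dens \<epsilon> t (x $ 1 / s - a) (x $ 2 / s - b)) * indicator \<Omega> x)"
   proof (cases "x \<in> \<Omega>")
    case True
    then have "norm x <= R" using R by force
    then show ?thesis using bd True h by (simp add: q_def ennreal_mult'[symmetric] ennreal_leI)
   qed simp
  qed
  also have "... = ennreal (h / (2 * pi)) * (\<integral>\<^sup>+x. ennreal (dens \<epsilon> t (x $ 1 / s - a) (x $ 2 / s - b)) * indicator \<Omega> x \<partial>lborel)"
   using dm B by (intro nn_integral_cmult) simp
  also have "... <= ennreal (h / (2 * pi)) * ennreal (measure lebesgue \<Omega> * m + 2)" by (rule mult_left_mono[OF b]) simp
  finally show "(\<integral>\<^sup>+x. ennreal (indicator \<Omega> x *\<^sub>R q x) \<partial>lborel) <= ennreal (h / (2 * pi) * (measure lebesgue \<Omega> * m + 2))"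
   using h m0 by (subst ennreal_mult) auto
 qed
 moreover have "H1 \<Omega> \<psi>" "GL_energy \<Omega> \<kappa> H \<psi> F_field = (LBINT x. indicator \<Omega> x *\<^sub>R q x)"
  unfolding q_def h_def using GL_energy_F[OF \<Omega> d(1)[rule_format] d(2)[rule_format]] by blast+
 ultimately show ?thesis by (intro exI[of _ \<psi>]) simp
qed

text \<open>The leading part of m is 2 pi (1 + \<epsilon>) arsinh (1/t), about pi (1 + \<epsilon>)
  L, and the factor \<open>h / (2 * pi)\<close> turns it into (1 + \<epsilon>) h L / 2. Half of c
  absorbs \<epsilon>; the other half absorbs the remainder k, which does not depend on
  \<kappa>.\<close>

lemma energy_limsup:
 fixes H :: "real => real"
 assumes \<Omega>: "bounded \<Omega>" "open \<Omega>" and Hp: "\<And>\<kappa>. 0 < \<kappa> ==> 0 < H \<kappa>"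
 defines "h \<equiv> %\<kappa>. \<kappa> * H \<kappa>" and "L \<equiv> %\<kappa>. ln (\<kappa> / H \<kappa>)"
 assumes L: "filterlim L at_top at_top" and c: "0 < c"
 shows "\<forall>\<^sub>F \<kappa> in at_top. \<exists>\<psi>. H1 \<Omega> \<psi> \<and> GL_energy \<Omega> \<kappa> (H \<kappa>) \<psi> F_field <= (measure lebesgue \<Omega> + c) * (h \<kappa> * L \<kappa> / 2)"
proof -
 define \<mu> where "\<mu> = measure lebesgue \<Omega>"
 have \<mu>: "0 <= \<mu>" by (simp add: \<mu>_def)
 define \<epsilon> where "\<epsilon> = c / (2 * (\<mu> + 1))"
 have \<epsilon>: "0 < \<epsilon>" "\<mu> * \<epsilon> <= c/2" using c \<mu> by (auto simp: \<epsilon>_def field_simps)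
 \<comment> \<open>The constant comes from arsinh y <= ln (3 y) for y >= 1 together with ln (1/t) =
   (L + ln (2 pi)) / 2.\<close>
 define c0 where "c0 = ln 3 + ln (2 * pi) / 2"
 define k where "k = 2 * (5 * pi^2 + 1) + pi^2 * (1 + \<epsilon>) * (2/pi * c0 + 1) + pi^2 * (1 + 1/\<epsilon>)"
 have "\<forall>\<^sub>F \<kappa> in at_top. 1 <= L \<kappa> \<and> 2 * (\<mu> * k + 2) / (pi * c) <= L \<kappa>"
  using L by (auto simp: filterlim_at_top intro: eventually_conj)
 then show ?thesis using eventually_gt_at_top[of 0]
 proof eventually_elim
  case (elim \<kappa>)
  have kH: "0 < \<kappa>" "0 < H \<kappa>" "0 < h \<kappa>" using elim Hp by (auto simp: h_def)
  define t where "t = sqrt (\<kappa> * H \<kappa> / (2 * pi)) / \<kappa>"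
  have t: "0 < t" using kH by (simp add: t_def)
  have lt: "ln (1/t) = (L \<kappa> + ln (2 * pi)) / 2"
   using kH by (simp add: t_def L_def ln_div ln_mult ln_sqrt field_simps)
  have "0 <= ln (1/t)" unfolding lt using elim pi_gt3 by simp
  then have t1: "1 <= 1/t" using t by (subst (asm) ln_ge_zero_iff) auto
  have "arsinh (1/t) <= ln (3 * (1/t))"
  proof -
   have "y^2 + 1 <= (2 * y)^2" if "1 <= y" for y :: real using power_mono[OF that, of 2] by (simp add: power_mult_distrib)
   from real_sqrt_le_mono[OF this[OF t1]] have "sqrt ((1/t)^2 + 1) <= sqrt ((2 * (1/t))^2)" .
   then have "1/t + sqrt ((1/t)^2 + 1) <= 3 * (1/t)" using t by simp
   moreover have "0 < 1/t + sqrt ((1/t)^2 + 1)" using t by (intro add_pos_nonneg) auto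
   ultimately show ?thesis unfolding arsinh_real_def by (intro ln_mono) auto
  qed
  also have "... = L \<kappa> / 2 + c0" using t lt by (subst ln_mult) (auto simp: c0_def add_divide_distrib)
  finally have ar: "arsinh (1/t) <= L \<kappa> / 2 + c0" .
  obtain \<psi> where \<psi>: "H1 \<Omega> \<psi>" "GL_energy \<Omega> \<kappa> (H \<kappa>) \<psi> F_field <= h \<kappa> / (2 * pi) * (\<mu> * (2 * (5 * pi^2 + 1) + pi^2 * (1 + \<epsilon>) * (2/pi * arsinh (1/t) + 1) + pi^2 * (1 + 1/\<epsilon>)) + 2)"
   using energy_upper_bound[OF \<Omega>(2,1) kH(1,2) \<epsilon>(1)] unfolding t_def h_def \<mu>_def by blast
  have "pi^2 * (1 + \<epsilon>) * (2/pi * arsinh (1/t) + 1) <= pi^2 * (1 + \<epsilon>) * (2/pi * (L \<kappa> / 2 + c0) + 1)"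
   using ar \<epsilon> by (intro mult_left_mono add_right_mono) auto
  also have "... = pi * (1 + \<epsilon>) * L \<kappa> + pi^2 * (1 + \<epsilon>) * (2/pi * c0 + 1)" by (simp add: field_simps power2_eq_square)
  finally have "h \<kappa> / (2 * pi) * (\<mu> * (2 * (5 * pi^2 + 1) + pi^2 * (1 + \<epsilon>) * (2/pi * arsinh (1/t) + 1) + pi^2 * (1 + 1/\<epsilon>)) + 2)
    <= h \<kappa> / (2 * pi) * (\<mu> * (pi * (1 + \<epsilon>) * L \<kappa> + k) + 2)"
   using kH \<mu> by (intro mult_left_mono add_right_mono) (auto simp: k_def)
  also have "... = (\<mu> + \<mu> * \<epsilon>) * (h \<kappa> * L \<kappa> / 2) + h \<kappa> / (2 * pi) * (\<mu> * k + 2)" by (simp add: field_simps)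
  also have "... <= (\<mu> + c/2) * (h \<kappa> * L \<kappa> / 2) + c/2 * (h \<kappa> * L \<kappa> / 2)"
  proof (rule add_mono)
   show "(\<mu> + \<mu> * \<epsilon>) * (h \<kappa> * L \<kappa> / 2) <= (\<mu> + c/2) * (h \<kappa> * L \<kappa> / 2)" using \<epsilon> kH elim by (intro mult_right_mono) auto
   have "2 * (\<mu> * k + 2) <= L \<kappa> * (pi * c)" using elim c by (simp add: field_simps)
   then have "h \<kappa> / (4 * pi) * (2 * (\<mu> * k + 2)) <= h \<kappa> / (4 * pi) * (L \<kappa> * (pi * c))" using kH by (intro mult_left_mono) auto
   then show "h \<kappa> / (2 * pi) * (\<mu> * k + 2) <= c/2 * (h \<kappa> * L \<kappa> / 2)" by (simp add: field_simps)
  qed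
  also have "... = (\<mu> + c) * (h \<kappa> * L \<kappa> / 2)" by (simp add: field_simps)
  finally show ?case using order_trans[OF \<psi>(2)] \<psi>(1) unfolding \<mu>_def by blast
 qed
qed

section \<open>Asymptotics of the infimum from the two matching bounds\<close>

theorem theorem1p1:
  fixes \<Omega> :: "(real^3) set" and H :: "real \<Rightarrow> real"
  assumes "bounded \<Omega>" and "open \<Omega>" and "smooth_boundary \<Omega>"
    and "\<forall>\<kappa>>0. H \<kappa> > 0"
    and "(\<lambda>\<kappa>. ln \<kappa> / \<kappa>) \<in> o[at_top](H)"
    and "H \<in> o[at_top](\<lambda>\<kappa>. \<kappa>)"
  shows "(\<lambda>\<kappa>. C0 \<Omega> \<kappa> (H \<kappa>) - measure lebesgue \<Omega> * (\<kappa> * H \<kappa> * ln (sqrt (\<kappa> / H \<kappa>))))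
           \<in> o[at_top](\<lambda>\<kappa>. \<kappa> * H \<kappa> * ln (sqrt (\<kappa> / H \<kappa>)))"
proof -
 define h where "h \<kappa> = \<kappa> * H \<kappa>" for \<kappa>
 define L where "L \<kappa> = ln (\<kappa> / H \<kappa>)" for \<kappa>
 have Hp: "0 < H \<kappa>" if "0 < \<kappa>" for \<kappa> using assms(4) that by blast
 have hln: "\<forall>\<^sub>F \<kappa> in at_top. ln \<kappa> <= c * h \<kappa>" if c: "0 < c" for c
  using landau_o.smallD[OF assms(5) c] eventually_gt_at_top[of 1]
 proof eventually_elim
  case (elim \<kappa>)
  then have "ln \<kappa> / \<kappa> <= c * H \<kappa>" using Hp[of \<kappa>] by simp
  then show ?case using elim by (simp add: h_def field_simps)
 qed
 have h: "filterlim h at_top at_top"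
  by (rule filterlim_at_top_mono[OF ln_at_top]) (use hln[of 1] in simp)
 have L: "filterlim L at_top at_top"
  unfolding filterlim_at_top
 proof
  fix Z :: real
  show "\<forall>\<^sub>F \<kappa> in at_top. Z <= L \<kappa>"
   using landau_o.smallD[OF assms(6) exp_gt_zero[of "- Z"]] eventually_gt_at_top[of 0]
  proof eventually_elim
   case (elim \<kappa>)
   have "H \<kappa> <= exp (- Z) * \<kappa>" using elim Hp[of \<kappa>] by simp
   then have "exp Z <= \<kappa> / H \<kappa>" using Hp[of \<kappa>] elim by (simp add: exp_minus field_simps)
   then show ?case using Hp[of \<kappa>] elim unfolding L_def by (subst ln_ge_iff) auto
  qed
 qed
 \<comment> \<open>Once h >= 1 one has ln H >= - ln \<kappa>, hence L <= 2 ln \<kappa>, and ln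
   \<kappa> is small against h by the lower hypothesis on H.\<close>
 have Lh: "((%\<kappa>. L \<kappa> / h \<kappa>) \<longlongrightarrow> 0) at_top"
 proof (rule tendstoI)
  fix e :: real assume e: "0 < e"
  then have e4: "0 < e/4" by simp
  have "\<forall>\<^sub>F \<kappa> in at_top. 1 <= h \<kappa>" "\<forall>\<^sub>F \<kappa> in at_top. 0 <= L \<kappa>" using h L by (auto simp: filterlim_at_top)
  then show "\<forall>\<^sub>F \<kappa> in at_top. dist (L \<kappa> / h \<kappa>) 0 < e"
   using hln[of "e/4", OF e4] eventually_gt_at_top[of 0]
  proof eventually_elim
   case (elim \<kappa>)
   have ln: "ln (h \<kappa>) = ln \<kappa> + ln (H \<kappa>)" using elim Hp[OF elim(4)] by (simp add: h_def ln_mult)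
   have "0 <= ln (h \<kappa>)" using elim by simp
   then have "L \<kappa> <= 2 * ln \<kappa>" using elim Hp[OF elim(4)] ln by (simp add: L_def ln_div)
   also have "... <= 2 * (e/4 * h \<kappa>)" using elim e by simp
   also have "... < e * h \<kappa>" using elim e by simp
   finally show ?case using elim by (simp add: field_simps)
  qed
 qed
 have N: "\<kappa> * H \<kappa> * ln (sqrt (\<kappa> / H \<kappa>)) = h \<kappa> * L \<kappa> / 2" if "0 < \<kappa>" for \<kappa>
  using that Hp[OF that] by (simp add: h_def L_def ln_sqrt)
 show ?thesis
 proof (rule landau_o.smallI)
  fix c :: real assume c: "0 < c"
  have "\<forall>\<^sub>F \<kappa> in at_top. 0 <= h \<kappa>" "\<forall>\<^sub>F \<kappa> in at_top. 0 <= L \<kappa>" using h L by (auto simp: filterlim_at_top)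
  then have "\<forall>\<^sub>F \<kappa> in at_top. 0 <= h \<kappa> * L \<kappa> / 2" by eventually_elim simp
  moreover have lo: "\<forall>\<^sub>F \<kappa> in at_top. \<forall>\<psi> A. H1 \<Omega> \<psi> \<and> Hdot1_div_F A --> (measure lebesgue \<Omega> - c) * (h \<kappa> * L \<kappa> / 2) <= GL_energy \<Omega> \<kappa> (H \<kappa>) \<psi> A"
   unfolding h_def L_def by (rule energy_liminf[OF assms(1-3) _ h[unfolded h_def[abs_def]] L[unfolded L_def[abs_def]] Lh[unfolded h_def L_def] c]) (rule Hp)
  moreover have up: "\<forall>\<^sub>F \<kappa> in at_top. \<exists>\<psi>. H1 \<Omega> \<psi> \<and> GL_energy \<Omega> \<kappa> (H \<kappa>) \<psi> F_field <= (measure lebesgue \<Omega> + c) * (h \<kappa> * L \<kappa> / 2)"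
   unfolding h_def L_def by (rule energy_limsup[OF assms(1,2) _ L[unfolded L_def[abs_def]] c]) (rule Hp)
  ultimately show "\<forall>\<^sub>F \<kappa> in at_top. norm (C0 \<Omega> \<kappa> (H \<kappa>) - measure lebesgue \<Omega> * (\<kappa> * H \<kappa> * ln (sqrt (\<kappa> / H \<kappa>))))
    <= c * norm (\<kappa> * H \<kappa> * ln (sqrt (\<kappa> / H \<kappa>)))"
   using eventually_gt_at_top[of 0]
  proof eventually_elim
   case (elim \<kappa>)
   \<comment> \<open>For large \<kappa> the lower bound makes S bounded below and the upper bound
     makes it non-empty, so that \<open>Inf\<close> is a true infimum and not an unspecified
     value.\<close>
   define S where "S = {GL_energy \<Omega> \<kappa> (H \<kappa>) \<psi> A | \<psi> A. H1 \<Omega> \<psi> \<and> Hdot1_div_F A}"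
   define n where "n = h \<kappa> * L \<kappa> / 2"
   have low: "(measure lebesgue \<Omega> - c) * n <= x" if "x \<in> S" for x
    using elim(2) that unfolding S_def n_def by blast
   obtain y where y: "y \<in> S" "y <= (measure lebesgue \<Omega> + c) * n"
    using elim(3) F_admissible unfolding S_def n_def by blast
   have "Inf S <= y" by (rule cInf_lower[OF y(1)]) (use low in \<open>auto simp: bdd_below_def\<close>)
   moreover have "(measure lebesgue \<Omega> - c) * n <= Inf S" by (rule cInf_greatest) (use y low in auto)
   ultimately have "\<bar>Inf S - measure lebesgue \<Omega> * n\<bar> <= c * n" using y(2) by (simp add: abs_le_iff algebra_simps)
   then show ?case unfolding N[OF elim(4)] n_def[symmetric] C0_def S_def[symmetric] using elim(1) by (simp add: n_def)
  qed
 qed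
qed

end
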